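(* Let $s\in(\frac32,\frac52)$ and $\lambda>0$. (i) The self-adjoint extensions in $L^2(\mathbb{R}^3)$ of the operator $\mathring{\mathsf{k}}^{(s/2)}$ form the family $(\mathsf{k}^{(s/2)}_\tau)_{\tau\in\mathbb{R}\cup\{\infty\}}$, where $\mathsf{k}^{(s/2)}_\infty$ is its Friedrichs extension, namely the self-adjoint fractional Laplacian $(-\Delta)^{s/2}$ with domain $H^s(\mathbb{R}^3)$, and all other extensions ($\tau\in\mathbb{R}$) are given by $$\mathcal{D}(\mathsf{k}^{(s/2)}_\tau):=\left\{g\in L^2(\mathbb{R}^3)\,\left|\,\begin{array}{c}\widehat g(p)=\widehat{f^\lambda}(p)+\dfrac{\tau\,\xi}{(|p|^s+\lambda)^2}+\dfrac{\xi}{|p|^s+\lambda},\\ \xi\in\mathbb{C},\ f^\lambda\in H^s(\mathbb{R}^3),\ \int_{\mathbb{R}^3}\widehat{f^\lambda}(p)\,dp=0\end{array}\right.\right\}$$ and $$\big(\mathsf{k}^{(s/2)}_\tau+\lambda\mathbf{1}\big)g:=\mathcal{F}^{-1}\Big((|p|^s+\lambda)\Big(\widehat{f^\lambda}+\frac{\tau\,\xi}{(|p|^s+\lambda)^2}\Big)\Big).$$ Moreover, for $\tau\neq0$, $$\mathcal{D}(\mathsf{k}^{(s/2)}_\tau)=\Big\{g=F^\lambda+\frac{2\pi s^2\sin(\frac{3\pi}{s})\lambda^{2-\frac3s}}{\tau(s-3)}\,F^\lambda(0)\,\mathsf{G}_{s,\lambda}\,\Big|\,F^\lambda\in H^s(\mathbb{R}^3)\Big\}.$$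 (ii) Each extension is semi-bounded from below and $$\inf\sigma(\mathsf{k}^{(s/2)}_\tau+\lambda\mathbf{1})\geqslant0\ \Leftrightarrow\ \tau\geqslant0,\qquad \inf\sigma(\mathsf{k}^{(s/2)}_\tau+\lambda\mathbf{1})>0\ \Leftrightarrow\ \tau>0,$$ $$(\mathsf{k}^{(s/2)}_\tau+\lambda\mathbf{1})\text{ is invertible}\ \Leftrightarrow\ \tau\neq0.$$ (iii) For each $\tau\in\mathbb{R}$ the quadratic form of the extension $\mathsf{k}^{(s/2)}_\tau$ is given by $$\mathcal{D}[\mathsf{k}^{(s/2)}_\tau]=H^{\frac s2}(\mathbb{R}^3)\dotplus\mathrm{span}\{\mathsf{G}_{s,\lambda}\},$$ $$\mathsf{k}^{(s/2)}_\tau[F^\lambda+\kappa_\lambda\mathsf{G}_{s,\lambda}]=\||\nabla|^{\frac s2}F^\lambda\|_{L^2}^2-\lambda\|F^\lambda+\kappa_\lambda\mathsf{G}_{s,\lambda}\|_{L^2}^2+\lambda\|F^\lambda\|_{L^2}^2+\frac{\tau(s-3)}{2\pi s^2\lambda^{2-\frac3s}\sin(\frac{3\pi}{s})}|\kappa_\lambda|^2$$ for any $F^\lambda\in H^{s/2}(\mathbb{R}^3)$ and $\kappa_\lambda\in\mathbb{C}$. (iv) For $\tau\neq0$ one has the resolvent identity $$(\mathsf{k}^{(s/2)}_\tau+\lambda\mathbf{1})^{-1}=((-\Delta)^{s/2}+\lambda\mathbf{1})^{-1}+\frac{2\pi s^2\sin(\frac{3\pi}{s})\lambda^{2-\fr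ac3s}}{\tau(s-3)}\,|\mathsf{G}_{s,\lambda}\rangle\langle\mathsf{G}_{s,\lambda}|.$$
   Context: Dimension $d=3$. Fourier transform: $(\mathcal{F}f)(p)=\widehat f(p)=(2\pi)^{-3/2}\int_{\mathbb{R}^3}e^{-ipx}f(x)\,dx$, with inverse $\mathcal{F}^{-1}={}^\vee$. $(-\Delta)^{s/2}$ is the Fourier multiplier by $|p|^s$ and $|\nabla|^{a}$ the Fourier multiplier by $|p|^a$. Scalar products are antilinear in the first entry; $|\mathsf{G}\rangle\langle\mathsf{G}|$ is the rank-one operator $h\mapsto\langle\mathsf{G},h\rangle_{L^2}\mathsf{G}$. For $\lambda>0$, $\mathsf{G}_{s,\lambda}(x):=(2\pi)^{-3/2}\big(\frac{1}{|p|^s+\lambda}\big)^\vee(x)$, so $((-\Delta)^{s/2}+\lambda)\mathsf{G}_{s,\lambda}=\delta$ as distributions. $\mathring{\mathsf{k}}^{(s/2)}:=\overline{(-\Delta)^{s/2}\upharpoonright C_0^\infty(\mathbb{R}^3\setminus\{0\})}$ (closure in $L^2(\mathbb{R}^3)$); for $s\in(\frac32,\frac52)$ it acts as $(-\Delta)^{s/2}$ on $\mathcal{D}(\mathring{\mathsf{k}}^{(s/2)})=\{f\in H^s(\mathbb{R}^3)\mid\int_{\mathbb{R}^3}\widehat f(p)\,dp=0\}$ and has deficiency index $1$. $F^\lambda(0)$ is the value at $0$ of the continuous representative of $F^\lambda\in H^s(\mathbb{R}^3)$. For a lower semi-bounded self-adjoint operator $T$, $\mathcal{D}[T]$ and $T[\cdot]$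 denote its (closed) quadratic form domain and quadratic form. $\dotplus$ denotes direct algebraic sum. $\sigma(\cdot)$ is the spectrum; invertible means having an everywhere defined bounded inverse. The value $\tau=\infty$ is regarded as positive and nonzero, and terms with $\tau$ in the denominator then vanish. *)

theory Defs
  imports "HOL-Analysis.Analysis"
begin

section \<open>The complex Hilbert space \<open>L\<^sup>2(\<real>\<^sup>3)\<close>\<close>

definition square_integrable :: "(real^3 \<Rightarrow> complex) \<Rightarrow> bool" where
  "square_integrable f \<longleftrightarrow>
     f \<in> borel_measurable lborel \<and> integrable lborel (\<lambda>x. (cmod (f x))\<^sup>2)"

definition L2_eq :: "(real^3 \<Rightarrow> complex) \<Rightarrow> (real^3 \<Rightarrow> complex) \<Rightarrow> bool" where
  "L2_eq f g \<longleftrightarrow>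
     square_integrable f \<and> square_integrable g \<and> (AE x in lborel. f x = g x)"

lemma square_integrable_zero: "square_integrable (\<lambda>x. 0)"
  by (simp add: square_integrable_def)

lemma L2_eq_part_equivp: "part_equivp L2_eq"
proof (rule part_equivpI)
  show "\<exists>f. L2_eq f f"
    using square_integrable_zero by (auto simp: L2_eq_def)
  show "symp L2_eq"
    by (auto simp: symp_def L2_eq_def elim: eventually_mono)
  show "transp L2_eq"
    by (auto simp: transp_def L2_eq_def elim: eventually_elim2)
qed

text \<open>\<open>to_L2 f\<close> is the class of \<open>f\<close>; it is meaningful only for square-integrable \<open>f\<close>.
  \<open>L2_fun u\<close> is some representative of \<open>u\<close>, determined almost everywhere.\<close>

quotient_type L2 = "real^3 \<Rightarrow> complex" / partial: L2_eq
  morphisms L2_fun to_L2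
  by (rule L2_eq_part_equivp)

lemma square_integrable_mult_integrable:
  assumes "square_integrable f" "square_integrable g"
  shows "integrable lborel (\<lambda>x. cnj (f x) * g x)"
proof (rule Bochner_Integration.integrable_bound)
  show "integrable lborel (\<lambda>x. (cmod (f x))\<^sup>2 + (cmod (g x))\<^sup>2)"
    using assms by (auto simp: square_integrable_def)
  show "(\<lambda>x. cnj (f x) * g x) \<in> borel_measurable lborel"
  proof -
    have "f \<in> borel_measurable borel" "g \<in> borel_measurable borel"
      using assms by (simp_all add: square_integrable_def)
    moreover have "cnj \<in> borel_measurable borel"
      by (intro borel_measurable_continuous_onI continuous_intros)
    ultimately show ?thesis
      by (simp add: borel_measurable_times measurable_compose[of f])
  qed
  have "cmod (cnj a * b) \<le> norm ((cmod a)\<^sup>2 + (cmod b)\<^sup>2)" for a b :: complex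
  proof -
    have "0 \<le> (cmod a - cmod b)\<^sup>2" by simp
    then have "2 * (cmod a * cmod b) \<le> (cmod a)\<^sup>2 + (cmod b)\<^sup>2"
      by (simp add: power2_diff)
    moreover have "0 \<le> cmod a * cmod b" by simp
    ultimately show ?thesis
      unfolding real_norm_def norm_mult complex_mod_cnj by linarith
  qed
  then show "AE x in lborel. cmod (cnj (f x) * g x) \<le> norm ((cmod (f x))\<^sup>2 + (cmod (g x))\<^sup>2)"
    by simp
qed

lemma square_integrable_add:
  assumes "square_integrable f" "square_integrable g"
  shows "square_integrable (\<lambda>x. f x + g x)"
  unfolding square_integrable_def
proof
  have m: "f \<in> borel_measurable lborel" "g \<in> borel_measurable lborel"
    using assms by (auto simp: square_integrable_def)
  then show m': "(\<lambda>x. f x + g x) \<in> borel_measurable lborel"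
    by (rule borel_measurable_add)
  have bound: "norm ((cmod (a + b))\<^sup>2) \<le> norm (2 * (cmod a)\<^sup>2 + 2 * (cmod b)\<^sup>2)" for a b :: complex
  proof -
    have "(cmod (a + b))\<^sup>2 \<le> (cmod a + cmod b)\<^sup>2"
      by (intro power_mono norm_triangle_ineq) simp
    moreover have "0 \<le> (cmod a - cmod b)\<^sup>2" by simp
    ultimately show ?thesis
      by (simp add: power2_diff power2_sum)
  qed
  show "integrable lborel (\<lambda>x. (cmod (f x + g x))\<^sup>2)"
  proof (rule Bochner_Integration.integrable_bound)
    show "integrable lborel (\<lambda>x. 2 * (cmod (f x))\<^sup>2 + 2 * (cmod (g x))\<^sup>2)"
      using assms by (auto simp: square_integrable_def)
    show "(\<lambda>x. (cmod (f x + g x))\<^sup>2) \<in> borel_measurable lborel"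
      using m' by measurable
  qed (use bound in \<open>auto intro!: AE_I2\<close>)
qed

lemma square_integrable_cmult:
  "square_integrable f \<Longrightarrow> square_integrable (\<lambda>x. c * f x)"
  by (auto simp: square_integrable_def norm_mult power_mult_distrib)

lemma square_integrable_uminus:
  "square_integrable f \<Longrightarrow> square_integrable (\<lambda>x. - f x)"
  using square_integrable_cmult[of f "-1"] by simp

lemma square_integrable_diff:
  "square_integrable f \<Longrightarrow> square_integrable g \<Longrightarrow> square_integrable (\<lambda>x. f x - g x)"
  using square_integrable_add[of f "\<lambda>x. - g x"] square_integrable_uminus[of g] by simp

lift_definition scaleC_L2 :: "complex \<Rightarrow> L2 \<Rightarrow> L2" (infixr "*\<^sub>C" 75) is "\<lambda>c f x. c * f x"
  by (auto simp: L2_eq_def square_integrable_cmult elim: eventually_mono)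

lift_definition cinner :: "L2 \<Rightarrow> L2 \<Rightarrow> complex" is "\<lambda>f g. \<integral>x. cnj (f x) * g x \<partial>lborel"
proof -
  fix f f' g g' assume "L2_eq f f'" "L2_eq g g'"
  then have *: "square_integrable f" "square_integrable f'" "square_integrable g" "square_integrable g'"
      "AE x in lborel. f x = f' x" "AE x in lborel. g x = g' x"
    by (auto simp: L2_eq_def)
  from *(5,6) have "AE x in lborel. cnj (f x) * g x = cnj (f' x) * g' x"
    by eventually_elim simp
  then show "(\<integral>x. cnj (f x) * g x \<partial>lborel) = (\<integral>x. cnj (f' x) * g' x \<partial>lborel)"
    using square_integrable_mult_integrable[OF *(1,3)] square_integrable_mult_integrable[OF *(2,4)]
    by (intro integral_cong_AE) auto
qed

instantiation L2 :: real_inner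
begin

lift_definition zero_L2 :: L2 is "\<lambda>x. 0"
  by (simp add: L2_eq_def square_integrable_zero)

lift_definition plus_L2 :: "L2 \<Rightarrow> L2 \<Rightarrow> L2" is "\<lambda>f g x. f x + g x"
  by (auto simp: L2_eq_def square_integrable_add elim: eventually_elim2)

lift_definition minus_L2 :: "L2 \<Rightarrow> L2 \<Rightarrow> L2" is "\<lambda>f g x. f x - g x"
  by (auto simp: L2_eq_def square_integrable_diff elim: eventually_elim2)

lift_definition uminus_L2 :: "L2 \<Rightarrow> L2" is "\<lambda>f x. - f x"
  by (auto simp: L2_eq_def square_integrable_uminus elim: eventually_mono)

definition scaleR_L2 :: "real \<Rightarrow> L2 \<Rightarrow> L2" where
  "scaleR_L2 r f = complex_of_real r *\<^sub>C f"

definition inner_L2 :: "L2 \<Rightarrow> L2 \<Rightarrow> real" where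
  "inner_L2 f g = Re (cinner f g)"

definition norm_L2 :: "L2 \<Rightarrow> real" where
  "norm_L2 f = sqrt (inner f f)"

definition dist_L2 :: "L2 \<Rightarrow> L2 \<Rightarrow> real" where
  "dist_L2 f g = norm (f - g)"

definition sgn_L2 :: "L2 \<Rightarrow> L2" where
  "sgn_L2 f = complex_of_real (inverse (norm f)) *\<^sub>C f"

definition uniformity_L2 :: "(L2 \<times> L2) filter" where
  "uniformity_L2 = (INF e\<in>{0<..}. principal {(x, y). dist x y < e})"

definition open_L2 :: "L2 set \<Rightarrow> bool" where
  "open_L2 U \<longleftrightarrow> (\<forall>x\<in>U. eventually (\<lambda>(x', y). x' = x \<longrightarrow> y \<in> U) uniformity)"

lemma Re_cinner_self:
  "square_integrable f \<Longrightarrow> Re (\<integral>x. cnj (f x) * f x \<partial>lborel) = (\<integral>x. (cmod (f x))\<^sup>2 \<partial>lborel)"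
proof -
  have "(\<lambda>x. cnj (f x) * f x) = (\<lambda>x. complex_of_real ((cmod (f x))\<^sup>2))"
    by (rule ext) (metis complex_norm_square mult.commute)
  then show ?thesis
    by (simp only: integral_complex_of_real Re_complex_of_real)
qed

instance
proof
  fix x y z :: L2 and r r' :: real
  show "x + y + z = x + (y + z)"
    by transfer (auto simp: L2_eq_def algebra_simps intro!: square_integrable_add)
  show "x + y = y + x"
    by transfer (auto simp: L2_eq_def algebra_simps intro!: square_integrable_add)
  show "0 + x = x"
    by transfer (auto simp: L2_eq_def)
  show "- x + x = 0"
    by transfer (auto simp: L2_eq_def square_integrable_zero)
  show "x - y = x + - y"
    by transfer (auto simp: L2_eq_def intro: square_integrable_diff)
  show "r *\<^sub>R (x + y) = r *\<^sub>R x + r *\<^sub>R y"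
    unfolding scaleR_L2_def
    by transfer (auto simp: L2_eq_def distrib_left distrib_right
      intro!: square_integrable_add square_integrable_cmult)
  show "(r + r') *\<^sub>R x = r *\<^sub>R x + r' *\<^sub>R x"
    unfolding scaleR_L2_def
    by transfer (auto simp: L2_eq_def distrib_left distrib_right
      intro!: square_integrable_add square_integrable_cmult)
  show "r *\<^sub>R r' *\<^sub>R x = (r * r') *\<^sub>R x"
    unfolding scaleR_L2_def
    by transfer (auto simp: L2_eq_def mult.assoc[symmetric] intro!: square_integrable_cmult)
  show "1 *\<^sub>R x = x"
    unfolding scaleR_L2_def by transfer (auto simp: L2_eq_def)
  show "sgn x = inverse (norm x) *\<^sub>R x"
    by (simp add: sgn_L2_def scaleR_L2_def)
  show "dist x y = norm (x - y)"
    by (simp add: dist_L2_def)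
  show "uniformity = (INF e\<in>{0<..}. principal {(x, y :: L2). dist x y < e})"
    by (simp add: uniformity_L2_def)
  show "open U \<longleftrightarrow> (\<forall>x\<in>U. eventually (\<lambda>(x', y). x' = x \<longrightarrow> y \<in> U) uniformity)" for U :: "L2 set"
    by (simp add: open_L2_def)
  show "norm x = sqrt (inner x x)"
    by (simp add: norm_L2_def)
  have cnj_int: "(\<integral>x. cnj (f x) * g x \<partial>lborel) = cnj (\<integral>x. cnj (g x) * f x \<partial>lborel)"
    for f g :: "real^3 \<Rightarrow> complex"
    unfolding Bochner_Integration.integral_cnj[symmetric] by (simp add: mult.commute)
  have "cinner x y = cnj (cinner y x)"
    by transfer (rule cnj_int)
  then show "inner x y = inner y x"
    by (simp add: inner_L2_def)
  have "cinner (x + y) z = cinner x z + cinner y z"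
    by transfer (auto simp: L2_eq_def distrib_right square_integrable_mult_integrable
      intro!: Bochner_Integration.integral_add)
  then show "inner (x + y) z = inner x z + inner y z"
    by (simp add: inner_L2_def)
  have "cinner (complex_of_real r *\<^sub>C x) y = complex_of_real r * cinner x y"
    by transfer (auto simp: L2_eq_def mult.assoc)
  then show "inner (r *\<^sub>R x) y = r * inner x y"
    by (simp add: inner_L2_def scaleR_L2_def)
  show "0 \<le> inner x x"
    unfolding inner_L2_def
    by transfer (auto simp: L2_eq_def Re_cinner_self)
  have "square_integrable f \<Longrightarrow>
      (Re (\<integral>x. cnj (f x) * f x \<partial>lborel) = 0) = L2_eq f (\<lambda>x. 0)" for f
  proof -
    assume f: "square_integrable f"
    then have "(\<integral>x. (cmod (f x))\<^sup>2 \<partial>lborel) = 0 \<longleftrightarrow> (AE x in lborel. (cmod (f x))\<^sup>2 = 0)"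
      by (intro integral_nonneg_eq_0_iff_AE) (auto simp: square_integrable_def)
    with f show ?thesis
      by (simp add: Re_cinner_self L2_eq_def square_integrable_zero)
  qed
  note * = this
  show "(inner x x = 0) = (x = 0)"
    unfolding inner_L2_def
    by transfer (use * in \<open>auto simp: L2_eq_def\<close>)
qed

end

section \<open>Unbounded operators, given by their graphs\<close>

type_synonym operator = "(L2 \<times> L2) set"

definition graph_of :: "(L2 \<Rightarrow> L2) \<Rightarrow> operator" where
  "graph_of B = {(f, B f) | f. True}"

definition op_apply :: "operator \<Rightarrow> L2 \<Rightarrow> L2" where
  "op_apply T f = (THE h. (f, h) \<in> T)"

definition op_add :: "operator \<Rightarrow> operator \<Rightarrow> operator" where
  "op_add S T = {(f, h + h') | f h h'. (f, h) \<in> S \<and> (f, h') \<in> T}"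

definition op_shift :: "operator \<Rightarrow> complex \<Rightarrow> operator" where
  "op_shift T z = op_add T (graph_of (\<lambda>f. z *\<^sub>C f))"

definition adjoint_op :: "operator \<Rightarrow> operator" where
  "adjoint_op T = {(u, v). \<forall>(f, h)\<in>T. cinner u h = cinner v f}"

text \<open>The adjoint of a densely defined operator is the graph of a linear operator, so
  linearity and single-valuedness of \<open>T\<close> need not be required separately.\<close>

definition self_adjoint :: "operator \<Rightarrow> bool" where
  "self_adjoint T \<longleftrightarrow> closure (Domain T) = UNIV \<and> adjoint_op T = T"

definition semibounded_below :: "operator \<Rightarrow> bool" where
  "semibounded_below T \<longleftrightarrow> (\<exists>c. \<forall>(f, h)\<in>T. c * (norm f)\<^sup>2 \<le> Re (cinner f h))"

definition invertible_op :: "operator \<Rightarrow> bool" where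
  "invertible_op T \<longleftrightarrow>
     (\<exists>B. bounded_linear B \<and> (\<forall>c f. B (c *\<^sub>C f) = c *\<^sub>C B f) \<and> converse T = graph_of B)"

definition spectrum :: "operator \<Rightarrow> complex set" where
  "spectrum T = {z. \<not> invertible_op (op_shift T (- z))}"

definition inf_spectrum :: "operator \<Rightarrow> ereal" where
  "inf_spectrum T = (INF z\<in>spectrum T. ereal (Re z))"

text \<open>The quadratic form of a lower semi-bounded symmetric operator \<open>T\<close>: the closure of
  \<open>f \<mapsto> \<langle>f, T f\<rangle>\<close> on the domain of \<open>T\<close>. For self-adjoint \<open>T\<close> this is the
  closed quadratic form of \<open>T\<close>. A sequence in the graph of \<open>T\<close> represents a sequence in the
  domain together with the images under \<open>T\<close>.\<close>

definition form_approx :: "operator \<Rightarrow> (nat \<Rightarrow> L2 \<times> L2) \<Rightarrow> L2 \<Rightarrow> bool" where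
  "form_approx T X f \<longleftrightarrow>
     (\<forall>n. X n \<in> T) \<and> (\<lambda>n. fst (X n)) \<longlonglongrightarrow> f \<and>
     (\<forall>e>0. \<exists>N. \<forall>m\<ge>N. \<forall>n\<ge>N.
        \<bar>Re (cinner (fst (X m) - fst (X n)) (snd (X m) - snd (X n)))\<bar> < e)"

definition form_domain :: "operator \<Rightarrow> L2 set" where
  "form_domain T = {f. \<exists>X. form_approx T X f}"

definition quad_form :: "operator \<Rightarrow> L2 \<Rightarrow> real" where
  "quad_form T f =
     (THE q. \<exists>X. form_approx T X f \<and> (\<lambda>n. Re (cinner (fst (X n)) (snd (X n)))) \<longlonglongrightarrow> q)"

text \<open>The Friedrichs extension of a lower semi-bounded symmetric operator \<open>T\<close> is the
  self-adjoint extension associated with the closure of the form of \<open>T\<close>.\<close>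

definition is_friedrichs_extension :: "operator \<Rightarrow> operator \<Rightarrow> bool" where
  "is_friedrichs_extension T A \<longleftrightarrow>
     T \<subseteq> A \<and> self_adjoint A \<and> semibounded_below A \<and>
     form_domain A = form_domain T \<and> (\<forall>f\<in>form_domain T. quad_form A f = quad_form T f)"

definition rank_one :: "L2 \<Rightarrow> L2 \<Rightarrow> L2" where
  "rank_one u h = cinner u h *\<^sub>C u"

section \<open>Fourier transform, multipliers and Sobolev spaces\<close>

text \<open>On \<open>L\<^sup>2\<close> the Fourier integral is the \<open>L\<^sup>2\<close>-limit of the integrals over balls.\<close>

definition fourier_ball :: "nat \<Rightarrow> (real^3 \<Rightarrow> complex) \<Rightarrow> real^3 \<Rightarrow> complex" where
  "fourier_ball n f p =
     complex_of_real ((2 * pi) powr (- 3 / 2)) *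
     (\<integral>x. indicator (cball 0 (real n)) x *\<^sub>R (exp (- \<i> * complex_of_real (p \<bullet> x)) * f x) \<partial>lborel)"

definition fourier :: "L2 \<Rightarrow> L2" where
  "fourier f = lim (\<lambda>n. to_L2 (fourier_ball n (L2_fun f)))"

abbreviation inv_fourier :: "L2 \<Rightarrow> L2" where
  "inv_fourier \<equiv> inv fourier"

abbreviation fhat :: "L2 \<Rightarrow> real^3 \<Rightarrow> complex" where
  "fhat f \<equiv> L2_fun (fourier f)"

definition fourier_multiplier :: "(real^3 \<Rightarrow> real) \<Rightarrow> operator" where
  "fourier_multiplier m =
     {(f, h). AE p in lborel. fhat h p = complex_of_real (m p) * fhat f p}"

definition sobolev :: "real \<Rightarrow> L2 set" where
  "sobolev a = {f. integrable lborel (\<lambda>p. (1 + (norm p)\<^sup>2) powr a * (cmod (fhat f p))\<^sup>2)}"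

definition abs_nabla :: "real \<Rightarrow> operator" where
  "abs_nabla a = fourier_multiplier (\<lambda>p. norm p powr a)"

definition frac_laplacian :: "real \<Rightarrow> operator" where
  "frac_laplacian s = fourier_multiplier (\<lambda>p. norm p powr s)"

definition value_at_0 :: "L2 \<Rightarrow> complex" where
  "value_at_0 F =
     (THE c. \<exists>\<phi>. continuous_on UNIV \<phi> \<and> (AE x in lborel. \<phi> x = L2_fun F x) \<and> \<phi> 0 = c)"

primrec n_times_differentiable :: "nat \<Rightarrow> ('a::real_normed_vector \<Rightarrow> 'b::real_normed_vector) \<Rightarrow> bool" where
  "n_times_differentiable 0 f \<longleftrightarrow> continuous_on UNIV f"
| "n_times_differentiable (Suc n) f \<longleftrightarrow>
     (\<forall>x. f differentiable (at x)) \<and>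
     (\<forall>v. n_times_differentiable n (\<lambda>x. frechet_derivative f (at x) v))"

definition test_functions_off_0 :: "(real^3 \<Rightarrow> complex) set" where
  "test_functions_off_0 =
     {\<phi>. (\<forall>n. n_times_differentiable n \<phi>) \<and>
         compact (closure {x. \<phi> x \<noteq> 0}) \<and> 0 \<notin> closure {x. \<phi> x \<noteq> 0}}"

section \<open>The operator \<open>k\<close> and its extensions\<close>

definition k_ring :: "real \<Rightarrow> operator" where
  "k_ring s = closure {(f, h) \<in> frac_laplacian s. f \<in> to_L2 ` test_functions_off_0}"

definition Gfun :: "real \<Rightarrow> real \<Rightarrow> L2" where
  "Gfun s lam = complex_of_real ((2 * pi) powr (- 3 / 2)) *\<^sub>C
     inv_fourier (to_L2 (\<lambda>p. complex_of_real (1 / (norm p powr s + lam))))"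

definition k_ext_real :: "real \<Rightarrow> real \<Rightarrow> real \<Rightarrow> operator" where
  "k_ext_real s lam \<tau> =
     {(g, h). \<exists>f \<xi>. f \<in> sobolev s \<and> (\<integral>p. fhat f p \<partial>lborel) = 0 \<and>
        (AE p in lborel. fhat g p = fhat f p
            + complex_of_real \<tau> * \<xi> / (complex_of_real (norm p powr s + lam))\<^sup>2
            + \<xi> / complex_of_real (norm p powr s + lam)) \<and>
        h + complex_of_real lam *\<^sub>C g =
          inv_fourier (to_L2 (\<lambda>p. complex_of_real (norm p powr s + lam) *
            (fhat f p + complex_of_real \<tau> * \<xi> / (complex_of_real (norm p powr s + lam))\<^sup>2)))}"

text \<open>The labelling by \<open>\<tau>\<close> depends on the shift \<open>lam\<close>. The parameter ranges over \<open>\<real> \<union> {\<infinity>}\<close>, that is, over the extended reals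
  other than \<open>-\<infinity>\<close>; the value at \<open>-\<infinity>\<close> is irrelevant.\<close>

definition k_ext :: "real \<Rightarrow> real \<Rightarrow> ereal \<Rightarrow> operator" where
  "k_ext s lam \<tau> =
     (if \<tau> = \<infinity> then frac_laplacian s else k_ext_real s lam (real_of_ereal \<tau>))"

definition G_coeff :: "real \<Rightarrow> real \<Rightarrow> ereal \<Rightarrow> real" where
  "G_coeff s lam \<tau> =
     (if \<tau> = \<infinity> then 0
      else 2 * pi * s\<^sup>2 * sin (3 * pi / s) * lam powr (2 - 3 / s) / (real_of_ereal \<tau> * (s - 3)))"

end

theory Submission
  imports Defs "HOL-Probability.Characteristic_Functions"
begin

text \<open>Put \<open>w(p) = \<bar>p\<bar>\<^sup>s + \<lambda>\<close> and \<open>\<eta>\<^sup>^ = 1/w\<close>. After adding \<open>\<lambda>\<close>, the minimal operator is the restriction of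
  the multiplication operator \<open>R\<^sup>-\<^sup>1 = w\<close> to \<open>R(\<eta>\<^sup>\<bottom>)\<close>, so its adjoint consists of the pairs \<open>(R v + \<xi> \<eta>, v)\<close>.
  A self-adjoint extension is a Lagrangian relation between \<open>\<xi>\<close> and \<open>\<langle>\<eta>, v\<rangle>\<close>, that is \<open>\<xi> = 0\<close> or
  \<open>\<langle>\<eta>, v\<rangle> = t \<xi>\<close> with \<open>t = \<tau> \<parallel>\<eta>\<parallel>\<^sup>2\<close> real, and its form is \<open>\<parallel>w\<^sup>1\<^sup>/\<^sup>2 F\<^sup>^\<parallel>\<^sup>2 + t \<bar>\<xi>\<bar>\<^sup>2\<close> on \<open>F + \<xi> \<eta>\<close>. Everything
  else is abstract Hilbert space theory, resting on \<open>\<eta>\<close> not being in the form domain because \<open>s < 3\<close>.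
  The identification of the closure of the test functions off the origin is where \<open>s < 5/2\<close> enters.\<close>

text \<open>At infinity 1/w decays like |p|^(-s): s > 3/2 places \<eta> in L^2, while the integral
  of 1/w diverges, so pairing with \<eta> is unbounded in the norm of \<open>Q v\<close>, where
  \<open>Q\<close> multiplies by w^(-1/2). That one fact yields semiboundedness for every t (the
  singular charge \<xi> is infinitesimally form bounded), density of the minimal domain, and the
  freedom to prescribe <\<eta>, v> while \<open>Q v\<close> approximates any given vector. The
  constants come from |\<eta>|^2, a Beta integral evaluated by the reflection formula; it is
  positive because s - 3 and sin(3 pi / s) are both negative. The factor (2 pi)^3 between it and the
  coefficient in the statement is the normalisation of the Green function. Operators are bare graphs
  and the Fourier transform is a limit of integrals over balls, so completeness, projections, bounds
  on the spectrum and Plancherel are obtained by elementary means, the last one by Gaussian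
  regularisation of functions continuous almost everywhere, followed by density.\<close>

section \<open>Almost-everywhere classes and the complex Hilbert space structure of L^2\<close>

lemma L2_eq_refl_iff: "L2_eq f f \<longleftrightarrow> square_integrable f"
  by (auto simp: L2_eq_def)

lemma square_integrable_L2_fun: "square_integrable (L2_fun u)"
  using Quotient3_rep_reflp[OF Quotient3_L2] by (simp add: L2_eq_refl_iff)

lemma L2_fun_measurable [measurable]: "L2_fun u \<in> borel_measurable borel"
  using square_integrable_L2_fun[of u] by (simp add: square_integrable_def)

lemma square_integrable_measurable: "square_integrable f \<Longrightarrow> f \<in> borel_measurable borel"
  by (simp add: square_integrable_def)

lemma to_L2_L2_fun [simp]: "to_L2 (L2_fun u) = u"
  by (rule Quotient3_abs_rep[OF Quotient3_L2])

lemma to_L2_eq_iff: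
  "square_integrable f \<Longrightarrow> square_integrable g \<Longrightarrow> to_L2 f = to_L2 g \<longleftrightarrow> (AE x in lborel. f x = g x)"
  using Quotient3_rel[OF Quotient3_L2, of f g] by (auto simp: L2_eq_def)

lemma L2_eqI: "(AE x in lborel. L2_fun u x = L2_fun v x) \<Longrightarrow> u = v"
  using to_L2_eq_iff[OF square_integrable_L2_fun square_integrable_L2_fun, of u v] by simp

lemma L2_fun_to_L2: "square_integrable f \<Longrightarrow> AE x in lborel. L2_fun (to_L2 f) x = f x"
  using to_L2_eq_iff[OF square_integrable_L2_fun, of f "to_L2 f"] by simp

text \<open>Square integrability of f is inherited from the representative of u along the equality
  almost everywhere, so measurability is all that remains to check.\<close>

lemma to_L2_eqI: "(AE x in lborel. L2_fun u x = f x) \<Longrightarrow> f \<in> borel_measurable borel \<Longrightarrow> to_L2 f = u"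
proof -
  assume a: "AE x in lborel. L2_fun u x = f x" and m: "f \<in> borel_measurable borel"
  have "integrable lborel (\<lambda>x. (cmod (L2_fun u x))\<^sup>2) = integrable lborel (\<lambda>x. (cmod (f x))\<^sup>2)"
    using a m by (intro integrable_cong_AE) auto
  then have "square_integrable f"
    using square_integrable_L2_fun[of u] m by (simp add: square_integrable_def)
  then have "to_L2 f = to_L2 (L2_fun u)"
    using a by (subst to_L2_eq_iff) (auto simp: square_integrable_L2_fun)
  then show ?thesis by simp
qed

lemma square_integrable_AE_cong:
  "square_integrable f \<Longrightarrow> (AE x in lborel. f x = g x) \<Longrightarrow> g \<in> borel_measurable borel \<Longrightarrow> square_integrable g"
proof -
  assume a: "square_integrable f" "AE x in lborel. f x = g x" and m: "g \<in> borel_measurable borel"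
  have "integrable lborel (\<lambda>x. (cmod (f x))\<^sup>2) = integrable lborel (\<lambda>x. (cmod (g x))\<^sup>2)"
    using a m by (intro integrable_cong_AE) (auto dest: square_integrable_measurable)
  then show ?thesis using a m by (simp add: square_integrable_def)
qed

lemma square_integrable_bound:
  assumes "square_integrable f" "g \<in> borel_measurable borel" "\<And>x. cmod (g x) \<le> C * cmod (f x)"
  shows "square_integrable g"
  unfolding square_integrable_def
proof
  show "g \<in> borel_measurable lborel" using assms by simp
  show "integrable lborel (\<lambda>x. (cmod (g x))\<^sup>2)"
  proof (rule Bochner_Integration.integrable_bound)
    show "integrable lborel (\<lambda>x. C\<^sup>2 * (cmod (f x))\<^sup>2)"
      using assms by (auto simp: square_integrable_def)
    show "AE x in lborel. norm ((cmod (g x))\<^sup>2) \<le> norm (C\<^sup>2 * (cmod (f x))\<^sup>2)"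
      using power_mono[OF assms(3) norm_ge_zero, of _ 2] by (auto simp: power_mult_distrib)
  qed (use assms in auto)
qed

lemma L2_fun_add: "AE x in lborel. L2_fun (u + v) x = L2_fun u x + L2_fun v x"
proof -
  have "u + v = to_L2 (\<lambda>x. L2_fun u x + L2_fun v x)"
    using plus_L2.abs_eq[of "L2_fun u" "L2_fun v"] by (simp add: L2_eq_refl_iff square_integrable_L2_fun)
  then show ?thesis
    using L2_fun_to_L2[OF square_integrable_add[OF square_integrable_L2_fun square_integrable_L2_fun]] by simp
qed

lemma L2_fun_diff: "AE x in lborel. L2_fun (u - v) x = L2_fun u x - L2_fun v x"
proof -
  have "u - v = to_L2 (\<lambda>x. L2_fun u x - L2_fun v x)"
    using minus_L2.abs_eq[of "L2_fun u" "L2_fun v"] by (simp add: L2_eq_refl_iff square_integrable_L2_fun)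
  then show ?thesis
    using L2_fun_to_L2[OF square_integrable_diff[OF square_integrable_L2_fun square_integrable_L2_fun]] by simp
qed

lemma L2_fun_scaleC: "AE x in lborel. L2_fun (c *\<^sub>C u) x = c * L2_fun u x"
proof -
  have "c *\<^sub>C u = to_L2 (\<lambda>x. c * L2_fun u x)"
    using scaleC_L2.abs_eq[of "L2_fun u" c] by (simp add: L2_eq_refl_iff square_integrable_L2_fun)
  then show ?thesis
    using L2_fun_to_L2[OF square_integrable_cmult[OF square_integrable_L2_fun]] by simp
qed

lemma L2_fun_0: "AE x in lborel. L2_fun 0 x = 0"
proof -
  have "(0::L2) = to_L2 (\<lambda>x. 0)" by (simp add: zero_L2_def)
  then show ?thesis using L2_fun_to_L2[OF square_integrable_zero] by simp
qed

lemma to_L2_add: "square_integrable f \<Longrightarrow> square_integrable g \<Longrightarrow> to_L2 (\<lambda>x. f x + g x) = to_L2 f + to_L2 g"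
  by (subst plus_L2.abs_eq) (auto simp: L2_eq_refl_iff)

lemma to_L2_diff: "square_integrable f \<Longrightarrow> square_integrable g \<Longrightarrow> to_L2 (\<lambda>x. f x - g x) = to_L2 f - to_L2 g"
  by (subst minus_L2.abs_eq) (auto simp: L2_eq_refl_iff)

lemma to_L2_scaleC: "square_integrable f \<Longrightarrow> to_L2 (\<lambda>x. c * f x) = c *\<^sub>C to_L2 f"
  by (subst scaleC_L2.abs_eq) (auto simp: L2_eq_refl_iff)

lemma cinner_to_L2:
  "square_integrable f \<Longrightarrow> square_integrable g \<Longrightarrow> cinner (to_L2 f) (to_L2 g) = (\<integral>x. cnj (f x) * g x \<partial>lborel)"
  by (subst cinner.abs_eq) (auto simp: L2_eq_refl_iff)

lemma cinner_L2_fun: "cinner u v = (\<integral>x. cnj (L2_fun u x) * L2_fun v x \<partial>lborel)"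
  using cinner_to_L2[OF square_integrable_L2_fun square_integrable_L2_fun, of u v] by simp

lemma cinner_cnj: "cinner u v = cnj (cinner v u)"
  unfolding cinner_L2_fun Bochner_Integration.integral_cnj[symmetric] by (simp add: mult.commute)

lemma cinner_add_right: "cinner u (v + w) = cinner u v + cinner u w"
proof -
  have "cinner u (v + w) = (\<integral>x. cnj (L2_fun u x) * L2_fun v x + cnj (L2_fun u x) * L2_fun w x \<partial>lborel)"
    unfolding cinner_L2_fun
  proof (intro integral_cong_AE)
    show "AE x in lborel. cnj (L2_fun u x) * L2_fun (v + w) x
        = cnj (L2_fun u x) * L2_fun v x + cnj (L2_fun u x) * L2_fun w x"
      using L2_fun_add[of v w] by eventually_elim (simp add: distrib_left)
  qed (use square_integrable_mult_integrable[OF square_integrable_L2_fun square_integrable_L2_fun] in auto)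
  then show ?thesis
    unfolding cinner_L2_fun
    by (simp add: square_integrable_mult_integrable square_integrable_L2_fun)
qed

lemma cinner_scaleC_right: "cinner u (c *\<^sub>C v) = c * cinner u v"
proof -
  have "cinner u (c *\<^sub>C v) = (\<integral>x. c * (cnj (L2_fun u x) * L2_fun v x) \<partial>lborel)"
    unfolding cinner_L2_fun
  proof (intro integral_cong_AE)
    show "AE x in lborel. cnj (L2_fun u x) * L2_fun (c *\<^sub>C v) x = c * (cnj (L2_fun u x) * L2_fun v x)"
      using L2_fun_scaleC[of c v] by eventually_elim simp
  qed (use square_integrable_mult_integrable[OF square_integrable_L2_fun square_integrable_L2_fun] in auto)
  then show ?thesis
    unfolding cinner_L2_fun by simp
qed

lemma cinner_add_left: "cinner (u + v) w = cinner u w + cinner v w"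
  by (subst (1 2 3) cinner_cnj) (simp add: cinner_add_right)

lemma cinner_scaleC_left: "cinner (c *\<^sub>C u) v = cnj c * cinner u v"
  by (subst (1 2) cinner_cnj) (simp add: cinner_scaleC_right)

lemma scaleC_minus1: "(-1) *\<^sub>C u = - u"
proof -
  have "- u = (-1) *\<^sub>R u" by simp
  then show ?thesis unfolding scaleR_L2_def by simp
qed

lemma cinner_diff_right: "cinner u (v - w) = cinner u v - cinner u w"
  using cinner_add_right[of u v "(-1) *\<^sub>C w"] cinner_scaleC_right[of u "-1" w] by (simp add: scaleC_minus1)

lemma cinner_diff_left: "cinner (u - v) w = cinner u w - cinner v w"
  by (subst (1 2 3) cinner_cnj) (simp add: cinner_diff_right)

lemma cinner_0_right [simp]: "cinner u 0 = 0"
  using cinner_diff_right[of u 0 0] by simp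

lemma cinner_0_left [simp]: "cinner 0 u = 0"
  using cinner_diff_left[of 0 0 u] by simp

lemmas cinner_simps = cinner_add_right cinner_add_left cinner_diff_right cinner_diff_left
  cinner_scaleC_right cinner_scaleC_left

lemma scaleC_add_right: "c *\<^sub>C (u + v) = c *\<^sub>C u + c *\<^sub>C (v::L2)"
  by transfer (auto simp: L2_eq_def distrib_left intro!: square_integrable_add square_integrable_cmult)

lemma scaleC_add_left: "(c + d) *\<^sub>C u = c *\<^sub>C u + d *\<^sub>C (u::L2)"
  by transfer (auto simp: L2_eq_def distrib_right intro!: square_integrable_add square_integrable_cmult)

lemma scaleC_scaleC [simp]: "c *\<^sub>C d *\<^sub>C u = (c * d) *\<^sub>C (u::L2)"
  by transfer (auto simp: L2_eq_def mult.assoc[symmetric] intro!: square_integrable_cmult)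

lemma scaleC_1 [simp]: "1 *\<^sub>C (u::L2) = u"
  by transfer (auto simp: L2_eq_def)

lemma scaleC_0_left [simp]: "0 *\<^sub>C (u::L2) = 0"
  by transfer (auto simp: L2_eq_def square_integrable_zero)

lemma scaleC_0_right [simp]: "c *\<^sub>C (0::L2) = 0"
  by transfer (auto simp: L2_eq_def square_integrable_zero)

lemma scaleC_minus_left: "(- c) *\<^sub>C u = - (c *\<^sub>C (u::L2))"
  using scaleC_add_left[of c "-c" u] by (simp add: eq_neg_iff_add_eq_0 add.commute)

lemma scaleC_minus_right: "c *\<^sub>C (- u) = - (c *\<^sub>C (u::L2))"
  using scaleC_add_right[of c u "-u"] by (simp add: eq_neg_iff_add_eq_0 add.commute)

lemma scaleC_diff_right: "c *\<^sub>C (u - v) = c *\<^sub>C u - c *\<^sub>C (v::L2)"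
  using scaleC_add_right[of c u "-v"] by (simp add: scaleC_minus_right)

lemma scaleC_diff_left: "(c - d) *\<^sub>C u = c *\<^sub>C u - d *\<^sub>C (u::L2)"
  using scaleC_add_left[of c "-d" u] by (simp add: scaleC_minus_left)

lemmas scaleC_simps = scaleC_add_left scaleC_add_right scaleC_diff_left scaleC_diff_right
  scaleC_minus_left scaleC_minus_right

lemma cinner_self: "cinner u u = complex_of_real ((norm u)\<^sup>2)"
proof -
  have "cinner u u = cnj (cinner u u)" by (rule cinner_cnj)
  then have "Im (cinner u u) = 0" by (metis cnj.sel(2) equal_neg_zero)
  moreover have "Re (cinner u u) = (norm u)\<^sup>2"
    using power2_norm_eq_inner[of u] by (simp add: inner_L2_def)
  ultimately show ?thesis by (simp add: complex_eq_iff)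
qed

lemma norm_scaleC [simp]: "norm (c *\<^sub>C (u::L2)) = cmod c * norm u"
proof -
  have "complex_of_real ((norm (c *\<^sub>C u))\<^sup>2) = (c * cnj c) * complex_of_real ((norm u)\<^sup>2)"
    unfolding cinner_self[symmetric] cinner_scaleC_left cinner_scaleC_right by simp
  also have "\<dots> = complex_of_real ((cmod c * norm u)\<^sup>2)"
    unfolding power_mult_distrib of_real_mult complex_norm_square ..
  finally show ?thesis
    by (simp only: of_real_eq_iff) (rule power2_eq_imp_eq; simp)
qed

lemma scaleC_eq_0_iff [simp]: "c *\<^sub>C (u::L2) = 0 \<longleftrightarrow> c = 0 \<or> u = 0"
  by (metis norm_eq_zero norm_scaleC mult_eq_0_iff)

lemma norm_L2_eq: "(norm u)\<^sup>2 = (\<integral>x. (cmod (L2_fun u x))\<^sup>2 \<partial>lborel)"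
  using Re_cinner_self[OF square_integrable_L2_fun, of u] cinner_self[of u]
  by (simp add: cinner_L2_fun)

lemma norm_to_L2: "square_integrable f \<Longrightarrow> (norm (to_L2 f))\<^sup>2 = (\<integral>x. (cmod (f x))\<^sup>2 \<partial>lborel)"
  using Re_cinner_self[of f] cinner_self[of "to_L2 f"] cinner_to_L2[of f f] by simp

text \<open>Multiplying v by the phase c turns the complex product into its modulus, which the real
  Cauchy-Schwarz inequality of the type class then bounds.\<close>

lemma cinner_Cauchy_Schwarz: "cmod (cinner u v) \<le> norm u * norm v"
proof (cases "cinner u v = 0")
  case False
  define c where "c = cnj (cinner u v) / cmod (cinner u v)"
  have c: "cmod c = 1" using False by (simp add: c_def norm_divide)
  have "c * cinner u v = complex_of_real (cmod (cinner u v))"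
    using False complex_norm_square[of "cinner u v"] unfolding c_def
    by (simp add: field_simps power2_eq_square)
  then have "cmod (cinner u v) = Re (cinner u (c *\<^sub>C v))"
    by (simp add: cinner_scaleC_right)
  also have "\<dots> \<le> norm u * norm (c *\<^sub>C v)"
    using norm_cauchy_schwarz[of u "c *\<^sub>C v"] by (simp add: inner_L2_def)
  finally show ?thesis by (simp add: c)
qed simp

lemma scaleR_scaleC: "r *\<^sub>R (u::L2) = complex_of_real r *\<^sub>C u"
  by (rule scaleR_L2_def)

lemma bounded_bilinear_cinner: "bounded_bilinear cinner"
proof
  show "\<exists>K. \<forall>a b. norm (cinner a b) \<le> norm a * norm b * K"
    by (rule exI[of _ 1]) (simp add: cinner_Cauchy_Schwarz)
qed (auto simp: cinner_simps scaleR_scaleC scaleR_conv_of_real)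

lemma bounded_bilinear_scaleC: "bounded_bilinear (\<lambda>c (u::L2). c *\<^sub>C u)"
proof
  show "\<exists>K. \<forall>a b. norm (a *\<^sub>C (b::L2)) \<le> norm a * norm b * K"
    by (rule exI[of _ 1]) simp
qed (auto simp: scaleC_simps scaleR_scaleC scaleR_conv_of_real mult_ac)

lemmas tendsto_cinner [tendsto_intros] = bounded_bilinear.tendsto[OF bounded_bilinear_cinner]
lemmas tendsto_scaleC [tendsto_intros] = bounded_bilinear.tendsto[OF bounded_bilinear_scaleC]

lemma cinner_all_0: "(\<And>v. cinner v u = 0) \<Longrightarrow> u = 0"
  using cinner_self[of u] by simp

lemma cinner_eqI: "(\<And>w. cinner w u = cinner w v) \<Longrightarrow> u = v"
  using cinner_all_0[of "u - v"] by (simp add: cinner_diff_right)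

section \<open>Completeness of L^2 and pointwise limits\<close>

lemma nn_integral_norm_L2: "(\<integral>\<^sup>+x. ennreal ((cmod (L2_fun u x))\<^sup>2) \<partial>lborel) = ennreal ((norm u)\<^sup>2)"
  using square_integrable_L2_fun[of u] unfolding norm_L2_eq square_integrable_def
  by (intro nn_integral_eq_integral) auto

lemma square_integrable_nn:
  "f \<in> borel_measurable borel \<Longrightarrow> (\<integral>\<^sup>+x. ennreal ((cmod (f x))\<^sup>2) \<partial>lborel) < \<infinity> \<Longrightarrow> square_integrable f"
  unfolding square_integrable_def by (auto intro!: integrableI_bounded)

lemma nn_integral_to_L2:
  "square_integrable f \<Longrightarrow> (\<integral>\<^sup>+x. ennreal ((cmod (f x))\<^sup>2) \<partial>lborel) = ennreal ((norm (to_L2 f))\<^sup>2)"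
  by (subst norm_to_L2) (auto simp: square_integrable_def intro!: nn_integral_eq_integral)

text \<open>Fatou: |X n - f|^2 is the pointwise limit of |X n - X m|^2 as m grows, so its integral
  is at most the Cauchy bound. No norm limit is presupposed, which lets the lemma serve the
  completeness proof as well as later identifications of limits.\<close>

lemma Cauchy_L2_AE_limit:
  assumes X: "Cauchy X" and ae: "AE x in lborel. (\<lambda>n. L2_fun (X n) x) \<longlonglongrightarrow> f x"
    and m [measurable]: "f \<in> borel_measurable borel"
  shows "square_integrable f \<and> X \<longlonglongrightarrow> to_L2 f"
proof -
  have bound: "(\<integral>\<^sup>+x. ennreal ((cmod (L2_fun (X n) x - f x))\<^sup>2) \<partial>lborel) \<le> ennreal (e\<^sup>2)"
    if N: "\<And>m. m \<ge> N \<Longrightarrow> norm (X n - X m) \<le> e" for n N e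
  proof -
    have "(\<integral>\<^sup>+x. ennreal ((cmod (L2_fun (X n) x - f x))\<^sup>2) \<partial>lborel)
        = (\<integral>\<^sup>+x. liminf (\<lambda>m. ennreal ((cmod (L2_fun (X n) x - L2_fun (X m) x))\<^sup>2)) \<partial>lborel)"
    proof (intro nn_integral_cong_AE)
      show "AE x in lborel. ennreal ((cmod (L2_fun (X n) x - f x))\<^sup>2)
          = liminf (\<lambda>m. ennreal ((cmod (L2_fun (X n) x - L2_fun (X m) x))\<^sup>2))"
        using ae
      proof eventually_elim
        case (elim x)
        have "(\<lambda>m. ennreal ((cmod (L2_fun (X n) x - L2_fun (X m) x))\<^sup>2))
            \<longlonglongrightarrow> ennreal ((cmod (L2_fun (X n) x - f x))\<^sup>2)"
          by (intro tendsto_intros elim)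
        from lim_imp_Liminf[OF sequentially_bot this] show ?case by (rule sym)
      qed
    qed
    also have "\<dots> \<le> liminf (\<lambda>m. \<integral>\<^sup>+x. ennreal ((cmod (L2_fun (X n) x - L2_fun (X m) x))\<^sup>2) \<partial>lborel)"
      by (intro nn_integral_liminf) auto
    also have "\<dots> = liminf (\<lambda>m. ennreal ((norm (X n - X m))\<^sup>2))"
    proof (intro arg_cong[where f=liminf] ext)
      fix m
      have "AE x in lborel. ennreal ((cmod (L2_fun (X n) x - L2_fun (X m) x))\<^sup>2)
          = ennreal ((cmod (L2_fun (X n - X m) x))\<^sup>2)"
        using L2_fun_diff[of "X n" "X m"] by eventually_elim simp
      then show "(\<integral>\<^sup>+x. ennreal ((cmod (L2_fun (X n) x - L2_fun (X m) x))\<^sup>2) \<partial>lborel)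
          = ennreal ((norm (X n - X m))\<^sup>2)"
        unfolding nn_integral_norm_L2[symmetric] by (rule nn_integral_cong_AE)
    qed
    also have "\<dots> \<le> liminf (\<lambda>m. ennreal (e\<^sup>2))"
      using N by (intro Liminf_mono eventually_sequentiallyI[of N] ennreal_leI power_mono) auto
    also have "\<dots> = ennreal (e\<^sup>2)" by (intro lim_imp_Liminf) auto
    finally show ?thesis .
  qed
  have N: "\<exists>N. \<forall>n\<ge>N. \<forall>m\<ge>N. norm (X n - X m) \<le> e" if "e > 0" for e
    using X that unfolding Cauchy_def dist_norm by (meson less_imp_le)
  obtain N1 where N1: "\<And>n m. n \<ge> N1 \<Longrightarrow> m \<ge> N1 \<Longrightarrow> norm (X n - X m) \<le> 1"
    using N[of 1] by auto
  \<comment> \<open>Only differences are controlled by the Cauchy bound; adding back one member of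
    the sequence gives f itself.\<close>
  have "square_integrable (\<lambda>x. L2_fun (X N1) x - f x)"
    using bound[of N1 N1 1] N1 by (intro square_integrable_nn) (auto simp: le_less_trans)
  from square_integrable_diff[OF square_integrable_L2_fun[of "X N1"] this]
  have si: "square_integrable f" by simp
  moreover have "X \<longlonglongrightarrow> to_L2 f"
  proof (rule LIMSEQ_I)
    fix e :: real assume e: "0 < e"
    obtain M where M: "\<And>n m. n \<ge> M \<Longrightarrow> m \<ge> M \<Longrightarrow> norm (X n - X m) \<le> e / 2"
      using N[of "e / 2"] e by auto
    have "norm (X n - to_L2 f) < e" if n: "n \<ge> M" for n
    proof -
      have eq: "X n - to_L2 f = to_L2 (\<lambda>x. L2_fun (X n) x - f x)"
        by (simp add: to_L2_diff square_integrable_L2_fun si)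
      have "ennreal ((norm (X n - to_L2 f))\<^sup>2) \<le> ennreal ((e / 2)\<^sup>2)"
        unfolding eq
        by (subst nn_integral_to_L2[symmetric])
          (use bound[of M n "e/2"] M n in \<open>auto intro: square_integrable_diff square_integrable_L2_fun si\<close>)
      then have "(norm (X n - to_L2 f))\<^sup>2 \<le> (e / 2)\<^sup>2"
        by (subst (asm) ennreal_le_iff) auto
      then have "norm (X n - to_L2 f) \<le> e / 2"
        by (rule power2_le_imp_le) (use e in simp)
      then show ?thesis using e by simp
    qed
    then show "\<exists>no. \<forall>n\<ge>no. norm (X n - to_L2 f) < e" by blast
  qed
  ultimately show ?thesis by blast
qed

lemma L2_limit_AE_limit:
  assumes "X \<longlonglongrightarrow> u" "AE x in lborel. (\<lambda>n. L2_fun (X n) x) \<longlonglongrightarrow> f x" "f \<in> borel_measurable borel"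
  shows "square_integrable f" "to_L2 f = u"
  using Cauchy_L2_AE_limit[OF LIMSEQ_imp_Cauchy[OF assms(1)] assms(2,3)] LIMSEQ_unique assms(1) by blast+

text \<open>If \<open>\<parallel>X\<^sub>n - X\<^sub>n\<^sub>+\<^sub>1\<parallel>\<^sup>2 \<le> 4\<^sup>-\<^sup>n\<close>, then \<open>\<Sum> 2\<^sup>n \<bar>X\<^sub>n - X\<^sub>n\<^sub>+\<^sub>1\<bar>\<^sup>2\<close> has finite integral, hence is finite almost
  everywhere, and the telescoping series converges geometrically there.\<close>

lemma L2_complete_aux:
  fixes X :: "nat \<Rightarrow> L2"
  assumes "\<And>n. norm (X (Suc n) - X n) \<le> (1/2) ^ n" "Cauchy X"
  shows "convergent X"
proof -
  define d where "d = (\<lambda>n x. L2_fun (X (Suc n)) x - L2_fun (X n) x)"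
  have dm [measurable]: "d n \<in> borel_measurable borel" for n
    unfolding d_def by (intro borel_measurable_diff L2_fun_measurable)
  have pow2: "(2::real) ^ n * ((1/2) ^ n)\<^sup>2 = (1/2) ^ n" for n
    by (induction n) (simp_all add: power2_eq_square)
  have d: "(\<integral>\<^sup>+x. ennreal (2 ^ n * (cmod (d n x))\<^sup>2) \<partial>lborel) \<le> ennreal ((1/2) ^ n)" for n
  proof -
    have "AE x in lborel. ennreal ((cmod (d n x))\<^sup>2) = ennreal ((cmod (L2_fun (X (Suc n) - X n) x))\<^sup>2)"
      using L2_fun_diff[of "X (Suc n)" "X n"] by eventually_elim (simp add: d_def)
    then have "(\<integral>\<^sup>+x. ennreal ((cmod (d n x))\<^sup>2) \<partial>lborel) = ennreal ((norm (X (Suc n) - X n))\<^sup>2)"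
      unfolding nn_integral_norm_L2[symmetric] by (rule nn_integral_cong_AE)
    also have "\<dots> \<le> ennreal (((1/2) ^ n)\<^sup>2)"
      by (intro ennreal_leI power_mono assms(1)) simp
    finally have "ennreal (2 ^ n) * (\<integral>\<^sup>+x. ennreal ((cmod (d n x))\<^sup>2) \<partial>lborel)
        \<le> ennreal (2 ^ n) * ennreal (((1/2) ^ n)\<^sup>2)" by (rule mult_left_mono) simp
    also have "\<dots> = ennreal ((1/2) ^ n)"
      using ennreal_mult[of "2 ^ n" "((1/2) ^ n)\<^sup>2"] unfolding pow2 by simp
    finally have *: "ennreal (2 ^ n) * (\<integral>\<^sup>+x. ennreal ((cmod (d n x))\<^sup>2) \<partial>lborel)
        \<le> ennreal ((1/2) ^ n)" .
    have "(\<integral>\<^sup>+x. ennreal (2 ^ n * (cmod (d n x))\<^sup>2) \<partial>lborel)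
        = (\<integral>\<^sup>+x. ennreal (2 ^ n) * ennreal ((cmod (d n x))\<^sup>2) \<partial>lborel)"
      by (intro nn_integral_cong ennreal_mult) auto
    also have "\<dots> = ennreal (2 ^ n) * (\<integral>\<^sup>+x. ennreal ((cmod (d n x))\<^sup>2) \<partial>lborel)"
      by (intro nn_integral_cmult) measurable
    finally show ?thesis using * by (simp only:)
  qed
  have "(\<integral>\<^sup>+x. (\<Sum>n. ennreal (2 ^ n * (cmod (d n x))\<^sup>2)) \<partial>lborel)
      = (\<Sum>n. \<integral>\<^sup>+x. ennreal (2 ^ n * (cmod (d n x))\<^sup>2) \<partial>lborel)"
    by (intro nn_integral_suminf) measurable
  also have "\<dots> \<le> (\<Sum>n. ennreal ((1/2) ^ n))" by (intro suminf_le d) auto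
  also have "\<dots> = ennreal (\<Sum>n. (1/2) ^ n)" by (intro suminf_ennreal2) auto
  finally have "(\<integral>\<^sup>+x. (\<Sum>n. ennreal (2 ^ n * (cmod (d n x))\<^sup>2)) \<partial>lborel) \<noteq> \<infinity>"
    by (auto simp: top_unique)
  then have "AE x in lborel. (\<Sum>n. ennreal (2 ^ n * (cmod (d n x))\<^sup>2)) \<noteq> \<infinity>"
    by (intro nn_integral_PInf_AE) auto
  then have conv: "AE x in lborel. convergent (\<lambda>n. L2_fun (X n) x)"
  proof eventually_elim
    case (elim x)
    define S where "S = (\<Sum>n. ennreal (2 ^ n * (cmod (d n x))\<^sup>2))"
    obtain C where C: "S = ennreal C" "C \<ge> 0" using elim unfolding S_def[symmetric] by (cases S) auto
    have "ennreal (2 ^ n * (cmod (d n x))\<^sup>2) \<le> ennreal C" for n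
    proof -
      have "sum (\<lambda>n. ennreal (2 ^ n * (cmod (d n x))\<^sup>2)) {n} \<le> S"
        unfolding S_def by (intro sum_le_suminf) auto
      then show ?thesis using C by simp
    qed
    then have dn: "2 ^ n * (cmod (d n x))\<^sup>2 \<le> C" for n
      using C by (simp add: ennreal_le_iff)
    have dl: "cmod (d n x) \<le> sqrt C * (sqrt (1/2)) ^ n" for n
    proof -
      have "(cmod (d n x))\<^sup>2 \<le> C * (1/2) ^ n" using dn[of n] by (simp add: field_simps)
      then have "cmod (d n x) \<le> sqrt (C * (1/2) ^ n)" by (rule real_le_rsqrt)
      then show ?thesis by (simp add: real_sqrt_mult real_sqrt_power)
    qed
    have sg: "summable (\<lambda>n. sqrt C * (sqrt (1/2)) ^ n)"
      by (intro summable_mult summable_geometric) (auto simp: real_sqrt_lt_1_iff)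
    from summable_comparison_test'[OF sg dl] have "summable (\<lambda>n. d n x)" .
    then have "(\<lambda>n. \<Sum>i<n. d i x) \<longlonglongrightarrow> (\<Sum>i. d i x)" by (rule summable_LIMSEQ)
    moreover have "(\<Sum>i<n. d i x) = L2_fun (X n) x - L2_fun (X 0) x" for n
      unfolding d_def by (rule sum_lessThan_telescope)
    ultimately have "(\<lambda>n. L2_fun (X n) x - L2_fun (X 0) x + L2_fun (X 0) x) \<longlonglongrightarrow> (\<Sum>i. d i x) + L2_fun (X 0) x"
      by (intro tendsto_add) auto
    then show ?case by (auto simp: convergent_def)
  qed
  have "AE x in lborel. (\<lambda>n. L2_fun (X n) x) \<longlonglongrightarrow> lim (\<lambda>n. L2_fun (X n) x)"
    using conv by eventually_elim (simp add: convergent_LIMSEQ_iff)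
  moreover have "(\<lambda>x. lim (\<lambda>n. L2_fun (X n) x)) \<in> borel_measurable borel"
    by (intro borel_measurable_lim_metric L2_fun_measurable)
  ultimately have "square_integrable (\<lambda>x. lim (\<lambda>n. L2_fun (X n) x))
      \<and> X \<longlonglongrightarrow> to_L2 (\<lambda>x. lim (\<lambda>n. L2_fun (X n) x))"
    by (rule Cauchy_L2_AE_limit[OF assms(2)])
  then show ?thesis by (blast intro: convergentI)
qed

instance L2 :: complete_space
proof
  fix X :: "nat \<Rightarrow> L2" assume X: "Cauchy X"
  then have "\<exists>M. \<forall>m\<ge>M. \<forall>n\<ge>M. dist (X m) (X n) < (1/2) ^ k" for k
    unfolding Cauchy_def by simp
  then obtain M where M: "\<And>k m n. m \<ge> M k \<Longrightarrow> n \<ge> M k \<Longrightarrow> dist (X m) (X n) < (1/2) ^ k"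
    by metis
  \<comment> \<open>The sum dominates every \<open>M i\<close> with i \<le> k, and the summand k
    makes the indices strictly increasing.\<close>
  define r where "r k = (\<Sum>i\<le>k. M i) + k" for k
  have r: "strict_mono r" unfolding r_def by (intro strict_monoI_Suc) simp
  have rM: "r k \<ge> M k" for k
    unfolding r_def using member_le_sum[of k "{..k}" M] by auto
  have "norm (X (r (Suc k)) - X (r k)) \<le> (1/2) ^ k" for k
    using less_imp_le[OF M[OF order_trans[OF rM strict_mono_leD[OF r le_SucI[OF order_refl]]] rM]]
    unfolding dist_norm .
  then have "convergent (X \<circ> r)"
    using L2_complete_aux[of "X \<circ> r"] Cauchy_subseq_Cauchy[OF X r] by simp
  then obtain l where "(X \<circ> r) \<longlonglongrightarrow> l" by (auto simp: convergent_def)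
  from Cauchy_converges_subseq[OF X r this] show "convergent X"
    by (rule convergentI)
qed

section \<open>Orthogonal projection and a density criterion\<close>

text \<open>The type class carries real scalars only, so closure under complex multiples is demanded
  explicitly.\<close>

definition csubspace :: "L2 set \<Rightarrow> bool" where
  "csubspace S \<longleftrightarrow> 0 \<in> S \<and> (\<forall>u\<in>S. \<forall>v\<in>S. u + v \<in> S) \<and> (\<forall>c. \<forall>u\<in>S. c *\<^sub>C u \<in> S)"

text \<open>Along the line u + t w the squared norm is a quadratic in t whose minimum lies below
  |u|^2 unless the linear term vanishes.\<close>

lemma minimal_norm_orthogonal:
  fixes u w :: L2
  assumes "\<And>t::real. norm u \<le> norm (u + t *\<^sub>R w)"
  shows "inner u w = 0"
proof (rule ccontr)
  assume ne: "inner u w \<noteq> 0"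
  then have w: "norm w > 0" by auto
  define t where "t = - inner u w / (norm w)\<^sup>2"
  have "(norm u)\<^sup>2 \<le> (norm (u + t *\<^sub>R w))\<^sup>2"
    using assms by (intro power_mono) auto
  also have "\<dots> = (norm u)\<^sup>2 + 2 * t * inner u w + t\<^sup>2 * (norm w)\<^sup>2"
    unfolding power2_norm_eq_inner
    by (simp add: inner_add_left inner_add_right inner_commute power2_eq_square algebra_simps)
  also have "\<dots> = (norm u)\<^sup>2 - (inner u w)\<^sup>2 / (norm w)\<^sup>2"
    using w unfolding t_def by (simp add: power2_eq_square field_simps)
  finally have "(inner u w)\<^sup>2 / (norm w)\<^sup>2 \<le> 0" by simp
  moreover have "(inner u w)\<^sup>2 / (norm w)\<^sup>2 > 0" using ne w by simp
  ultimately show False by simp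
qed

lemma parallelogram_law_diff:
  fixes a b :: "'a::real_inner"
  shows "(norm (a - b))\<^sup>2 = 2 * (norm a)\<^sup>2 + 2 * (norm b)\<^sup>2 - (norm (a + b))\<^sup>2"
  unfolding power2_norm_eq_inner
  by (simp add: inner_add_left inner_add_right inner_diff_left inner_diff_right inner_commute)

text \<open>A point f outside S is projected onto S: a minimising sequence is Cauchy by the
  parallelogram law, its limit l is a nearest point, and f - l is the vector sought.\<close>

lemma orthogonal_vector_exists:
  assumes S: "csubspace S" "closed S" "S \<noteq> UNIV"
  obtains u where "u \<noteq> 0" "\<And>v. v \<in> S \<Longrightarrow> cinner u v = 0"
proof -
  obtain f where f: "f \<notin> S" using S by auto
  have S0: "S \<noteq> {}" using S by (auto simp: csubspace_def)
  define d where "d = infdist f S"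
  have d_le: "d \<le> norm (f - v)" if "v \<in> S" for v
    using infdist_le[OF that, of f] by (simp add: d_def dist_norm)
  have d0: "d \<ge> 0" by (simp add: d_def infdist_nonneg)
  have "\<exists>v\<in>S. norm (f - v) < d + inverse (real (Suc n))" for n
  proof -
    have "infdist f S < d + inverse (real (Suc n))" by (simp add: d_def)
    then have "(INF a\<in>S. dist f a) < d + inverse (real (Suc n))" using S0 by (simp add: infdist_notempty)
    then show ?thesis
      by (subst (asm) cINF_less_iff) (use S0 in \<open>auto simp: dist_norm intro!: bdd_belowI[of _ 0]\<close>)
  qed
  then obtain v where v: "\<And>n. v n \<in> S" "\<And>n. norm (f - v n) < d + inverse (real (Suc n))" by metis
  \<comment> \<open>Midpoints stay in S, so f - v n + (f - v m) has norm at least 2 d; the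
    parallelogram law converts near-minimality into closeness.\<close>
  have par: "(norm (v m - v n))\<^sup>2 \<le> 4 * (2 * d * e + e\<^sup>2)"
    if "norm (f - v m) \<le> d + e" "norm (f - v n) \<le> d + e" for m n e
  proof -
    have mid: "(1/2) *\<^sub>C (v m + v n) \<in> S" using v(1) S by (auto simp: csubspace_def)
    have "f - v n + (f - v m) = 2 *\<^sub>C (f - (1/2) *\<^sub>C (v m + v n))"
      using scaleC_add_left[of 1 1 f] by (simp add: scaleC_diff_right)
    then have "norm (f - v n + (f - v m)) = 2 * norm (f - (1/2) *\<^sub>C (v m + v n))"
      by simp
    then have "2 * d \<le> norm (f - v n + (f - v m))" using d_le[OF mid] by simp
    then have "(2 * d)\<^sup>2 \<le> (norm (f - v n + (f - v m)))\<^sup>2" using d0 by (intro power_mono) auto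
    moreover have "(norm (f - v m))\<^sup>2 \<le> (d + e)\<^sup>2" "(norm (f - v n))\<^sup>2 \<le> (d + e)\<^sup>2"
      using that by (auto intro: power_mono)
    ultimately have "(norm ((f - v n) - (f - v m)))\<^sup>2 \<le> 4 * (d + e)\<^sup>2 - (2 * d)\<^sup>2"
      using parallelogram_law_diff[of "f - v n" "f - v m"] by simp
    then show ?thesis by (simp add: power2_eq_square algebra_simps)
  qed
  have "Cauchy v"
  proof (rule metric_CauchyI)
    fix r :: real assume r: "0 < r"
    have "(\<lambda>n. 4 * (2 * d * inverse (real (Suc n)) + (inverse (real (Suc n)))\<^sup>2)) \<longlonglongrightarrow> 4 * (2 * d * 0 + 0\<^sup>2)"
      by (intro tendsto_intros LIMSEQ_inverse_real_of_nat)
    then have "\<forall>\<^sub>F n in sequentially. 4 * (2 * d * inverse (real (Suc n)) + (inverse (real (Suc n)))\<^sup>2) < r\<^sup>2"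
      using r by (intro order_tendstoD) auto
    then obtain N where N: "4 * (2 * d * inverse (real (Suc N)) + (inverse (real (Suc N)))\<^sup>2) < r\<^sup>2"
      by (auto simp: eventually_sequentially)
    have "dist (v m) (v n) < r" if "m \<ge> N" "n \<ge> N" for m n
    proof -
      have "norm (f - v k) \<le> d + inverse (real (Suc N))" if "k \<ge> N" for k
      proof -
        have "inverse (real (Suc k)) \<le> inverse (real (Suc N))"
          using that by (intro le_imp_inverse_le) auto
        then show ?thesis using v(2)[of k] by linarith
      qed
      then have "(norm (v m - v n))\<^sup>2 < r\<^sup>2" using par[of m "inverse (real (Suc N))" n] that N by auto
      then show ?thesis using r by (simp add: dist_norm power2_less_imp_less)
    qed
    then show "\<exists>M. \<forall>m\<ge>M. \<forall>n\<ge>M. dist (v m) (v n) < r" by blast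
  qed
  then obtain l where l: "v \<longlonglongrightarrow> l" using Cauchy_convergent_iff convergent_def by blast
  have lS: "l \<in> S" using closed_sequentially[OF S(2) v(1) l] .
  have "(\<lambda>n. norm (f - v n)) \<longlonglongrightarrow> norm (f - l)" by (intro tendsto_intros l)
  moreover have "(\<lambda>n. d + inverse (real (Suc n))) \<longlonglongrightarrow> d + 0"
    by (intro tendsto_intros LIMSEQ_inverse_real_of_nat)
  ultimately have le: "norm (f - l) \<le> d"
    by (intro LIMSEQ_le[of "\<lambda>n. norm (f - v n)" _ "\<lambda>n. d + inverse (real (Suc n))"])
      (use v(2) less_imp_le in auto)
  have re: "inner (f - l) w = 0" if "w \<in> S" for w
  proof (rule minimal_norm_orthogonal)
    fix t :: real
    have "complex_of_real t *\<^sub>C w \<in> S" using that S(1) by (simp add: csubspace_def)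
    then have "(-1) *\<^sub>C (complex_of_real t *\<^sub>C w) \<in> S" using S(1) unfolding csubspace_def by blast
    then have "l + (-1) *\<^sub>C (complex_of_real t *\<^sub>C w) \<in> S" using S(1) lS unfolding csubspace_def by blast
    then have "d \<le> norm (f - (l - complex_of_real t *\<^sub>C w))"
      using d_le by (simp add: scaleC_minus1 scaleC_minus_left)
    then show "norm (f - l) \<le> norm (f - l + t *\<^sub>R w)" using le by (simp add: scaleR_scaleC algebra_simps)
  qed
  show thesis
  proof (rule that[of "f - l"])
    show "f - l \<noteq> 0" using f lS by auto
    fix w assume w: "w \<in> S"
    \<comment> \<open>Minimality controls only the real part of the product; testing with
      \<open>\<i> *\<^sub>C w\<close> gives the imaginary part.\<close>
    have "\<i> *\<^sub>C w \<in> S" using w S(1) by (simp add: csubspace_def)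
    from re[OF w] re[OF this] have "Re (cinner (f - l) w) = 0" "Re (\<i> * cinner (f - l) w) = 0"
      by (simp_all add: inner_L2_def cinner_scaleC_right)
    then show "cinner (f - l) w = 0" by (simp add: complex_eq_iff)
  qed
qed

lemma csubspace_closure:
  assumes "csubspace S" shows "csubspace (closure S)"
  unfolding csubspace_def
proof (intro conjI ballI allI)
  show "0 \<in> closure S" using assms closure_subset by (auto simp: csubspace_def)
  fix u assume "u \<in> closure S"
  then obtain X where X: "\<And>n. X n \<in> S" "X \<longlonglongrightarrow> u" by (auto simp: closure_sequential)
  show "c *\<^sub>C u \<in> closure S" for c
    unfolding closure_sequential
    by (rule exI[of _ "\<lambda>n. c *\<^sub>C X n"]) (use assms X in \<open>auto simp: csubspace_def intro!: tendsto_intros\<close>)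
  fix v assume "v \<in> closure S"
  then obtain Y where Y: "\<And>n. Y n \<in> S" "Y \<longlonglongrightarrow> v" by (auto simp: closure_sequential)
  show "u + v \<in> closure S"
    unfolding closure_sequential
    by (rule exI[of _ "\<lambda>n. X n + Y n"]) (use assms X Y in \<open>auto simp: csubspace_def intro!: tendsto_intros\<close>)
qed

lemma orthogonal_dense:
  assumes "csubspace S" "\<And>u. (\<And>v. v \<in> S \<Longrightarrow> cinner u v = 0) \<Longrightarrow> u = 0"
  shows "closure S = UNIV"
proof (rule ccontr)
  assume "closure S \<noteq> UNIV"
  then obtain u where u: "u \<noteq> 0" "\<And>v. v \<in> closure S \<Longrightarrow> cinner u v = 0"
    using orthogonal_vector_exists[OF csubspace_closure[OF assms(1)]] closed_closure by metis
  then show False using assms(2) closure_subset by blast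
qed

section \<open>Self-adjoint operators\<close>

lemma mem_op_shift: "(f, h) \<in> op_shift T z \<longleftrightarrow> (f, h - z *\<^sub>C f) \<in> T"
proof
  assume "(f, h) \<in> op_shift T z"
  then show "(f, h - z *\<^sub>C f) \<in> T" by (auto simp: op_shift_def op_add_def graph_of_def)
next
  assume "(f, h - z *\<^sub>C f) \<in> T"
  then show "(f, h) \<in> op_shift T z"
    unfolding op_shift_def op_add_def graph_of_def
    by (intro CollectI case_prodI exI[of _ f] exI[of _ "h - z *\<^sub>C f"] exI[of _ "z *\<^sub>C f"]) auto
qed

lemma op_shift_op_shift [simp]: "op_shift (op_shift T z) w = op_shift T (z + w)"
  by (rule set_eqI) (auto simp: mem_op_shift scaleC_add_left algebra_simps)

lemma op_shift_0 [simp]: "op_shift T 0 = T"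
  by (rule set_eqI) (auto simp: mem_op_shift)

lemma Domain_op_shift [simp]: "Domain (op_shift T z) = Domain T"
proof -
  have "Domain (op_shift T z) \<subseteq> Domain T" for T z by (auto simp: mem_op_shift Domain_iff)
  from this[of T z] this[of "op_shift T z" "-z"] show ?thesis by simp
qed

lemma closed_op_shift:
  assumes "closed T" shows "closed (op_shift T z)"
proof (unfold closed_sequential_limits, intro allI impI, elim conjE)
  fix X and l :: "L2 \<times> L2"
  assume X: "\<forall>n. X n \<in> op_shift T z" "X \<longlonglongrightarrow> l"
  have "(fst (X n), snd (X n) - z *\<^sub>C fst (X n)) \<in> T" for n
    using X(1) by (metis mem_op_shift prod.collapse)
  moreover have "(\<lambda>n. (fst (X n), snd (X n) - z *\<^sub>C fst (X n))) \<longlonglongrightarrow> (fst l, snd l - z *\<^sub>C fst l)"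
    by (intro tendsto_intros X)
  ultimately have "(fst l, snd l - z *\<^sub>C fst l) \<in> T" by (rule closed_sequentially[OF assms])
  then show "l \<in> op_shift T z" by (metis mem_op_shift prod.collapse)
qed

lemma adjoint_op_shift: "adjoint_op (op_shift T z) = op_shift (adjoint_op T) (cnj z)"
proof (rule set_eqI, clarify)
  fix u v
  have "(u, v) \<in> adjoint_op (op_shift T z) \<longleftrightarrow> (\<forall>f h. (f, h - z *\<^sub>C f) \<in> T \<longrightarrow> cinner u h = cinner v f)"
    by (auto simp: adjoint_op_def mem_op_shift)
  also have "\<dots> \<longleftrightarrow> (\<forall>f h. (f, h) \<in> T \<longrightarrow> cinner u (h + z *\<^sub>C f) = cinner v f)"
    by (metis add_diff_cancel_right' diff_add_cancel)
  also have "\<dots> \<longleftrightarrow> (u, v) \<in> op_shift (adjoint_op T) (cnj z)"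
    by (auto simp: adjoint_op_def mem_op_shift cinner_simps algebra_simps eq_diff_eq)
  finally show "(u, v) \<in> adjoint_op (op_shift T z) \<longleftrightarrow> (u, v) \<in> op_shift (adjoint_op T) (cnj z)" .
qed

lemma self_adjoint_shift: "self_adjoint T \<Longrightarrow> self_adjoint (op_shift T (complex_of_real r))"
  by (simp add: self_adjoint_def adjoint_op_shift)

lemma adjoint_op_mono: "S \<subseteq> T \<Longrightarrow> adjoint_op T \<subseteq> adjoint_op S"
  by (auto simp: adjoint_op_def)

lemma mem_adjoint_op: "(u, v) \<in> adjoint_op T \<longleftrightarrow> (\<forall>f h. (f, h) \<in> T \<longrightarrow> cinner u h = cinner v f)"
  by (auto simp: adjoint_op_def)

lemma closed_adjoint_op: "closed (adjoint_op T)"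
  unfolding closed_sequential_limits
proof (intro allI impI, elim conjE)
  fix X and l :: "L2 \<times> L2" assume X: "\<forall>n. X n \<in> adjoint_op T" "X \<longlonglongrightarrow> l"
  have "cinner (fst l) h = cinner (snd l) f" if "(f, h) \<in> T" for f h
  proof (rule LIMSEQ_unique)
    show "(\<lambda>n. cinner (fst (X n)) h) \<longlonglongrightarrow> cinner (fst l) h" by (intro tendsto_intros X)
    have "cinner (fst (X n)) h = cinner (snd (X n)) f" for n
      using X(1) that by (metis mem_adjoint_op prod.collapse)
    moreover have "(\<lambda>n. cinner (snd (X n)) f) \<longlonglongrightarrow> cinner (snd l) f" by (intro tendsto_intros X)
    ultimately show "(\<lambda>n. cinner (fst (X n)) h) \<longlonglongrightarrow> cinner (snd l) f" by simp
  qed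
  then show "l \<in> adjoint_op T" by (cases l) (simp add: mem_adjoint_op)
qed

lemma self_adjoint_closed: "self_adjoint T \<Longrightarrow> closed T"
  using closed_adjoint_op[of T] by (simp add: self_adjoint_def)

lemma self_adjoint_sym: "self_adjoint T \<Longrightarrow> (f, h) \<in> T \<Longrightarrow> (f', h') \<in> T \<Longrightarrow> cinner f h' = cinner h f'"
  by (metis self_adjoint_def mem_adjoint_op)

text \<open>Maximality: a pair compatible with the whole graph belongs to it. The zero pair, sums
  and multiples in a self-adjoint graph are all obtained this way, an \<open>operator\<close> being
  an arbitrary set of pairs.\<close>

lemma self_adjointI_mem: "self_adjoint T \<Longrightarrow> (\<And>f h. (f, h) \<in> T \<Longrightarrow> cinner u h = cinner v f) \<Longrightarrow> (u, v) \<in> T"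
  by (metis self_adjoint_def mem_adjoint_op)

lemma self_adjoint_0: "self_adjoint T \<Longrightarrow> (0, 0) \<in> T"
  by (rule self_adjointI_mem) auto

lemma self_adjoint_add: "self_adjoint T \<Longrightarrow> (f, h) \<in> T \<Longrightarrow> (f', h') \<in> T \<Longrightarrow> (f + f', h + h') \<in> T"
  by (rule self_adjointI_mem) (auto simp: cinner_simps self_adjoint_sym)

lemma self_adjoint_diff: "self_adjoint T \<Longrightarrow> (f, h) \<in> T \<Longrightarrow> (f', h') \<in> T \<Longrightarrow> (f - f', h - h') \<in> T"
  by (rule self_adjointI_mem) (auto simp: cinner_simps self_adjoint_sym)

lemma self_adjoint_scaleC: "self_adjoint T \<Longrightarrow> (f, h) \<in> T \<Longrightarrow> (c *\<^sub>C f, c *\<^sub>C h) \<in> T"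
  by (rule self_adjointI_mem) (auto simp: cinner_simps self_adjoint_sym)

text \<open>Taking adjoints reverses the inclusion, so B is contained in A as well.\<close>

lemma self_adjoint_subset_eq:
  assumes "self_adjoint A" "self_adjoint B" "A \<subseteq> B" shows "A = B"
  using adjoint_op_mono[OF assms(3)] assms by (simp add: self_adjoint_def)

section \<open>Lower bounds, resolvents and the bottom of the spectrum\<close>

definition op_ge :: "operator \<Rightarrow> real \<Rightarrow> bool" where
  "op_ge T c \<longleftrightarrow> (\<forall>f h. (f, h) \<in> T \<longrightarrow> c * (norm f)\<^sup>2 \<le> Re (cinner f h))"

lemma semibounded_below_iff: "semibounded_below T \<longleftrightarrow> (\<exists>c. op_ge T c)"
  by (auto simp: semibounded_below_def op_ge_def)

lemma op_ge_shift: "op_ge (op_shift T (complex_of_real r)) c \<longleftrightarrow> op_ge T (c - r)"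
proof -
  have "op_ge T c \<Longrightarrow> op_ge (op_shift T (complex_of_real r)) (c + r)" for T c r
    unfolding op_ge_def by (force simp: mem_op_shift cinner_simps cinner_self algebra_simps)
  from this[of T "c - r" r] this[of "op_shift T (complex_of_real r)" c "- r"] show ?thesis
    by auto
qed

text \<open>The form bound gives (c - Re z) |f| \<le> |(T - z) f|, hence injectivity, a closed range
  and a bounded inverse. Surjectivity follows once nothing is orthogonal to the range.\<close>

lemma resolvent_below_form_bound:
  assumes T: "self_adjoint T" and ge: "op_ge T c" and z: "Re z < c"
  shows "invertible_op (op_shift T (- z))"
proof -
  define m where "m = c - Re z"
  have m: "m > 0" using z by (simp add: m_def)
  define T' where "T' = op_shift T (- z)"
  have mem: "(f, h) \<in> T' \<longleftrightarrow> (f, h + z *\<^sub>C f) \<in> T" for f h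
    by (simp add: T'_def mem_op_shift scaleC_minus_left)
  have lower: "m * norm f \<le> norm h" if "(f, h) \<in> T'" for f h
  proof (cases "f = 0")
    case False
    have "c * (norm f)\<^sup>2 \<le> Re (cinner f (h + z *\<^sub>C f))"
      using ge that unfolding op_ge_def mem by blast
    then have "m * (norm f)\<^sup>2 \<le> Re (cinner f h)"
      by (simp add: cinner_simps cinner_self m_def algebra_simps)
    also have "\<dots> \<le> norm f * norm h"
      using cinner_Cauchy_Schwarz[of f h] complex_Re_le_cmod order_trans by blast
    finally have "norm f * (m * norm f) \<le> norm f * norm h" by (simp add: power2_eq_square mult_ac)
    then show ?thesis by (rule mult_left_le_imp_le) (use False in simp)
  qed simp
  have add: "(f + f', h + h') \<in> T'" if "(f, h) \<in> T'" "(f', h') \<in> T'" for f h f' h'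
    using self_adjoint_add[OF T that[unfolded mem]] unfolding mem by (simp add: scaleC_simps algebra_simps)
  have scale: "(a *\<^sub>C f, a *\<^sub>C h) \<in> T'" if "(f, h) \<in> T'" for f h a
    using self_adjoint_scaleC[OF T that[unfolded mem]] unfolding mem by (simp add: scaleC_simps mult.commute)
  have zero: "(0, 0) \<in> T'" using self_adjoint_0[OF T] by (simp add: mem)
  have diff: "(f - f', h - h') \<in> T'" if "(f, h) \<in> T'" "(f', h') \<in> T'" for f h f' h'
    using add[OF that(1) scale[OF that(2), of "-1"]] by (simp add: scaleC_minus1 scaleC_minus_left)
  have inj: "f = f'" if "(f, h) \<in> T'" "(f', h) \<in> T'" for f f' h
    using lower[OF diff[OF that]] m by (simp add: mult_le_0_iff)
  have sub: "csubspace (Range T')"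
    unfolding csubspace_def using add scale zero by blast
  have "closed (Range T')"
    unfolding closed_sequential_limits
  proof (intro allI impI, elim conjE)
    fix h l assume h: "\<forall>n. h n \<in> Range T'" "h \<longlonglongrightarrow> l"
    have "\<exists>f. \<forall>n. (f n, h n) \<in> T'" using h(1) by (intro choice) blast
    then obtain f where f: "\<And>n. (f n, h n) \<in> T'" by blast
    have "Cauchy f"
    proof (rule metric_CauchyI)
      fix e :: real assume e: "e > 0"
      have "Cauchy h" using h(2) by (rule LIMSEQ_imp_Cauchy)
      then obtain M where M: "\<And>i j. i \<ge> M \<Longrightarrow> j \<ge> M \<Longrightarrow> dist (h i) (h j) < m * e"
        using e m by (metis Cauchy_def mult_pos_pos)
      have "dist (f i) (f j) < e" if "i \<ge> M" "j \<ge> M" for i j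
        using lower[OF diff[OF f f], of i j] M[OF that] m
        unfolding dist_norm by (smt (verit) mult_less_cancel_left_pos)
      then show "\<exists>M. \<forall>i\<ge>M. \<forall>j\<ge>M. dist (f i) (f j) < e" by blast
    qed
    then obtain g where g: "f \<longlonglongrightarrow> g" using Cauchy_convergent_iff convergent_def by blast
    have "(\<lambda>n. (f n, h n + z *\<^sub>C f n)) \<longlonglongrightarrow> (g, l + z *\<^sub>C g)" by (intro tendsto_intros g h)
    then have "(g, l + z *\<^sub>C g) \<in> T"
      using closed_sequentially[OF self_adjoint_closed[OF T], of "\<lambda>n. (f n, h n + z *\<^sub>C f n)"] f
      by (auto simp: mem)
    then show "l \<in> Range T'" using mem by blast
  qed
  moreover have "u = 0" if u: "\<And>h. h \<in> Range T' \<Longrightarrow> cinner u h = 0" for u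
  proof -
    \<comment> \<open>Orthogonality to the range of T - z makes T u equal to
      \<open>cnj z *\<^sub>C u\<close>; for nonzero u this violates the lower bound.\<close>
    have "cinner u h = cinner (cnj z *\<^sub>C u) f" if "(f, h) \<in> T" for f h
    proof -
      have "(f, h - z *\<^sub>C f) \<in> T'" using that by (simp add: mem)
      then have "cinner u (h - z *\<^sub>C f) = 0" using u by blast
      then show ?thesis by (simp add: cinner_simps)
    qed
    then have "(u, cnj z *\<^sub>C u) \<in> T" by (rule self_adjointI_mem[OF T])
    then have "c * (norm u)\<^sup>2 \<le> Re (cinner u (cnj z *\<^sub>C u))" using ge unfolding op_ge_def by blast
    then have "(c - Re z) * (norm u)\<^sup>2 \<le> 0" by (simp add: cinner_simps cinner_self algebra_simps)
    then show ?thesis using z by (simp add: mult_le_0_iff)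
  qed
  ultimately have surj: "Range T' = UNIV"
    using orthogonal_dense[OF sub] closure_closed by metis
  define B where "B h = (THE f. (f, h) \<in> T')" for h
  have B: "(f, h) \<in> T' \<longleftrightarrow> f = B h" for f h
  proof -
    obtain f' where f': "(f', h) \<in> T'" using surj by blast
    then have "B h = f'" unfolding B_def using inj by blast
    then show ?thesis using f' inj by blast
  qed
  have Badd: "B (x + y) = B x + B y" for x y using add[of "B x" x "B y" y] B by metis
  have Bscale: "B (a *\<^sub>C x) = a *\<^sub>C B x" for a x using scale[of "B x" x a] B by metis
  have "bounded_linear B"
  proof (rule bounded_linear_intro[where K="1/m"])
    show "norm (B x) \<le> norm x * (1 / m)" for x
      using lower[of "B x" x] m B[of "B x" x] by (simp add: field_simps)
  qed (simp_all add: Badd Bscale scaleR_scaleC)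
  moreover have "converse T' = graph_of B" by (auto simp: graph_of_def B)
  ultimately show ?thesis unfolding invertible_op_def T'_def[symmetric] using Bscale by blast
qed

lemma discriminant_nonneg:
  fixes a b c :: real
  assumes "\<And>t. 0 \<le> a + 2 * t * b + t\<^sup>2 * c" "c \<ge> 0"
  shows "b\<^sup>2 \<le> a * c"
proof (cases "c = 0")
  case True
  show ?thesis
  proof (cases "b = 0")
    case False
    \<comment> \<open>Without a quadratic term the expression is affine in t, and this t gives it
      the value -1.\<close>
    have "0 \<le> a + 2 * (- (a + 1) / (2 * b)) * b" using assms(1)[of "- (a + 1) / (2 * b)"] True by simp
    also have "a + 2 * (- (a + 1) / (2 * b)) * b = - 1" using False by (simp add: field_simps)
    finally show ?thesis by simp
  qed (simp add: True)
next
  case False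
  with assms(2) have c: "c > 0" by simp
  have "0 \<le> a + 2 * (- b / c) * b + (- b / c)\<^sup>2 * c" by (rule assms(1))
  also have "\<dots> = a - b\<^sup>2 / c" using c by (simp add: power2_eq_square field_simps)
  finally show ?thesis using c by (simp add: field_simps)
qed

text \<open>Positivity of the form of T along the real line f + t f' makes its discriminant
  nonpositive; symmetry of T merges the two mixed terms.\<close>

lemma nonneg_op_Cauchy_Schwarz:
  assumes T: "self_adjoint T" and ge: "op_ge T 0" and m: "(f, h) \<in> T" "(f', h') \<in> T"
  shows "(Re (cinner f h'))\<^sup>2 \<le> Re (cinner f h) * Re (cinner f' h')"
proof (rule discriminant_nonneg)
  show "0 \<le> Re (cinner f' h')" using ge m(2) by (auto simp: op_ge_def)
  fix t :: real
  have "(f + complex_of_real t *\<^sub>C f', h + complex_of_real t *\<^sub>C h') \<in> T"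
    by (intro self_adjoint_add self_adjoint_scaleC T m)
  then have "0 \<le> Re (cinner (f + complex_of_real t *\<^sub>C f') (h + complex_of_real t *\<^sub>C h'))"
    using ge by (auto simp: op_ge_def)
  moreover have "Re (cinner f' h) = Re (cinner f h')"
    using self_adjoint_sym[OF T m] cinner_cnj[of f' h] by (metis complex_cnj_cnj cnj.sel(1))
  ultimately show "0 \<le> Re (cinner f h) + 2 * t * Re (cinner f h') + t\<^sup>2 * Re (cinner f' h')"
    by (simp add: cinner_simps power2_eq_square algebra_simps)
qed

text \<open>Apply the form inequality to f and B f: the mixed term is |f|^2, and <B f, f> \<le> K
  |f|^2 leaves |f|^2 \<le> K <f, T f>. The lower bound is the reciprocal of a bound for the
  inverse.\<close>

lemma invertible_nonneg_op_ge:
  assumes T: "self_adjoint T" and ge: "op_ge T 0" and inv: "invertible_op T"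
  obtains m where "m > 0" "op_ge T m"
proof -
  obtain B where B: "bounded_linear B" "converse T = graph_of B"
    using inv by (auto simp: invertible_op_def)
  obtain K where K: "K > 0" "\<And>x. norm (B x) \<le> norm x * K"
    using bounded_linear.pos_bounded[OF B(1)] by auto
  have BT: "(B x, x) \<in> T" for x using B(2) by (auto simp: graph_of_def)
  have "op_ge T (1 / K)"
    unfolding op_ge_def
  proof (intro allI impI)
    fix f h assume fh: "(f, h) \<in> T"
    show "1 / K * (norm f)\<^sup>2 \<le> Re (cinner f h)"
    proof (cases "f = 0")
      case False
      have "((norm f)\<^sup>2)\<^sup>2 \<le> Re (cinner f h) * Re (cinner (B f) f)"
        using nonneg_op_Cauchy_Schwarz[OF T ge fh BT[of f]] by (simp add: cinner_self)
      also have "\<dots> \<le> Re (cinner f h) * (K * (norm f)\<^sup>2)"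
      proof (rule mult_left_mono)
        have "Re (cinner (B f) f) \<le> norm (B f) * norm f"
          using cinner_Cauchy_Schwarz[of "B f" f] complex_Re_le_cmod order_trans by blast
        also have "\<dots> \<le> norm f * K * norm f" by (intro mult_right_mono K) simp
        finally show "Re (cinner (B f) f) \<le> K * (norm f)\<^sup>2" by (simp add: power2_eq_square mult_ac)
        show "0 \<le> Re (cinner f h)" using ge fh by (auto simp: op_ge_def)
      qed
      finally have "(norm f)\<^sup>2 * (norm f)\<^sup>2 \<le> (Re (cinner f h) * K) * (norm f)\<^sup>2"
        by (simp add: power2_eq_square mult_ac)
      then have "(norm f)\<^sup>2 \<le> Re (cinner f h) * K"
        by (rule mult_right_le_imp_le) (use False in simp)
      then show ?thesis using K by (simp add: field_simps)
    qed simp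
  qed
  then show thesis using that K(1) by (metis divide_pos_pos zero_less_one)
qed

text \<open>The infimum \<open>m\<close> of the numerical range lies in the spectrum: otherwise \<open>T - m\<close>, being nonnegative
  and boundedly invertible, would be bounded below by a positive constant.\<close>

lemma inf_spectrum_ge_iff:
  assumes T: "self_adjoint T" and sb: "semibounded_below T"
  shows "ereal c \<le> inf_spectrum T \<longleftrightarrow> op_ge T c"
proof
  assume ge: "op_ge T c"
  show "ereal c \<le> inf_spectrum T"
    unfolding inf_spectrum_def
  proof (rule INF_greatest)
    fix z assume "z \<in> spectrum T"
    then have "\<not> Re z < c" using resolvent_below_form_bound[OF T ge] by (auto simp: spectrum_def)
    then show "ereal c \<le> ereal (Re z)" by simp
  qed
next
  assume le: "ereal c \<le> inf_spectrum T"
  show "op_ge T c"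
  proof (rule ccontr)
    assume "\<not> op_ge T c"
    then obtain f0 h0 where f0: "(f0, h0) \<in> T" "Re (cinner f0 h0) < c * (norm f0)\<^sup>2"
      by (auto simp: op_ge_def not_le)
    then have f0n: "f0 \<noteq> 0" by auto
    define N where "N = {Re (cinner f h) / (norm f)\<^sup>2 | f h. (f, h) \<in> T \<and> f \<noteq> 0}"
    obtain c0 where c0: "op_ge T c0" using sb by (auto simp: semibounded_below_iff)
    have bdd: "bdd_below N"
      by (rule bdd_belowI[of _ c0]) (use c0 in \<open>auto simp: N_def op_ge_def field_simps\<close>)
    define m where "m = Inf N"
    have q0: "Re (cinner f0 h0) / (norm f0)\<^sup>2 \<in> N" using f0 f0n by (auto simp: N_def)
    have "m \<le> Re (cinner f0 h0) / (norm f0)\<^sup>2" unfolding m_def by (rule cInf_lower[OF q0 bdd])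
    also have "\<dots> < c" using f0(2) f0n by (simp add: field_simps)
    finally have mc: "m < c" .
    have ge: "op_ge T m"
      unfolding op_ge_def
    proof (intro allI impI)
      fix f h assume fh: "(f, h) \<in> T"
      show "m * (norm f)\<^sup>2 \<le> Re (cinner f h)"
      proof (cases "f = 0")
        case False
        then have "m \<le> Re (cinner f h) / (norm f)\<^sup>2"
          unfolding m_def using fh by (intro cInf_lower[OF _ bdd]) (auto simp: N_def)
        then show ?thesis using False by (simp add: field_simps)
      qed simp
    qed
    have "complex_of_real m \<in> spectrum T"
      unfolding spectrum_def
    proof (rule CollectI, rule notI)
      assume inv: "invertible_op (op_shift T (- complex_of_real m))"
      have "self_adjoint (op_shift T (- complex_of_real m))" "op_ge (op_shift T (- complex_of_real m)) 0"
        using self_adjoint_shift[OF T, of "-m"] op_ge_shift[of T "-m" 0] ge by simp_all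
      then obtain d where d: "d > 0" "op_ge (op_shift T (- complex_of_real m)) d"
        using invertible_nonneg_op_ge inv by metis
      then have ge': "op_ge T (d + m)" using op_ge_shift[of T "-m" d] by simp
      have "d + m \<le> Inf N"
      proof (rule cInf_greatest)
        show "N \<noteq> {}" using q0 by blast
        fix x assume "x \<in> N"
        then show "d + m \<le> x" using ge' by (auto simp: N_def op_ge_def field_simps)
      qed
      then show False using d(1) by (simp add: m_def)
    qed
    then have "inf_spectrum T \<le> ereal m"
      unfolding inf_spectrum_def by (intro INF_lower2[of "complex_of_real m"]) auto
    then show False using le mc by (meson ereal_less_eq(3) not_less order_trans)
  qed
qed

text \<open>The infimum is an extended real, so a real number is squeezed between 0 and it before
  the criterion for real bounds is applied.\<close>

lemma inf_spectrum_pos_iff: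
  assumes "self_adjoint T" "semibounded_below T"
  shows "0 < inf_spectrum T \<longleftrightarrow> (\<exists>m>0. op_ge T m)"
proof
  assume "0 < inf_spectrum T"
  then obtain c where "0 < ereal c" "ereal c < inf_spectrum T" using ereal_dense2 by blast
  then show "\<exists>m>0. op_ge T m" using inf_spectrum_ge_iff[OF assms, of c] by auto
next
  assume "\<exists>m>0. op_ge T m"
  then obtain m where "m > 0" "ereal m \<le> inf_spectrum T" using inf_spectrum_ge_iff[OF assms] by auto
  then show "0 < inf_spectrum T" by (metis ereal_less(2) less_le_trans)
qed

section \<open>Closed quadratic forms\<close>

lemma form_approx_mono: "T \<subseteq> A \<Longrightarrow> form_approx T X f \<Longrightarrow> form_approx A X f"
  by (auto simp: form_approx_def)

text \<open>The shift adds r |f m - f n|^2 to the form of differences, and this tends to zero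
  because the first components converge.\<close>

lemma form_approx_shift:
  assumes "form_approx T X f"
  shows "form_approx (op_shift T (complex_of_real r)) (\<lambda>n. (fst (X n), snd (X n) + complex_of_real r *\<^sub>C fst (X n))) f"
  unfolding form_approx_def
proof (intro conjI allI impI)
  from assms have X: "\<And>n. X n \<in> T" "(\<lambda>n. fst (X n)) \<longlonglongrightarrow> f"
    and C: "\<And>e. e > 0 \<Longrightarrow> \<exists>N. \<forall>m\<ge>N. \<forall>n\<ge>N.
        \<bar>Re (cinner (fst (X m) - fst (X n)) (snd (X m) - snd (X n)))\<bar> < e"
    by (auto simp: form_approx_def)
  show "(fst (X n), snd (X n) + complex_of_real r *\<^sub>C fst (X n)) \<in> op_shift T (complex_of_real r)" for n
    using X(1)[of n] by (simp add: mem_op_shift)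
  show "(\<lambda>n. fst (fst (X n), snd (X n) + complex_of_real r *\<^sub>C fst (X n))) \<longlonglongrightarrow> f" using X(2) by simp
  fix e :: real assume e: "e > 0"
  \<comment> \<open>This radius makes |r| d^2 smaller than e / 2; the added 1 also covers r =
    0.\<close>
  define d where "d = sqrt (e / (2 * (\<bar>r\<bar> + 1)))"
  have d: "d > 0" "\<bar>r\<bar> * d\<^sup>2 < e / 2"
  proof -
    have "\<bar>r\<bar> * d\<^sup>2 = (e / 2) * (\<bar>r\<bar> / (\<bar>r\<bar> + 1))" using e by (simp add: d_def field_simps)
    also have "\<dots> < (e / 2) * 1" using e by (intro mult_strict_left_mono) (auto simp: field_simps)
    finally show "\<bar>r\<bar> * d\<^sup>2 < e / 2" by simp
  qed (use e in \<open>simp add: d_def add_nonneg_pos\<close>)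
  obtain N1 where N1: "\<And>m n. m \<ge> N1 \<Longrightarrow> n \<ge> N1 \<Longrightarrow>
      \<bar>Re (cinner (fst (X m) - fst (X n)) (snd (X m) - snd (X n)))\<bar> < e / 2"
    using C[of "e/2"] e by auto
  obtain N2 where N2: "\<And>m n. m \<ge> N2 \<Longrightarrow> n \<ge> N2 \<Longrightarrow> norm (fst (X m) - fst (X n)) < d"
    using LIMSEQ_imp_Cauchy[OF X(2)] d(1) unfolding Cauchy_def dist_norm by metis
  show "\<exists>N. \<forall>m\<ge>N. \<forall>n\<ge>N.
     \<bar>Re (cinner (fst (fst (X m), snd (X m) + complex_of_real r *\<^sub>C fst (X m))
          - fst (fst (X n), snd (X n) + complex_of_real r *\<^sub>C fst (X n)))
        (snd (fst (X m), snd (X m) + complex_of_real r *\<^sub>C fst (X m))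
          - snd (fst (X n), snd (X n) + complex_of_real r *\<^sub>C fst (X n))))\<bar> < e"
  proof (intro exI[of _ "max N1 N2"] allI impI)
    fix m n assume mn: "max N1 N2 \<le> m" "max N1 N2 \<le> n"
    define u where "u = fst (X m) - fst (X n)"
    define v where "v = snd (X m) - snd (X n)"
    have "snd (X m) + complex_of_real r *\<^sub>C fst (X m) - (snd (X n) + complex_of_real r *\<^sub>C fst (X n))
        = v + complex_of_real r *\<^sub>C u" by (simp add: u_def v_def scaleC_simps)
    moreover have "Re (cinner u (v + complex_of_real r *\<^sub>C u)) = Re (cinner u v) + r * (norm u)\<^sup>2"
      by (simp add: cinner_simps cinner_self)
    moreover have "\<bar>r * (norm u)\<^sup>2\<bar> \<le> \<bar>r\<bar> * d\<^sup>2"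
      unfolding abs_mult using N2[of m n] mn unfolding u_def
      by (intro mult_left_mono) (auto intro: power_mono)
    moreover have "\<bar>Re (cinner u v)\<bar> < e / 2" using N1[of m n] mn unfolding u_def v_def by simp
    ultimately show "\<bar>Re (cinner (fst (fst (X m), snd (X m) + complex_of_real r *\<^sub>C fst (X m))
          - fst (fst (X n), snd (X n) + complex_of_real r *\<^sub>C fst (X n)))
        (snd (fst (X m), snd (X m) + complex_of_real r *\<^sub>C fst (X m))
          - snd (fst (X n), snd (X n) + complex_of_real r *\<^sub>C fst (X n))))\<bar> < e"
      using d(2) unfolding fst_conv snd_conv u_def[symmetric] by simp
  qed
qed

lemma form_domain_shift: "form_domain (op_shift T (complex_of_real r)) = form_domain T"
proof -
  have "form_domain T \<subseteq> form_domain (op_shift T (complex_of_real r))" for T r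
    unfolding form_domain_def using form_approx_shift by blast
  from this[of T r] this[of "op_shift T (complex_of_real r)" "-r"] show ?thesis by simp
qed

text \<open>Symmetry writes q n - Re <h n, f m> as Re <f n, h n - h m>, which the form inequality
  bounds by half of q n plus half of the form of f n - f m. Letting m grow removes the mixed term,
  and half of q n is absorbed on the left.\<close>

lemma form_closable:
  assumes T: "self_adjoint T" and ge: "op_ge T 0" and X: "form_approx T X 0"
  shows "(\<lambda>n. Re (cinner (fst (X n)) (snd (X n)))) \<longlonglongrightarrow> 0"
proof (rule LIMSEQ_I)
  fix e :: real assume e: "e > 0"
  define f where "f n = fst (X n)" for n
  define h where "h n = snd (X n)" for n
  define q where "q n = Re (cinner (f n) (h n))" for n
  have fh: "(f n, h n) \<in> T" for n using X by (simp add: form_approx_def f_def h_def)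
  have f0: "f \<longlonglongrightarrow> 0" using X by (simp add: form_approx_def f_def[abs_def])
  have qC: "\<exists>N. \<forall>m\<ge>N. \<forall>n\<ge>N. \<bar>Re (cinner (f m - f n) (h m - h n))\<bar> < d" if "d > 0" for d
    using X that unfolding form_approx_def f_def h_def by blast
  have q0: "q n \<ge> 0" for n using ge fh unfolding q_def op_ge_def by fastforce
  obtain N where N: "\<And>m n. m \<ge> N \<Longrightarrow> n \<ge> N \<Longrightarrow> \<bar>Re (cinner (f m - f n) (h m - h n))\<bar> < e / 4"
    using qC[of "e/4"] e by auto
  have "q n \<le> e / 2" if n: "n \<ge> N" for n
  proof -
    have lim: "(\<lambda>m. Re (cinner (h n) (f m))) \<longlonglongrightarrow> Re (cinner (h n) 0)"
      by (intro tendsto_intros f0)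
    have ineq: "q n - Re (cinner (h n) (f m)) \<le> q n / 2 + e / 8" if m: "m \<ge> N" for m
    proof -
      define r where "r = Re (cinner (f n - f m) (h n - h m))"
      have r: "0 \<le> r" "r \<le> e / 4"
        using ge self_adjoint_diff[OF T fh fh, of n m] N[of n m] m n unfolding op_ge_def r_def by fastforce+
      have sq: "(Re (cinner (f n) (h n - h m)))\<^sup>2 \<le> q n * r"
        using nonneg_op_Cauchy_Schwarz[OF T ge fh self_adjoint_diff[OF T fh fh], of n n m]
        by (simp add: q_def r_def)
      have "(Re (cinner (f n) (h n - h m)))\<^sup>2 \<le> ((q n + r) / 2)\<^sup>2"
        using sq zero_le_power2[of "q n - r"] by (simp add: power2_eq_square field_simps)
      then have "Re (cinner (f n) (h n - h m)) \<le> (q n + r) / 2"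
        by (rule power2_le_imp_le) (use q0[of n] r in simp)
      moreover have "Re (cinner (f n) (h n - h m)) = q n - Re (cinner (h n) (f m))"
        using self_adjoint_sym[OF T fh fh, of n m] by (simp add: cinner_simps q_def)
      ultimately show ?thesis using r by simp
    qed
    have "(\<lambda>m. q n - Re (cinner (h n) (f m))) \<longlonglongrightarrow> q n - Re (cinner (h n) 0)"
      by (intro tendsto_intros lim)
    then have "q n - Re (cinner (h n) 0) \<le> q n / 2 + e / 8"
      by (rule LIMSEQ_le_const2) (use ineq in blast)
    then show ?thesis using e by simp
  qed
  then have "\<forall>n\<ge>N. norm (q n - 0) < e" using q0 e by fastforce
  then show "\<exists>no. \<forall>n\<ge>no. norm (Re (cinner (fst (X n)) (snd (X n))) - 0) < e"
    unfolding q_def f_def h_def by blast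
qed

text \<open>By the parallelogram identity the form of a difference of increments is at most twice
  the sum of the two forms; positivity lets the remaining term be dropped.\<close>

lemma form_approx_diff:
  assumes T: "self_adjoint T" and ge: "op_ge T 0"
    and X: "form_approx T X f" and Y: "form_approx T Y g"
  shows "form_approx T (\<lambda>n. (fst (X n) - fst (Y n), snd (X n) - snd (Y n))) (f - g)"
  unfolding form_approx_def fst_conv snd_conv
proof (intro conjI allI impI)
  have XT: "(fst (X n), snd (X n)) \<in> T" and YT: "(fst (Y n), snd (Y n)) \<in> T" for n
    using X Y by (auto simp: form_approx_def)
  show "(fst (X n) - fst (Y n), snd (X n) - snd (Y n)) \<in> T" for n
    by (rule self_adjoint_diff[OF T XT YT])
  show "(\<lambda>n. fst (X n) - fst (Y n)) \<longlonglongrightarrow> f - g"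
    using X Y by (auto simp: form_approx_def intro: tendsto_diff)
  fix e :: real assume e: "e > 0"
  obtain N1 where N1: "\<And>m n. m \<ge> N1 \<Longrightarrow> n \<ge> N1 \<Longrightarrow>
      \<bar>Re (cinner (fst (X m) - fst (X n)) (snd (X m) - snd (X n)))\<bar> < e / 4"
    using X e unfolding form_approx_def by (meson divide_pos_pos zero_less_numeral)
  obtain N2 where N2: "\<And>m n. m \<ge> N2 \<Longrightarrow> n \<ge> N2 \<Longrightarrow>
      \<bar>Re (cinner (fst (Y m) - fst (Y n)) (snd (Y m) - snd (Y n)))\<bar> < e / 4"
    using Y e unfolding form_approx_def by (meson divide_pos_pos zero_less_numeral)
  show "\<exists>N. \<forall>m\<ge>N. \<forall>n\<ge>N. \<bar>Re (cinner (fst (X m) - fst (Y m) - (fst (X n) - fst (Y n)))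
      (snd (X m) - snd (Y m) - (snd (X n) - snd (Y n))))\<bar> < e"
  proof (intro exI[of _ "max N1 N2"] allI impI)
    fix m n assume mn: "max N1 N2 \<le> m" "max N1 N2 \<le> n"
    define u u' v v' where "u = fst (X m) - fst (X n)" "u' = snd (X m) - snd (X n)"
      "v = fst (Y m) - fst (Y n)" "v' = snd (Y m) - snd (Y n)"
    have uv: "(u, u') \<in> T" "(v, v') \<in> T"
      unfolding u_u'_v_v'_def by (intro self_adjoint_diff T XT YT)+
    have eq: "fst (X m) - fst (Y m) - (fst (X n) - fst (Y n)) = u - v"
      "snd (X m) - snd (Y m) - (snd (X n) - snd (Y n)) = u' - v'"
      by (auto simp: u_u'_v_v'_def)
    have "0 \<le> Re (cinner (u + v) (u' + v'))" "0 \<le> Re (cinner (u - v) (u' - v'))"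
      using ge self_adjoint_add[OF T uv] self_adjoint_diff[OF T uv] by (auto simp: op_ge_def)
    moreover have "Re (cinner (u + v) (u' + v')) + Re (cinner (u - v) (u' - v'))
        = 2 * Re (cinner u u') + 2 * Re (cinner v v')" by (simp add: cinner_simps)
    moreover have "Re (cinner u u') < e / 4" "Re (cinner v v') < e / 4"
      using N1[of m n] N2[of m n] mn unfolding u_u'_v_v'_def by auto
    ultimately show "\<bar>Re (cinner (fst (X m) - fst (Y m) - (fst (X n) - fst (Y n)))
      (snd (X m) - snd (Y m) - (snd (X n) - snd (Y n))))\<bar> < e"
      unfolding eq by linarith
  qed
qed

text \<open>The difference a n - b n of the form values is the mixed term of X + Y and X - Y. Its
  square is at most p n d n, where d n tends to 0 by closability and p n stays bounded by the
  parallelogram identity.\<close>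

lemma form_limit_unique_nonneg:
  assumes T: "self_adjoint T" and ge: "op_ge T 0"
    and X: "form_approx T X f" and Y: "form_approx T Y f"
    and qX: "(\<lambda>n. Re (cinner (fst (X n)) (snd (X n)))) \<longlonglongrightarrow> q"
    and qY: "(\<lambda>n. Re (cinner (fst (Y n)) (snd (Y n)))) \<longlonglongrightarrow> q'"
  shows "q = q'"
proof -
  have XT: "(fst (X n), snd (X n)) \<in> T" and YT: "(fst (Y n), snd (Y n)) \<in> T" for n
    using X Y by (auto simp: form_approx_def)
  define d where "d n = Re (cinner (fst (X n) - fst (Y n)) (snd (X n) - snd (Y n)))" for n
  define p where "p n = Re (cinner (fst (X n) + fst (Y n)) (snd (X n) + snd (Y n)))" for n
  define a where "a n = Re (cinner (fst (X n)) (snd (X n)))" for n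
  define b where "b n = Re (cinner (fst (Y n)) (snd (Y n)))" for n
  have d0: "d \<longlonglongrightarrow> 0"
    using form_closable[OF T ge] form_approx_diff[OF T ge X Y] unfolding d_def by force
  have pd: "p n + d n = 2 * a n + 2 * b n" for n
    unfolding p_def d_def a_def b_def by (simp add: cinner_simps)
  have ab: "(a n - b n)\<^sup>2 \<le> p n * d n" for n
  proof -
    have "Re (cinner (fst (Y n)) (snd (X n))) = Re (cinner (fst (X n)) (snd (Y n)))"
      using self_adjoint_sym[OF T XT YT, of n n] cinner_cnj[of "fst (Y n)" "snd (X n)"]
      by (metis complex_cnj_cnj cnj.sel(1))
    then have "Re (cinner (fst (X n) + fst (Y n)) (snd (X n) - snd (Y n))) = a n - b n"
      unfolding a_def b_def by (simp add: cinner_simps)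
    with nonneg_op_Cauchy_Schwarz[OF T ge self_adjoint_add[OF T XT YT] self_adjoint_diff[OF T XT YT], of n n n n]
    show ?thesis by (simp add: p_def d_def)
  qed
  have aq: "a \<longlonglongrightarrow> q" and bq: "b \<longlonglongrightarrow> q'" using qX qY by (simp_all add: a_def[abs_def] b_def[abs_def])
  have "(\<lambda>n. (2 * a n + 2 * b n - d n) * d n) \<longlonglongrightarrow> (2 * q + 2 * q' - 0) * 0"
    by (intro tendsto_intros aq bq d0)
  moreover have "(\<lambda>n. (a n - b n)\<^sup>2) \<longlonglongrightarrow> (q - q')\<^sup>2" by (intro tendsto_intros aq bq)
  moreover have "(a n - b n)\<^sup>2 \<le> (2 * a n + 2 * b n - d n) * d n" for n
    using ab[of n] pd[of n] by (simp add: eq_diff_eq[symmetric])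
  ultimately have "(q - q')\<^sup>2 \<le> (2 * q + 2 * q' - 0) * 0"
    by (intro LIMSEQ_le) auto
  then show ?thesis by simp
qed

lemma form_limit_shift:
  assumes "form_approx T X f" "(\<lambda>n. Re (cinner (fst (X n)) (snd (X n)))) \<longlonglongrightarrow> q"
  shows "(\<lambda>n. Re (cinner (fst (X n)) (snd (X n) + complex_of_real r *\<^sub>C fst (X n)))) \<longlonglongrightarrow> q + r * (norm f)\<^sup>2"
proof -
  have "(\<lambda>n. Re (cinner (fst (X n)) (snd (X n))) + r * (norm (fst (X n)))\<^sup>2) \<longlonglongrightarrow> q + r * (norm f)\<^sup>2"
    using assms by (intro tendsto_intros) (auto simp: form_approx_def)
  then show ?thesis by (simp add: cinner_simps cinner_self)
qed

text \<open>Uniqueness of the limit is inherited from the ambient self-adjoint A once its lower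
  bound is shifted to 0. Allowing a restriction T covers the minimal operator.\<close>

lemma quad_form_eqI:
  assumes A: "self_adjoint A" and sb: "semibounded_below A" and TA: "T \<subseteq> A"
    and X: "form_approx T X f" and q: "(\<lambda>n. Re (cinner (fst (X n)) (snd (X n)))) \<longlonglongrightarrow> q"
  shows "quad_form T f = q"
  unfolding quad_form_def
proof (rule the_equality)
  show "\<exists>X. form_approx T X f \<and> (\<lambda>n. Re (cinner (fst (X n)) (snd (X n)))) \<longlonglongrightarrow> q" using X q by blast
  fix q' assume "\<exists>Y. form_approx T Y f \<and> (\<lambda>n. Re (cinner (fst (Y n)) (snd (Y n)))) \<longlonglongrightarrow> q'"
  then obtain Y where Y: "form_approx T Y f" "(\<lambda>n. Re (cinner (fst (Y n)) (snd (Y n)))) \<longlonglongrightarrow> q'" by blast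
  obtain c where c: "op_ge A c" using sb by (auto simp: semibounded_below_iff)
  have "op_ge (op_shift A (complex_of_real (-c))) 0" using op_ge_shift[of A "-c" 0] c by simp
  from form_limit_unique_nonneg[OF self_adjoint_shift[OF A] this
      form_approx_shift[OF form_approx_mono[OF TA X]] form_approx_shift[OF form_approx_mono[OF TA Y(1)]]]
    form_limit_shift[OF X q, of "-c"] form_limit_shift[OF Y, of "-c"]
  show "q' = q" by fastforce
qed

section \<open>Rank-one singular perturbations\<close>

text \<open>Abstract setting: \<open>Q\<close> plays the role of \<open>((-\<Delta>)\<^sup>s\<^sup>/\<^sup>2 + \<lambda>)\<^sup>-\<^sup>1\<^sup>/\<^sup>2\<close> and \<open>\<eta>\<close> that of
  the Green function. Assumption \<open>concentrating\<close> expresses that \<open>\<eta>\<close> is not in the form domain \<open>range Q\<close>.\<close>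

locale singular_perturbation =
  fixes Q :: "L2 \<Rightarrow> L2" and \<eta> :: L2 and C :: real
  assumes Q_add: "Q (u + v) = Q u + Q v"
    and Q_scaleC: "Q (c *\<^sub>C u) = c *\<^sub>C Q u"
    and C_pos: "C > 0"
    and Q_bound: "norm (Q u) \<le> C * norm u"
    and Q_sym: "cinner (Q u) v = cinner u (Q v)"
    and Q_inj: "Q u = 0 \<Longrightarrow> u = 0"
    and concentrating: "e > 0 \<Longrightarrow> \<exists>\<theta>. cinner \<eta> \<theta> = 1 \<and> norm (Q \<theta>) < e"
begin

definition R :: "L2 \<Rightarrow> L2" where "R u = Q (Q u)"
definition W :: operator where "W = {(R v, v) | v. True}"
definition S :: operator where "S = {(R v, v) | v. cinner \<eta> v = 0}"
text \<open>A boundary condition: \<xi> is the coefficient of the singular part, and in the concrete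
  model \<open>cinner \<eta> v\<close> is the integral of the Fourier transform of the regular part
  \<open>R v\<close>. The extension \<open>W\<close> plays the role of infinite t.\<close>

definition K :: "real \<Rightarrow> operator" where
  "K t = {(R v + \<xi> *\<^sub>C \<eta>, v) | v \<xi>. cinner \<eta> v = complex_of_real t * \<xi>}"

section \<open>Density of ranges and free choice of the boundary value\<close>

lemma Q_diff: "Q (u - v) = Q u - Q v"
  using Q_add[of u "(-1) *\<^sub>C v"] Q_scaleC[of "-1" v] by (simp add: scaleC_minus1)

lemma Q_0 [simp]: "Q 0 = 0"
  using Q_diff[of 0 0] by simp

lemma bounded_linear_Q: "bounded_linear Q"
  by (rule bounded_linear_intro[where K=C])
    (use Q_bound in \<open>simp_all add: Q_add Q_scaleC scaleR_scaleC mult.commute\<close>)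

lemmas tendsto_Q [tendsto_intros] = bounded_linear.tendsto[OF bounded_linear_Q]

lemma R_add: "R (u + v) = R u + R v" and R_diff: "R (u - v) = R u - R v"
  and R_scaleC: "R (c *\<^sub>C u) = c *\<^sub>C R u" and R_0 [simp]: "R 0 = 0"
  by (simp_all add: R_def Q_add Q_diff Q_scaleC)

lemma R_sym: "cinner (R u) v = cinner u (R v)"
  by (simp add: R_def Q_sym)

lemma csubspace_range_Q: "csubspace (range Q)"
proof -
  have "c *\<^sub>C Q u \<in> range Q" "Q u + Q v \<in> range Q" "0 \<in> range Q" for c u v
    by (metis Q_scaleC rangeI, metis Q_add rangeI, metis Q_0 rangeI)
  then show ?thesis unfolding csubspace_def by blast
qed

text \<open>By symmetry a vector orthogonal to the range lies in the kernel, which is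
  trivial.\<close>

lemma closure_range_Q: "closure (range Q) = UNIV"
proof (rule orthogonal_dense[OF csubspace_range_Q])
  fix u assume "\<And>v. v \<in> range Q \<Longrightarrow> cinner u v = 0"
  then have "cinner u (Q v) = 0" for v by blast
  then have "cinner v (Q u) = 0" for v using cinner_cnj[of "Q v" u] by (simp add: Q_sym)
  then show "u = 0" using cinner_all_0 Q_inj by blast
qed

lemma range_Q_approx:
  assumes "e > 0" obtains v where "norm (u - Q v) < e"
proof -
  have "u \<in> closure (range Q)" by (simp add: closure_range_Q)
  then obtain y where "y \<in> range Q" "dist y u < e" using assms closure_approachable by blast
  then show thesis using that by (auto simp: dist_norm norm_minus_commute)
qed

text \<open>Pairing \<open>Q \<Phi> + \<xi> *\<^sub>C \<eta>\<close> with \<theta> gives <\<Phi>, Q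
  \<theta>> plus the conjugate of \<xi>. Since |Q \<theta>| can be made arbitrarily small while
  <\<eta>, \<theta>> = 1, a vanishing combination forces \<xi> = 0.\<close>

lemma eta_notin_range: "Q \<Phi> + \<xi> *\<^sub>C \<eta> = 0 \<longleftrightarrow> \<Phi> = 0 \<and> \<xi> = 0"
proof
  assume eq: "Q \<Phi> + \<xi> *\<^sub>C \<eta> = 0"
  have "\<xi> = 0"
  proof (rule ccontr)
    assume xi: "\<xi> \<noteq> 0"
    define e where "e = cmod \<xi> / (norm \<Phi> + 1)"
    have e: "e > 0" using xi by (simp add: e_def add_nonneg_pos)
    obtain \<theta> where \<theta>: "cinner \<eta> \<theta> = 1" "norm (Q \<theta>) < e" using concentrating[OF e] by blast
    have "cinner (Q \<Phi> + \<xi> *\<^sub>C \<eta>) \<theta> = 0" by (simp add: eq)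
    then have "cinner \<Phi> (Q \<theta>) + cnj \<xi> = 0" by (simp add: cinner_simps Q_sym \<theta>)
    then have "cmod \<xi> = cmod (cinner \<Phi> (Q \<theta>))"
      by (metis add_eq_0_iff complex_mod_cnj norm_minus_cancel)
    also have "\<dots> \<le> norm \<Phi> * norm (Q \<theta>)" by (rule cinner_Cauchy_Schwarz)
    also have "\<dots> \<le> norm \<Phi> * e" using \<theta>(2) by (intro mult_left_mono) auto
    also have "\<dots> < (norm \<Phi> + 1) * e" using e by simp
    also have "\<dots> = cmod \<xi>" by (simp add: e_def add_nonneg_eq_0_iff)
    finally show False by simp
  qed
  then show "\<Phi> = 0 \<and> \<xi> = 0" using eq Q_inj by simp
qed simp

text \<open>The functional <\<eta>, v> is unbounded in the norm of \<open>Q v\<close>, so its value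
  is corrected by a multiple of \<theta> at arbitrarily small cost. This decouples the boundary
  value from the form.\<close>

lemma S_approx:
  assumes "e > 0"
  obtains v where "cinner \<eta> v = a" "norm (\<Phi> - Q v) < e"
proof -
  obtain v0 where v0: "norm (\<Phi> - Q v0) < e / 2" using range_Q_approx[of "e/2" \<Phi>] assms by auto
  define d where "d = a - cinner \<eta> v0"
  obtain \<theta> where \<theta>: "cinner \<eta> \<theta> = 1" "norm (Q \<theta>) < e / (2 * (cmod d + 1))"
    using concentrating[of "e / (2 * (cmod d + 1))"] assms by (auto simp: add_nonneg_pos)
  show thesis
  proof (rule that[of "v0 + d *\<^sub>C \<theta>"])
    show "cinner \<eta> (v0 + d *\<^sub>C \<theta>) = a" by (simp add: cinner_simps \<theta> d_def)
    have "norm (\<Phi> - Q (v0 + d *\<^sub>C \<theta>)) = norm ((\<Phi> - Q v0) - d *\<^sub>C Q \<theta>)"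
      by (simp add: Q_add Q_scaleC algebra_simps)
    also have "\<dots> \<le> norm (\<Phi> - Q v0) + cmod d * norm (Q \<theta>)"
      using norm_triangle_ineq4[of "\<Phi> - Q v0" "d *\<^sub>C Q \<theta>"] by simp
    also have "cmod d * norm (Q \<theta>) \<le> (cmod d + 1) * norm (Q \<theta>)" by (intro mult_right_mono) auto
    also have "(cmod d + 1) * norm (Q \<theta>) \<le> e / 2"
    proof -
      have "0 < cmod d + 1" by (simp add: add_nonneg_pos)
      then show ?thesis using \<theta>(2) by (simp add: field_simps)
    qed
    finally show "norm (\<Phi> - Q (v0 + d *\<^sub>C \<theta>)) < e" using v0 by simp
  qed
qed

lemma S_approx_seq:
  obtains v where "\<And>n. cinner \<eta> (v n) = a" "(\<lambda>n. Q (v n)) \<longlonglongrightarrow> \<Phi>"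
proof -
  have "\<exists>v. cinner \<eta> v = a \<and> norm (\<Phi> - Q v) < inverse (real (Suc n))" for n
    using S_approx[of "inverse (real (Suc n))" a \<Phi>] by (metis inverse_positive_iff_positive of_nat_0_less_iff zero_less_Suc)
  then obtain v where v: "\<And>n. cinner \<eta> (v n) = a" "\<And>n. norm (\<Phi> - Q (v n)) < inverse (real (Suc n))"
    by metis
  have "(\<lambda>n. Q (v n) - \<Phi>) \<longlonglongrightarrow> 0"
    by (rule Lim_null_comparison[OF _ LIMSEQ_inverse_real_of_nat])
      (use v(2) in \<open>auto simp: norm_minus_commute intro!: always_eventually less_imp_le\<close>)
  then have "(\<lambda>n. Q (v n)) \<longlonglongrightarrow> \<Phi>" by (simp add: LIM_zero_iff)
  then show thesis using that v(1) by blast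
qed

lemma closure_Domain_S: "closure (Domain S) = UNIV"
proof -
  have "u \<in> closure (Domain S)" for u
  proof (rule closure_approachable[THEN iffD2], intro allI impI)
    fix e :: real assume e: "e > 0"
    obtain \<Phi> where \<Phi>: "norm (u - Q \<Phi>) < e / 2" using range_Q_approx[of "e/2" u] e by auto
    obtain v where v: "cinner \<eta> v = 0" "norm (\<Phi> - Q v) < e / (2 * C)"
      using S_approx[of "e / (2 * C)" 0 \<Phi>] e C_pos by auto
    have "norm (R v - u) \<le> norm (u - Q \<Phi>) + norm (Q (\<Phi> - Q v))"
      using norm_triangle_ineq[of "u - Q \<Phi>" "Q (\<Phi> - Q v)"]
      by (simp add: Q_diff R_def norm_minus_commute)
    also have "norm (Q (\<Phi> - Q v)) \<le> C * norm (\<Phi> - Q v)" by (rule Q_bound)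
    also have "C * norm (\<Phi> - Q v) \<le> e / 2" using v(2) C_pos by (simp add: field_simps)
    finally have "dist (R v) u < e" using \<Phi> by (simp add: dist_norm)
    then show "\<exists>y\<in>Domain S. dist y u < e" using v(1) by (auto simp: S_def)
  qed
  then show ?thesis by blast
qed

lemma closure_Domain_superset: "S \<subseteq> T \<Longrightarrow> closure (Domain T) = UNIV"
  using closure_mono[OF Domain_mono[of S T]] closure_Domain_S by auto

lemma S_subset_W: "S \<subseteq> W" by (auto simp: S_def W_def)

lemma S_subset_K: "S \<subseteq> K t"
proof -
  have "(R v, v) \<in> K t" if "cinner \<eta> v = 0" for v
    unfolding K_def using that by (intro CollectI exI[of _ v] exI[of _ 0]) simp
  then show ?thesis by (auto simp: S_def)
qed

lemma eta_pos: "cinner \<eta> \<eta> = complex_of_real ((norm \<eta>)\<^sup>2)" "norm \<eta> > 0"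
  using cinner_self eta_notin_range[of 0 1] by auto

text \<open>The vector u - R v annihilates the orthogonal complement of \<eta>, so subtracting its
  \<eta>-component leaves a vector orthogonal to itself.\<close>

lemma adjoint_S: "(u, v) \<in> adjoint_op S \<longleftrightarrow> (\<exists>\<xi>. u = R v + \<xi> *\<^sub>C \<eta>)"
proof
  assume a: "(u, v) \<in> adjoint_op S"
  define w where "w = u - R v"
  have orth: "cinner w h = 0" if "cinner \<eta> h = 0" for h
  proof -
    have "(R h, h) \<in> S" using that by (auto simp: S_def)
    then have "cinner u h = cinner v (R h)" using a by (simp add: mem_adjoint_op)
    then show ?thesis by (simp add: w_def cinner_simps R_sym)
  qed
  define \<xi> where "\<xi> = cinner \<eta> w / cinner \<eta> \<eta>"
  have n0: "cinner \<eta> \<eta> \<noteq> 0" using eta_pos by simp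
  have o: "cinner \<eta> (w - \<xi> *\<^sub>C \<eta>) = 0" using n0 by (simp add: cinner_simps \<xi>_def)
  then have "cinner (w - \<xi> *\<^sub>C \<eta>) (w - \<xi> *\<^sub>C \<eta>) = 0"
    using orth[OF o] by (simp only: cinner_diff_left cinner_scaleC_left) simp
  then have "w = \<xi> *\<^sub>C \<eta>" by (simp add: cinner_self)
  then show "\<exists>\<xi>. u = R v + \<xi> *\<^sub>C \<eta>" by (auto simp: w_def algebra_simps)
next
  assume "\<exists>\<xi>. u = R v + \<xi> *\<^sub>C \<eta>"
  then show "(u, v) \<in> adjoint_op S"
    by (auto simp: mem_adjoint_op S_def cinner_simps R_sym)
qed

section \<open>The boundary form and the self-adjoint extensions\<close>

text \<open>Green identity: the terms with \<open>R\<close> cancel by symmetry, so the symmetry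
  defect of two pairs of the adjoint is a form in the boundary data \<xi> and
  \<open>cinner \<eta> v\<close> alone.\<close>

lemma cinner_eta_sym:
  "cinner (R v + \<xi> *\<^sub>C \<eta>) v' = cinner v (R v' + \<xi>' *\<^sub>C \<eta>) \<longleftrightarrow>
    cnj \<xi> * cinner \<eta> v' = \<xi>' * cnj (cinner \<eta> v)"
  using cinner_cnj[of v \<eta>] by (simp add: cinner_simps R_sym)

lemma self_adjoint_W: "self_adjoint W"
  unfolding self_adjoint_def
proof
  show "closure (Domain W) = UNIV" by (rule closure_Domain_superset[OF S_subset_W])
  have "(u, v) \<in> adjoint_op W \<longleftrightarrow> (u, v) \<in> W" for u v
  proof
    assume a: "(u, v) \<in> adjoint_op W"
    have "cinner h u = cinner h (R v)" for h
    proof -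
      have "cinner u h = cinner v (R h)" using a by (auto simp: mem_adjoint_op W_def)
      then show ?thesis using cinner_cnj[of h u] cinner_cnj[of "R h" v] by (simp add: R_sym)
    qed
    then have "u = R v" by (rule cinner_eqI)
    then show "(u, v) \<in> W" by (auto simp: W_def)
  next
    assume "(u, v) \<in> W"
    then show "(u, v) \<in> adjoint_op W" by (auto simp: mem_adjoint_op W_def R_sym)
  qed
  then show "adjoint_op W = W" by auto
qed

lemma self_adjoint_K: "self_adjoint (K t)"
  unfolding self_adjoint_def
proof
  show "closure (Domain (K t)) = UNIV" by (rule closure_Domain_superset[OF S_subset_K])
  have "(u, v) \<in> adjoint_op (K t) \<longleftrightarrow> (u, v) \<in> K t" for u v
  proof
    assume a: "(u, v) \<in> adjoint_op (K t)"
    then have "(u, v) \<in> adjoint_op S" using adjoint_op_mono[OF S_subset_K] by blast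
    then obtain \<xi> where u: "u = R v + \<xi> *\<^sub>C \<eta>" using adjoint_S by blast
    obtain \<theta> where \<theta>: "cinner \<eta> \<theta> = 1" using concentrating[of 1] by auto
    \<comment> \<open>The resulting pair of \<open>K t\<close> has charge 1; it is the one test
      direction beyond \<open>S\<close> that recovers the boundary condition.\<close>
    define v' where "v' = complex_of_real t *\<^sub>C \<theta>"
    have v': "cinner \<eta> v' = complex_of_real t * 1" by (simp add: v'_def cinner_simps \<theta>)
    then have "(R v' + 1 *\<^sub>C \<eta>, v') \<in> K t" unfolding K_def by blast
    then have "cinner u v' = cinner v (R v' + 1 *\<^sub>C \<eta>)" using a by (simp add: mem_adjoint_op)
    then have "cnj \<xi> * complex_of_real t = cnj (cinner \<eta> v)"
      unfolding u cinner_eta_sym using v' by simp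
    then have "cinner \<eta> v = complex_of_real t * \<xi>"
      by (metis complex_cnj_cnj complex_cnj_complex_of_real complex_cnj_mult mult.commute)
    then show "(u, v) \<in> K t" unfolding K_def u by blast
  next
    assume "(u, v) \<in> K t"
    then obtain \<xi> where uv: "u = R v + \<xi> *\<^sub>C \<eta>" "cinner \<eta> v = complex_of_real t * \<xi>" by (auto simp: K_def)
    have "cinner u v' = cinner v u'" if mem: "(u', v') \<in> K t" for u' v'
    proof -
      obtain \<xi>' where uv': "u' = R v' + \<xi>' *\<^sub>C \<eta>" "cinner \<eta> v' = complex_of_real t * \<xi>'"
        using mem unfolding K_def by blast
      show ?thesis unfolding uv(1) uv'(1) cinner_eta_sym by (simp add: uv(2) uv'(2))
    qed
    then show "(u, v) \<in> adjoint_op (K t)" by (simp add: mem_adjoint_op)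
  qed
  then show "adjoint_op (K t) = K t" by auto
qed

text \<open>The pairs \<open>(\<xi>, \<langle>\<eta>, v\<rangle>)\<close> arising from a symmetric extension satisfy \<open>\<xi>\<^sup>* a' = \<xi>' a\<^sup>*\<close>, hence lie
  on a real line.\<close>

lemma self_adjoint_extensions:
  "self_adjoint T \<and> S \<subseteq> T \<longleftrightarrow> T = W \<or> (\<exists>t. T = K t)"
proof
  assume a: "self_adjoint T \<and> S \<subseteq> T"
  then have T: "self_adjoint T" and "adjoint_op T \<subseteq> adjoint_op S" using adjoint_op_mono by auto
  then have TS: "T \<subseteq> adjoint_op S" by (simp add: self_adjoint_def)
  have pair: "cnj \<xi> * cinner \<eta> v' = \<xi>' * cnj (cinner \<eta> v)"
    if "(R v + \<xi> *\<^sub>C \<eta>, v) \<in> T" "(R v' + \<xi>' *\<^sub>C \<eta>, v') \<in> T" for v \<xi> v' \<xi>'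
    using self_adjoint_sym[OF T that] cinner_eta_sym by blast
  show "T = W \<or> (\<exists>t. T = K t)"
  proof (cases "\<forall>v \<xi>. (R v + \<xi> *\<^sub>C \<eta>, v) \<in> T \<longrightarrow> \<xi> = 0")
    case True
    have "(u, v) \<in> W" if uv: "(u, v) \<in> T" for u v
    proof -
      obtain \<xi> where "u = R v + \<xi> *\<^sub>C \<eta>" using TS uv adjoint_S by blast
      with True uv show ?thesis by (auto simp: W_def)
    qed
    then have "T \<subseteq> W" by auto
    then show ?thesis using self_adjoint_subset_eq T self_adjoint_W by blast
  next
    case False
    then obtain v0 \<xi>0 where 0: "(R v0 + \<xi>0 *\<^sub>C \<eta>, v0) \<in> T" "\<xi>0 \<noteq> 0" by blast
    define t where "t = Re (cinner \<eta> v0 / \<xi>0)"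
    have "cinner \<eta> v0 / \<xi>0 = cnj (cinner \<eta> v0 / \<xi>0)"
      using pair[OF 0(1) 0(1)] 0(2) by (simp add: field_simps)
    then have t: "cinner \<eta> v0 = complex_of_real t * \<xi>0"
      unfolding t_def using 0(2) by (metis Reals_cnj_iff nonzero_eq_divide_eq of_real_Re)
    have "(u, v) \<in> K t" if uv: "(u, v) \<in> T" for u v
    proof -
      obtain \<xi> where u: "u = R v + \<xi> *\<^sub>C \<eta>" using TS uv adjoint_S by blast
      have "cnj \<xi>0 * cinner \<eta> v = \<xi> * cnj (cinner \<eta> v0)" using pair[OF 0(1)] uv u by blast
      then have "cnj \<xi>0 * cinner \<eta> v = cnj \<xi>0 * (complex_of_real t * \<xi>)" by (simp add: t mult_ac)
      then have "cinner \<eta> v = complex_of_real t * \<xi>" using 0(2) by simp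
      then show ?thesis unfolding K_def u by blast
    qed
    then have "T \<subseteq> K t" by auto
    then show ?thesis using self_adjoint_subset_eq T self_adjoint_K by blast
  qed
next
  assume "T = W \<or> (\<exists>t. T = K t)"
  then show "self_adjoint T \<and> S \<subseteq> T"
    using self_adjoint_W self_adjoint_K S_subset_W S_subset_K by blast
qed

section \<open>Lower bounds and invertibility of the extensions\<close>

lemma form_W: "cinner (R v) v = complex_of_real ((norm (Q v))\<^sup>2)"
  by (simp add: R_def Q_sym cinner_self)

lemma form_K:
  assumes "cinner \<eta> v = complex_of_real t * \<xi>"
  shows "Re (cinner (R v + \<xi> *\<^sub>C \<eta>) v) = (norm (Q v))\<^sup>2 + t * (cmod \<xi>)\<^sup>2"
proof -
  have "cinner (R v + \<xi> *\<^sub>C \<eta>) v = complex_of_real ((norm (Q v))\<^sup>2) + complex_of_real t * (\<xi> * cnj \<xi>)"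
    by (simp add: cinner_simps form_W assms mult_ac)
  then show ?thesis by (simp add: complex_norm_square[symmetric] cmod_power2)
qed

lemma op_ge_W: "op_ge W (1 / C\<^sup>2)"
  unfolding op_ge_def
proof (intro allI impI)
  fix f h assume "(f, h) \<in> W"
  then have f: "f = Q (Q h)" by (auto simp: W_def R_def)
  have "(norm f)\<^sup>2 \<le> (C * norm (Q h))\<^sup>2" unfolding f by (intro power_mono Q_bound) auto
  then show "1 / C\<^sup>2 * (norm f)\<^sup>2 \<le> Re (cinner f h)"
    using form_W[of h] C_pos by (simp add: f R_def power_mult_distrib field_simps)
qed

text \<open>Pairing g = \<open>Q \<Phi> + \<xi> *\<^sub>C \<eta>\<close> with a fixed \<theta>
  expresses \<xi> through <g, \<theta>> and <\<Phi>, Q \<theta>>. The first is controlled by |g|,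
  the second by |\<Phi>| times a factor as small as desired: \<xi> is infinitesimally form
  bounded.\<close>

lemma xi_bound:
  assumes e: "e > 0"
  obtains D where "D > 0" "\<And>\<Phi> \<xi>. (cmod \<xi>)\<^sup>2 \<le> e * (norm \<Phi>)\<^sup>2 + D * (norm (Q \<Phi> + \<xi> *\<^sub>C \<eta>))\<^sup>2"
proof -
  obtain \<theta> where \<theta>: "cinner \<eta> \<theta> = 1" "norm (Q \<theta>) < sqrt (e / 2)" using concentrating[of "sqrt (e/2)"] e by auto
  have "(norm (Q \<theta>))\<^sup>2 \<le> (sqrt (e / 2))\<^sup>2" using \<theta>(2) by (intro power_mono) auto
  then have Q2: "(norm (Q \<theta>))\<^sup>2 \<le> e / 2" using e by simp
  have \<theta>0: "\<theta> \<noteq> 0" using \<theta>(1) by auto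
  show thesis
  proof (rule that)
    show "2 * (norm \<theta>)\<^sup>2 > 0" using \<theta>0 by simp
    fix \<Phi> \<xi>
    define g where "g = Q \<Phi> + \<xi> *\<^sub>C \<eta>"
    have "cinner g \<theta> = cinner \<Phi> (Q \<theta>) + cnj \<xi>" by (simp add: g_def cinner_simps Q_sym \<theta>)
    then have "cmod (cnj \<xi>) = cmod (cinner g \<theta> - cinner \<Phi> (Q \<theta>))" by simp
    also have "\<dots> \<le> norm g * norm \<theta> + norm \<Phi> * norm (Q \<theta>)"
      by (rule order_trans[OF norm_triangle_ineq4]) (intro add_mono cinner_Cauchy_Schwarz)
    finally have "(cmod \<xi>)\<^sup>2 \<le> (norm g * norm \<theta> + norm \<Phi> * norm (Q \<theta>))\<^sup>2"
      by (intro power_mono) auto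
    also have "\<dots> \<le> 2 * (norm g * norm \<theta>)\<^sup>2 + 2 * (norm \<Phi> * norm (Q \<theta>))\<^sup>2"
      using zero_le_power2[of "norm g * norm \<theta> - norm \<Phi> * norm (Q \<theta>)"]
      by (simp add: power2_sum power2_diff)
    also have "(norm \<Phi> * norm (Q \<theta>))\<^sup>2 \<le> (norm \<Phi>)\<^sup>2 * (e / 2)"
      unfolding power_mult_distrib by (intro mult_left_mono Q2) simp
    finally show "(cmod \<xi>)\<^sup>2 \<le> e * (norm \<Phi>)\<^sup>2 + 2 * (norm \<theta>)\<^sup>2 * (norm (Q \<Phi> + \<xi> *\<^sub>C \<eta>))\<^sup>2"
      by (simp add: g_def[symmetric] power_mult_distrib algebra_simps)
  qed
qed

text \<open>With relative bound 1 / (2 (|t| + 1)) the possibly negative term t |\<xi>|^2 costs at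
  most half of |\<Phi>|^2. Besides semiboundedness, this controls \<Phi> along form Cauchy
  sequences.\<close>

lemma form_lower_bound:
  obtains D where "\<And>\<Phi> \<xi>. (norm \<Phi>)\<^sup>2 / 2 \<le> (norm \<Phi>)\<^sup>2 + t * (cmod \<xi>)\<^sup>2 + D * (norm (Q \<Phi> + \<xi> *\<^sub>C \<eta>))\<^sup>2"
proof -
  have e: "1 / (2 * (\<bar>t\<bar> + 1)) > 0" by (simp add: add_nonneg_pos)
  obtain D where D: "\<And>\<Phi> \<xi>. (cmod \<xi>)\<^sup>2 \<le> 1 / (2 * (\<bar>t\<bar> + 1)) * (norm \<Phi>)\<^sup>2 + D * (norm (Q \<Phi> + \<xi> *\<^sub>C \<eta>))\<^sup>2" "D > 0"
    using xi_bound[OF e] by metis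
  show thesis
  proof (rule that)
    fix \<Phi> \<xi>
    define g where "g = Q \<Phi> + \<xi> *\<^sub>C \<eta>"
    have "- t * (cmod \<xi>)\<^sup>2 \<le> (\<bar>t\<bar> + 1) * (cmod \<xi>)\<^sup>2" by (intro mult_right_mono) auto
    also have "\<dots> \<le> (\<bar>t\<bar> + 1) * (1 / (2 * (\<bar>t\<bar> + 1)) * (norm \<Phi>)\<^sup>2 + D * (norm g)\<^sup>2)"
      unfolding g_def by (intro mult_left_mono D) auto
    also have "\<dots> = (norm \<Phi>)\<^sup>2 / 2 + (\<bar>t\<bar> + 1) * D * (norm g)\<^sup>2"
      using e by (simp add: field_simps)
    finally show "(norm \<Phi>)\<^sup>2 / 2 \<le> (norm \<Phi>)\<^sup>2 + t * (cmod \<xi>)\<^sup>2 + (\<bar>t\<bar> + 1) * D * (norm (Q \<Phi> + \<xi> *\<^sub>C \<eta>))\<^sup>2"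
      unfolding g_def by linarith
  qed
qed

lemma semibounded_K: "semibounded_below (K t)"
proof -
  obtain D where D: "\<And>\<Phi> \<xi>. (norm \<Phi>)\<^sup>2 / 2 \<le> (norm \<Phi>)\<^sup>2 + t * (cmod \<xi>)\<^sup>2 + D * (norm (Q \<Phi> + \<xi> *\<^sub>C \<eta>))\<^sup>2"
    using form_lower_bound by metis
  have "op_ge (K t) (- D)"
    unfolding op_ge_def
  proof (intro allI impI)
    fix f h assume "(f, h) \<in> K t"
    then obtain \<xi> where f: "f = R h + \<xi> *\<^sub>C \<eta>" "cinner \<eta> h = complex_of_real t * \<xi>" by (auto simp: K_def)
    have "0 \<le> (norm (Q h))\<^sup>2 / 2" by simp
    with D[of "Q h" \<xi>] have "0 \<le> (norm (Q h))\<^sup>2 + t * (cmod \<xi>)\<^sup>2 + D * (norm f)\<^sup>2"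
      unfolding f R_def by linarith
    then show "- D * (norm f)\<^sup>2 \<le> Re (cinner f h)" unfolding f(1) form_K[OF f(2)] by linarith
  qed
  then show ?thesis by (auto simp: semibounded_below_iff)
qed

lemma semibounded_W: "semibounded_below W"
  using op_ge_W by (auto simp: semibounded_below_iff)

lemma op_ge_K_iff: "op_ge (K t) 0 \<longleftrightarrow> 0 \<le> t"
proof
  assume "0 \<le> t"
  then have "0 \<le> Re (cinner (R h + \<xi> *\<^sub>C \<eta>) h)" if "cinner \<eta> h = complex_of_real t * \<xi>" for h \<xi>
    unfolding form_K[OF that] by simp
  then show "op_ge (K t) 0" unfolding op_ge_def K_def by auto
next
  assume ge: "op_ge (K t) 0"
  show "0 \<le> t"
  proof (rule ccontr)
    assume t: "\<not> 0 \<le> t"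
    \<comment> \<open>For t < 0 take \<xi> = 1 and make \<open>Q v\<close> so small that the form
      value |Q v|^2 + t remains negative.\<close>
    obtain v where v: "cinner \<eta> v = complex_of_real t * 1" "norm (0 - Q v) < sqrt (- t)"
      using S_approx[of "sqrt (- t)" "complex_of_real t * 1" 0] t by (metis neg_0_less_iff_less not_le real_sqrt_gt_0_iff)
    have "(R v + 1 *\<^sub>C \<eta>, v) \<in> K t" using v(1) unfolding K_def by blast
    then have "0 \<le> Re (cinner (R v + 1 *\<^sub>C \<eta>) v)" using ge unfolding op_ge_def by fastforce
    then have "0 \<le> (norm (Q v))\<^sup>2 + t" using form_K[OF v(1)] by simp
    moreover have "(norm (Q v))\<^sup>2 < (sqrt (- t))\<^sup>2" using v(2) by (intro power_strict_mono) auto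
    ultimately show False using t by simp
  qed
qed

text \<open>For t \<noteq> 0 the boundary condition can be solved for \<xi>; this is Krein's
  resolvent formula with a rank-one correction.\<close>

lemma converse_K:
  assumes "t \<noteq> 0"
  shows "converse (K t) = graph_of (\<lambda>v. R v + (cinner \<eta> v / complex_of_real t) *\<^sub>C \<eta>)"
proof -
  have "(u, v) \<in> K t \<longleftrightarrow> u = R v + (cinner \<eta> v / complex_of_real t) *\<^sub>C \<eta>" for u v
  proof -
    have "cinner \<eta> v = complex_of_real t * \<xi> \<longleftrightarrow> \<xi> = cinner \<eta> v / complex_of_real t" for \<xi>
      using assms by (auto simp: field_simps)
    then show ?thesis unfolding K_def by auto
  qed
  then show ?thesis unfolding graph_of_def by auto
qed

lemma converse_W: "converse W = graph_of R"
  by (auto simp: graph_of_def W_def)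

lemma bounded_linear_R: "bounded_linear R"
  using bounded_linear_compose[OF bounded_linear_Q bounded_linear_Q] by (simp add: R_def[abs_def])

lemma invertible_W: "invertible_op W"
  unfolding invertible_op_def using bounded_linear_R R_scaleC converse_W by blast

lemma invertible_K_iff: "invertible_op (K t) \<longleftrightarrow> t \<noteq> 0"
proof
  assume inv: "invertible_op (K t)"
  show "t \<noteq> 0"
  proof
    \<comment> \<open>At t = 0 the pair of \<eta> and 0 lies in the graph, so the kernel is
      nontrivial.\<close>
    assume t: "t = 0"
    have "(R 0 + 1 *\<^sub>C \<eta>, 0) \<in> K t" "(R 0 + 0 *\<^sub>C \<eta>, 0) \<in> K t"
      unfolding K_def t by (rule CollectI, (rule exI)+, rule conjI[OF refl], simp)+
    then have "(0, \<eta>) \<in> converse (K t)" "(0, 0) \<in> converse (K t)" by simp_all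
    moreover obtain B where "converse (K t) = graph_of B" using inv unfolding invertible_op_def by blast
    ultimately have "(0, \<eta>) \<in> graph_of B" "(0, 0) \<in> graph_of B" by metis+
    then have "\<eta> = 0" unfolding graph_of_def by auto
    then show False using eta_pos by simp
  qed
next
  assume t: "t \<noteq> 0"
  let ?B = "\<lambda>v. R v + (cinner \<eta> v / complex_of_real t) *\<^sub>C \<eta>"
  have "bounded_linear (\<lambda>v. cinner \<eta> v / complex_of_real t)"
    using bounded_bilinear.bounded_linear_right[OF bounded_bilinear_cinner, of \<eta>]
    by (intro bounded_linear_compose[OF bounded_linear_divide]) 
  then have "bounded_linear (\<lambda>v. (cinner \<eta> v / complex_of_real t) *\<^sub>C \<eta>)"
    by (rule bounded_linear_compose[OF bounded_bilinear.bounded_linear_left[OF bounded_bilinear_scaleC]])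
  then have "bounded_linear ?B" by (intro bounded_linear_add bounded_linear_R)
  moreover have "?B (c *\<^sub>C v) = c *\<^sub>C ?B v" for c v
    by (simp add: R_scaleC cinner_simps scaleC_simps)
  ultimately show "invertible_op (K t)"
    unfolding invertible_op_def using converse_K[OF t] by blast
qed

section \<open>Form domains and the Friedrichs extension\<close>

text \<open>The charge \<xi> is kept fixed while \<open>Q (v n)\<close> tends to \<Phi> under the
  constraint on <\<eta>, v n>; differences have charge 0, so their form is |Q (v m - v n)|^2. The
  constraint is exported so that the case t = \<xi> = 0 can be read as a sequence in
  \<open>S\<close>.\<close>

lemma form_approx_exists:
  obtains v where "form_approx (K t) (\<lambda>n. (R (v n) + \<xi> *\<^sub>C \<eta>, v n)) (Q \<Phi> + \<xi> *\<^sub>C \<eta>)"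
    "(\<lambda>n. Re (cinner (R (v n) + \<xi> *\<^sub>C \<eta>) (v n))) \<longlonglongrightarrow> (norm \<Phi>)\<^sup>2 + t * (cmod \<xi>)\<^sup>2"
    "\<And>n. cinner \<eta> (v n) = complex_of_real t * \<xi>"
proof -
  obtain v where v: "\<And>n. cinner \<eta> (v n) = complex_of_real t * \<xi>" "(\<lambda>n. Q (v n)) \<longlonglongrightarrow> \<Phi>"
    using S_approx_seq by metis
  show thesis
  proof (rule that)
    show "(\<lambda>n. Re (cinner (R (v n) + \<xi> *\<^sub>C \<eta>) (v n))) \<longlonglongrightarrow> (norm \<Phi>)\<^sup>2 + t * (cmod \<xi>)\<^sup>2"
      unfolding form_K[OF v(1)] by (intro tendsto_intros v)
    show "form_approx (K t) (\<lambda>n. (R (v n) + \<xi> *\<^sub>C \<eta>, v n)) (Q \<Phi> + \<xi> *\<^sub>C \<eta>)"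
      unfolding form_approx_def fst_conv snd_conv
    proof (intro conjI allI impI)
      show "(R (v n) + \<xi> *\<^sub>C \<eta>, v n) \<in> K t" for n using v(1) unfolding K_def by blast
      show "(\<lambda>n. R (v n) + \<xi> *\<^sub>C \<eta>) \<longlonglongrightarrow> Q \<Phi> + \<xi> *\<^sub>C \<eta>"
        unfolding R_def by (intro tendsto_intros v)
      fix e :: real assume e: "e > 0"
      obtain N where N: "\<And>m n. m \<ge> N \<Longrightarrow> n \<ge> N \<Longrightarrow> norm (Q (v m) - Q (v n)) < sqrt e"
        using LIMSEQ_imp_Cauchy[OF v(2)] e unfolding Cauchy_def dist_norm by (metis real_sqrt_gt_0_iff)
      have "\<bar>Re (cinner (R (v m) + \<xi> *\<^sub>C \<eta> - (R (v n) + \<xi> *\<^sub>C \<eta>)) (v m - v n))\<bar> < e"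
        if "m \<ge> N" "n \<ge> N" for m n
      proof -
        have "R (v m) + \<xi> *\<^sub>C \<eta> - (R (v n) + \<xi> *\<^sub>C \<eta>) = R (v m - v n)" by (simp add: R_diff)
        moreover have "(norm (Q (v m) - Q (v n)))\<^sup>2 < (sqrt e)\<^sup>2"
          using N[OF that] by (intro power_strict_mono) auto
        ultimately show ?thesis using e by (simp add: form_W Q_diff)
      qed
      then show "\<exists>N. \<forall>m\<ge>N. \<forall>n\<ge>N.
          \<bar>Re (cinner (R (v m) + \<xi> *\<^sub>C \<eta> - (R (v n) + \<xi> *\<^sub>C \<eta>)) (v m - v n))\<bar> < e" by blast
    qed
  qed (rule v(1))
qed

lemma quad_form_K: "quad_form (op_shift (K t) (complex_of_real r)) (Q \<Phi> + \<xi> *\<^sub>C \<eta>)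
    = (norm \<Phi>)\<^sup>2 + t * (cmod \<xi>)\<^sup>2 + r * (norm (Q \<Phi> + \<xi> *\<^sub>C \<eta>))\<^sup>2"
proof -
  obtain v where v: "form_approx (K t) (\<lambda>n. (R (v n) + \<xi> *\<^sub>C \<eta>, v n)) (Q \<Phi> + \<xi> *\<^sub>C \<eta>)"
    "(\<lambda>n. Re (cinner (R (v n) + \<xi> *\<^sub>C \<eta>) (v n))) \<longlonglongrightarrow> (norm \<Phi>)\<^sup>2 + t * (cmod \<xi>)\<^sup>2"
    using form_approx_exists[of t \<xi> \<Phi>] by blast
  have "semibounded_below (op_shift (K t) (complex_of_real r))"
    using semibounded_K[of t] op_ge_shift[of "K t" r] by (metis add_diff_cancel_right' semibounded_below_iff)
  from quad_form_eqI[OF self_adjoint_shift[OF self_adjoint_K] this order_refl form_approx_shift[OF v(1)]]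
    form_limit_shift[OF v(1)] v(2)
  show ?thesis by simp
qed

text \<open>Nothing but these vectors occurs: \<open>form_lower_bound\<close> turns form convergence
  into convergence of \<open>Q (v n)\<close>, and the charges then converge too, being recovered by
  pairing with \<eta>.\<close>

lemma form_domain_K: "form_domain (K t) = {Q \<Phi> + \<xi> *\<^sub>C \<eta> | \<Phi> \<xi>. True}"
proof
  show "{Q \<Phi> + \<xi> *\<^sub>C \<eta> | \<Phi> \<xi>. True} \<subseteq> form_domain (K t)"
  proof clarify
    fix \<Phi> \<xi> show "Q \<Phi> + \<xi> *\<^sub>C \<eta> \<in> form_domain (K t)"
      using form_approx_exists[of t \<xi> \<Phi>] unfolding form_domain_def by blast
  qed
  show "form_domain (K t) \<subseteq> {Q \<Phi> + \<xi> *\<^sub>C \<eta> | \<Phi> \<xi>. True}"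
  proof
    fix f assume "f \<in> form_domain (K t)"
    then obtain X where X: "form_approx (K t) X f" by (auto simp: form_domain_def)
    have "\<forall>n. \<exists>\<xi>. fst (X n) = R (snd (X n)) + \<xi> *\<^sub>C \<eta> \<and> cinner \<eta> (snd (X n)) = complex_of_real t * \<xi>"
    proof
      fix n
      have "X n \<in> K t" using X by (simp add: form_approx_def)
      then show "\<exists>\<xi>. fst (X n) = R (snd (X n)) + \<xi> *\<^sub>C \<eta> \<and> cinner \<eta> (snd (X n)) = complex_of_real t * \<xi>"
        by (auto simp: K_def)
    qed
    then obtain \<xi> where \<xi>: "\<And>n. fst (X n) = R (snd (X n)) + \<xi> n *\<^sub>C \<eta>"
      "\<And>n. cinner \<eta> (snd (X n)) = complex_of_real t * \<xi> n" by metis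
    define v where "v n = snd (X n)" for n
    have lim: "(\<lambda>n. fst (X n)) \<longlonglongrightarrow> f" using X by (simp add: form_approx_def)
    obtain D where D: "\<And>\<Phi> \<xi>. (norm \<Phi>)\<^sup>2 / 2 \<le> (norm \<Phi>)\<^sup>2 + t * (cmod \<xi>)\<^sup>2 + D * (norm (Q \<Phi> + \<xi> *\<^sub>C \<eta>))\<^sup>2"
      using form_lower_bound by metis
    have key: "(norm (Q (v m) - Q (v n)))\<^sup>2 / 2 \<le> \<bar>Re (cinner (fst (X m) - fst (X n)) (snd (X m) - snd (X n)))\<bar>
        + \<bar>D\<bar> * (norm (fst (X m) - fst (X n)))\<^sup>2" for m n
    proof -
      have d: "fst (X m) - fst (X n) = R (v m - v n) + (\<xi> m - \<xi> n) *\<^sub>C \<eta>"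
        by (simp add: \<xi>(1) v_def R_diff scaleC_simps)
      have e: "cinner \<eta> (v m - v n) = complex_of_real t * (\<xi> m - \<xi> n)"
        by (simp add: cinner_simps \<xi>(2) v_def algebra_simps)
      have "D * (norm (fst (X m) - fst (X n)))\<^sup>2 \<le> \<bar>D\<bar> * (norm (fst (X m) - fst (X n)))\<^sup>2"
        by (intro mult_right_mono) auto
      moreover have "Re (cinner (fst (X m) - fst (X n)) (snd (X m) - snd (X n)))
          = (norm (Q (v m - v n)))\<^sup>2 + t * (cmod (\<xi> m - \<xi> n))\<^sup>2"
        unfolding d v_def[symmetric] by (rule form_K[OF e])
      ultimately show ?thesis
        using D[of "Q (v m - v n)" "\<xi> m - \<xi> n"] unfolding R_def[symmetric] d[symmetric] Q_diff[symmetric]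
        by linarith
    qed
    have "Cauchy (\<lambda>n. Q (v n))"
    proof (rule metric_CauchyI)
      fix e :: real assume e: "e > 0"
      define d where "d = e / (2 * sqrt (\<bar>D\<bar> + 1))"
      have d: "d > 0" "(\<bar>D\<bar> + 1) * d\<^sup>2 = e\<^sup>2 / 4"
      proof -
        have D: "\<bar>D\<bar> + 1 > 0" by simp
        then show "d > 0" using e by (simp add: d_def)
        have "d\<^sup>2 = e\<^sup>2 / (4 * (\<bar>D\<bar> + 1))" using D by (simp add: d_def power_divide power_mult_distrib)
        then show "(\<bar>D\<bar> + 1) * d\<^sup>2 = e\<^sup>2 / 4" using D by (simp add: field_simps)
      qed
      obtain N1 where N1: "\<And>m n. m \<ge> N1 \<Longrightarrow> n \<ge> N1 \<Longrightarrow>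
          \<bar>Re (cinner (fst (X m) - fst (X n)) (snd (X m) - snd (X n)))\<bar> < e\<^sup>2 / 4"
        using X e unfolding form_approx_def by (meson divide_pos_pos zero_less_numeral zero_less_power)
      obtain N2 where N2: "\<And>m n. m \<ge> N2 \<Longrightarrow> n \<ge> N2 \<Longrightarrow> norm (fst (X m) - fst (X n)) < d"
        using LIMSEQ_imp_Cauchy[OF lim] d(1) unfolding Cauchy_def dist_norm by metis
      have "dist (Q (v m)) (Q (v n)) < e" if mn: "m \<ge> max N1 N2" "n \<ge> max N1 N2" for m n
      proof -
        have "(norm (fst (X m) - fst (X n)))\<^sup>2 \<le> d\<^sup>2"
          using N2[of m n] mn by (intro power_mono) auto
        then have "\<bar>D\<bar> * (norm (fst (X m) - fst (X n)))\<^sup>2 \<le> (\<bar>D\<bar> + 1) * d\<^sup>2"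
          by (intro mult_mono) auto
        moreover have "\<bar>Re (cinner (fst (X m) - fst (X n)) (snd (X m) - snd (X n)))\<bar> < e\<^sup>2 / 4"
          using N1 mn by simp
        ultimately have "(norm (Q (v m) - Q (v n)))\<^sup>2 < e\<^sup>2" using key[of m n] d(2) by linarith
        then show ?thesis using e by (simp add: dist_norm power2_less_imp_less)
      qed
      then show "\<exists>M. \<forall>m\<ge>M. \<forall>n\<ge>M. dist (Q (v m)) (Q (v n)) < e" by blast
    qed
    then obtain \<Phi> where \<Phi>: "(\<lambda>n. Q (v n)) \<longlonglongrightarrow> \<Phi>" using Cauchy_convergent_iff convergent_def by blast
    have \<xi>eq: "\<xi> = (\<lambda>n. (cinner \<eta> (fst (X n)) - cinner \<eta> (Q (Q (v n)))) / cinner \<eta> \<eta>)"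
      using eta_pos unfolding \<xi>(1) by (simp add: R_def v_def cinner_simps fun_eq_iff)
    have "(\<lambda>n. (cinner \<eta> (fst (X n)) - cinner \<eta> (Q (Q (v n)))) / cinner \<eta> \<eta>)
        \<longlonglongrightarrow> (cinner \<eta> f - cinner \<eta> (Q \<Phi>)) / cinner \<eta> \<eta>"
      using eta_pos by (intro tendsto_intros lim \<Phi>) auto
    then have \<xi>lim: "\<xi> \<longlonglongrightarrow> (cinner \<eta> f - cinner \<eta> (Q \<Phi>)) / cinner \<eta> \<eta>"
      unfolding \<xi>eq[symmetric] .
    have "(\<lambda>n. Q (Q (v n)) + \<xi> n *\<^sub>C \<eta>) \<longlonglongrightarrow> Q \<Phi> + ((cinner \<eta> f - cinner \<eta> (Q \<Phi>)) / cinner \<eta> \<eta>) *\<^sub>C \<eta>"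
      by (intro tendsto_intros \<Phi> \<xi>lim)
    moreover have "(\<lambda>n. Q (Q (v n)) + \<xi> n *\<^sub>C \<eta>) = (\<lambda>n. fst (X n))"
      unfolding \<xi>(1) by (simp add: R_def v_def)
    ultimately have "f = Q \<Phi> + ((cinner \<eta> f - cinner \<eta> (Q \<Phi>)) / cinner \<eta> \<eta>) *\<^sub>C \<eta>"
      using LIMSEQ_unique lim by metis
    then show "f \<in> {Q \<Phi> + \<xi> *\<^sub>C \<eta> | \<Phi> \<xi>. True}" by blast
  qed
qed

lemma form_domain_W_subset: "form_domain W \<subseteq> range Q"
proof
  fix f assume "f \<in> form_domain W"
  then obtain X where X: "form_approx W X f" by (auto simp: form_domain_def)
  have XW: "fst (X n) = R (snd (X n))" for n
    using X by (auto simp: form_approx_def W_def) (metis fst_conv snd_conv)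
  have lim: "(\<lambda>n. fst (X n)) \<longlonglongrightarrow> f" using X by (simp add: form_approx_def)
  have "Cauchy (\<lambda>n. Q (snd (X n)))"
  proof (rule metric_CauchyI)
    fix e :: real assume e: "e > 0"
    obtain N where N: "\<And>m n. m \<ge> N \<Longrightarrow> n \<ge> N \<Longrightarrow>
        \<bar>Re (cinner (fst (X m) - fst (X n)) (snd (X m) - snd (X n)))\<bar> < e\<^sup>2"
      using X e unfolding form_approx_def by (meson zero_less_power)
    have "dist (Q (snd (X m))) (Q (snd (X n))) < e" if "m \<ge> N" "n \<ge> N" for m n
    proof -
      have "(norm (Q (snd (X m)) - Q (snd (X n))))\<^sup>2 < e\<^sup>2"
        using N[OF that] unfolding XW R_diff[symmetric] form_W Q_diff[symmetric] by simp
      then show ?thesis using e by (simp add: dist_norm power2_less_imp_less)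
    qed
    then show "\<exists>M. \<forall>m\<ge>M. \<forall>n\<ge>M. dist (Q (snd (X m))) (Q (snd (X n))) < e" by blast
  qed
  then obtain \<Phi> where \<Phi>: "(\<lambda>n. Q (snd (X n))) \<longlonglongrightarrow> \<Phi>" using Cauchy_convergent_iff convergent_def by blast
  have "(\<lambda>n. Q (Q (snd (X n)))) \<longlonglongrightarrow> Q \<Phi>" by (intro tendsto_intros \<Phi>)
  then have "(\<lambda>n. fst (X n)) \<longlonglongrightarrow> Q \<Phi>" unfolding XW R_def .
  then have "f = Q \<Phi>" using LIMSEQ_unique lim by blast
  then show "f \<in> range Q" by blast
qed

text \<open>Every \<open>Q \<Phi>\<close> is approximated already within \<open>S\<close>, by the
  sequences of \<open>form_approx_exists\<close> with t = \<xi> = 0. Hence \<open>S\<close> and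
  \<open>W\<close> have the same closed form, with domain \<open>range Q\<close>.\<close>

lemma friedrichs_W:
  "is_friedrichs_extension (op_shift S (complex_of_real r)) (op_shift W (complex_of_real r))"
proof -
  let ?S = "op_shift S (complex_of_real r)" and ?W = "op_shift W (complex_of_real r)"
  have sub: "?S \<subseteq> ?W" using S_subset_W by (auto simp: mem_op_shift)
  have sa: "self_adjoint ?W" by (rule self_adjoint_shift[OF self_adjoint_W])
  have sb: "semibounded_below ?W"
    using semibounded_W op_ge_shift[of W r] by (metis add_diff_cancel_right' semibounded_below_iff)
  have ex: "\<exists>v. form_approx S (\<lambda>n. (R (v n), v n)) (Q \<Phi>) \<and>
      (\<lambda>n. Re (cinner (R (v n)) (v n))) \<longlonglongrightarrow> (norm \<Phi>)\<^sup>2" for \<Phi>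
  proof -
    obtain v where v: "form_approx (K 0) (\<lambda>n. (R (v n) + 0 *\<^sub>C \<eta>, v n)) (Q \<Phi> + 0 *\<^sub>C \<eta>)"
      "(\<lambda>n. Re (cinner (R (v n) + 0 *\<^sub>C \<eta>) (v n))) \<longlonglongrightarrow> (norm \<Phi>)\<^sup>2 + 0 * (cmod 0)\<^sup>2"
      "\<And>n. cinner \<eta> (v n) = complex_of_real 0 * 0"
      using form_approx_exists[of 0 0 \<Phi>] by blast
    have "(R (v n), v n) \<in> S" for n using v(3) by (auto simp: S_def)
    then have "form_approx S (\<lambda>n. (R (v n), v n)) (Q \<Phi>)"
      using v(1) by (auto simp: form_approx_def)
    then show ?thesis using v(2) by auto
  qed
  have "range Q \<subseteq> form_domain S" using ex unfolding form_domain_def by blast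
  moreover have "form_domain S \<subseteq> form_domain W"
    using form_approx_mono[OF S_subset_W] unfolding form_domain_def by blast
  ultimately have dom: "form_domain S = range Q" "form_domain W = range Q"
    using form_domain_W_subset by auto
  have "quad_form ?W f = quad_form ?S f" if f: "f \<in> range Q" for f
  proof -
    obtain \<Phi> where \<Phi>: "f = Q \<Phi>" using f by blast
    obtain v where v: "form_approx S (\<lambda>n. (R (v n), v n)) f"
      "(\<lambda>n. Re (cinner (R (v n)) (v n))) \<longlonglongrightarrow> (norm \<Phi>)\<^sup>2" using ex \<Phi> by blast
    have lim: "(\<lambda>n. Re (cinner (R (v n)) (v n + complex_of_real r *\<^sub>C R (v n)))) \<longlonglongrightarrow> (norm \<Phi>)\<^sup>2 + r * (norm f)\<^sup>2"
      using form_limit_shift[OF v(1), of "(norm \<Phi>)\<^sup>2" r] v(2) by simp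
    have fa: "form_approx ?S (\<lambda>n. (R (v n), v n + complex_of_real r *\<^sub>C R (v n))) f"
      using form_approx_shift[OF v(1), of r] by simp
    have "quad_form ?S f = (norm \<Phi>)\<^sup>2 + r * (norm f)\<^sup>2"
      by (rule quad_form_eqI[OF sa sb sub fa]) (simp add: lim)
    moreover have "quad_form ?W f = (norm \<Phi>)\<^sup>2 + r * (norm f)\<^sup>2"
      by (rule quad_form_eqI[OF sa sb order_refl form_approx_mono[OF sub fa]]) (simp add: lim)
    ultimately show ?thesis by simp
  qed
  then show ?thesis
    unfolding is_friedrichs_extension_def form_domain_shift dom using sub sa sb by blast
qed

end

section \<open>The Fourier integral\<close>

text \<open>Lebesgue measure is the image of a product of one-dimensional measures, so an integrand
  that factorises over the coordinates can be integrated factor by factor.\<close>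

lemma
  fixes f :: "'a::euclidean_space \<Rightarrow> real \<Rightarrow> complex"
  assumes f: "\<And>b. b \<in> Basis \<Longrightarrow> integrable lborel (f b)"
  shows integrable_lborel_prod: "integrable lborel (\<lambda>x::'a. \<Prod>b\<in>Basis. f b (x \<bullet> b))"
    and integral_lborel_prod: "(\<integral>(x::'a). (\<Prod>b\<in>Basis. f b (x \<bullet> b)) \<partial>lborel) = (\<Prod>b\<in>Basis. (\<integral>x. f b x \<partial>lborel))"
proof -
  interpret product_sigma_finite "\<lambda>_::'a. lborel :: real measure" by standard
  have m [measurable]: "f b \<in> borel_measurable borel" if "b \<in> Basis" for b
    using f[OF that] by simp
  have mm: "(\<lambda>f. \<Sum>b\<in>Basis. f b *\<^sub>R b) \<in> measurable (\<Pi>\<^sub>M b\<in>Basis. lborel) (borel :: 'a measure)"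
    by measurable
  have mp: "(\<lambda>x::'a. \<Prod>b\<in>Basis. f b (x \<bullet> b)) \<in> borel_measurable borel" by measurable
  have eq: "(\<lambda>x. \<Prod>b\<in>Basis. f b ((\<Sum>c\<in>Basis. x c *\<^sub>R c) \<bullet> b)) = (\<lambda>x. \<Prod>b\<in>(Basis::'a set). f b (x b))"
    by (intro ext prod.cong) (auto simp: inner_sum_left inner_Basis if_distrib cong: if_cong)
  show "integrable lborel (\<lambda>x::'a. \<Prod>b\<in>Basis. f b (x \<bullet> b))"
    unfolding lborel_eq[where 'a='a] integrable_distr_eq[OF mm mp] eq
    by (intro product_integrable_prod f) auto
  show "(\<integral>(x::'a). (\<Prod>b\<in>Basis. f b (x \<bullet> b)) \<partial>lborel) = (\<Prod>b\<in>Basis. (\<integral>x. f b x \<partial>lborel))"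
    unfolding lborel_eq[where 'a='a] integral_distr[OF mm mp] eq
    by (subst product_integral_prod) (auto intro: f simp flip: lborel_eq)
qed

lemma
  fixes f :: "'a::euclidean_space \<Rightarrow> complex"
  assumes c: "c \<noteq> 0"
  shows lborel_integrable_affine: "integrable lborel f \<Longrightarrow> integrable lborel (\<lambda>x. f (t + c *\<^sub>R x))"
    and lborel_integral_affine:
      "integrable lborel f \<Longrightarrow> (\<integral>x. f x \<partial>lborel) = (\<bar>c\<bar> ^ DIM('a)) *\<^sub>R (\<integral>x. f (t + c *\<^sub>R x) \<partial>lborel)"
proof -
  assume f: "integrable lborel f"
  then have m [measurable]: "f \<in> borel_measurable borel" by simp
  let ?D = "density (distr lborel borel (\<lambda>x. t + c *\<^sub>R x)) (\<lambda>_. \<bar>c\<bar>^DIM('a))"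
  have mt: "(\<lambda>x. t + c *\<^sub>R x) \<in> measurable lborel borel" by simp
  have "integrable ?D f" using f lborel_affine[OF c, of t] by simp
  then have "integrable (distr lborel borel (\<lambda>x. t + c *\<^sub>R x)) (\<lambda>x. (\<bar>c\<bar> ^ DIM('a)) *\<^sub>R f x)"
    by (subst (asm) integrable_density) auto
  from integrable_scaleR_right[OF this, of "1 / \<bar>c\<bar> ^ DIM('a)"]
  have "integrable (distr lborel borel (\<lambda>x. t + c *\<^sub>R x)) f" using c by simp
  then show i: "integrable lborel (\<lambda>x. f (t + c *\<^sub>R x))"
    by (subst (asm) integrable_distr_eq[OF mt]) auto
  have "(\<integral>x. f x \<partial>lborel) = (\<integral>x. f x \<partial>?D)" using lborel_affine[OF c, of t] by simp
  also have "\<dots> = (\<integral>x. (\<bar>c\<bar> ^ DIM('a)) *\<^sub>R f x \<partial>distr lborel borel (\<lambda>x. t + c *\<^sub>R x))"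
    by (subst integral_density) auto
  also have "\<dots> = (\<integral>x. (\<bar>c\<bar> ^ DIM('a)) *\<^sub>R f (t + c *\<^sub>R x) \<partial>lborel)"
    by (subst integral_distr[OF mt]) auto
  finally show "(\<integral>x. f x \<partial>lborel) = (\<bar>c\<bar> ^ DIM('a)) *\<^sub>R (\<integral>x. f (t + c *\<^sub>R x) \<partial>lborel)" by simp
qed

definition fconst :: complex where "fconst = complex_of_real ((2 * pi) powr (- 3 / 2))"

text \<open>The absolutely convergent integral, continuous for integrable f. The limit
  \<open>fourier\<close> agrees with it on functions that are both integrable and square
  integrable.\<close>

definition ft :: "(real^3 \<Rightarrow> complex) \<Rightarrow> real^3 \<Rightarrow> complex" where
  "ft f p = fconst * (\<integral>x. exp (- \<i> * complex_of_real (p \<bullet> x)) * f x \<partial>lborel)"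

lemma cmod_exp_i [simp]: "cmod (exp (- (\<i> * complex_of_real r))) = 1" "cmod (exp (\<i> * complex_of_real r)) = 1"
  using norm_exp_i_times[of "- r"] by (simp_all add: norm_exp_i_times)

lemma measurable_exp_i [measurable]:
  "(\<lambda>x. exp (- \<i> * complex_of_real (p \<bullet> x))) \<in> borel_measurable borel"
  "(\<lambda>x. exp (\<i> * complex_of_real (p \<bullet> x))) \<in> borel_measurable borel"
  by (intro borel_measurable_continuous_onI continuous_intros)+

lemma cmod_mult_le: "cmod b \<le> M \<Longrightarrow> cmod (a * b) \<le> M * cmod a"
  unfolding norm_mult by (subst mult.commute) (intro mult_right_mono, auto)

lemma integrable_exp_mult:
  assumes "integrable lborel f"
  shows "integrable lborel (\<lambda>x. exp (- \<i> * complex_of_real (p \<bullet> x)) * f x)"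
    "integrable lborel (\<lambda>x. exp (\<i> * complex_of_real (p \<bullet> x)) * f x)"
proof -
  have [measurable]: "f \<in> borel_measurable borel" using assms by simp
  show "integrable lborel (\<lambda>x. exp (- \<i> * complex_of_real (p \<bullet> x)) * f x)"
    by (rule Bochner_Integration.integrable_bound[OF assms]) (auto simp: norm_mult)
  show "integrable lborel (\<lambda>x. exp (\<i> * complex_of_real (p \<bullet> x)) * f x)"
    by (rule Bochner_Integration.integrable_bound[OF assms]) (auto simp: norm_mult)
qed

lemma fconst_pos: "(2 * pi) powr (- 3 / 2) > (0::real)" "cnj fconst = fconst"
    "cmod fconst = (2 * pi) powr (- 3 / 2)" "fconst \<noteq> 0"
  by (simp_all add: fconst_def)

lemma ft_bound: "integrable lborel f \<Longrightarrow> cmod (ft f p) \<le> cmod fconst * (\<integral>x. cmod (f x) \<partial>lborel)"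
  unfolding ft_def norm_mult
  by (intro mult_left_mono order_trans[OF integral_norm_bound]) (auto simp: norm_mult)

lemma ft_add: "integrable lborel f \<Longrightarrow> integrable lborel g \<Longrightarrow> ft (\<lambda>x. f x + g x) p = ft f p + ft g p"
  by (simp only: ft_def distrib_left Bochner_Integration.integral_add[OF integrable_exp_mult(1) integrable_exp_mult(1)])

lemma ft_diff: "integrable lborel f \<Longrightarrow> integrable lborel g \<Longrightarrow> ft (\<lambda>x. f x - g x) p = ft f p - ft g p"
  by (simp only: ft_def right_diff_distrib Bochner_Integration.integral_diff[OF integrable_exp_mult(1) integrable_exp_mult(1)])

lemma ft_cmult: "ft (\<lambda>x. c * f x) p = c * ft f p"
  unfolding ft_def by (simp add: mult.left_commute[of _ c])

lemma ft_cong_AE: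
  assumes "AE x in lborel. f x = g x" "f \<in> borel_measurable borel" "g \<in> borel_measurable borel"
  shows "ft f p = ft g p"
  unfolding ft_def by (intro arg_cong[where f="\<lambda>z. fconst * z"] integral_cong_AE) (use assms in auto)

text \<open>Dominated convergence with function and frequency moving together: a constant sequence
  of functions gives continuity of the transform, a constant frequency gives the limit of ball
  integrals.\<close>

lemma tendsto_ft:
  assumes f: "integrable lborel w" "\<And>n x. cmod (f n x) \<le> w x" "AE x in lborel. (\<lambda>n. f n x) \<longlonglongrightarrow> g x"
    and m [measurable]: "\<And>n. f n \<in> borel_measurable borel" "g \<in> borel_measurable borel" and p: "P \<longlonglongrightarrow> p"
  shows "(\<lambda>n. ft (f n) (P n)) \<longlonglongrightarrow> ft g p"
  unfolding ft_def
proof (intro tendsto_intros integral_dominated_convergence[OF _ _ f(1)])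
  show "AE x in lborel. (\<lambda>n. exp (- \<i> * complex_of_real (P n \<bullet> x)) * f n x)
      \<longlonglongrightarrow> exp (- \<i> * complex_of_real (p \<bullet> x)) * g x"
    using f(3) by eventually_elim (intro tendsto_intros p)
qed (use f(2) in \<open>auto simp: norm_mult\<close>)

lemma continuous_ft: "integrable lborel f \<Longrightarrow> continuous_on UNIV (ft f)"
  unfolding continuous_on_sequentially
  by (auto simp: comp_def intro!: tendsto_ft[where w="\<lambda>x. cmod (f x)"])

lemma borel_measurable_ft [measurable]: "integrable lborel f \<Longrightarrow> ft f \<in> borel_measurable borel"
  by (rule borel_measurable_continuous_onI[OF continuous_ft])

text \<open>Fubini, the kernel being symmetric in position and frequency.\<close>

lemma ft_mult_formula:
  assumes u: "integrable lborel u" and v: "integrable lborel v"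
  shows "(\<integral>p. ft u p * v p \<partial>lborel) = (\<integral>x. u x * ft v x \<partial>lborel)"
proof -
  have [measurable]: "u \<in> borel_measurable borel" "v \<in> borel_measurable borel" using u v by auto
  let ?F = "\<lambda>x p. u x * (v p * exp (- \<i> * complex_of_real (p \<bullet> x)))"
  have "integrable (lborel \<Otimes>\<^sub>M lborel) (case_prod ?F)"
  proof (rule lborel_pair.Fubini_integrable)
    have "(\<lambda>z::(real^3)\<times>(real^3). exp (- \<i> * complex_of_real (snd z \<bullet> fst z))) \<in> borel_measurable borel"
      by (intro borel_measurable_continuous_onI continuous_intros)
    then have [measurable]: "(\<lambda>z::(real^3)\<times>(real^3). exp (- \<i> * complex_of_real (snd z \<bullet> fst z)))
        \<in> borel_measurable (lborel \<Otimes>\<^sub>M lborel)" by (simp add: borel_prod)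
    show "case_prod ?F \<in> borel_measurable (lborel \<Otimes>\<^sub>M lborel)"
      unfolding split_beta' by measurable
    show "integrable lborel (\<lambda>x. \<integral>y. norm (case_prod ?F (x, y)) \<partial>lborel)"
      using u by (simp add: norm_mult)
    have "integrable lborel (\<lambda>y. exp (- \<i> * complex_of_real (x \<bullet> y)) * v y)" for x
      by (rule integrable_exp_mult(1)[OF v])
    then have "integrable lborel (\<lambda>y. u x * (exp (- \<i> * complex_of_real (x \<bullet> y)) * v y))" for x by simp
    then show "AE x in lborel. integrable lborel (\<lambda>y. case_prod ?F (x, y))"
      by (intro always_eventually allI) (simp add: inner_commute mult.commute)
  qed
  from lborel_pair.Fubini_integral[OF this]
  have fub: "(\<integral>p. (\<integral>x. ?F x p \<partial>lborel) \<partial>lborel) = (\<integral>x. (\<integral>p. ?F x p \<partial>lborel) \<partial>lborel)" .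
  have e1: "(\<integral>x. ?F x p \<partial>lborel) = v p * (\<integral>x. exp (- \<i> * complex_of_real (p \<bullet> x)) * u x \<partial>lborel)" for p
    unfolding integral_mult_right_zero[symmetric] by (intro Bochner_Integration.integral_cong) (auto simp: mult_ac)
  have e2: "(\<integral>p. ?F x p \<partial>lborel) = u x * (\<integral>p. exp (- \<i> * complex_of_real (x \<bullet> p)) * v p \<partial>lborel)" for x
    unfolding integral_mult_right_zero[symmetric]
    by (intro Bochner_Integration.integral_cong) (auto simp: mult_ac inner_commute)
  have "fconst * (\<integral>p. v p * (\<integral>x. exp (- \<i> * complex_of_real (p \<bullet> x)) * u x \<partial>lborel) \<partial>lborel)
      = fconst * (\<integral>x. u x * (\<integral>p. exp (- \<i> * complex_of_real (x \<bullet> p)) * v p \<partial>lborel) \<partial>lborel)"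
    using fub unfolding e1 e2 by (rule arg_cong)
  moreover have "(\<lambda>p. ft u p * v p)
      = (\<lambda>p. fconst * (v p * (\<integral>x. exp (- \<i> * complex_of_real (p \<bullet> x)) * u x \<partial>lborel)))"
    "(\<lambda>x. u x * ft v x)
      = (\<lambda>x. fconst * (u x * (\<integral>p. exp (- \<i> * complex_of_real (x \<bullet> p)) * v p \<partial>lborel)))"
    by (simp_all add: ft_def fun_eq_iff)
  ultimately show ?thesis by (simp only: integral_mult_right_zero)
qed

section \<open>Gaussian regularisation\<close>

definition gauss :: "real^3 \<Rightarrow> complex" where
  "gauss u = complex_of_real (exp (- (norm u)\<^sup>2 / 2))"

text \<open>The integral is the characteristic function of the standard normal distribution,
  multiplied by the normalising constant sqrt(2 pi).\<close>

lemma gauss_1d: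
  shows "integrable lborel (\<lambda>t. exp (\<i> * complex_of_real (a * t)) * complex_of_real (exp (- t\<^sup>2 / 2)))"
    "(\<integral>t. exp (\<i> * complex_of_real (a * t)) * complex_of_real (exp (- t\<^sup>2 / 2)) \<partial>lborel)
      = complex_of_real (sqrt (2 * pi) * exp (- a\<^sup>2 / 2))"
proof -
  interpret prob_space std_normal_distribution by (rule prob_space_normal_density) simp
  have c: "0 < sqrt (2 * pi)" by simp
  have eq: "exp (\<i> * complex_of_real (a * t)) * complex_of_real (exp (- t\<^sup>2 / 2))
      = complex_of_real (sqrt (2 * pi)) * (std_normal_density t *\<^sub>R iexp (a * t))" for t
    using c by (simp add: std_normal_density_def scaleR_conv_of_real del: real_sqrt_mult)
  have "integrable std_normal_distribution (\<lambda>x. iexp (a * x))"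
    by (rule integrable_const_bound[where B=1]) auto
  then have i: "integrable lborel (\<lambda>t. std_normal_density t *\<^sub>R iexp (a * t))"
    by (subst (asm) integrable_density) auto
  then show "integrable lborel (\<lambda>t. exp (\<i> * complex_of_real (a * t)) * complex_of_real (exp (- t\<^sup>2 / 2)))"
    unfolding eq by (rule integrable_mult_right)
  have "(\<integral>t. std_normal_density t *\<^sub>R iexp (a * t) \<partial>lborel) = char std_normal_distribution a"
    unfolding char_def by (subst integral_density) auto
  then show "(\<integral>t. exp (\<i> * complex_of_real (a * t)) * complex_of_real (exp (- t\<^sup>2 / 2)) \<partial>lborel)
      = complex_of_real (sqrt (2 * pi) * exp (- a\<^sup>2 / 2))"
    unfolding eq integral_mult_right_zero by (simp add: char_std_normal_distribution)
qed

lemma norm_sq_Basis: "(norm (u::'a::euclidean_space))\<^sup>2 = (\<Sum>b\<in>Basis. (u \<bullet> b)\<^sup>2)"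
  unfolding power2_norm_eq_inner euclidean_inner[of u u] by (simp add: power2_eq_square)

lemma powr_three_half: "0 < x \<Longrightarrow> (sqrt x) ^ 3 = x powr (3/2)"
  by (simp add: powr_half_sqrt[symmetric] powr_realpow[symmetric] powr_powr)

lemma gauss_3d:
  shows "integrable lborel (\<lambda>u. exp (\<i> * complex_of_real (a \<bullet> u)) * gauss u)"
    "fconst * (\<integral>u. exp (\<i> * complex_of_real (a \<bullet> u)) * gauss u \<partial>lborel) = gauss a"
proof -
  let ?f = "\<lambda>b t. exp (\<i> * complex_of_real ((a \<bullet> b) * t)) * complex_of_real (exp (- t\<^sup>2 / 2))"
  have eq: "(\<lambda>u. exp (\<i> * complex_of_real (a \<bullet> u)) * gauss u) = (\<lambda>u. \<Prod>b\<in>Basis. ?f b (u \<bullet> b))"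
  proof
    fix u
    have "(\<Prod>b\<in>Basis. exp (\<i> * complex_of_real ((a \<bullet> b) * (u \<bullet> b)))) = exp (\<i> * complex_of_real (a \<bullet> u))"
      by (subst exp_sum[symmetric]) (simp_all add: euclidean_inner[of a u] sum_distrib_left)
    moreover have "(\<Prod>b\<in>Basis. exp (- (u \<bullet> b)\<^sup>2 / 2)) = exp (- (norm u)\<^sup>2 / 2)"
      by (subst exp_sum[symmetric]) (simp_all add: norm_sq_Basis sum_negf sum_divide_distrib)
    ultimately show "exp (\<i> * complex_of_real (a \<bullet> u)) * gauss u = (\<Prod>b\<in>Basis. ?f b (u \<bullet> b))"
      unfolding prod.distrib gauss_def of_real_prod[symmetric] by simp
  qed
  show "integrable lborel (\<lambda>u. exp (\<i> * complex_of_real (a \<bullet> u)) * gauss u)"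
    unfolding eq by (intro integrable_lborel_prod gauss_1d)
  have "(\<integral>u. exp (\<i> * complex_of_real (a \<bullet> u)) * gauss u \<partial>lborel)
      = (\<Prod>b\<in>Basis. complex_of_real (sqrt (2 * pi) * exp (- (a \<bullet> b)\<^sup>2 / 2)))"
    unfolding eq by (subst integral_lborel_prod[OF gauss_1d(1)]) (simp only: gauss_1d(2))
  also have "\<dots> = complex_of_real (sqrt (2 * pi) ^ 3 * exp (- (norm a)\<^sup>2 / 2))"
    unfolding of_real_prod[symmetric] prod.distrib
    by (subst exp_sum[symmetric]) (simp_all add: norm_sq_Basis sum_negf sum_divide_distrib)
  also have "sqrt (2 * pi) ^ 3 = (2 * pi) powr (3 / 2)" by (rule powr_three_half) simp
  finally show "fconst * (\<integral>u. exp (\<i> * complex_of_real (a \<bullet> u)) * gauss u \<partial>lborel) = gauss a"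
    by (simp add: fconst_def gauss_def mult.assoc[symmetric] of_real_mult[symmetric] powr_add[symmetric]
        del: of_real_mult)
qed

lemma gauss_integrable: "integrable lborel gauss"
  using gauss_3d(1)[of 0] by simp

lemma gauss_integral: "fconst * (\<integral>u. gauss u \<partial>lborel) = 1"
  using gauss_3d(2)[of 0] by (simp add: gauss_def)

lemma gauss_measurable [measurable]: "gauss \<in> borel_measurable borel"
  using gauss_integrable by simp

lemma gauss_real: "gauss u = complex_of_real (cmod (gauss u))" "cnj (gauss u) = gauss u"
  by (simp_all add: gauss_def)

lemma gauss_scaled_integrable: "\<sigma> > 0 \<Longrightarrow> integrable lborel (\<lambda>p. gauss (\<sigma> *\<^sub>R p))"
  using lborel_integrable_affine[OF _ gauss_integrable, of \<sigma> 0] by simp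

lemma ft_modulated_gauss:
  assumes \<sigma>: "\<sigma> > 0"
  shows "ft (\<lambda>p. exp (\<i> * complex_of_real (x \<bullet> p)) * gauss (\<sigma> *\<^sub>R p)) y
      = complex_of_real ((1 / \<sigma>) ^ 3) * gauss ((1 / \<sigma>) *\<^sub>R (x - y))"
proof -
  let ?h = "\<lambda>p. exp (\<i> * complex_of_real ((x - y) \<bullet> p)) * gauss (\<sigma> *\<^sub>R p)"
  have h: "integrable lborel ?h"
    by (rule integrable_exp_mult(2)[OF gauss_scaled_integrable[OF \<sigma>]])
  have eq: "exp (- \<i> * complex_of_real (y \<bullet> p)) * (exp (\<i> * complex_of_real (x \<bullet> p)) * gauss (\<sigma> *\<^sub>R p)) = ?h p" for p
    unfolding mult.assoc[symmetric] exp_add[symmetric]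
    by (rule arg_cong2[where f="(*)", OF arg_cong[where f=exp] refl])
      (simp add: inner_diff_left right_diff_distrib)
  have "ft (\<lambda>p. exp (\<i> * complex_of_real (x \<bullet> p)) * gauss (\<sigma> *\<^sub>R p)) y = fconst * (\<integral>p. ?h p \<partial>lborel)"
    unfolding ft_def eq ..
  also have "(\<integral>p. ?h p \<partial>lborel) = ((1 / \<sigma>) ^ 3) *\<^sub>R (\<integral>u. ?h ((1 / \<sigma>) *\<^sub>R u) \<partial>lborel)"
    using lborel_integral_affine[OF _ h, of "1 / \<sigma>" 0] \<sigma> by simp
  also have "(\<integral>u. ?h ((1 / \<sigma>) *\<^sub>R u) \<partial>lborel)
      = (\<integral>u. exp (\<i> * complex_of_real (((1 / \<sigma>) *\<^sub>R (x - y)) \<bullet> u)) * gauss u \<partial>lborel)"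
    using \<sigma> by simp
  finally show ?thesis
    using gauss_3d(2)[of "(1 / \<sigma>) *\<^sub>R (x - y)"]
    by (simp add: scaleR_conv_of_real mult.left_commute[of fconst])
qed

text \<open>Convolution with a Gaussian of width \<sigma>, written after rescaling so that the
  weight is independent of \<sigma> and can serve as dominating function when \<sigma> tends to
  0.\<close>

definition mollify :: "real \<Rightarrow> (real^3 \<Rightarrow> complex) \<Rightarrow> real^3 \<Rightarrow> complex" where
  "mollify \<sigma> g x = fconst * (\<integral>u. gauss u * g (x + \<sigma> *\<^sub>R u) \<partial>lborel)"

text \<open>Regularised Fourier inversion: the Gaussian factor makes the inverse integral absolutely
  convergent, and the multiplication formula moves the transform from g onto a modulated
  Gaussian.\<close>

lemma mollify_ft:
  assumes \<sigma>: "\<sigma> > 0" and g: "integrable lborel g"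
  shows "fconst * (\<integral>p. exp (\<i> * complex_of_real (x \<bullet> p)) * (ft g p * gauss (\<sigma> *\<^sub>R p)) \<partial>lborel) = mollify \<sigma> g x"
proof -
  let ?E = "\<lambda>p. exp (\<i> * complex_of_real (x \<bullet> p)) * gauss (\<sigma> *\<^sub>R p)"
  have [measurable]: "g \<in> borel_measurable borel" using g by simp
  have E: "integrable lborel ?E" by (rule integrable_exp_mult(2)[OF gauss_scaled_integrable[OF \<sigma>]])
  let ?k = "\<lambda>y. complex_of_real ((1 / \<sigma>) ^ 3) * gauss ((1 / \<sigma>) *\<^sub>R (x - y))"
  have ik: "integrable lborel (\<lambda>y. g y * ?k y)"
  proof (rule Bochner_Integration.integrable_bound)
    show "integrable lborel (\<lambda>y. complex_of_real ((1 / \<sigma>) ^ 3) * g y)" using g by simp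
    have g1: "cmod (gauss z) \<le> 1" for z by (simp add: gauss_def)
    have "norm (g y * ?k y) \<le> norm (complex_of_real ((1 / \<sigma>) ^ 3) * g y)" for y
    proof -
      have "norm (g y * ?k y) = norm (complex_of_real ((1 / \<sigma>) ^ 3) * g y) * cmod (gauss ((1 / \<sigma>) *\<^sub>R (x - y)))"
        by (simp only: norm_mult mult_ac)
      also have "\<dots> \<le> norm (complex_of_real ((1 / \<sigma>) ^ 3) * g y)" by (intro mult_left_le g1 norm_ge_zero)
      finally show ?thesis .
    qed
    then show "AE y in lborel. norm (g y * ?k y) \<le> norm (complex_of_real ((1 / \<sigma>) ^ 3) * g y)" by simp
  qed measurable
  have "(\<integral>p. exp (\<i> * complex_of_real (x \<bullet> p)) * (ft g p * gauss (\<sigma> *\<^sub>R p)) \<partial>lborel) = (\<integral>p. ft g p * ?E p \<partial>lborel)"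
    by (simp add: mult_ac)
  also have "\<dots> = (\<integral>y. g y * ft ?E y \<partial>lborel)" by (rule ft_mult_formula[OF g E])
  also have "\<dots> = (\<integral>y. g y * ?k y \<partial>lborel)" unfolding ft_modulated_gauss[OF \<sigma>] ..
  also have "\<dots> = (\<bar>\<sigma>\<bar> ^ DIM(real^3)) *\<^sub>R (\<integral>u. g (x + \<sigma> *\<^sub>R u) * ?k (x + \<sigma> *\<^sub>R u) \<partial>lborel)"
    by (rule lborel_integral_affine[OF _ ik]) (use \<sigma> in simp)
  also have "\<dots> = (\<integral>u. (\<sigma> ^ 3) *\<^sub>R (g (x + \<sigma> *\<^sub>R u) * ?k (x + \<sigma> *\<^sub>R u)) \<partial>lborel)"
    using \<sigma> by simp
  also have "\<dots> = (\<integral>u. gauss u * g (x + \<sigma> *\<^sub>R u) \<partial>lborel)"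
  proof (intro Bochner_Integration.integral_cong refl)
    fix u :: "real^3"
    have "gauss ((1 / \<sigma>) *\<^sub>R (x - (x + \<sigma> *\<^sub>R u))) = gauss u" using \<sigma> by (simp add: gauss_def)
    then show "(\<sigma> ^ 3) *\<^sub>R (g (x + \<sigma> *\<^sub>R u) * ?k (x + \<sigma> *\<^sub>R u)) = gauss u * g (x + \<sigma> *\<^sub>R u)"
      using \<sigma> by (simp add: scaleR_conv_of_real power_divide)
  qed
  finally show ?thesis by (simp add: mollify_def)
qed

text \<open>Use the multiplication formula with h, the conjugate of \<open>ft f\<close> damped by a
  Gaussian: its transform is the conjugate of the mollified f. The damping supplies the
  integrability that |ft f|^2 is not yet known to have.\<close>

lemma ft_norm_regularised:
  assumes \<sigma>: "\<sigma> > 0" and f: "integrable lborel f"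
  shows "integrable lborel (\<lambda>p. (cmod (ft f p))\<^sup>2 * cmod (gauss (\<sigma> *\<^sub>R p)))"
    and "complex_of_real (\<integral>p. (cmod (ft f p))\<^sup>2 * cmod (gauss (\<sigma> *\<^sub>R p)) \<partial>lborel) = (\<integral>x. f x * cnj (mollify \<sigma> f x) \<partial>lborel)"
proof -
  define h where "h p = cnj (ft f p) * gauss (\<sigma> *\<^sub>R p)" for p
  define M where "M = cmod fconst * (\<integral>x. cmod (f x) \<partial>lborel)"
  have M: "cmod (ft f p) \<le> M" for p unfolding M_def by (rule ft_bound[OF f])
  have M0: "M \<ge> 0" using M[of 0] norm_ge_zero order_trans by blast
  have [measurable]: "ft f \<in> borel_measurable borel" using f by simp
  have [measurable]: "(\<lambda>p. cnj (ft f p)) \<in> borel_measurable borel"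
    by (intro borel_measurable_continuous_onI continuous_intros continuous_ft f)
  have h: "integrable lborel h"
  proof (rule Bochner_Integration.integrable_bound)
    show "integrable lborel (\<lambda>p. complex_of_real M * gauss (\<sigma> *\<^sub>R p))"
      using gauss_scaled_integrable[OF \<sigma>] by simp
    show "AE p in lborel. norm (h p) \<le> norm (complex_of_real M * gauss (\<sigma> *\<^sub>R p))"
      using M M0 by (auto simp: h_def norm_mult intro!: mult_right_mono)
    show "h \<in> borel_measurable lborel" unfolding h_def[abs_def] by measurable
  qed
  have fth: "ft h x = cnj (mollify \<sigma> f x)" for x
  proof -
    have "exp (- \<i> * complex_of_real (x \<bullet> p)) * h p
        = cnj (exp (\<i> * complex_of_real (x \<bullet> p)) * (ft f p * gauss (\<sigma> *\<^sub>R p)))" for p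
      by (simp add: h_def exp_cnj gauss_real(2))
    then have "ft h x = cnj (fconst * (\<integral>p. exp (\<i> * complex_of_real (x \<bullet> p)) * (ft f p * gauss (\<sigma> *\<^sub>R p)) \<partial>lborel))"
      unfolding ft_def[of h] complex_cnj_mult fconst_pos(2) Bochner_Integration.integral_cnj[symmetric] by simp
    then show ?thesis by (simp add: mollify_ft[OF \<sigma> f])
  qed
  have eq: "ft f p * h p = complex_of_real ((cmod (ft f p))\<^sup>2 * cmod (gauss (\<sigma> *\<^sub>R p)))" for p
    using gauss_real(1)[of "\<sigma> *\<^sub>R p"] by (simp add: h_def complex_norm_square mult.assoc[symmetric] del: of_real_power)
  have "integrable lborel (\<lambda>p. complex_of_real ((cmod (ft f p))\<^sup>2 * cmod (gauss (\<sigma> *\<^sub>R p))))"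
  proof (rule Bochner_Integration.integrable_bound)
    show "integrable lborel (\<lambda>p. complex_of_real M * h p)" using h by simp
    show "AE p in lborel. norm (complex_of_real ((cmod (ft f p))\<^sup>2 * cmod (gauss (\<sigma> *\<^sub>R p)))) \<le> norm (complex_of_real M * h p)"
      using M M0 unfolding eq[symmetric] by (auto simp: norm_mult intro!: mult_right_mono)
  qed measurable
  from integrable_Re[OF this] show "integrable lborel (\<lambda>p. (cmod (ft f p))\<^sup>2 * cmod (gauss (\<sigma> *\<^sub>R p)))" by simp
  have "complex_of_real (\<integral>p. (cmod (ft f p))\<^sup>2 * cmod (gauss (\<sigma> *\<^sub>R p)) \<partial>lborel) = (\<integral>p. ft f p * h p \<partial>lborel)"
    unfolding eq by (rule integral_complex_of_real[symmetric])
  also have "\<dots> = (\<integral>x. f x * ft h x \<partial>lborel)" by (rule ft_mult_formula[OF f h])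
  finally show "complex_of_real (\<integral>p. (cmod (ft f p))\<^sup>2 * cmod (gauss (\<sigma> *\<^sub>R p)) \<partial>lborel)
      = (\<integral>x. f x * cnj (mollify \<sigma> f x) \<partial>lborel)" by (simp add: fth)
qed

text \<open>Boundedness and continuity almost everywhere let mollifications converge boundedly
  almost everywhere. In contrast to continuous functions, the class is stable under multiplication
  by indicators of convex sets.\<close>

definition nice :: "(real^3 \<Rightarrow> complex) \<Rightarrow> bool" where
  "nice f \<longleftrightarrow> integrable lborel f \<and> (\<exists>M. \<forall>x. cmod (f x) \<le> M) \<and> (AE x in lborel. isCont f x)"

lemma nice_square_integrable:
  assumes "nice f" shows "square_integrable f"
proof -
  obtain M where M: "\<And>x. cmod (f x) \<le> M" using assms by (auto simp: nice_def)
  have i: "integrable lborel f" using assms by (simp add: nice_def)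
  show ?thesis unfolding square_integrable_def
  proof
    show "f \<in> borel_measurable lborel" using i by simp
    show "integrable lborel (\<lambda>x. (cmod (f x))\<^sup>2)"
    proof (rule Bochner_Integration.integrable_bound)
      show "integrable lborel (\<lambda>x. M * cmod (f x))" using i by simp
      have "cmod (f x) * cmod (f x) \<le> M * cmod (f x)" for x by (intro mult_right_mono M) simp
      then show "AE x in lborel. norm ((cmod (f x))\<^sup>2) \<le> norm (M * cmod (f x))"
        by (intro always_eventually allI) (metis abs_ge_self norm_ge_zero order_trans power2_eq_square real_norm_def abs_of_nonneg zero_le_power2)
    qed (use i in auto)
  qed
qed

lemma mollify_tendsto:
  assumes M: "\<And>x. cmod (f x) \<le> M" and f [measurable]: "f \<in> borel_measurable borel" and c: "isCont f x"
  shows "(\<lambda>n. mollify (inverse (real (Suc n))) f x) \<longlonglongrightarrow> f x"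
proof -
  have "(\<lambda>n. \<integral>u. gauss u * f (x + inverse (real (Suc n)) *\<^sub>R u) \<partial>lborel) \<longlonglongrightarrow> (\<integral>u. gauss u * f x \<partial>lborel)"
  proof (rule integral_dominated_convergence)
    show "integrable lborel (\<lambda>u. M * cmod (gauss u))" using gauss_integrable by simp
    show "AE u in lborel. (\<lambda>n. gauss u * f (x + inverse (real (Suc n)) *\<^sub>R u)) \<longlonglongrightarrow> gauss u * f x"
    proof (intro always_eventually allI tendsto_mult tendsto_const)
      fix u
      have "(\<lambda>n. x + inverse (real (Suc n)) *\<^sub>R u) \<longlonglongrightarrow> x + 0 *\<^sub>R u"
        by (intro tendsto_intros LIMSEQ_inverse_real_of_nat)
      then have "(\<lambda>n. x + inverse (real (Suc n)) *\<^sub>R u) \<longlonglongrightarrow> x" by simp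
      then show "(\<lambda>n. f (x + inverse (real (Suc n)) *\<^sub>R u)) \<longlonglongrightarrow> f x" by (rule isCont_tendsto_compose[OF c])
    qed
    show "AE u in lborel. norm (gauss u * f (x + inverse (real (Suc n)) *\<^sub>R u)) \<le> M * cmod (gauss u)" for n
      by (intro always_eventually allI cmod_mult_le M)
  qed measurable
  then have "(\<lambda>n. mollify (inverse (real (Suc n))) f x) \<longlonglongrightarrow> fconst * (\<integral>u. gauss u * f x \<partial>lborel)"
    unfolding mollify_def by (intro tendsto_intros)
  also have "fconst * (\<integral>u. gauss u * f x \<partial>lborel) = f x"
    using gauss_integral by (simp add: mult.assoc[symmetric])
  finally show ?thesis .
qed

lemma mollify_bound:
  assumes M: "\<And>x. cmod (f x) \<le> M" and [measurable]: "f \<in> borel_measurable borel"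
  shows "cmod (mollify \<sigma> f x) \<le> M"
proof -
  have i: "integrable lborel (\<lambda>u. M * cmod (gauss u))" using gauss_integrable by simp
  have b: "norm (gauss u * f (x + \<sigma> *\<^sub>R u)) \<le> M * cmod (gauss u)" for u
    by (intro cmod_mult_le M)
  have "cmod (\<integral>u. gauss u * f (x + \<sigma> *\<^sub>R u) \<partial>lborel) \<le> (\<integral>u. M * cmod (gauss u) \<partial>lborel)"
  proof (rule order_trans[OF integral_norm_bound integral_mono])
    show "integrable lborel (\<lambda>u. norm (gauss u * f (x + \<sigma> *\<^sub>R u)))"
      using b by (intro integrable_norm Bochner_Integration.integrable_bound[OF i] always_eventually allI)
        (auto intro: order_trans[OF _ abs_ge_self])
  qed (use b i in auto)
  then have "cmod (mollify \<sigma> f x) \<le> M * (cmod fconst * (\<integral>u. cmod (gauss u) \<partial>lborel))"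
    unfolding mollify_def norm_mult by (subst mult.left_commute) (intro mult_left_mono, auto)
  also have "cmod fconst * (\<integral>u. cmod (gauss u) \<partial>lborel) = 1"
  proof -
    have "complex_of_real (cmod fconst * (\<integral>u. cmod (gauss u) \<partial>lborel)) = fconst * (\<integral>u. gauss u \<partial>lborel)"
      unfolding of_real_mult integral_complex_of_real[symmetric] gauss_real(1)[symmetric]
      by (simp add: fconst_def)
    then show ?thesis unfolding gauss_integral by (metis of_real_eq_1_iff)
  qed
  finally show ?thesis by simp
qed

text \<open>As the width decreases, the position side converges by domination with M |f|, and the
  frequency side increases. Monotone convergence yields integrability of |ft f|^2 together with the
  identity.\<close>

lemma Plancherel_nice:
  assumes "nice f"
  shows "square_integrable (ft f)" "(\<integral>p. (cmod (ft f p))\<^sup>2 \<partial>lborel) = (\<integral>x. (cmod (f x))\<^sup>2 \<partial>lborel)"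
proof -
  have f: "integrable lborel f" and cont: "AE x in lborel. isCont f x" using assms by (auto simp: nice_def)
  obtain M where M: "\<And>x. cmod (f x) \<le> M" using assms by (auto simp: nice_def)
  have fm [measurable]: "f \<in> borel_measurable borel" using f by simp
  define s where "s n = inverse (real (Suc n))" for n
  have s: "s n > 0" for n by (simp add: s_def)
  have "(\<lambda>n. complex_of_real (\<integral>p. (cmod (ft f p))\<^sup>2 * cmod (gauss (s n *\<^sub>R p)) \<partial>lborel)) \<longlonglongrightarrow> (\<integral>x. f x * cnj (f x) \<partial>lborel)"
    unfolding ft_norm_regularised(2)[OF s f]
  proof (rule integral_dominated_convergence)
    show "integrable lborel (\<lambda>x. M * cmod (f x))" using f by simp
    show "AE x in lborel. (\<lambda>n. f x * cnj (mollify (s n) f x)) \<longlonglongrightarrow> f x * cnj (f x)"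
      using cont unfolding s_def by eventually_elim (intro tendsto_intros mollify_tendsto[OF M fm])
    show "AE x in lborel. norm (f x * cnj (mollify (s n) f x)) \<le> M * cmod (f x)" for n
      by (intro always_eventually allI cmod_mult_le) (simp add: mollify_bound[OF M fm])
    have [measurable]: "(\<lambda>x. cnj (g x)) \<in> borel_measurable borel" if "g \<in> borel_measurable borel" for g :: "real^3 \<Rightarrow> complex"
      using borel_measurable_continuous_on[OF _ that, of cnj] by (auto intro: continuous_intros)
    have [measurable]: "mollify \<sigma> f \<in> borel_measurable borel" for \<sigma>
      unfolding mollify_def[abs_def] by measurable
    show "(\<lambda>x. f x * cnj (f x)) \<in> borel_measurable lborel"
      "(\<lambda>x. f x * cnj (mollify (s n) f x)) \<in> borel_measurable lborel" for n by measurable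
  qed
  from tendsto_Re[OF this]
  have lim: "(\<lambda>n. \<integral>p. (cmod (ft f p))\<^sup>2 * cmod (gauss (s n *\<^sub>R p)) \<partial>lborel) \<longlonglongrightarrow> (\<integral>x. (cmod (f x))\<^sup>2 \<partial>lborel)"
    unfolding complex_norm_square[symmetric] integral_complex_of_real Re_complex_of_real .
  have mono: "AE p in lborel. mono (\<lambda>n. (cmod (ft f p))\<^sup>2 * cmod (gauss (s n *\<^sub>R p)))"
  proof (intro always_eventually allI monoI mult_left_mono)
    fix p :: "real^3" and m n :: nat assume "m \<le> n"
    then have "s n \<le> s m" by (simp add: s_def field_simps)
    then have "(s n)\<^sup>2 \<le> (s m)\<^sup>2" using s[of n] by (intro power_mono) auto
    then have "(s n)\<^sup>2 * (norm p)\<^sup>2 \<le> (s m)\<^sup>2 * (norm p)\<^sup>2" by (intro mult_right_mono) auto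
    then show "cmod (gauss (s m *\<^sub>R p)) \<le> cmod (gauss (s n *\<^sub>R p))"
      by (simp add: gauss_def power_mult_distrib)
  qed simp
  have lim1: "AE p in lborel. (\<lambda>n. (cmod (ft f p))\<^sup>2 * cmod (gauss (s n *\<^sub>R p))) \<longlonglongrightarrow> (cmod (ft f p))\<^sup>2"
  proof (intro always_eventually allI)
    fix p
    have "(\<lambda>n. (cmod (ft f p))\<^sup>2 * exp (- ((\<bar>s n\<bar> * norm p)\<^sup>2) / 2)) \<longlonglongrightarrow> (cmod (ft f p))\<^sup>2 * exp (- ((\<bar>0\<bar> * norm p)\<^sup>2) / 2)"
      unfolding s_def by (intro tendsto_intros LIMSEQ_inverse_real_of_nat) auto
    then show "(\<lambda>n. (cmod (ft f p))\<^sup>2 * cmod (gauss (s n *\<^sub>R p))) \<longlonglongrightarrow> (cmod (ft f p))\<^sup>2"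
      by (simp add: gauss_def)
  qed
  have [measurable]: "ft f \<in> borel_measurable borel" using f by simp
  note mc = integrable_monotone_convergence[OF ft_norm_regularised(1)[OF s f] mono lim1 lim]
    integral_monotone_convergence[OF ft_norm_regularised(1)[OF s f] mono lim1 lim]
  show "square_integrable (ft f)" using mc(1) by (simp add: square_integrable_def)
  show "(\<integral>p. (cmod (ft f p))\<^sup>2 \<partial>lborel) = (\<integral>x. (cmod (f x))\<^sup>2 \<partial>lborel)" using mc(2) by simp
qed

section \<open>Density of functions that are continuous almost everywhere\<close>

lemma AE_isCont_indicator:
  fixes S :: "(real^3) set"
  assumes "convex S"
  shows "AE x in lborel. isCont (indicator S :: _ \<Rightarrow> real) x"
proof -
  have "frontier S \<in> null_sets lebesgue"
    using negligible_convex_frontier[OF assms] by (simp add: negligible_iff_null_sets)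
  then have "frontier S \<in> null_sets lborel"
    by (subst (asm) null_sets_completion_iff) (auto intro: borel_closed frontier_closed)
  then have "AE x in lborel. x \<notin> frontier S" by (rule AE_not_in)
  then show ?thesis by eventually_elim (simp add: isCont_indicator)
qed

lemma nice_indicator_mult:
  assumes S: "convex S" "S \<in> sets borel" and f: "nice f"
  shows "nice (\<lambda>x. indicator S x *\<^sub>R f x)"
proof -
  obtain M where M: "\<And>x. cmod (f x) \<le> M" using f by (auto simp: nice_def)
  have "M \<ge> 0" using M[of 0] norm_ge_zero order_trans by blast
  then have "cmod (indicator S x *\<^sub>R f x) \<le> M" for x using M by (auto simp: indicator_def)
  moreover have "AE x in lborel. isCont (\<lambda>x. indicator S x *\<^sub>R f x) x"
    using AE_isCont_indicator[OF S(1)] f unfolding nice_def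
    by (auto elim!: eventually_elim2 intro: isCont_scaleR)
  moreover have "integrable lborel (\<lambda>x. indicator S x *\<^sub>R f x)"
    using f S by (intro integrable_mult_indicator) (auto simp: nice_def)
  ultimately show ?thesis unfolding nice_def by blast
qed

lemma nice_indicator_box: "nice (\<lambda>x. complex_of_real (indicator (box a b) x))"
proof -
  have "AE x in lborel. isCont (\<lambda>x. complex_of_real (indicator (box a b) x)) x"
    using AE_isCont_indicator[of "box a b"] by (auto elim!: eventually_mono intro!: continuous_intros)
  moreover have "integrable lborel (\<lambda>x. complex_of_real (indicator (box a b) x))"
    by (intro integrable_of_real integrable_real_indicator) (auto simp: emeasure_lborel_box_eq)
  moreover have "cmod (complex_of_real (indicator (box a b) x)) \<le> 1" for x by (auto simp: indicator_def)
  ultimately show ?thesis unfolding nice_def by blast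
qed

lemma nice_add: "nice f \<Longrightarrow> nice g \<Longrightarrow> nice (\<lambda>x. f x + g x)"
proof -
  assume f: "nice f" and g: "nice g"
  obtain M N where "\<And>x. cmod (f x) \<le> M" "\<And>x. cmod (g x) \<le> N" using f g by (auto simp: nice_def)
  then have "cmod (f x + g x) \<le> M + N" for x by (intro norm_triangle_le add_mono)
  moreover have "AE x in lborel. isCont (\<lambda>x. f x + g x) x"
    using f g unfolding nice_def by (auto elim!: eventually_elim2 intro: continuous_intros)
  ultimately show ?thesis using f g unfolding nice_def by (auto intro: Bochner_Integration.integrable_add)
qed

lemma nice_cmult: "nice f \<Longrightarrow> nice (\<lambda>x. c * f x)"
proof -
  assume f: "nice f"
  obtain M where M: "\<And>x. cmod (f x) \<le> M" using f by (auto simp: nice_def)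
  have "cmod (c * f x) \<le> cmod c * M" for x unfolding norm_mult by (intro mult_left_mono M) simp
  moreover have "AE x in lborel. isCont (\<lambda>x. c * f x) x"
    using f unfolding nice_def by (auto elim!: eventually_mono intro: continuous_intros)
  ultimately show ?thesis using f unfolding nice_def by auto
qed

lemma nice_diff: "nice f \<Longrightarrow> nice g \<Longrightarrow> nice (\<lambda>x. f x - g x)"
  using nice_add[OF _ nice_cmult, of f g "-1"] by simp

text \<open>Boxes are stable under intersection and generate the Borel sets, so the vanishing
  spreads to all Borel sets; \<open>tot\<close> handles complements. Vanishing set integrals then
  determine the real and imaginary parts.\<close>

lemma AE_zero_if_box_integrals_zero:
  fixes v :: "real^3 \<Rightarrow> complex"
  assumes v: "integrable lborel v" and box: "\<And>a b. (LINT x:box a b|lborel. v x) = 0"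
    and tot: "(\<integral>x. v x \<partial>lborel) = 0"
  shows "AE x in lborel. v x = 0"
proof -
  have zero: "(LINT x:A|lborel. v x) = 0" if A: "A \<in> sets borel" for A
  proof -
    have "Int_stable (range (\<lambda>(a, b). box a b :: (real^3) set))"
      by (auto simp: Int_stable_def box_Int_box)
    moreover have "(range (\<lambda>(a, b). box a b :: (real^3) set)) \<subseteq> Pow UNIV" by auto
    moreover have "A \<in> sigma_sets UNIV (range (\<lambda>(a, b). box a b))"
      using A unfolding borel_eq_box by simp
    ultimately show ?thesis
    proof (induction rule: sigma_sets_induct_disjoint)
      case (basic A) then show ?case using box by auto
    next
      case empty then show ?case by (simp add: set_lebesgue_integral_def)
    next
      case (compl A)
      then have m [measurable]: "A \<in> sets borel" by (simp add: borel_eq_box)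
      have "(LINT x:UNIV - A|lborel. v x) = (\<integral>x. v x - indicator A x *\<^sub>R v x \<partial>lborel)"
        unfolding set_lebesgue_integral_def
        by (intro Bochner_Integration.integral_cong) (auto simp: indicator_def)
      also have "\<dots> = (\<integral>x. v x \<partial>lborel) - (LINT x:A|lborel. v x)"
        unfolding set_lebesgue_integral_def
        by (intro Bochner_Integration.integral_diff v integrable_mult_indicator) auto
      finally show ?case using compl tot by simp
    next
      case (union F)
      then have m [measurable]: "\<And>i. F i \<in> sets borel" by (simp add: borel_eq_box subset_eq)
      have "(LINT x:(\<Union>i. F i)|lborel. v x) = (\<Sum>i. (LINT x:(F i)|lborel. v x))"
      proof (rule lebesgue_integral_countable_add)
        show "set_integrable lborel (\<Union>i. F i) v"
          unfolding set_integrable_def by (intro integrable_mult_indicator v) auto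
      qed (use union in \<open>auto simp: disjoint_family_on_def\<close>)
      then show ?case using union by simp
    qed
  qed
  have "AE x in lborel. Re (v x) = 0"
  proof (rule density_unique_real)
    fix A :: "(real^3) set" assume "A \<in> sets lborel"
    then have "(\<integral>x. indicator A x *\<^sub>R v x \<partial>lborel) = 0" "integrable lborel (\<lambda>x. indicator A x *\<^sub>R v x)"
      using zero[of A] v by (auto simp: set_lebesgue_integral_def intro: integrable_mult_indicator)
    then have "(\<integral>x. Re (indicator A x *\<^sub>R v x) \<partial>lborel) = 0" by (subst integral_Re) auto
    then show "(\<integral>x\<in>A. Re (v x) \<partial>lborel) = (\<integral>x\<in>A. 0 \<partial>lborel)" by (simp add: set_lebesgue_integral_def)
  qed (use v in auto)
  moreover have "AE x in lborel. Im (v x) = 0"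
  proof (rule density_unique_real)
    fix A :: "(real^3) set" assume "A \<in> sets lborel"
    then have "(\<integral>x. indicator A x *\<^sub>R v x \<partial>lborel) = 0" "integrable lborel (\<lambda>x. indicator A x *\<^sub>R v x)"
      using zero[of A] v by (auto simp: set_lebesgue_integral_def intro: integrable_mult_indicator)
    then have "(\<integral>x. Im (indicator A x *\<^sub>R v x) \<partial>lborel) = 0" by (subst integral_Im) auto
    then show "(\<integral>x\<in>A. Im (v x) \<partial>lborel) = (\<integral>x\<in>A. 0 \<partial>lborel)" by (simp add: set_lebesgue_integral_def)
  qed (use v in auto)
  ultimately show ?thesis by eventually_elim (simp add: complex_eq_iff)
qed

text \<open>A vector orthogonal to all nice functions has zero integral over every box. Restricting
  it to one box at a time makes it integrable, and integrals of the restriction over boxes are again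
  integrals over boxes.\<close>

lemma nice_dense: "closure (to_L2 ` Collect nice) = UNIV"
proof (rule orthogonal_dense)
  show "csubspace (to_L2 ` Collect nice)"
    unfolding csubspace_def
  proof (intro conjI ballI allI)
    have "nice (\<lambda>x. 0)" by (auto simp: nice_def)
    moreover have "to_L2 (\<lambda>x. 0) = 0" by (rule to_L2_eqI) (simp_all add: L2_fun_0)
    ultimately show "0 \<in> to_L2 ` Collect nice" by (metis image_eqI mem_Collect_eq)
    fix u assume "u \<in> to_L2 ` Collect nice"
    then obtain f where f: "nice f" "u = to_L2 f" by auto
    have "c *\<^sub>C u = to_L2 (\<lambda>x. c * f x)" for c
      unfolding f(2) by (rule to_L2_scaleC[symmetric, OF nice_square_integrable[OF f(1)]])
    then show "c *\<^sub>C u \<in> to_L2 ` Collect nice" for c using nice_cmult[OF f(1)] by auto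
    fix v assume "v \<in> to_L2 ` Collect nice"
    then obtain g where g: "nice g" "v = to_L2 g" by auto
    have "u + v = to_L2 (\<lambda>x. f x + g x)"
      unfolding f(2) g(2) by (rule to_L2_add[symmetric, OF nice_square_integrable[OF f(1)] nice_square_integrable[OF g(1)]])
    then show "u + v \<in> to_L2 ` Collect nice" using nice_add[OF f(1) g(1)] by auto
  qed
  fix u assume u: "\<And>v. v \<in> to_L2 ` Collect nice \<Longrightarrow> cinner u v = 0"
  define h where "h x = cnj (L2_fun u x)" for x
  have [measurable]: "h \<in> borel_measurable borel"
    using borel_measurable_continuous_on[OF _ L2_fun_measurable[of u], of cnj]
    unfolding h_def[abs_def] by (auto intro: continuous_intros)
  have ind: "square_integrable (\<lambda>x. complex_of_real (indicator (box a b) x))" for a b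
    by (rule nice_square_integrable[OF nice_indicator_box])
  have int: "integrable lborel (\<lambda>x. indicator (box a b) x *\<^sub>R h x)" for a b
    using square_integrable_mult_integrable[OF square_integrable_L2_fun[of u] ind[of a b]]
    by (simp add: h_def scaleR_conv_of_real mult.commute)
  have zero: "(\<integral>x. indicator (box a b) x *\<^sub>R h x \<partial>lborel) = 0" for a b
  proof -
    have "cinner u (to_L2 (\<lambda>x. complex_of_real (indicator (box a b) x))) = 0"
      using u nice_indicator_box by blast
    then have "(\<integral>x. cnj (L2_fun u x) * complex_of_real (indicator (box a b) x) \<partial>lborel) = 0"
      using cinner_to_L2[OF square_integrable_L2_fun[of u] ind[of a b]] by simp
    then show ?thesis by (simp add: h_def scaleR_conv_of_real mult.commute)
  qed
  have "AE x in lborel. indicator (box c d) x *\<^sub>R h x = 0" for c d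
  proof (rule AE_zero_if_box_integrals_zero[OF int _ zero])
    fix a b
    have "box a b \<inter> box c d \<in> range (\<lambda>(a, b). box a b)" by (auto simp: box_Int_box)
    then obtain a' b' where ab: "box a b \<inter> box c d = box a' b'" by auto
    have "(LINT x:box a b|lborel. indicator (box c d) x *\<^sub>R h x) = (\<integral>x. indicator (box a' b') x *\<^sub>R h x \<partial>lborel)"
      unfolding set_lebesgue_integral_def ab[symmetric] by (simp add: indicator_inter_arith)
    then show "(LINT x:box a b|lborel. indicator (box c d) x *\<^sub>R h x) = 0" by (simp add: zero)
  qed
  then have "AE x in lborel. \<forall>n::nat. indicator (box (- (\<Sum>i\<in>Basis. real n *\<^sub>R i)) (\<Sum>i\<in>Basis. real n *\<^sub>R i)) x *\<^sub>R h x = 0"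
    by (subst AE_all_countable) auto
  then have "AE x in lborel. L2_fun u x = L2_fun 0 x"
    using L2_fun_0
  proof eventually_elim
    case (elim x)
    obtain n :: nat where n: "norm x < real n" using reals_Archimedean2 by blast
    have "x \<in> box (- (\<Sum>i\<in>Basis. real n *\<^sub>R i)) (\<Sum>i\<in>Basis. real n *\<^sub>R i)"
    proof (unfold mem_box, intro ballI)
      fix b :: "real^3" assume b: "b \<in> Basis"
      have "\<bar>x \<bullet> b\<bar> < real n" using Basis_le_norm[OF b, of x] n by linarith
      then show "- (\<Sum>i\<in>Basis. real n *\<^sub>R i) \<bullet> b < x \<bullet> b \<and> x \<bullet> b < (\<Sum>i\<in>Basis. real n *\<^sub>R i) \<bullet> b"
        using b by (simp add: inner_sum_left inner_Basis if_distrib abs_less_iff cong: if_cong)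
    qed
    then have "h x = 0" using elim(1) by (metis indicator_simps(1) scaleR_one)
    then show ?case using elim(2) by (simp add: h_def)
  qed
  then show "u = 0" by (rule L2_eqI)
qed

section \<open>The Plancherel theorem\<close>

definition ball_cut :: "nat \<Rightarrow> (real^3 \<Rightarrow> complex) \<Rightarrow> real^3 \<Rightarrow> complex" where
  "ball_cut n f x = indicator (cball 0 (real n)) x *\<^sub>R f x"

lemma fourier_ball_eq: "fourier_ball n f = ft (ball_cut n f)"
  unfolding fourier_ball_def ft_def ball_cut_def fconst_def
  by (simp add: fun_eq_iff mult_ac scaleR_conv_of_real)

lemma ball_cut_measurable [measurable]: "f \<in> borel_measurable borel \<Longrightarrow> ball_cut n f \<in> borel_measurable borel"
  unfolding ball_cut_def[abs_def] by (intro borel_measurable_scaleR borel_measurable_indicator) auto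

lemma ball_cut_le: "cmod (ball_cut n f x) \<le> cmod (f x)"
  by (auto simp: ball_cut_def indicator_def)

lemma ball_cut_square_integrable: "square_integrable f \<Longrightarrow> square_integrable (ball_cut n f)"
  by (rule square_integrable_bound[where C=1]) (auto simp: ball_cut_le dest: square_integrable_measurable)

lemma ball_square_integrable: "square_integrable (\<lambda>x. complex_of_real (indicator (cball 0 r) x))"
proof -
  have eq: "(cmod (complex_of_real (indicator (cball 0 r) x)))\<^sup>2 = indicator (cball 0 r) x" for x :: "real^3"
    by (auto simp: indicator_def)
  have "emeasure lborel (cball 0 r :: (real^3) set) < \<infinity>"
    by (rule emeasure_bounded_finite) simp
  then have i: "integrable lborel (indicator (cball 0 r) :: real^3 \<Rightarrow> real)"
    by (intro integrable_real_indicator) auto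
  from integrable_of_real[OF this, where 'a=complex] i show ?thesis
    unfolding square_integrable_def eq by (auto dest: borel_measurable_integrable)
qed

lemma square_integrable_norm: "square_integrable f \<Longrightarrow> square_integrable (\<lambda>x. complex_of_real (cmod (f x)))"
  by (rule square_integrable_bound[where C=1]) (auto dest: square_integrable_measurable)

lemma ball_cut_integrable:
  assumes f: "square_integrable f"
  shows "integrable lborel (ball_cut n f)"
    and "(\<integral>x. cmod (ball_cut n f x) \<partial>lborel)
      \<le> norm (to_L2 (\<lambda>x. complex_of_real (indicator (cball 0 (real n)) x))) * norm (to_L2 f)"
proof -
  have eq: "cnj (complex_of_real (indicator (cball 0 (real n)) x)) * f x = ball_cut n f x" for x
    by (simp add: ball_cut_def scaleR_conv_of_real)
  show "integrable lborel (ball_cut n f)"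
    using square_integrable_mult_integrable[OF ball_square_integrable[of "real n"] f] unfolding eq .
  let ?g = "\<lambda>x. complex_of_real (cmod (f x))"
  have eq2: "cnj (complex_of_real (indicator (cball 0 (real n)) x)) * ?g x = complex_of_real (cmod (ball_cut n f x))" for x
    by (simp add: ball_cut_def)
  have "(\<integral>x. complex_of_real (cmod (ball_cut n f x)) \<partial>lborel)
      = cinner (to_L2 (\<lambda>x. complex_of_real (indicator (cball 0 (real n)) x))) (to_L2 ?g)"
    unfolding cinner_to_L2[OF ball_square_integrable square_integrable_norm[OF f]] eq2 ..
  then have "cmod (\<integral>x. complex_of_real (cmod (ball_cut n f x)) \<partial>lborel)
      \<le> norm (to_L2 (\<lambda>x. complex_of_real (indicator (cball 0 (real n)) x))) * norm (to_L2 ?g)"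
    by (simp add: cinner_Cauchy_Schwarz)
  moreover have "norm (to_L2 ?g) = norm (to_L2 f)"
    by (rule power2_eq_imp_eq) (simp_all add: norm_to_L2 square_integrable_norm f)
  ultimately show "(\<integral>x. cmod (ball_cut n f x) \<partial>lborel)
      \<le> norm (to_L2 (\<lambda>x. complex_of_real (indicator (cball 0 (real n)) x))) * norm (to_L2 f)"
    unfolding integral_complex_of_real by simp
qed

lemma norm_to_L2_eqI:
  "square_integrable f \<Longrightarrow> square_integrable g \<Longrightarrow> (\<integral>x. (cmod (f x))\<^sup>2 \<partial>lborel) = (\<integral>x. (cmod (g x))\<^sup>2 \<partial>lborel)
    \<Longrightarrow> norm (to_L2 f) = norm (to_L2 g)"
  by (rule power2_eq_imp_eq) (simp_all add: norm_to_L2)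

lemma norm_to_L2_mono:
  assumes "square_integrable f" "square_integrable g" "\<And>x. cmod (f x) \<le> cmod (g x)"
  shows "norm (to_L2 f) \<le> norm (to_L2 g)"
proof -
  have "(norm (to_L2 f))\<^sup>2 \<le> (norm (to_L2 g))\<^sup>2"
    unfolding norm_to_L2[OF assms(1)] norm_to_L2[OF assms(2)]
    using assms by (intro integral_mono power_mono) (auto simp: square_integrable_def)
  then show ?thesis by (rule power2_le_imp_le) simp
qed

text \<open>Approximants from the dense class are cut to the same ball, where L^2 convergence
  implies L^1 convergence and hence pointwise convergence of the transforms. Plancherel for the
  approximants makes these transforms Cauchy, and the pointwise limit identifies their L^2
  limit.\<close>

lemma Plancherel_ball_cut:
  assumes f: "square_integrable f"
  shows "square_integrable (ft (ball_cut n f))" "norm (to_L2 (ft (ball_cut n f))) = norm (to_L2 (ball_cut n f))"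
proof -
  define h where "h = ball_cut n f"
  have h: "square_integrable h" unfolding h_def by (rule ball_cut_square_integrable[OF f])
  have hi: "integrable lborel h" unfolding h_def by (rule ball_cut_integrable[OF f])
  have "to_L2 h \<in> closure (to_L2 ` Collect nice)" by (simp add: nice_dense)
  then obtain X where X: "\<And>k. X k \<in> to_L2 ` Collect nice" "X \<longlonglongrightarrow> to_L2 h" by (auto simp: closure_sequential)
  then have "\<forall>k. \<exists>f. nice f \<and> X k = to_L2 f" by auto
  then obtain f' where f': "\<And>k. nice (f' k)" "\<And>k. X k = to_L2 (f' k)" by metis
  define g where "g k = ball_cut n (f' k)" for k
  have g: "nice (g k)" for k
    unfolding g_def ball_cut_def[abs_def] by (intro nice_indicator_mult f') auto
  have gi: "integrable lborel (g k)" for k using g[of k] by (simp add: nice_def)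
  have gs: "square_integrable (g k)" and f's: "square_integrable (f' k)" for k
    using nice_square_integrable g f'(1) by auto
  have dd: "ball_cut n (\<lambda>x. f' k x - h x) x = g k x - h x" for k x
    by (simp add: g_def h_def ball_cut_def indicator_def)
  have ds: "square_integrable (\<lambda>x. f' k x - h x)" for k by (rule square_integrable_diff[OF f's h])
  have Xh: "(\<lambda>k. norm (X k - to_L2 h)) \<longlonglongrightarrow> 0"
    by (rule tendsto_norm_zero[OF LIM_zero[OF X(2)]])
  have Xd: "X k - to_L2 h = to_L2 (\<lambda>x. f' k x - h x)" for k
    unfolding f'(2) by (rule to_L2_diff[symmetric, OF f's h])
  have gh: "(\<lambda>k. to_L2 (g k)) \<longlonglongrightarrow> to_L2 h"
  proof -
    have "cmod (g k x - h x) \<le> cmod (f' k x - h x)" for k x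
      using ball_cut_le[of n "\<lambda>x. f' k x - h x" x] unfolding dd .
    then have "norm (to_L2 (g k) - to_L2 h) \<le> norm (X k - to_L2 h)" for k
      unfolding Xd to_L2_diff[symmetric, OF gs h]
      by (rule norm_to_L2_mono[OF square_integrable_diff[OF gs h] ds])
    then have "(\<lambda>k. to_L2 (g k) - to_L2 h) \<longlonglongrightarrow> 0"
      by (intro Lim_null_comparison[OF _ Xh]) auto
    then show ?thesis by (simp add: LIM_zero_iff)
  qed
  have ptw: "(\<lambda>k. ft (g k) p) \<longlonglongrightarrow> ft h p" for p
  proof -
    define c where "c = cmod fconst * norm (to_L2 (\<lambda>x. complex_of_real (indicator (cball 0 (real n)) x)))"
    have "norm (ft (g k) p - ft h p) \<le> c * norm (X k - to_L2 h)" for k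
    proof -
      have "norm (ft (g k) p - ft h p) \<le> cmod fconst * (\<integral>x. cmod (g k x - h x) \<partial>lborel)"
        unfolding ft_diff[symmetric, OF gi hi] by (rule ft_bound) (intro Bochner_Integration.integrable_diff gi hi)
      also have "\<dots> \<le> c * norm (X k - to_L2 h)"
        unfolding c_def Xd mult.assoc using ball_cut_integrable(2)[OF ds[of k], of n]
        by (intro mult_left_mono) (simp_all add: dd)
      finally show ?thesis .
    qed
    moreover have "(\<lambda>k. c * norm (X k - to_L2 h)) \<longlonglongrightarrow> 0" using tendsto_mult_left[OF Xh, of c] by simp
    ultimately have "(\<lambda>k. ft (g k) p - ft h p) \<longlonglongrightarrow> 0"
      by (rule Lim_null_comparison[OF always_eventually[OF allI]])
    then show ?thesis by (simp add: LIM_zero_iff)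
  qed
  define Y where "Y k = to_L2 (ft (g k))" for k
  have fgs: "square_integrable (ft (g k))" for k by (rule Plancherel_nice[OF g])
  have Ynorm: "norm (Y k) = norm (to_L2 (g k))" for k
    unfolding Y_def by (rule norm_to_L2_eqI[OF fgs gs]) (rule Plancherel_nice[OF g])
  have Yd: "norm (Y k - Y l) = norm (to_L2 (g k) - to_L2 (g l))" for k l
  proof -
    have n: "nice (\<lambda>x. g k x - g l x)" by (rule nice_diff[OF g g])
    have "Y k - Y l = to_L2 (ft (\<lambda>x. g k x - g l x))"
      unfolding Y_def to_L2_diff[symmetric, OF fgs fgs] ft_diff[OF gi gi, abs_def] ..
    moreover have "norm (to_L2 (ft (\<lambda>x. g k x - g l x))) = norm (to_L2 (\<lambda>x. g k x - g l x))"
      by (rule norm_to_L2_eqI[OF Plancherel_nice(1)[OF n] nice_square_integrable[OF n] Plancherel_nice(2)[OF n]])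
    ultimately show ?thesis unfolding to_L2_diff[OF gs gs] by simp
  qed
  have "Cauchy Y"
    using LIMSEQ_imp_Cauchy[OF gh] unfolding Cauchy_def dist_norm Yd .
  moreover have "AE p in lborel. (\<lambda>k. L2_fun (Y k) p) \<longlonglongrightarrow> ft h p"
  proof -
    have "AE p in lborel. \<forall>k. L2_fun (Y k) p = ft (g k) p"
      unfolding Y_def by (subst AE_all_countable) (auto intro: L2_fun_to_L2 fgs)
    then show ?thesis by eventually_elim (simp add: ptw)
  qed
  moreover have "ft h \<in> borel_measurable borel" using hi by simp
  ultimately have *: "square_integrable (ft h)" "Y \<longlonglongrightarrow> to_L2 (ft h)"
    using Cauchy_L2_AE_limit by blast+
  show "square_integrable (ft (ball_cut n f))" using *(1) by (simp add: h_def)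
  have "(\<lambda>k. norm (Y k)) \<longlonglongrightarrow> norm (to_L2 (ft h))" by (intro tendsto_intros *)
  moreover have "(\<lambda>k. norm (Y k)) \<longlonglongrightarrow> norm (to_L2 h)" unfolding Ynorm by (intro tendsto_intros gh)
  ultimately show "norm (to_L2 (ft (ball_cut n f))) = norm (to_L2 (ball_cut n f))"
    unfolding h_def using LIMSEQ_unique by blast
qed

lemma ball_cut_eventually: "\<forall>\<^sub>F n in sequentially. ball_cut n f x = f x"
proof -
  obtain N :: nat where N: "norm x \<le> real N" using real_arch_simple by blast
  have "ball_cut n f x = f x" if "n \<ge> N" for n
    using N that by (auto simp: ball_cut_def indicator_def)
  then show ?thesis by (auto simp: eventually_sequentially)
qed

lemma ball_cut_tendsto:
  assumes f: "square_integrable f"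
  shows "(\<lambda>n. to_L2 (ball_cut n f)) \<longlonglongrightarrow> to_L2 f"
proof -
  have fm [measurable]: "f \<in> borel_measurable borel" using f by (rule square_integrable_measurable)
  have "(\<lambda>n. \<integral>x. (cmod (ball_cut n f x - f x))\<^sup>2 \<partial>lborel) \<longlonglongrightarrow> (\<integral>x. 0 \<partial>(lborel :: (real^3) measure))"
  proof (rule integral_dominated_convergence)
    show "integrable lborel (\<lambda>x. (cmod (f x))\<^sup>2)" using f by (simp add: square_integrable_def)
    show "AE x in lborel. (\<lambda>n. (cmod (ball_cut n f x - f x))\<^sup>2) \<longlonglongrightarrow> 0"
    proof (intro always_eventually allI)
      fix x
      show "(\<lambda>n. (cmod (ball_cut n f x - f x))\<^sup>2) \<longlonglongrightarrow> 0"
        by (rule tendsto_eventually) (use ball_cut_eventually[of f x] in eventually_elim, simp)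
    qed
    show "AE x in lborel. norm ((cmod (ball_cut n f x - f x))\<^sup>2) \<le> (cmod (f x))\<^sup>2" for n
      by (auto simp: ball_cut_def indicator_def)
  qed measurable
  moreover have "(\<integral>x. (cmod (ball_cut n f x - f x))\<^sup>2 \<partial>lborel) = (norm (to_L2 (ball_cut n f) - to_L2 f))\<^sup>2" for n
    unfolding to_L2_diff[symmetric, OF ball_cut_square_integrable[OF f] f]
    by (rule norm_to_L2[symmetric, OF square_integrable_diff[OF ball_cut_square_integrable[OF f] f]])
  ultimately have "(\<lambda>n. (norm (to_L2 (ball_cut n f) - to_L2 f))\<^sup>2) \<longlonglongrightarrow> 0" by simp
  then have "(\<lambda>n. sqrt ((norm (to_L2 (ball_cut n f) - to_L2 f))\<^sup>2)) \<longlonglongrightarrow> sqrt 0" by (intro tendsto_intros)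
  then show ?thesis by (simp add: tendsto_norm_zero_iff LIM_zero_iff)
qed

lemma ball_cut_add: "ball_cut n (\<lambda>x. f x + g x) = (\<lambda>x. ball_cut n f x + ball_cut n g x)"
  and ball_cut_cmult: "ball_cut n (\<lambda>x. c * f x) = (\<lambda>x. c * ball_cut n f x)"
  by (auto simp: ball_cut_def fun_eq_iff algebra_simps scaleR_conv_of_real)

text \<open>The terms of the sequence whose limit defines \<open>fourier\<close>, expressed through
  \<open>ft\<close> of a truncated function.\<close>

definition fball :: "nat \<Rightarrow> L2 \<Rightarrow> L2" where
  "fball n u = to_L2 (ft (ball_cut n (L2_fun u)))"

lemma fball_AE:
  assumes "AE x in lborel. L2_fun u x = f x" "f \<in> borel_measurable borel"
  shows "fball n u = to_L2 (ft (ball_cut n f))"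
proof -
  have "ft (ball_cut n (L2_fun u)) = ft (ball_cut n f)"
    by (intro ext ft_cong_AE) (use assms in \<open>auto simp: ball_cut_def elim: eventually_mono\<close>)
  then show ?thesis by (simp add: fball_def)
qed

lemma fball_add: "fball n (u + v) = fball n u + fball n v"
proof -
  have "fball n (u + v) = to_L2 (ft (ball_cut n (\<lambda>x. L2_fun u x + L2_fun v x)))"
    by (rule fball_AE[OF L2_fun_add]) measurable
  moreover have "ft (\<lambda>x. ball_cut n (L2_fun u) x + ball_cut n (L2_fun v) x)
      = (\<lambda>p. ft (ball_cut n (L2_fun u)) p + ft (ball_cut n (L2_fun v)) p)"
    by (intro ext ft_add ball_cut_integrable square_integrable_L2_fun)
  ultimately show ?thesis
    unfolding ball_cut_add fball_def
    by (simp add: to_L2_add square_integrable_L2_fun Plancherel_ball_cut)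
qed

lemma fball_scaleC: "fball n (c *\<^sub>C u) = c *\<^sub>C fball n u"
proof -
  have "fball n (c *\<^sub>C u) = to_L2 (ft (ball_cut n (\<lambda>x. c * L2_fun u x)))"
    by (rule fball_AE[OF L2_fun_scaleC]) measurable
  then show ?thesis
    unfolding ball_cut_cmult fball_def
    by (simp add: ft_cmult[abs_def] to_L2_scaleC square_integrable_L2_fun Plancherel_ball_cut)
qed

lemma fball_convergent: "(\<lambda>n. fball n u) \<longlonglongrightarrow> fourier u"
proof -
  have eq: "fball n u = to_L2 (fourier_ball n (L2_fun u))" for n by (simp add: fball_def fourier_ball_eq)
  let ?f = "L2_fun u"
  note f = square_integrable_L2_fun[of u]
  have i: "integrable lborel (ball_cut n ?f)" for n by (rule ball_cut_integrable[OF f])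
  have d: "norm (fball n u - fball m u) \<le> norm (to_L2 (ball_cut n ?f) - to_L2 (ball_cut m ?f))" for n m
  proof -
    \<comment> \<open>The difference of two truncations is itself unchanged by truncation to the
      larger ball, so the isometry for truncated functions applies to it.\<close>
    define k where "k = max n m"
    have cut: "(\<lambda>x. ball_cut n ?f x - ball_cut m ?f x) = ball_cut k (\<lambda>x. ball_cut n ?f x - ball_cut m ?f x)"
      by (auto simp: ball_cut_def indicator_def k_def fun_eq_iff)
    have s: "square_integrable (\<lambda>x. ball_cut n ?f x - ball_cut m ?f x)"
      by (intro square_integrable_diff ball_cut_square_integrable f)
    have "fball n u - fball m u = to_L2 (ft (\<lambda>x. ball_cut n ?f x - ball_cut m ?f x))"
      unfolding fball_def ft_diff[OF i i, abs_def]
      by (rule to_L2_diff[symmetric]) (rule Plancherel_ball_cut[OF f])+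
    then have "norm (fball n u - fball m u) = norm (to_L2 (\<lambda>x. ball_cut n ?f x - ball_cut m ?f x))"
      using Plancherel_ball_cut(2)[OF s, of k] cut by simp
    then show ?thesis by (simp add: to_L2_diff ball_cut_square_integrable f)
  qed
  have "Cauchy (\<lambda>n. fball n u)"
    using LIMSEQ_imp_Cauchy[OF ball_cut_tendsto[OF f]] unfolding Cauchy_def dist_norm
    by (meson d le_less_trans)
  then have "(\<lambda>n. fball n u) \<longlonglongrightarrow> lim (\<lambda>n. fball n u)"
    by (simp add: Cauchy_convergent_iff convergent_LIMSEQ_iff)
  then show "(\<lambda>n. fball n u) \<longlonglongrightarrow> fourier u" unfolding fourier_def eq .
qed

lemma norm_fourier [simp]: "norm (fourier u) = norm u"
proof -
  have "(\<lambda>n. norm (fball n u)) \<longlonglongrightarrow> norm (fourier u)" by (intro tendsto_intros fball_convergent)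
  moreover have "(\<lambda>n. norm (fball n u)) \<longlonglongrightarrow> norm u"
    using tendsto_norm[OF ball_cut_tendsto[OF square_integrable_L2_fun[of u]]]
    by (simp add: fball_def Plancherel_ball_cut(2) square_integrable_L2_fun)
  ultimately show ?thesis using LIMSEQ_unique by blast
qed

lemma fourier_add: "fourier (u + v) = fourier u + fourier v"
  using tendsto_add[OF fball_convergent[of u] fball_convergent[of v]] fball_convergent[of "u + v"]
  unfolding fball_add using LIMSEQ_unique by blast

lemma fourier_scaleC: "fourier (c *\<^sub>C u) = c *\<^sub>C fourier u"
  using tendsto_scaleC[OF tendsto_const[of c] fball_convergent[of u]] fball_convergent[of "c *\<^sub>C u"]
  unfolding fball_scaleC using LIMSEQ_unique by blast

lemma fourier_diff: "fourier (u - v) = fourier u - fourier v"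
  using fourier_add[of u "(-1) *\<^sub>C v"] fourier_scaleC[of "-1" v] by (simp add: scaleC_minus1)

text \<open>The transforms of the truncations converge to \<open>fourier\<close> in norm and to
  \<open>ft f\<close> pointwise, so the two limits coincide.\<close>

lemma fourier_to_L2:
  assumes f: "square_integrable f" and i: "integrable lborel f"
  shows "square_integrable (ft f)" "fourier (to_L2 f) = to_L2 (ft f)"
proof -
  have fm [measurable]: "f \<in> borel_measurable borel" using i by simp
  have eq: "fball n (to_L2 f) = to_L2 (ft (ball_cut n f))" for n
    by (rule fball_AE[OF L2_fun_to_L2[OF f] fm])
  have lim: "(\<lambda>n. ft (ball_cut n f) p) \<longlonglongrightarrow> ft f p" for p
  proof (rule tendsto_ft[where w="\<lambda>x. cmod (f x)"])
    show "AE x in lborel. (\<lambda>n. ball_cut n f x) \<longlonglongrightarrow> f x"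
      by (intro always_eventually allI tendsto_eventually ball_cut_eventually)
  qed (use i ball_cut_le in auto)
  have "AE p in lborel. \<forall>n. L2_fun (fball n (to_L2 f)) p = ft (ball_cut n f) p"
    unfolding eq by (subst AE_all_countable) (auto intro: L2_fun_to_L2 Plancherel_ball_cut f)
  then have "AE p in lborel. (\<lambda>n. L2_fun (fball n (to_L2 f)) p) \<longlonglongrightarrow> ft f p"
    by eventually_elim (simp add: lim)
  from L2_limit_AE_limit[OF fball_convergent this] i
  show "square_integrable (ft f)" "fourier (to_L2 f) = to_L2 (ft f)" by auto
qed

text \<open>Pointwise conjugation. Conjugating the transform by it gives the inverse transform, so
  one integral kernel suffices.\<close>

definition cnj_L2 :: "L2 \<Rightarrow> L2" where "cnj_L2 u = to_L2 (\<lambda>x. cnj (L2_fun u x))"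

lemma measurable_cnj [measurable]: "f \<in> borel_measurable M \<Longrightarrow> (\<lambda>x. cnj (f x)) \<in> borel_measurable M"
  using borel_measurable_continuous_on[of cnj f M] by (auto intro: continuous_intros)

lemma square_integrable_cnj: "square_integrable f \<Longrightarrow> square_integrable (\<lambda>x. cnj (f x))"
  by (auto simp: square_integrable_def)

lemma L2_fun_cnj: "AE x in lborel. L2_fun (cnj_L2 u) x = cnj (L2_fun u x)"
  unfolding cnj_L2_def by (rule L2_fun_to_L2[OF square_integrable_cnj[OF square_integrable_L2_fun]])

lemma cnj_to_L2: "square_integrable f \<Longrightarrow> cnj_L2 (to_L2 f) = to_L2 (\<lambda>x. cnj (f x))"
proof -
  assume f: "square_integrable f"
  have "AE x in lborel. L2_fun (cnj_L2 (to_L2 f)) x = cnj (f x)"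
    using L2_fun_cnj[of "to_L2 f"] L2_fun_to_L2[OF f] by eventually_elim simp
  then show ?thesis by (intro to_L2_eqI[symmetric]) (use f in \<open>auto dest: square_integrable_measurable\<close>)
qed

lemma cnj_cnj_L2 [simp]: "cnj_L2 (cnj_L2 u) = u"
proof (rule L2_eqI)
  show "AE x in lborel. L2_fun (cnj_L2 (cnj_L2 u)) x = L2_fun u x"
    using L2_fun_cnj[of "cnj_L2 u"] L2_fun_cnj[of u] by eventually_elim simp
qed

lemma norm_cnj_L2 [simp]: "norm (cnj_L2 u) = norm u"
  using norm_to_L2_eqI[OF square_integrable_cnj[OF square_integrable_L2_fun[of u]] square_integrable_L2_fun[of u]]
  by (simp add: cnj_L2_def)

lemma cnj_L2_diff: "cnj_L2 (u - v) = cnj_L2 u - cnj_L2 v"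
proof (rule L2_eqI)
  show "AE x in lborel. L2_fun (cnj_L2 (u - v)) x = L2_fun (cnj_L2 u - cnj_L2 v) x"
    using L2_fun_cnj[of "u - v"] L2_fun_cnj[of u] L2_fun_cnj[of v] L2_fun_diff[of u v] L2_fun_diff[of "cnj_L2 u" "cnj_L2 v"]
    by eventually_elim simp
qed

lemma tendsto_cnj_L2: "X \<longlonglongrightarrow> u \<Longrightarrow> (\<lambda>n. cnj_L2 (X n)) \<longlonglongrightarrow> cnj_L2 u"
proof -
  assume "X \<longlonglongrightarrow> u"
  then have "(\<lambda>n. norm (X n - u)) \<longlonglongrightarrow> 0" by (rule tendsto_norm_zero[OF LIM_zero])
  then have "(\<lambda>n. norm (cnj_L2 (X n) - cnj_L2 u)) \<longlonglongrightarrow> 0" by (simp add: cnj_L2_diff[symmetric])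
  then show ?thesis by (rule LIM_zero_cancel[OF tendsto_norm_zero_cancel])
qed

lemma cinner_cnj_cnj: "cinner (cnj_L2 u) (cnj_L2 v) = cnj (cinner u v)"
proof -
  have "cinner (cnj_L2 u) (cnj_L2 v) = (\<integral>x. cnj (cnj (L2_fun u x) * L2_fun v x) \<partial>lborel)"
    unfolding cnj_L2_def
    by (subst cinner_to_L2) (auto intro: square_integrable_cnj square_integrable_L2_fun)
  then show ?thesis unfolding cinner_L2_fun[of u v] Bochner_Integration.integral_cnj .
qed

text \<open>The symmetric bilinear multiplication formula, passed to the limit along truncations;
  the conjugations compensate for the antilinear first entry of \<open>cinner\<close>.\<close>

lemma fourier_mult_formula: "cinner (cnj_L2 (fourier u)) v = cinner (cnj_L2 u) (fourier v)"
proof (rule LIMSEQ_unique)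
  let ?u = "\<lambda>n. ball_cut n (L2_fun u)" and ?v = "\<lambda>n. ball_cut n (L2_fun v)"
  note s = square_integrable_L2_fun
  have cut: "(\<lambda>n. to_L2 (ball_cut n (L2_fun w))) \<longlonglongrightarrow> w" for w
    using ball_cut_tendsto[OF s[of w]] by simp
  show "(\<lambda>n. cinner (cnj_L2 (fball n u)) (to_L2 (?v n))) \<longlonglongrightarrow> cinner (cnj_L2 (fourier u)) v"
    by (intro tendsto_intros tendsto_cnj_L2 fball_convergent cut)
  have "cinner (cnj_L2 (fball n u)) (to_L2 (?v n)) = cinner (cnj_L2 (to_L2 (?u n))) (fball n v)" for n
  proof -
    have "cinner (cnj_L2 (fball n u)) (to_L2 (?v n)) = (\<integral>p. ft (?u n) p * ?v n p \<partial>lborel)"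
      unfolding fball_def cnj_to_L2[OF Plancherel_ball_cut(1)[OF s]]
      by (subst cinner_to_L2) (auto intro: square_integrable_cnj Plancherel_ball_cut(1) ball_cut_square_integrable s)
    also have "\<dots> = (\<integral>x. ?u n x * ft (?v n) x \<partial>lborel)"
      by (intro ft_mult_formula ball_cut_integrable s)
    also have "\<dots> = cinner (cnj_L2 (to_L2 (?u n))) (fball n v)"
      unfolding fball_def cnj_to_L2[OF ball_cut_square_integrable[OF s]]
      by (subst cinner_to_L2) (auto intro: square_integrable_cnj Plancherel_ball_cut(1) ball_cut_square_integrable s)
    finally show ?thesis .
  qed
  then show "(\<lambda>n. cinner (cnj_L2 (fball n u)) (to_L2 (?v n))) \<longlonglongrightarrow> cinner (cnj_L2 u) (fourier v)"
    by (simp, intro tendsto_intros tendsto_cnj_L2 fball_convergent cut)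
qed

text \<open>Since \<open>F\<^sup>* = C F C\<close> with the complex conjugation \<open>C\<close>, both \<open>F\<close> and \<open>F\<^sup>*\<close> are isometries;
  this forces surjectivity.\<close>

lemma cinner_fourier_adjoint: "cinner (fourier u) v = cinner u (cnj_L2 (fourier (cnj_L2 v)))"
  using fourier_mult_formula[of u "cnj_L2 v"] cinner_cnj_cnj[of "fourier u" v]
    cinner_cnj_cnj[of u "cnj_L2 (fourier (cnj_L2 v))"] by (metis cnj_cnj_L2 complex_cnj_cnj)

text \<open>Equality in Cauchy-Schwarz: w and v have the same norm, and the product of
  \<open>fourier w\<close> with v equals its square, which forces \<open>fourier w\<close> to be
  v.\<close>

lemma fourier_right_inverse: "fourier (cnj_L2 (fourier (cnj_L2 v))) = v"
proof -
  define w where "w = cnj_L2 (fourier (cnj_L2 v))"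
  have nw: "norm w = norm v" by (simp add: w_def)
  have "cinner (fourier w) v = cinner w w" unfolding cinner_fourier_adjoint w_def ..
  then have "inner (fourier w) v = (norm v)\<^sup>2" by (simp add: inner_L2_def cinner_self nw)
  then have "(norm (fourier w - v))\<^sup>2 = 0"
    using dot_norm_neg[of "fourier w" v] nw by simp
  then show ?thesis by (simp add: w_def)
qed

lemma bij_fourier: "bij fourier"
  unfolding bij_def
proof
  show "inj fourier"
    by (rule injI) (metis fourier_diff norm_fourier norm_eq_zero right_minus_eq)
  show "surj fourier" by (rule surjI) (rule fourier_right_inverse)
qed

lemma inv_fourier_eq: "inv_fourier v = cnj_L2 (fourier (cnj_L2 v))"
  by (metis bij_fourier bij_inv_eq_iff fourier_right_inverse)

lemma fourier_inv_fourier [simp]: "fourier (inv_fourier u) = u"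
  and inv_fourier_fourier [simp]: "inv_fourier (fourier u) = u"
  using bij_fourier by (simp_all add: bij_is_surj surj_f_inv_f bij_is_inj)

lemma fourier_eq_iff [simp]: "fourier u = fourier v \<longleftrightarrow> u = v"
  using bij_fourier by (simp add: bij_is_inj inj_eq)

lemma cinner_fourier [simp]: "cinner (fourier u) (fourier v) = cinner u v"
proof -
  have "cinner (fourier u) (fourier v) = cinner u (inv_fourier (fourier v))"
    unfolding cinner_fourier_adjoint inv_fourier_eq ..
  then show ?thesis by simp
qed

section \<open>Point evaluation by Fourier inversion\<close>

text \<open>An integrable transform is inverted by an absolutely convergent integral, which is a
  continuous representative. Two continuous representatives agree, since the open set where they
  differ is null. The second claim serves representatives given in advance, such as test
  functions.\<close>

lemma value_at_0_eq:
  assumes i: "integrable lborel (fhat F)"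
  shows "value_at_0 F = fconst * (\<integral>p. fhat F p \<partial>lborel)"
    and "continuous_on UNIV \<psi> \<Longrightarrow> AE x in lborel. \<psi> x = L2_fun F x \<Longrightarrow> \<psi> 0 = fconst * (\<integral>p. fhat F p \<partial>lborel)"
proof -
  define \<phi> where "\<phi> x = cnj (ft (\<lambda>p. cnj (fhat F p)) x)" for x
  have ic: "integrable lborel (\<lambda>p. cnj (fhat F p))" using i by simp
  have s: "square_integrable (\<lambda>p. cnj (fhat F p))"
    by (rule square_integrable_cnj[OF square_integrable_L2_fun])
  have "F = cnj_L2 (fourier (cnj_L2 (fourier F)))" using inv_fourier_eq[of "fourier F"] by simp
  also have "cnj_L2 (fourier F) = to_L2 (\<lambda>p. cnj (fhat F p))" by (simp add: cnj_L2_def)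
  also have "fourier \<dots> = to_L2 (ft (\<lambda>p. cnj (fhat F p)))" by (rule fourier_to_L2[OF s ic])
  also have "cnj_L2 \<dots> = to_L2 \<phi>"
    unfolding \<phi>_def[abs_def] by (rule cnj_to_L2[OF fourier_to_L2(1)[OF s ic]])
  finally have F: "F = to_L2 \<phi>" .
  have "square_integrable \<phi>"
    unfolding \<phi>_def[abs_def] by (rule square_integrable_cnj[OF fourier_to_L2(1)[OF s ic]])
  then have ae: "AE x in lborel. \<phi> x = L2_fun F x"
    using L2_fun_to_L2[of \<phi>] unfolding F by (auto elim: eventually_mono)
  have cont: "continuous_on UNIV \<phi>"
    unfolding \<phi>_def[abs_def] by (intro continuous_intros continuous_ft ic)
  have \<phi>0: "\<phi> 0 = fconst * (\<integral>p. fhat F p \<partial>lborel)"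
    by (simp add: \<phi>_def ft_def fconst_pos)
  have uniq: "\<psi> 0 = \<phi> 0" if \<psi>: "continuous_on UNIV \<psi>" "AE x in lborel. \<psi> x = L2_fun F x" for \<psi>
  proof (rule ccontr)
    assume ne: "\<psi> 0 \<noteq> \<phi> 0"
    define U where "U = {x. \<psi> x \<noteq> \<phi> x}"
    have "open U" unfolding U_def by (intro open_Collect_neq \<psi> cont)
    moreover have "0 \<in> U" using ne by (simp add: U_def)
    ultimately obtain e where e: "e > 0" "ball 0 e \<subseteq> U" using open_contains_ball by blast
    have "AE x in lborel. x \<notin> U" using \<psi>(2) ae by eventually_elim (simp add: U_def)
    then have "AE x in lborel. x \<notin> ball (0::real^3) e" by eventually_elim (use e in blast)
    then have "emeasure lborel (ball (0::real^3) e) = 0"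
      by (subst (asm) AE_iff_measurable[where N="ball 0 e"]) auto
    then have "measure lborel (ball (0::real^3) e) = 0" by (simp add: measure_def)
    then show False using content_ball_pos[OF e(1), of "0::real^3"] by simp
  qed
  have ex: "\<exists>\<phi>. continuous_on UNIV \<phi> \<and> (AE x in lborel. \<phi> x = L2_fun F x) \<and> \<phi> 0 = fconst * (\<integral>p. fhat F p \<partial>lborel)"
    using cont ae \<phi>0 by blast
  show "value_at_0 F = fconst * (\<integral>p. fhat F p \<partial>lborel)"
    unfolding value_at_0_def
    by (rule the_equality[where P="\<lambda>c. \<exists>\<phi>. continuous_on UNIV \<phi> \<and> (AE x in lborel. \<phi> x = L2_fun F x) \<and> \<phi> 0 = c", OF ex])
      (use uniq \<phi>0 in auto)
  show "continuous_on UNIV \<psi> \<Longrightarrow> AE x in lborel. \<psi> x = L2_fun F x \<Longrightarrow> \<psi> 0 = fconst * (\<integral>p. fhat F p \<partial>lborel)"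
    using uniq \<phi>0 by simp
qed

section \<open>The integral of the squared Green function\<close>

lemma Gamma_reflection_real: "Gamma (x::real) * Gamma (1 - x) = pi / sin (pi * x)"
proof -
  have "complex_of_real (Gamma x * Gamma (1 - x)) = Gamma (complex_of_real x) * Gamma (1 - complex_of_real x)"
    unfolding of_real_mult Gamma_complex_of_real[symmetric] by simp
  also have "\<dots> = complex_of_real (pi / sin (pi * x))"
    unfolding Gamma_reflection_complex by (simp only: of_real_divide sin_of_real[symmetric] of_real_mult)
  finally show ?thesis by (simp only: of_real_eq_iff)
qed

text \<open>Shifting both Gamma factors by one reduces to the reflection formula; the denominator is
  Gamma(3) = 2, and 1 < x < 2 keeps 1 - x away from the poles.\<close>

lemma Beta_shifted_reflection:
  fixes x :: real
  assumes "1 < x" "x < 2"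
  shows "Beta (2 - x) (1 + x) = x * (1 - x) * pi / (2 * sin (pi * x))"
proof -
  have nn: "x \<notin> \<int>\<^sub>\<le>\<^sub>0" using assms by (auto elim!: nonpos_Ints_cases)
  have nn1: "1 - x \<notin> \<int>\<^sub>\<le>\<^sub>0"
  proof
    assume "1 - x \<in> \<int>\<^sub>\<le>\<^sub>0"
    then obtain k where "1 - x = of_int k" by (auto elim!: nonpos_Ints_cases)
    with assms have "real_of_int (-1) < real_of_int k" "real_of_int k < real_of_int 0" by auto
    then have "-1 < k" "k < 0" by (simp_all only: of_int_less_iff)
    then show False by simp
  qed
  have 1: "Gamma (1 + x) = x * Gamma x" using Gamma_plus1[OF nn] by (simp add: add.commute)
  have 2: "Gamma (2 - x) = (1 - x) * Gamma (1 - x)" using Gamma_plus1[OF nn1] by (simp add: algebra_simps)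
  have 3: "Gamma (2 - x + (1 + x)) = (2::real)" using Gamma_numeral[of "Num.num.One", where 'a=real] Gamma_numeral[of "num.Bit1 num.One", where 'a=real] by (simp add: fact_numeral)
  have "Beta (2 - x) (1 + x) = x * (1 - x) * (Gamma x * Gamma (1 - x)) / 2"
    unfolding Beta_def 1 2 3 by simp
  then show ?thesis unfolding Gamma_reflection_real by simp
qed

locale frac_weight =
  fixes s lam :: real
  assumes s_gt: "3 / 2 < s" and s_lt: "s < 5 / 2" and lam_pos: "0 < lam"
begin

definition w :: "real^3 \<Rightarrow> real" where "w p = norm p powr s + lam"

lemma w_ge: "lam \<le> w p" and w_pos: "0 < w p" and w_nz: "w p \<noteq> 0"
  using lam_pos powr_ge_zero[of "norm p" s] unfolding w_def by linarith+

lemma w_measurable [measurable]: "w \<in> borel_measurable borel"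
  unfolding w_def[abs_def] by measurable

lemma sin_neg: "sin (3 * pi / s) < 0"
proof -
  have "pi < 3 * pi / s" "3 * pi / s < 2 * pi"
    using s_gt s_lt by (simp_all add: field_simps)
  then show ?thesis by (rule sin_lt_zero)
qed

text \<open>The closed form of the integral of 1 / w^2, that is of |\<eta>|^2.\<close>

definition wint :: real where "wint = 4 * pi\<^sup>2 * (s - 3) / (s\<^sup>2 * sin (3 * pi / s)) * lam powr (3 / s - 2)"

lemma wint_pos: "wint > 0"
  unfolding wint_def using sin_neg s_gt s_lt lam_pos
  by (intro mult_pos_pos divide_neg_neg mult_pos_neg mult_pos_pos) (auto simp: mult_less_0_iff)

text \<open>Layer-cake formula: the superlevel sets of \<open>1/w\<close> are balls, and the resulting one-dimensional
  integral is a Beta integral.\<close>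

lemma superlevel_ball:
  assumes "0 < y"
  shows "emeasure lborel {p. y < 1 / w p} = ennreal (if y < 1 / lam then 4 / 3 * pi * (1 / y - lam) powr (3 / s) else 0)"
proof (cases "y < 1 / lam")
  case True
  have d: "0 < 1 / y - lam" using True assms lam_pos by (simp add: field_simps)
  have s0: "s > 0" using s_gt by simp
  define r where "r = (1 / y - lam) powr (1 / s)"
  have r: "r \<ge> 0" by (simp add: r_def)
  have rs: "r powr s = 1 / y - lam" using d s0 by (simp add: r_def powr_powr)
  have eq: "y < 1 / w p \<longleftrightarrow> norm p < r" for p
  proof -
    have "y < 1 / w p \<longleftrightarrow> norm p powr s < r powr s"
      unfolding rs using assms w_pos[of p] by (auto simp: w_def field_simps)
    also have "\<dots> \<longleftrightarrow> norm p < r"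
    proof
      assume less: "norm p powr s < r powr s"
      show "norm p < r"
      proof (rule ccontr)
        assume "\<not> norm p < r"
        then have "r powr s \<le> norm p powr s" using r s0 by (intro powr_mono2) auto
        then show False using less by simp
      qed
    qed (use s0 in \<open>intro powr_less_mono2; simp\<close>)
    finally show ?thesis .
  qed
  have "{p. y < 1 / w p} = ball 0 r" unfolding eq by (simp add: ball_def)
  moreover have "r ^ 3 = (1 / y - lam) powr (3 / s)"
    unfolding r_def using d by (simp add: powr_realpow[symmetric] powr_powr)
  ultimately show ?thesis using True by (simp add: emeasure_ball[OF r] unit_ball_vol_3)
next
  case False
  have "\<not> y < 1 / w p" for p
  proof -
    have "1 / w p \<le> 1 / lam" using w_ge lam_pos by (intro divide_left_mono) (auto intro: w_pos mult_pos_pos)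
    then show ?thesis using False by linarith
  qed
  then show ?thesis using False by simp
qed

lemma nn_integral_w_square: "(\<integral>\<^sup>+p. ennreal ((1 / w p)\<^sup>2) \<partial>lborel) = ennreal wint"
proof -
  \<comment> \<open>The bound x < 2 is the condition s > 3/2; it makes the Beta integral converge at
    0, where the levels belong to large momenta.\<close>
  define x where "x = 3 / s"
  have x: "1 < x" "x < 2" using s_gt s_lt by (auto simp: x_def field_simps)
  \<comment> \<open>Layer cake for a square: levels y carry the weight 2 y.\<close>
  have sq: "ennreal (a\<^sup>2) = (\<integral>\<^sup>+y. ennreal (2 * y) * indicator {0<..<a} y \<partial>lborel)" if "a > 0" for a :: real
  proof -
    have "((\<lambda>y. 2 * y) has_integral (a\<^sup>2 - 0\<^sup>2)) {0..a}"
      using that by (intro fundamental_theorem_of_calculus)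
        (auto intro!: derivative_eq_intros simp: has_real_derivative_iff_has_vector_derivative[symmetric])
    from nn_integral_has_integral_lebesgue[OF _ this]
    have "(\<integral>\<^sup>+y. ennreal (indicator {0..a} y * (2 * y)) \<partial>lborel) = ennreal (a\<^sup>2)" by simp
    moreover have "AE y in lborel. ennreal (indicator {0..a} y * (2 * y)) = ennreal (2 * y) * indicator {0<..<a} y"
      using AE_lborel_singleton[of 0] AE_lborel_singleton[of a]
      by eventually_elim (auto simp: indicator_def)
    ultimately show ?thesis using nn_integral_cong_AE by force
  qed
  have "(\<integral>\<^sup>+p. ennreal ((1 / w p)\<^sup>2) \<partial>lborel)
      = (\<integral>\<^sup>+p. \<integral>\<^sup>+y. ennreal (2 * y) * indicator {0<..<1 / w p} y \<partial>lborel \<partial>lborel)"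
    using w_pos by (intro nn_integral_cong sq) simp
  also have "\<dots> = (\<integral>\<^sup>+y. \<integral>\<^sup>+p. ennreal (2 * y) * indicator {0<..<1 / w p} y \<partial>lborel \<partial>lborel)"
  proof (rule lborel_pair.Fubini')
    have "Measurable.pred (borel \<Otimes>\<^sub>M borel) (\<lambda>z::real \<times> (real^3). 0 < fst z \<and> fst z < 1 / w (snd z))"
      by measurable
    then have m: "{z::real \<times> (real^3). 0 < fst z \<and> fst z < 1 / w (snd z)} \<in> sets (borel \<Otimes>\<^sub>M borel)"
      by (simp add: pred_def space_pair_measure)
    have "(\<lambda>z::real \<times> (real^3). ennreal (2 * fst z) * indicator {z. 0 < fst z \<and> fst z < 1 / w (snd z)} z)
        \<in> borel_measurable (borel \<Otimes>\<^sub>M borel)"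
      by (intro borel_measurable_times_ennreal borel_measurable_indicator m) measurable
    moreover have "(\<lambda>z::real \<times> (real^3). ennreal (2 * fst z) * indicator {z. 0 < fst z \<and> fst z < 1 / w (snd z)} z)
        = (\<lambda>(y, p). ennreal (2 * y) * indicator {0<..<1 / w p} y)"
      by (auto simp: fun_eq_iff indicator_def)
    ultimately show "(\<lambda>(y, p). ennreal (2 * y) * indicator {0<..<1 / w p} y) \<in> borel_measurable (lborel \<Otimes>\<^sub>M (lborel :: (real^3) measure))"
      by (simp cong: measurable_cong_sets)
  qed
  also have "\<dots> = (\<integral>\<^sup>+y. ennreal (indicator {0<..<1 / lam} y * (2 * y * (4 / 3 * pi * (1 / y - lam) powr x))) \<partial>lborel)"
  proof (intro nn_integral_cong)
    fix y :: real
    show "(\<integral>\<^sup>+p. ennreal (2 * y) * indicator {0<..<1 / w p} y \<partial>lborel)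
        = ennreal (indicator {0<..<1 / lam} y * (2 * y * (4 / 3 * pi * (1 / y - lam) powr x)))"
    proof (cases "0 < y")
      case True
      have "(\<integral>\<^sup>+p. ennreal (2 * y) * indicator {0<..<1 / w p} y \<partial>lborel)
          = (\<integral>\<^sup>+p. ennreal (2 * y) * indicator {p. y < 1 / w p} p \<partial>lborel)"
        using True by (intro nn_integral_cong) (auto simp: indicator_def)
      also have "\<dots> = ennreal (2 * y) * emeasure lborel {p. y < 1 / w p}"
        by (rule nn_integral_cmult_indicator) measurable
      finally show ?thesis unfolding superlevel_ball[OF True] x_def
        using True by (auto simp: indicator_def ennreal_mult[symmetric])
    qed simp
  qed
  \<comment> \<open>The substitution y = z / lam maps the levels to the unit interval; together with
    the Jacobian the integrand scales like lam^(x - 2).\<close>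
  also have "\<dots> = ennreal \<bar>1 / lam\<bar> * (\<integral>\<^sup>+z. ennreal (indicator {0<..<1 / lam} (0 + 1 / lam * z)
      * (2 * (0 + 1 / lam * z) * (4 / 3 * pi * (1 / (0 + 1 / lam * z) - lam) powr x))) \<partial>lborel)"
    using lam_pos by (intro nn_integral_real_affine) auto
  also have "\<dots> = (\<integral>\<^sup>+z. ennreal \<bar>1 / lam\<bar> * ennreal (indicator {0<..<1 / lam} (0 + 1 / lam * z)
      * (2 * (0 + 1 / lam * z) * (4 / 3 * pi * (1 / (0 + 1 / lam * z) - lam) powr x))) \<partial>lborel)"
    by (rule nn_integral_cmult[symmetric]) measurable
  also have "\<dots> = (\<integral>\<^sup>+z. ennreal (8 / 3 * pi * lam powr (x - 2)) * ennreal (indicator {0..1} z * (z powr (2 - x - 1) * (1 - z) powr (1 + x - 1))) \<partial>lborel)"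
  proof (rule nn_integral_cong_AE)
    have pt: "ennreal \<bar>1 / lam\<bar> * ennreal (indicator {0<..<1 / lam} (0 + 1 / lam * z)
        * (2 * (0 + 1 / lam * z) * (4 / 3 * pi * (1 / (0 + 1 / lam * z) - lam) powr x)))
        = ennreal (8 / 3 * pi * lam powr (x - 2)) * ennreal (indicator {0..1} z * (z powr (2 - x - 1) * (1 - z) powr (1 + x - 1)))"
      if "z \<noteq> 0" "z \<noteq> 1" for z
    proof (cases "0 < z \<and> z < 1")
      case True
      have e1: "1 / (1 / lam * z) - lam = lam * ((1 - z) / z)" using True lam_pos by (simp add: field_simps)
      have e2: "(lam * ((1 - z) / z)) powr x = lam powr x * ((1 - z) powr x / z powr x)"
        using True lam_pos by (simp add: powr_mult powr_divide)
      have e3: "lam powr (x - 2) = lam powr x / lam\<^sup>2" using lam_pos by (simp add: powr_diff)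
      have e4: "z powr (1 - x) = z / z powr x" using True by (simp add: powr_diff)
      have "1 / lam * (2 * (1 / lam * z) * (4 / 3 * pi * (1 / (1 / lam * z) - lam) powr x))
          = 8 / 3 * pi * lam powr (x - 2) * (z powr (1 - x) * (1 - z) powr x)"
        unfolding e1 e2 e3 e4 by (simp add: power2_eq_square mult_ac)
      then show ?thesis using True lam_pos
        by (simp add: indicator_def ennreal_mult[symmetric] field_simps)
    next
      case False
      then show ?thesis using that lam_pos by (auto simp: indicator_def field_simps zero_less_mult_iff)
    qed
    show "AE z in lborel. ennreal \<bar>1 / lam\<bar> * ennreal (indicator {0<..<1 / lam} (0 + 1 / lam * z)
        * (2 * (0 + 1 / lam * z) * (4 / 3 * pi * (1 / (0 + 1 / lam * z) - lam) powr x)))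
        = ennreal (8 / 3 * pi * lam powr (x - 2)) * ennreal (indicator {0..1} z * (z powr (2 - x - 1) * (1 - z) powr (1 + x - 1)))"
      using AE_lborel_singleton[of "0::real"] AE_lborel_singleton[of "1::real"]
      by eventually_elim (rule pt)
  qed
  also have "\<dots> = ennreal (8 / 3 * pi * lam powr (x - 2)) * (\<integral>\<^sup>+z. ennreal (indicator {0..1} z * (z powr (2 - x - 1) * (1 - z) powr (1 + x - 1))) \<partial>lborel)"
    by (rule nn_integral_cmult) measurable
  also have "(\<integral>\<^sup>+z. ennreal (indicator {0..1} z * (z powr (2 - x - 1) * (1 - z) powr (1 + x - 1))) \<partial>lborel)
      = ennreal (Beta (2 - x) (1 + x))"
  proof (rule nn_integral_has_integral_lebesgue)
    show "((\<lambda>z. z powr (2 - x - 1) * (1 - z) powr (1 + x - 1)) has_integral Beta (2 - x) (1 + x)) {0..1}"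
      by (rule has_integral_Beta_real) (use x in auto)
  qed simp
  also have "ennreal (8 / 3 * pi * lam powr (x - 2)) * ennreal (Beta (2 - x) (1 + x))
      = ennreal (8 / 3 * pi * lam powr (x - 2) * Beta (2 - x) (1 + x))"
    using x by (intro ennreal_mult'[symmetric]) simp
  also have "8 / 3 * pi * lam powr (x - 2) * Beta (2 - x) (1 + x) = wint"
  proof -
    have "pi * x = 3 * pi / s" by (simp add: x_def)
    moreover have "8 / 3 * pi * (x * (1 - x) * pi / 2) = 4 * pi\<^sup>2 * (s - 3) / s\<^sup>2"
      using s_gt by (simp add: x_def power2_eq_square field_simps)
    ultimately have e: "8 / 3 * pi * Beta (2 - x) (1 + x) = 4 * pi\<^sup>2 * (s - 3) / s\<^sup>2 / sin (3 * pi / s)"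
      unfolding Beta_shifted_reflection[OF x] by simp
    have "8 / 3 * pi * lam powr (x - 2) * Beta (2 - x) (1 + x) = (8 / 3 * pi * Beta (2 - x) (1 + x)) * lam powr (x - 2)"
      by (simp only: mult_ac)
    also have "\<dots> = wint" unfolding e by (simp add: wint_def x_def)
    finally show ?thesis .
  qed
  finally show ?thesis .
qed

end

section \<open>Multiplication operators in Fourier space\<close>

definition fmul :: "(real^3 \<Rightarrow> real) \<Rightarrow> L2 \<Rightarrow> L2" where
  "fmul m u = inv_fourier (to_L2 (\<lambda>p. complex_of_real (m p) * fhat u p))"

lemma fmul_square_integrable:
  assumes "m \<in> borel_measurable borel" "\<And>p. \<bar>m p\<bar> \<le> C"
  shows "square_integrable (\<lambda>p. complex_of_real (m p) * L2_fun u p)"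
  by (rule square_integrable_bound[OF square_integrable_L2_fun[of u], where C=C])
    (use assms in \<open>auto simp: norm_mult intro: mult_right_mono\<close>)

lemma fhat_fmul:
  assumes "m \<in> borel_measurable borel" "\<And>p. \<bar>m p\<bar> \<le> C"
  shows "AE p in lborel. fhat (fmul m u) p = complex_of_real (m p) * fhat u p"
  unfolding fmul_def fourier_inv_fourier by (rule L2_fun_to_L2[OF fmul_square_integrable[OF assms]])

lemma fhat_eqI: "(AE p in lborel. fhat u p = fhat v p) \<Longrightarrow> u = v"
  using L2_eqI[of "fourier u" "fourier v"] by simp

lemma fhat_add: "AE p in lborel. fhat (u + v) p = fhat u p + fhat v p"
  unfolding fourier_add by (rule L2_fun_add)

lemma fhat_diff: "AE p in lborel. fhat (u - v) p = fhat u p - fhat v p"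
  unfolding fourier_diff by (rule L2_fun_diff)

lemma fhat_scaleC: "AE p in lborel. fhat (c *\<^sub>C u) p = c * fhat u p"
  unfolding fourier_scaleC by (rule L2_fun_scaleC)

lemma fhat_inv_fourier: "square_integrable f \<Longrightarrow> AE p in lborel. fhat (inv_fourier (to_L2 f)) p = f p"
  unfolding fourier_inv_fourier by (rule L2_fun_to_L2)

lemma cinner_fhat: "cinner u v = (\<integral>p. cnj (fhat u p) * fhat v p \<partial>lborel)"
  using cinner_L2_fun[of "fourier u" "fourier v"] by simp

lemma norm_fhat: "(norm u)\<^sup>2 = (\<integral>p. (cmod (fhat u p))\<^sup>2 \<partial>lborel)"
  using norm_L2_eq[of "fourier u"] by simp

lemma cinner_fhat_AE:
  assumes "AE p in lborel. fhat u p = f p" "AE p in lborel. fhat v p = g p"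
    "f \<in> borel_measurable borel" "g \<in> borel_measurable borel"
  shows "cinner u v = (\<integral>p. cnj (f p) * g p \<partial>lborel)"
  unfolding cinner_fhat
  by (rule integral_cong_AE) (use assms in \<open>auto elim: eventually_elim2\<close>)

lemma fmul_add:
  assumes "m \<in> borel_measurable borel" "\<And>p. \<bar>m p\<bar> \<le> C"
  shows "fmul m (u + v) = fmul m u + fmul m v"
proof (rule fhat_eqI)
  show "AE p in lborel. fhat (fmul m (u + v)) p = fhat (fmul m u + fmul m v) p"
    using fhat_fmul[OF assms, of "u + v"] fhat_fmul[OF assms, of u] fhat_fmul[OF assms, of v]
      fhat_add[of u v] fhat_add[of "fmul m u" "fmul m v"]
    by eventually_elim (simp add: distrib_left)
qed

lemma fmul_scaleC:
  assumes "m \<in> borel_measurable borel" "\<And>p. \<bar>m p\<bar> \<le> C"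
  shows "fmul m (c *\<^sub>C u) = c *\<^sub>C fmul m u"
proof (rule fhat_eqI)
  show "AE p in lborel. fhat (fmul m (c *\<^sub>C u)) p = fhat (c *\<^sub>C fmul m u) p"
    using fhat_fmul[OF assms, of "c *\<^sub>C u"] fhat_fmul[OF assms, of u]
      fhat_scaleC[of c u] fhat_scaleC[of c "fmul m u"]
    by eventually_elim simp
qed

lemma fmul_norm:
  assumes "m \<in> borel_measurable borel" "\<And>p. \<bar>m p\<bar> \<le> C"
  shows "norm (fmul m u) \<le> C * norm u"
proof -
  have C: "C \<ge> 0" using assms(2)[of 0] by linarith
  have s: "square_integrable (\<lambda>p. complex_of_real (m p) * fhat u p)" by (rule fmul_square_integrable[OF assms])
  have "norm (fmul m u) = norm (to_L2 (\<lambda>p. complex_of_real (m p) * fhat u p))"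
    unfolding fmul_def by (metis fourier_inv_fourier norm_fourier)
  also have "\<dots> \<le> norm (to_L2 (\<lambda>p. complex_of_real C * fhat u p))"
    by (rule norm_to_L2_mono[OF s square_integrable_cmult[OF square_integrable_L2_fun]])
      (use assms C in \<open>auto simp: norm_mult intro!: mult_right_mono\<close>)
  also have "\<dots> = C * norm u"
    using C by (simp add: to_L2_scaleC square_integrable_L2_fun)
  finally show ?thesis .
qed

lemma fmul_sym:
  assumes "m \<in> borel_measurable borel" "\<And>p. \<bar>m p\<bar> \<le> C"
  shows "cinner (fmul m u) v = cinner u (fmul m v)"
proof -
  have [measurable]: "m \<in> borel_measurable borel" by (rule assms)
  have "cinner (fmul m u) v = (\<integral>p. cnj (complex_of_real (m p) * fhat u p) * fhat v p \<partial>lborel)"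
    by (rule cinner_fhat_AE[OF fhat_fmul[OF assms]]) auto
  moreover have "cinner u (fmul m v) = (\<integral>p. cnj (fhat u p) * (complex_of_real (m p) * fhat v p) \<partial>lborel)"
    by (rule cinner_fhat_AE[OF _ fhat_fmul[OF assms]]) auto
  ultimately show ?thesis by (simp add: mult_ac)
qed

text \<open>Dividing by a multiplier without zeros inverts it, so its range is a weighted space.
  Sobolev spaces and operator graphs are recognised through this.\<close>

lemma range_fmul:
  assumes m [measurable]: "m \<in> borel_measurable borel" and "\<And>p. \<bar>m p\<bar> \<le> C" "\<And>p. m p \<noteq> 0"
  shows "F \<in> range (fmul m) \<longleftrightarrow> square_integrable (\<lambda>p. complex_of_real (1 / m p) * fhat F p)"
    "F = fmul m v \<longleftrightarrow> (AE p in lborel. fhat v p = complex_of_real (1 / m p) * fhat F p)"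
proof -
  show eq: "F = fmul m v \<longleftrightarrow> (AE p in lborel. fhat v p = complex_of_real (1 / m p) * fhat F p)" for v
  proof
    assume F: "F = fmul m v"
    show "AE p in lborel. fhat v p = complex_of_real (1 / m p) * fhat F p"
      unfolding F using fhat_fmul[OF assms(1,2), of v] by eventually_elim (use assms(3) in simp)
  next
    assume "AE p in lborel. fhat v p = complex_of_real (1 / m p) * fhat F p"
    then have "AE p in lborel. fhat F p = fhat (fmul m v) p"
      using fhat_fmul[OF assms(1,2), of v] by eventually_elim (use assms(3) in simp)
    then show "F = fmul m v" by (rule fhat_eqI)
  qed
  show "F \<in> range (fmul m) \<longleftrightarrow> square_integrable (\<lambda>p. complex_of_real (1 / m p) * fhat F p)"
  proof
    assume "F \<in> range (fmul m)"
    then obtain v where "AE p in lborel. fhat v p = complex_of_real (1 / m p) * fhat F p" using eq by blast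
    then show "square_integrable (\<lambda>p. complex_of_real (1 / m p) * fhat F p)"
      by (rule square_integrable_AE_cong[OF square_integrable_L2_fun]) measurable
  next
    assume "square_integrable (\<lambda>p. complex_of_real (1 / m p) * fhat F p)"
    from fhat_inv_fourier[OF this] show "F \<in> range (fmul m)" using eq by blast
  qed
qed

lemma integrable_weight_equiv:
  fixes g :: "real^3 \<Rightarrow> real"
  assumes [measurable]: "a \<in> borel_measurable borel" "b \<in> borel_measurable borel" "g \<in> borel_measurable borel"
    and g: "\<And>p. 0 \<le> g p" and a: "\<And>p. 0 \<le> a p" "\<And>p. a p \<le> c * b p"
    and i: "integrable lborel (\<lambda>p. b p * g p)"
  shows "integrable lborel (\<lambda>p. a p * g p)"
proof (rule Bochner_Integration.integrable_bound)
  show "integrable lborel (\<lambda>p. c * (b p * g p))" using i by simp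
  have "a p * g p \<le> c * (b p * g p)" for p using mult_right_mono[OF a(2) g, of p p] by (simp add: mult.assoc)
  then show "AE p in lborel. norm (a p * g p) \<le> norm (c * (b p * g p))"
    using g a(1) by (intro always_eventually allI) (smt (verit) mult_nonneg_nonneg real_norm_def)
qed measurable

section \<open>The concrete model and the divergence of the integral of 1/w\<close>

context frac_weight
begin

lemma sqrt_w: "1 / sqrt (w p) \<noteq> 0" "\<bar>1 / sqrt (w p)\<bar> \<le> 1 / sqrt lam" "\<bar>1 / w p\<bar> \<le> 1 / lam" "1 / w p \<noteq> 0"
  using w_pos[of p] w_ge[of p] lam_pos by (auto simp: frac_le)

lemma sqrt_w_measurable [measurable]: "(\<lambda>p. 1 / sqrt (w p)) \<in> borel_measurable borel" "(\<lambda>p. 1 / w p) \<in> borel_measurable borel"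
  by measurable

definition Q :: "L2 \<Rightarrow> L2" where "Q = fmul (\<lambda>p. 1 / sqrt (w p))"

text \<open>The Green function without its normalising factor: \<open>Gfun s lam\<close> is
  \<open>fconst *\<^sub>C \<eta>\<close>. Powers of 2 pi thus stay out of the abstract
  theory.\<close>

definition \<eta> :: L2 where "\<eta> = inv_fourier (to_L2 (\<lambda>p. complex_of_real (1 / w p)))"

lemma square_integrable_inv_w: "square_integrable (\<lambda>p. complex_of_real (1 / w p))"
proof (rule square_integrable_nn)
  have "(cmod (complex_of_real (1 / w p)))\<^sup>2 = (1 / w p)\<^sup>2" for p
    unfolding norm_of_real by (rule power2_abs)
  then show "(\<integral>\<^sup>+p. ennreal ((cmod (complex_of_real (1 / w p)))\<^sup>2) \<partial>lborel) < \<infinity>"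
    using nn_integral_w_square by simp
qed measurable

lemma fhat_eta: "AE p in lborel. fhat \<eta> p = complex_of_real (1 / w p)"
  unfolding \<eta>_def by (rule fhat_inv_fourier[OF square_integrable_inv_w])

lemma norm_eta: "(norm \<eta>)\<^sup>2 = wint"
proof -
  have "norm \<eta> = norm (to_L2 (\<lambda>p. complex_of_real (1 / w p)))"
    unfolding \<eta>_def by (metis fourier_inv_fourier norm_fourier)
  then have "ennreal ((norm \<eta>)\<^sup>2) = (\<integral>\<^sup>+p. ennreal ((cmod (complex_of_real (1 / w p)))\<^sup>2) \<partial>lborel)"
    using nn_integral_to_L2[OF square_integrable_inv_w] by simp
  also have "\<dots> = (\<integral>\<^sup>+p. ennreal ((1 / w p)\<^sup>2) \<partial>lborel)"
    unfolding norm_of_real power2_abs ..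
  also have "\<dots> = ennreal wint" by (rule nn_integral_w_square)
  finally show ?thesis using wint_pos by simp
qed

lemma cinner_eta:
  "cinner \<eta> v = (\<integral>p. fhat v p / complex_of_real (w p) \<partial>lborel)"
  "integrable lborel (\<lambda>p. fhat v p / complex_of_real (w p))"
proof -
  have "cinner \<eta> v = (\<integral>p. cnj (complex_of_real (1 / w p)) * fhat v p \<partial>lborel)"
    by (rule cinner_fhat_AE[OF fhat_eta]) auto
  then show "cinner \<eta> v = (\<integral>p. fhat v p / complex_of_real (w p) \<partial>lborel)" by simp
  show "integrable lborel (\<lambda>p. fhat v p / complex_of_real (w p))"
    using square_integrable_mult_integrable[OF square_integrable_inv_w square_integrable_L2_fun[of "fourier v"]] by simp
qed

text \<open>Let \<theta> have as transform the indicator of a ball divided by J, the integral of 1/w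
  over that ball; then <\<eta>, \<theta>> = 1 and |Q \<theta>|^2 = 1 / J. J diverges because the
  volume grows like r^3 while w is at most (1 + lam) r^(5/2) on the ball.\<close>

lemma concentrating_sequence:
  assumes "e > 0"
  shows "\<exists>\<theta>. cinner \<eta> \<theta> = 1 \<and> norm (Q \<theta>) < e"
proof -
  have "\<exists>r\<ge>1. 1 / e\<^sup>2 < r powr (1 / 2) / (1 + lam)"
  proof -
    \<comment> \<open>A square, so that the square root in the lower bound r^(1/2) / (1 + lam) for J
      resolves explicitly.\<close>
    define r where "r = (max 1 (2 * (1 + lam) / e\<^sup>2))\<^sup>2"
    have "r powr (1 / 2) = max 1 (2 * (1 + lam) / e\<^sup>2)"
      unfolding r_def by (subst powr_half_sqrt) auto
    moreover have "2 * (1 + lam) / e\<^sup>2 \<le> max 1 (2 * (1 + lam) / e\<^sup>2)" by simp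
    moreover have "1 / e\<^sup>2 < (2 * (1 + lam) / e\<^sup>2) / (1 + lam)"
    proof -
      have "L \<noteq> 0 \<Longrightarrow> (2 * L / e\<^sup>2) / L = 2 / e\<^sup>2" for L by simp
      from this[of "1 + lam"] have "(2 * (1 + lam) / e\<^sup>2) / (1 + lam) = 2 / e\<^sup>2" using lam_pos by simp
      then show ?thesis using assms by (simp add: divide_strict_right_mono)
    qed
    ultimately have "1 / e\<^sup>2 < r powr (1 / 2) / (1 + lam)"
      using lam_pos by (smt (verit) divide_right_mono)
    moreover have "1 \<le> r" unfolding r_def by simp
    ultimately show ?thesis by blast
  qed
  then obtain r where r: "r \<ge> 1" "1 / e\<^sup>2 < r powr (1 / 2) / (1 + lam)" by blast
  define B where "B = cball (0::real^3) r"
  define J where "J = (\<integral>p. indicator B p / w p \<partial>lborel)"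
  have [measurable]: "B \<in> sets borel" by (simp add: B_def)
  have finB: "emeasure lborel B < \<infinity>" unfolding B_def by (rule emeasure_bounded_finite) simp
  have iB: "integrable lborel (indicator B :: _ \<Rightarrow> real)" using finB by simp
  have iJ: "integrable lborel (\<lambda>p. indicator B p / w p)"
  proof (rule Bochner_Integration.integrable_bound)
    show "integrable lborel (\<lambda>p. 1 / lam * indicator B p)" using iB by simp
    show "AE p in lborel. norm (indicator B p / w p) \<le> norm (1 / lam * indicator B p)"
      using sqrt_w(3) lam_pos by (auto simp: indicator_def)
  qed measurable
  have s0: "s > 0" using s_gt by simp
  have "J \<ge> (\<integral>p. 1 / ((1 + lam) * r powr (5/2)) * indicator B p \<partial>lborel)"
    unfolding J_def
  proof (intro integral_mono iJ)
    show "integrable lborel (\<lambda>p. 1 / ((1 + lam) * r powr (5/2)) * indicator B p)" using iB by simp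
    fix p :: "real^3"
    show "1 / ((1 + lam) * r powr (5/2)) * indicator B p \<le> indicator B p / w p"
    proof (cases "p \<in> B")
      case True
      have "norm p powr s \<le> r powr s" using True s0 by (intro powr_mono2) (auto simp: B_def)
      also have "\<dots> \<le> r powr (5/2)" using s_lt r(1) by (intro powr_mono) auto
      finally have "norm p powr s \<le> r powr (5/2)" .
      moreover have "lam * 1 \<le> lam * r powr (5/2)"
        using r(1) lam_pos by (intro mult_left_mono ge_one_powr_ge_zero) auto
      ultimately have "w p \<le> (1 + lam) * r powr (5/2)" by (simp add: w_def distrib_right)
      then show ?thesis using True w_pos[of p] by (simp add: frac_le)
    qed simp
  qed
  moreover have "(\<integral>p. 1 / ((1 + lam) * r powr (5/2)) * indicator B p \<partial>lborel)
      = 1 / ((1 + lam) * r powr (5/2)) * (4 / 3 * pi * r ^ 3)"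
    using r(1) by (simp add: B_def content_cball unit_ball_vol_3 mult_ac)
  moreover have "1 / ((1 + lam) * r powr (5/2)) * (4 / 3 * pi * r ^ 3) \<ge> r powr (1/2) / (1 + lam)"
  proof -
    have "r ^ 3 = r powr (5/2) * r powr (1/2)"
    proof -
      have "r ^ 3 = r powr (5/2 + 1/2)" using r(1) by simp
      then show ?thesis unfolding powr_add .
    qed
    then have "1 / ((1 + lam) * r powr (5/2)) * (4 / 3 * pi * r ^ 3) = 4 / 3 * pi * (r powr (1/2) / (1 + lam))"
    proof -
      have "a \<noteq> 0 \<Longrightarrow> 1 / (L * a) * (4 / 3 * pi * (a * b)) = 4 / 3 * pi * (b / L)" for a b L :: real by simp
      from this[of "r powr (5/2)" "1 + lam" "r powr (1/2)"] show ?thesis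
        using r(1) \<open>r ^ 3 = r powr (5/2) * r powr (1/2)\<close> by simp
    qed
    moreover have "1 * (r powr (1/2) / (1 + lam)) \<le> 4 / 3 * pi * (r powr (1/2) / (1 + lam))"
      using pi_gt3 lam_pos by (intro mult_right_mono) auto
    ultimately show ?thesis by simp
  qed
  ultimately have J: "1 / e\<^sup>2 < J" using r(2) by linarith
  moreover have "0 < 1 / e\<^sup>2" using assms by simp
  ultimately have J0: "J > 0" by linarith
  have sB: "square_integrable (\<lambda>p. complex_of_real (indicator B p / J))"
    using square_integrable_cmult[OF ball_square_integrable[of r], of "1 / complex_of_real J"]
    by (simp add: B_def)
  define \<theta> where "\<theta> = inv_fourier (to_L2 (\<lambda>p. complex_of_real (indicator B p / J)))"
  have \<theta>: "AE p in lborel. fhat \<theta> p = complex_of_real (indicator B p / J)"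
    unfolding \<theta>_def by (rule fhat_inv_fourier[OF sB])
  have mB: "(\<lambda>p. complex_of_real (indicator B p / J)) \<in> borel_measurable borel"
    using sB by (rule square_integrable_measurable)
  have "cinner \<eta> \<theta> = (\<integral>p. cnj (complex_of_real (1 / w p)) * complex_of_real (indicator B p / J) \<partial>lborel)"
    by (rule cinner_fhat_AE[OF fhat_eta \<theta> _ mB]) measurable
  also have "\<dots> = (\<integral>p. complex_of_real (1 / J * (indicator B p / w p)) \<partial>lborel)"
    by (intro Bochner_Integration.integral_cong) (auto simp: mult_ac)
  also have "\<dots> = complex_of_real (1 / J * J)"
    unfolding integral_complex_of_real integral_mult_right_zero J_def[symmetric] ..
  finally have 1: "cinner \<eta> \<theta> = 1" using J0 by simp
  have Q\<theta>: "AE p in lborel. fhat (Q \<theta>) p = complex_of_real (1 / sqrt (w p) * (indicator B p / J))"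
    using fhat_fmul[OF sqrt_w_measurable(1) sqrt_w(2), of \<theta>] \<theta> unfolding Q_def[symmetric]
    by eventually_elim simp
  have mQ: "(\<lambda>p. complex_of_real (1 / sqrt (w p) * (indicator B p / J))) \<in> borel_measurable borel"
    by (simp only: of_real_mult) (intro borel_measurable_times mB, measurable)
  have "complex_of_real ((norm (Q \<theta>))\<^sup>2) = cinner (Q \<theta>) (Q \<theta>)" by (rule cinner_self[symmetric])
  also have "\<dots> = (\<integral>p. cnj (complex_of_real (1 / sqrt (w p) * (indicator B p / J))) * complex_of_real (1 / sqrt (w p) * (indicator B p / J)) \<partial>lborel)"
    by (rule cinner_fhat_AE[OF Q\<theta> Q\<theta> mQ mQ])
  also have "\<dots> = (\<integral>p. complex_of_real (1 / J\<^sup>2 * (indicator B p / w p)) \<partial>lborel)"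
  proof (intro Bochner_Integration.integral_cong refl)
    fix p
    have "1 / sqrt (w p) * (1 / sqrt (w p)) = 1 / w p" using w_pos[of p] by (simp add: real_sqrt_mult[symmetric])
    then have "1 / sqrt (w p) * (indicator B p / J) * (1 / sqrt (w p) * (indicator B p / J)) = 1 / J\<^sup>2 * (indicator B p / w p)"
      by (auto simp: indicator_def power2_eq_square field_simps)
    then show "cnj (complex_of_real (1 / sqrt (w p) * (indicator B p / J))) * complex_of_real (1 / sqrt (w p) * (indicator B p / J))
        = complex_of_real (1 / J\<^sup>2 * (indicator B p / w p))"
      by (simp only: complex_cnj_complex_of_real of_real_mult[symmetric])
  qed
  also have "\<dots> = complex_of_real (1 / J\<^sup>2 * J)"
    unfolding integral_complex_of_real integral_mult_right_zero J_def[symmetric] ..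
  finally have "(norm (Q \<theta>))\<^sup>2 = 1 / J\<^sup>2 * J" by (simp only: of_real_eq_iff)
  also have "\<dots> = 1 / J" using J0 by (simp add: power2_eq_square)
  also have "\<dots> < e\<^sup>2" using J J0 assms by (simp add: field_simps)
  finally have "norm (Q \<theta>) < e" using assms by (simp add: power2_less_imp_less)
  with 1 show ?thesis by blast
qed

sublocale singular_perturbation Q \<eta> "1 / sqrt lam"
proof
  fix u v :: L2 and c :: complex and e :: real
  show "Q (u + v) = Q u + Q v" unfolding Q_def by (rule fmul_add[OF sqrt_w_measurable(1) sqrt_w(2)])
  show "Q (c *\<^sub>C u) = c *\<^sub>C Q u" unfolding Q_def by (rule fmul_scaleC[OF sqrt_w_measurable(1) sqrt_w(2)])
  show "1 / sqrt lam > 0" using lam_pos by simp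
  show "norm (Q u) \<le> 1 / sqrt lam * norm u" unfolding Q_def by (rule fmul_norm[OF sqrt_w_measurable(1) sqrt_w(2)])
  show "cinner (Q u) v = cinner u (Q v)" unfolding Q_def by (rule fmul_sym[OF sqrt_w_measurable(1) sqrt_w(2)])
  show "Q u = 0 \<Longrightarrow> u = 0"
  proof -
    assume "Q u = 0"
    then have "AE p in lborel. fhat u p = complex_of_real (1 / (1 / sqrt (w p))) * fhat 0 p"
      using range_fmul(2)[OF sqrt_w_measurable(1) sqrt_w(2) sqrt_w(1), of 0 u] unfolding Q_def by metis
    moreover have "fourier 0 = 0" using fourier_scaleC[of 0 0] by simp
    ultimately have "AE p in lborel. fhat u p = fhat 0 p"
      using L2_fun_0 by (auto elim: eventually_elim2)
    then show "u = 0" by (rule fhat_eqI)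
  qed
  show "e > 0 \<Longrightarrow> \<exists>\<theta>. cinner \<eta> \<theta> = 1 \<and> norm (Q \<theta>) < e" by (rule concentrating_sequence)
qed

lemma R_fmul: "R = fmul (\<lambda>p. 1 / w p)"
proof (rule ext, rule fhat_eqI)
  fix u
  show "AE p in lborel. fhat (R u) p = fhat (fmul (\<lambda>p. 1 / w p) u) p"
    using fhat_fmul[OF sqrt_w_measurable(1) sqrt_w(2), of u] fhat_fmul[OF sqrt_w_measurable(1) sqrt_w(2), of "Q u"]
      fhat_fmul[OF sqrt_w_measurable(2) sqrt_w(3), of u]
    unfolding Q_def[symmetric] R_def
  proof eventually_elim
    case (elim p)
    have "complex_of_real (1 / sqrt (w p)) * complex_of_real (1 / sqrt (w p)) = complex_of_real (1 / w p)"
      unfolding of_real_mult[symmetric] using w_pos[of p] by (simp add: real_sqrt_mult[symmetric])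
    then show ?case unfolding elim mult.assoc[symmetric] by simp
  qed
qed

lemma fhat_R: "AE p in lborel. fhat (R u) p = fhat u p / complex_of_real (w p)"
  using fhat_fmul[OF sqrt_w_measurable(2) sqrt_w(3), of u] unfolding R_fmul by eventually_elim simp

lemma eq_R_iff: "F = R v \<longleftrightarrow> (AE p in lborel. fhat v p = complex_of_real (w p) * fhat F p)"
  using range_fmul(2)[OF sqrt_w_measurable(2) sqrt_w(3) sqrt_w(4), of F v] unfolding R_fmul by simp

lemma eq_Q_iff: "F = Q v \<longleftrightarrow> (AE p in lborel. fhat v p = complex_of_real (sqrt (w p)) * fhat F p)"
  using range_fmul(2)[OF sqrt_w_measurable(1) sqrt_w(2) sqrt_w(1), of F v] unfolding Q_def by simp

section \<open>Sobolev spaces as ranges and the identification of the operators\<close>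

text \<open>Two-sided comparability of \<open>w\<close> with the Sobolev weight; it makes
  \<open>sobolev s\<close> and \<open>sobolev (s / 2)\<close> coincide with the ranges of
  \<open>R\<close> and \<open>Q\<close>, whatever the value of lam.\<close>

lemma weight_bounds:
  "w p \<le> (1 + lam) * (1 + (norm p)\<^sup>2) powr (s / 2)"
  "(1 + (norm p)\<^sup>2) powr (s / 2) \<le> 2 powr (s / 2) * (1 / lam + 1) * w p"
proof -
  have s0: "s > 0" using s_gt by simp
  have ps: "norm p powr s = ((norm p)\<^sup>2) powr (s / 2)"
  proof (cases "p = 0")
    case False
    then have "(norm p)\<^sup>2 = norm p powr 2" by simp
    then show ?thesis by (simp only: powr_powr) simp
  qed simp
  have "norm p powr s \<le> (1 + (norm p)\<^sup>2) powr (s / 2)"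
    unfolding ps using s0 by (intro powr_mono2) auto
  moreover have "lam * 1 \<le> lam * (1 + (norm p)\<^sup>2) powr (s / 2)"
    using lam_pos s0 by (intro mult_left_mono ge_one_powr_ge_zero) auto
  ultimately show "w p \<le> (1 + lam) * (1 + (norm p)\<^sup>2) powr (s / 2)" by (simp add: w_def distrib_right)
  have "1 + (norm p)\<^sup>2 \<le> 2 * max 1 ((norm p)\<^sup>2)" by simp
  then have "(1 + (norm p)\<^sup>2) powr (s / 2) \<le> (2 * max 1 ((norm p)\<^sup>2)) powr (s / 2)"
    using s0 by (intro powr_mono2) auto
  also have "\<dots> = 2 powr (s / 2) * (max 1 ((norm p)\<^sup>2)) powr (s / 2)" by (rule powr_mult) 
  also have "(max 1 ((norm p)\<^sup>2)) powr (s / 2) \<le> 1 + norm p powr s"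
    unfolding ps max_def by auto
  also have "1 + norm p powr s \<le> (1 / lam + 1) * w p"
    using lam_pos by (simp add: w_def field_simps)
  finally show "(1 + (norm p)\<^sup>2) powr (s / 2) \<le> 2 powr (s / 2) * (1 / lam + 1) * w p"
    by (simp add: mult.assoc)
qed

lemma sobolev_half: "sobolev (s / 2) = range Q"
proof (rule set_eqI)
  fix F
  have eq: "(cmod (complex_of_real (1 / (1 / sqrt (w p))) * fhat F p))\<^sup>2 = w p * (cmod (fhat F p))\<^sup>2" for p
    using w_pos[of p] by (simp add: norm_mult power_mult_distrib)
  have "F \<in> range Q \<longleftrightarrow> integrable lborel (\<lambda>p. w p * (cmod (fhat F p))\<^sup>2)"
    unfolding Q_def range_fmul(1)[OF sqrt_w_measurable(1) sqrt_w(2) sqrt_w(1)] square_integrable_def eq by simp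
  also have "\<dots> \<longleftrightarrow> F \<in> sobolev (s / 2)"
    unfolding sobolev_def mem_Collect_eq
  proof (intro iffI; rule integrable_weight_equiv[rotated -1], assumption)
    fix p :: "real^3"
    show "(1 + (norm p)\<^sup>2) powr (s / 2) \<le> (2 powr (s / 2) * (1 / lam + 1)) * w p" by (rule weight_bounds)
    show "w p \<le> (1 + lam) * (1 + (norm p)\<^sup>2) powr (s / 2)" by (rule weight_bounds)
  qed (auto intro: less_imp_le[OF w_pos])
  finally show "F \<in> sobolev (s / 2) \<longleftrightarrow> F \<in> range Q" by simp
qed

lemma sobolev_range_R: "sobolev s = range R"
proof (rule set_eqI)
  fix F
  have eq: "(cmod (complex_of_real (1 / (1 / w p)) * fhat F p))\<^sup>2 = (w p)\<^sup>2 * (cmod (fhat F p))\<^sup>2" for p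
    using w_pos[of p] by (simp add: norm_mult power_mult_distrib)
  have sq: "(1 + (norm p)\<^sup>2) powr s = ((1 + (norm p)\<^sup>2) powr (s / 2))\<^sup>2" for p :: "real^3"
    by (simp add: power2_eq_square powr_add[symmetric])
  have "F \<in> range R \<longleftrightarrow> integrable lborel (\<lambda>p. (w p)\<^sup>2 * (cmod (fhat F p))\<^sup>2)"
    unfolding R_fmul range_fmul(1)[OF sqrt_w_measurable(2) sqrt_w(3) sqrt_w(4)] square_integrable_def eq by simp
  also have "\<dots> \<longleftrightarrow> F \<in> sobolev s"
    unfolding sobolev_def mem_Collect_eq sq
  proof (intro iffI; rule integrable_weight_equiv[rotated -1], assumption)
    fix p :: "real^3"
    show "((1 + (norm p)\<^sup>2) powr (s / 2))\<^sup>2 \<le> (2 powr (s / 2) * (1 / lam + 1))\<^sup>2 * (w p)\<^sup>2"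
      unfolding power_mult_distrib[symmetric] by (intro power_mono weight_bounds) simp
    show "(w p)\<^sup>2 \<le> (1 + lam)\<^sup>2 * ((1 + (norm p)\<^sup>2) powr (s / 2))\<^sup>2"
      unfolding power_mult_distrib[symmetric] by (intro power_mono weight_bounds less_imp_le[OF w_pos])
  qed auto
  finally show "F \<in> sobolev s \<longleftrightarrow> F \<in> range R" by simp
qed

lemma frac_laplacian_shift: "op_shift (frac_laplacian s) (complex_of_real lam) = W"
proof (rule set_eqI, clarify)
  fix f h
  have "(f, h) \<in> op_shift (frac_laplacian s) (complex_of_real lam)
      \<longleftrightarrow> (AE p in lborel. fhat (h - complex_of_real lam *\<^sub>C f) p = complex_of_real (norm p powr s) * fhat f p)"
    by (simp add: mem_op_shift frac_laplacian_def fourier_multiplier_def)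
  also have "\<dots> \<longleftrightarrow> (AE p in lborel. fhat h p = complex_of_real (w p) * fhat f p)"
  proof -
    have "AE p in lborel. fhat (h - complex_of_real lam *\<^sub>C f) p = fhat h p - complex_of_real lam * fhat f p"
      using fhat_diff[of h "complex_of_real lam *\<^sub>C f"] fhat_scaleC[of "complex_of_real lam" f]
      by eventually_elim simp
    then have "AE p in lborel. (fhat (h - complex_of_real lam *\<^sub>C f) p = complex_of_real (norm p powr s) * fhat f p)
        = (fhat h p = complex_of_real (w p) * fhat f p)"
      by eventually_elim (auto simp: w_def algebra_simps)
    then show ?thesis by (rule eventually_subst)
  qed
  also have "\<dots> \<longleftrightarrow> (f, h) \<in> W" unfolding eq_R_iff[symmetric] by (auto simp: W_def)
  finally show "(f, h) \<in> op_shift (frac_laplacian s) (complex_of_real lam) \<longleftrightarrow> (f, h) \<in> W" .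
qed

lemma cinner_eta_R:
  assumes "F = R v"
  shows "integrable lborel (fhat F)" "(\<integral>p. fhat F p \<partial>lborel) = cinner \<eta> v"
proof -
  have ae: "AE p in lborel. fhat F p = fhat v p / complex_of_real (w p)" unfolding assms by (rule fhat_R)
  show "integrable lborel (fhat F)"
    using cinner_eta(2)[of v] ae by (subst integrable_cong_AE[where g="\<lambda>p. fhat v p / complex_of_real (w p)"]) auto
  show "(\<integral>p. fhat F p \<partial>lborel) = cinner \<eta> v"
    unfolding cinner_eta(1) by (rule integral_cong_AE) (use ae in auto)
qed

text \<open>With f = R a the image is v = a + \<tau> \<xi> \<eta>, and then g = R v + \<xi> \<eta>.
  The vanishing integral of the transform of f reads <\<eta>, a> = 0, which becomes <\<eta>, v> =
  \<tau> |\<eta>|^2 \<xi>; hence the parameter \<open>\<tau> * wint\<close>.\<close>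

lemma k_ext_real_shift: "op_shift (k_ext_real s lam \<tau>) (complex_of_real lam) = K (\<tau> * wint)"
proof (rule set_eqI, clarify)
  fix g v
  note ce = cinner_self[of \<eta>, unfolded norm_eta]
  have sqw: "AE p in lborel. fhat (inv_fourier (to_L2 (\<lambda>p. complex_of_real (norm p powr s + lam) *
            (fhat f p + complex_of_real \<tau> * \<xi> / (complex_of_real (norm p powr s + lam))\<^sup>2)))) p
        = fhat a p + complex_of_real \<tau> * \<xi> * fhat \<eta> p"
    and sqw2: "inv_fourier (to_L2 (\<lambda>p. complex_of_real (norm p powr s + lam) *
            (fhat f p + complex_of_real \<tau> * \<xi> / (complex_of_real (norm p powr s + lam))\<^sup>2)))
        = a + (complex_of_real \<tau> * \<xi>) *\<^sub>C \<eta>"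
    if f: "f = R a" for f a \<xi>
  proof -
    let ?h = "\<lambda>p. complex_of_real (norm p powr s + lam) *
            (fhat f p + complex_of_real \<tau> * \<xi> / (complex_of_real (norm p powr s + lam))\<^sup>2)"
    have eq: "?h p = complex_of_real (w p) * fhat f p + complex_of_real \<tau> * \<xi> * complex_of_real (1 / w p)" for p
      using w_nz[of p] unfolding w_def[symmetric] by (simp add: distrib_left power2_eq_square)
    have ae: "AE p in lborel. L2_fun (fourier (a + (complex_of_real \<tau> * \<xi>) *\<^sub>C \<eta>)) p = ?h p"
      using fhat_add[of a "(complex_of_real \<tau> * \<xi>) *\<^sub>C \<eta>"] fhat_scaleC[of "complex_of_real \<tau> * \<xi>" \<eta>]
        fhat_eta f[unfolded eq_R_iff] unfolding eq by eventually_elim simp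
    have "to_L2 ?h = fourier (a + (complex_of_real \<tau> * \<xi>) *\<^sub>C \<eta>)"
      by (rule to_L2_eqI[OF ae]) measurable
    then show i: "inv_fourier (to_L2 ?h) = a + (complex_of_real \<tau> * \<xi>) *\<^sub>C \<eta>" by simp
    show "AE p in lborel. fhat (inv_fourier (to_L2 ?h)) p = fhat a p + complex_of_real \<tau> * \<xi> * fhat \<eta> p"
      unfolding i using fhat_add[of a "(complex_of_real \<tau> * \<xi>) *\<^sub>C \<eta>"] fhat_scaleC[of "complex_of_real \<tau> * \<xi>" \<eta>]
      by eventually_elim simp
  qed
  have geq: "(AE p in lborel. fhat g p = fhat f p
            + complex_of_real \<tau> * \<xi> / (complex_of_real (norm p powr s + lam))\<^sup>2
            + \<xi> / complex_of_real (norm p powr s + lam))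
      \<longleftrightarrow> g = R (a + (complex_of_real \<tau> * \<xi>) *\<^sub>C \<eta>) + \<xi> *\<^sub>C \<eta>" if f: "f = R a" for f a \<xi>
  proof -
    let ?G = "R (a + (complex_of_real \<tau> * \<xi>) *\<^sub>C \<eta>) + \<xi> *\<^sub>C \<eta>"
    have G: "AE p in lborel. fhat ?G p = fhat f p
            + complex_of_real \<tau> * \<xi> / (complex_of_real (norm p powr s + lam))\<^sup>2
            + \<xi> / complex_of_real (norm p powr s + lam)"
      using fhat_add[of "R (a + (complex_of_real \<tau> * \<xi>) *\<^sub>C \<eta>)" "\<xi> *\<^sub>C \<eta>"] fhat_scaleC[of \<xi> \<eta>]
        fhat_add[of a "(complex_of_real \<tau> * \<xi>) *\<^sub>C \<eta>"] fhat_scaleC[of "complex_of_real \<tau> * \<xi>" \<eta>]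
        fhat_R[of "a + (complex_of_real \<tau> * \<xi>) *\<^sub>C \<eta>"] fhat_R[of a] fhat_eta
      unfolding w_def[symmetric] f
      by eventually_elim (simp add: add_divide_distrib power2_eq_square)
    show ?thesis
    proof
      assume "AE p in lborel. fhat g p = fhat f p
            + complex_of_real \<tau> * \<xi> / (complex_of_real (norm p powr s + lam))\<^sup>2
            + \<xi> / complex_of_real (norm p powr s + lam)"
      then have "AE p in lborel. fhat g p = fhat ?G p" using G by eventually_elim simp
      then show "g = ?G" by (rule fhat_eqI)
    next
      assume "g = ?G"
      then show "AE p in lborel. fhat g p = fhat f p
            + complex_of_real \<tau> * \<xi> / (complex_of_real (norm p powr s + lam))\<^sup>2
            + \<xi> / complex_of_real (norm p powr s + lam)" using G by simp
    qed
  qed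
  show "(g, v) \<in> op_shift (k_ext_real s lam \<tau>) (complex_of_real lam) \<longleftrightarrow> (g, v) \<in> K (\<tau> * wint)"
  proof
    assume "(g, v) \<in> op_shift (k_ext_real s lam \<tau>) (complex_of_real lam)"
    then obtain f \<xi> where f: "f \<in> sobolev s" "(\<integral>p. fhat f p \<partial>lborel) = 0"
      and g: "AE p in lborel. fhat g p = fhat f p
            + complex_of_real \<tau> * \<xi> / (complex_of_real (norm p powr s + lam))\<^sup>2
            + \<xi> / complex_of_real (norm p powr s + lam)"
      and v: "v = inv_fourier (to_L2 (\<lambda>p. complex_of_real (norm p powr s + lam) *
            (fhat f p + complex_of_real \<tau> * \<xi> / (complex_of_real (norm p powr s + lam))\<^sup>2)))"
      unfolding mem_op_shift k_ext_real_def by auto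
    obtain a where a: "f = R a" using f(1) unfolding sobolev_range_R by blast
    have v': "v = a + (complex_of_real \<tau> * \<xi>) *\<^sub>C \<eta>" using v sqw2[OF a, of \<xi>] by simp
    have "cinner \<eta> v = complex_of_real (\<tau> * wint) * \<xi>"
      using cinner_eta_R(2)[OF a] f(2) by (simp add: v' cinner_simps ce)
    moreover have "g = R v + \<xi> *\<^sub>C \<eta>" using g unfolding geq[OF a] v' .
    ultimately show "(g, v) \<in> K (\<tau> * wint)" unfolding K_def by blast
  next
    assume "(g, v) \<in> K (\<tau> * wint)"
    then obtain \<xi> where \<xi>: "g = R v + \<xi> *\<^sub>C \<eta>" "cinner \<eta> v = complex_of_real (\<tau> * wint) * \<xi>"
      by (auto simp: K_def)
    define a where "a = v - (complex_of_real \<tau> * \<xi>) *\<^sub>C \<eta>"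
    have va: "v = a + (complex_of_real \<tau> * \<xi>) *\<^sub>C \<eta>" by (simp add: a_def)
    have "(\<integral>p. fhat (R a) p \<partial>lborel) = 0"
      using cinner_eta_R(2)[OF refl, of a] \<xi>(2) by (simp add: a_def cinner_simps ce)
    moreover have "R a \<in> sobolev s" unfolding sobolev_range_R by blast
    moreover have "AE p in lborel. fhat g p = fhat (R a) p
            + complex_of_real \<tau> * \<xi> / (complex_of_real (norm p powr s + lam))\<^sup>2
            + \<xi> / complex_of_real (norm p powr s + lam)"
      by (rule geq[OF refl, THEN iffD2]) (simp add: \<xi>(1) va[symmetric])
    moreover have "v - complex_of_real lam *\<^sub>C g + complex_of_real lam *\<^sub>C g
        = inv_fourier (to_L2 (\<lambda>p. complex_of_real (norm p powr s + lam) *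
            (fhat (R a) p + complex_of_real \<tau> * \<xi> / (complex_of_real (norm p powr s + lam))\<^sup>2)))"
      unfolding sqw2[OF refl] va[symmetric] by simp
    ultimately show "(g, v) \<in> op_shift (k_ext_real s lam \<tau>) (complex_of_real lam)"
      unfolding mem_op_shift k_ext_real_def by blast
  qed
qed

end

section \<open>A smooth bump function\<close>

text \<open>Polynomials in 1/x times the flat exponential: a family stable under differentiation, so
  smoothness at 0 is obtained for all orders at once.\<close>

definition exp_inv :: "real poly \<Rightarrow> real \<Rightarrow> real" where
  "exp_inv P x = (if x > 0 then poly P (inverse x) * exp (- inverse x) else 0)"

lemma poly_mult_exp_tendsto_0:
  fixes P :: "real poly"
  shows "((\<lambda>u. poly P u * exp (- u)) \<longlongrightarrow> 0) at_top"
proof -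
  have "((\<lambda>u. \<Sum>i\<le>degree P. coeff P i * (u ^ i / exp u)) \<longlongrightarrow> (\<Sum>i\<le>degree P. coeff P i * 0)) at_top"
    by (intro tendsto_sum tendsto_mult tendsto_const tendsto_power_div_exp_0)
  moreover have "(\<Sum>i\<le>degree P. coeff P i * (u ^ i / exp u)) = poly P u * exp (- u)" for u
    by (simp add: poly_altdef sum_distrib_right exp_minus divide_inverse mult.assoc)
  ultimately show ?thesis by simp
qed

text \<open>The factor u^2 with u = 1/x comes from the chain rule. At 0 the right difference
  quotient is again of this kind, with polynomial u P(u), and tends to 0.\<close>

lemma exp_inv_deriv:
  "(exp_inv P has_real_derivative exp_inv ([:0, 0, 1:] * (P - pderiv P)) x) (at x)"
proof -
  let ?P' = "[:0, 0, 1:] * (P - pderiv P)"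
  consider "x > 0" | "x < 0" | "x = 0" by linarith
  then show ?thesis
  proof cases
    case 1
    have "((\<lambda>x. poly P (inverse x) * exp (- inverse x)) has_real_derivative
        poly (pderiv P) (inverse x) * (- (inverse x * inverse x)) * exp (- inverse x)
        + exp (- inverse x) * (inverse x * inverse x) * poly P (inverse x)) (at x)"
      using 1 by (auto intro!: derivative_eq_intros DERIV_chain'[where g="poly P", OF _ poly_DERIV] simp: power2_eq_square)
    moreover have "poly (pderiv P) (inverse x) * (- (inverse x * inverse x)) * exp (- inverse x)
        + exp (- inverse x) * (inverse x * inverse x) * poly P (inverse x) = exp_inv ?P' x"
      using 1 by (simp add: exp_inv_def algebra_simps)
    ultimately have "((\<lambda>x. poly P (inverse x) * exp (- inverse x)) has_real_derivative exp_inv ?P' x) (at x)" by simp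
    then show ?thesis
      by (rule has_field_derivative_transform_within_open[where S="{0<..}"])
        (use 1 in \<open>auto simp: exp_inv_def\<close>)
  next
    case 2
    have "((\<lambda>x. 0::real) has_real_derivative exp_inv ?P' x) (at x)"
      using 2 by (simp add: exp_inv_def)
    then show ?thesis
      by (rule has_field_derivative_transform_within_open[where S="{..<0}"])
        (use 2 in \<open>auto simp: exp_inv_def\<close>)
  next
    case 3
    have "((\<lambda>h. (exp_inv P (0 + h) - exp_inv P 0) / h) \<longlongrightarrow> 0) (at 0)"
    proof (rule filterlim_split_at)
      have "\<forall>\<^sub>F h in at_left 0. (exp_inv P (0 + h) - exp_inv P 0) / h = 0"
        by (rule eventually_at_leftI[of "-1"]) (auto simp: exp_inv_def)
      then show "((\<lambda>h. (exp_inv P (0 + h) - exp_inv P 0) / h) \<longlongrightarrow> 0) (at_left 0)"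
        by (rule tendsto_eventually)
      have "((\<lambda>h. poly (pCons 0 P) (inverse h) * exp (- inverse h)) \<longlongrightarrow> 0) (at_right 0)"
        by (rule filterlim_compose[OF poly_mult_exp_tendsto_0 filterlim_inverse_at_top_right])
      moreover have "\<forall>\<^sub>F h in at_right 0. poly (pCons 0 P) (inverse h) * exp (- inverse h) = (exp_inv P (0 + h) - exp_inv P 0) / h"
        by (rule eventually_at_rightI[of _ 1]) (auto simp: exp_inv_def field_simps)
      ultimately show "((\<lambda>h. (exp_inv P (0 + h) - exp_inv P 0) / h) \<longlongrightarrow> 0) (at_right 0)"
        by (rule Lim_transform_eventually)
    qed
    then show ?thesis using 3 by (simp add: DERIV_def exp_inv_def)
  qed
qed

text \<open>A class closed under differentiation whose members vanish for |x| \<ge> 1, so that every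
  derivative of the bump is again differentiable and supported in the interval.\<close>

inductive bump_fun :: "(real \<Rightarrow> real) \<Rightarrow> bool" where
  base: "bump_fun (\<lambda>x. exp_inv P (1 + x) * exp_inv Q (1 - x))"
| add: "bump_fun f \<Longrightarrow> bump_fun g \<Longrightarrow> bump_fun (\<lambda>x. f x + g x)"

lemma bump_fun_deriv: "bump_fun f \<Longrightarrow> \<exists>g. bump_fun g \<and> (\<forall>x. (f has_real_derivative g x) (at x))"
proof (induction rule: bump_fun.induct)
  case (base P Q)
  define P' where "P' = [:0, 0, 1:] * (P - pderiv P)"
  define Q' where "Q' = [:0, 0, 1:] * (Q - pderiv Q)"
  have neg: "exp_inv (- S) x = - exp_inv S x" for S x by (simp add: exp_inv_def)
  have "((\<lambda>x. exp_inv P (1 + x) * exp_inv Q (1 - x)) has_real_derivative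
      (exp_inv P' (1 + x) * exp_inv Q (1 - x) + exp_inv P (1 + x) * exp_inv (- Q') (1 - x))) (at x)" for x
    unfolding neg
    unfolding P'_def Q'_def
    by (auto intro!: derivative_eq_intros DERIV_chain'[where g="exp_inv P", OF _ exp_inv_deriv]
        DERIV_chain'[where g="exp_inv Q", OF _ exp_inv_deriv] simp del: mult_pCons_left)
  then show ?case using bump_fun.add[OF bump_fun.base bump_fun.base] by blast
next
  case (add f g)
  then obtain f' g' where "bump_fun f'" "bump_fun g'"
    "\<And>x. (f has_real_derivative f' x) (at x)" "\<And>x. (g has_real_derivative g' x) (at x)" by blast
  then show ?case using bump_fun.add by (blast intro: DERIV_add)
qed

lemma bump_fun_zero: "bump_fun f \<Longrightarrow> 1 \<le> \<bar>x\<bar> \<Longrightarrow> f x = 0"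
  by (induction rule: bump_fun.induct) (auto simp: exp_inv_def)

definition bump :: "nat \<Rightarrow> real \<Rightarrow> real" where
  "bump k = (deriv ^^ k) (\<lambda>x. exp_inv 1 (1 + x) * exp_inv 1 (1 - x))"

lemma bump_fun_bump: "bump_fun (bump k)"
proof (induction k)
  case 0 show ?case unfolding bump_def by (simp add: bump_fun.base)
next
  case (Suc k)
  obtain g where g: "bump_fun g" "\<And>x. (bump k has_real_derivative g x) (at x)"
    using bump_fun_deriv[OF Suc] by blast
  then have "bump (Suc k) = g" by (auto simp: bump_def fun_eq_iff DERIV_imp_deriv)
  then show ?case using g by simp
qed

lemma bump_deriv: "(bump k has_real_derivative bump (Suc k) x) (at x)"
proof -
  obtain g where g: "\<And>x. (bump k has_real_derivative g x) (at x)"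
    using bump_fun_deriv[OF bump_fun_bump] by blast
  then have "bump (Suc k) = g" by (auto simp: bump_def fun_eq_iff DERIV_imp_deriv)
  then show ?thesis using g by simp
qed

lemma bump_zero: "1 \<le> \<bar>x\<bar> \<Longrightarrow> bump k x = 0"
  by (rule bump_fun_zero[OF bump_fun_bump])

lemma bump_continuous: "continuous_on S (bump k)"
  by (intro continuous_at_imp_continuous_on ballI DERIV_isCont[OF bump_deriv])

lemma bump_0_pos: "0 \<le> bump 0 x" "\<bar>x\<bar> < 1 \<Longrightarrow> 0 < bump 0 x"
  by (auto simp: bump_def exp_inv_def)

lemma bump_integrable: "integrable lborel (\<lambda>x. exp (- \<i> * complex_of_real (t * x)) * complex_of_real (bump k x))"
proof -
  have "set_integrable lborel {-1..1} (\<lambda>x. exp (- \<i> * complex_of_real (t * x)) * complex_of_real (bump k x))"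
    unfolding set_integrable_def
    by (intro borel_integrable_compact continuous_intros bump_continuous) auto
  moreover have "indicator {-1..1} x *\<^sub>R (exp (- \<i> * complex_of_real (t * x)) * complex_of_real (bump k x))
      = exp (- \<i> * complex_of_real (t * x)) * complex_of_real (bump k x)" for x
    using bump_zero[of x k] by (auto simp: indicator_def)
  ultimately show ?thesis by (simp add: set_integrable_def)
qed

definition bump_ft :: "nat \<Rightarrow> real \<Rightarrow> complex" where
  "bump_ft k t = (\<integral>x. exp (- \<i> * complex_of_real (t * x)) * complex_of_real (bump k x) \<partial>lborel)"

text \<open>Integration by parts on [-1, 1]; the boundary terms vanish with the bump.\<close>

lemma bump_ft_Suc: "bump_ft (Suc k) t = \<i> * complex_of_real t * bump_ft k t"
proof -
  let ?e = "\<lambda>x. exp (- \<i> * complex_of_real (t * x))"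
  let ?f = "\<lambda>x. ?e x * complex_of_real (bump (Suc k) x) - \<i> * complex_of_real t * (?e x * complex_of_real (bump k x))"
  have "(LBINT x. indicator {-1..1} x *\<^sub>R ?f x) = ?e 1 * complex_of_real (bump k 1) - ?e (-1) * complex_of_real (bump k (-1))"
  proof (rule integral_FTC_Icc)
    fix x :: real
    have b: "((\<lambda>x. complex_of_real (bump k x)) has_vector_derivative complex_of_real (bump (Suc k) x)) (at x within {-1..1})"
      by (intro has_vector_derivative_of_real)
        (metis bump_deriv has_real_derivative_iff_has_vector_derivative has_vector_derivative_at_within)
    have "((\<lambda>z. exp (- \<i> * (complex_of_real t * z))) has_field_derivative
        exp (- \<i> * (complex_of_real t * complex_of_real x)) * (- \<i> * complex_of_real t)) (at (complex_of_real x))"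
      by (auto intro!: derivative_eq_intros)
    from has_vector_derivative_real_field[OF this]
    have "(?e has_vector_derivative ?e x * (- \<i> * complex_of_real t)) (at x within {-1..1})"
      by simp
    from has_vector_derivative_mult[OF this b]
    show "((\<lambda>x. ?e x * complex_of_real (bump k x)) has_vector_derivative ?f x) (at x within {-1..1})"
      by (simp add: algebra_simps)
  next
    show "continuous_on {-1..1} ?f" by (intro continuous_intros bump_continuous)
  qed simp
  then have "(LBINT x. indicator {-1..1} x *\<^sub>R ?f x) = 0" by (simp add: bump_zero)
  moreover have "indicator {-1..1} x *\<^sub>R ?f x = ?f x" for x
    using bump_zero[of x k] bump_zero[of x "Suc k"] by (auto simp: indicator_def)
  ultimately have "(LBINT x. ?f x) = 0" by simp
  moreover have "(LBINT x. ?f x) = bump_ft (Suc k) t - \<i> * complex_of_real t * bump_ft k t"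
    unfolding bump_ft_def integral_mult_right_zero[symmetric]
    by (intro Bochner_Integration.integral_diff bump_integrable integrable_mult_right)
  ultimately show ?thesis by simp
qed

lemma bump_ft_bound: "cmod (bump_ft k t) \<le> (\<integral>x. \<bar>bump k x\<bar> \<partial>lborel)"
  unfolding bump_ft_def by (rule order_trans[OF integral_norm_bound]) (simp add: norm_mult)

lemma bump_ft_decay: "\<bar>t\<bar> ^ k * cmod (bump_ft 0 t) \<le> (\<integral>x. \<bar>bump k x\<bar> \<partial>lborel)"
proof -
  have "cmod (bump_ft k t) = \<bar>t\<bar> ^ k * cmod (bump_ft 0 t)"
    by (induction k) (simp_all add: bump_ft_Suc norm_mult)
  then show ?thesis using bump_ft_bound[of k t] by simp
qed

lemma bump_ft_0_nonzero: "bump_ft 0 0 \<noteq> 0"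
proof
  assume "bump_ft 0 0 = 0"
  then have z: "(\<integral>x. bump 0 x \<partial>lborel) = 0" by (simp add: bump_ft_def integral_complex_of_real)
  have "integrable lborel (bump 0)" using integrable_Re[OF bump_integrable[of 0 0]] by simp
  from integral_nonneg_eq_0_iff_AE[OF this] z have "AE x in lborel. bump 0 x = 0" by (simp add: bump_0_pos)
  then have "AE x in lborel. x \<notin> {-1<..<1::real}"
    by eventually_elim (use bump_0_pos(2) in \<open>force simp: abs_less_iff\<close>)
  then have "emeasure lborel {-1<..<1::real} = 0"
    by (subst (asm) AE_iff_measurable[where N="{-1<..<1::real}"]) auto
  then show False by simp
qed

section \<open>Product bumps in three dimensions\<close>

text \<open>Here k is the order of the derivative in each coordinate, a the inverse scale and y the
  centre. Admitting all k closes the family under partial derivatives up to factors, which drives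
  the induction for smoothness.\<close>

definition bump3 :: "(real^3 \<Rightarrow> nat) \<Rightarrow> real \<Rightarrow> real^3 \<Rightarrow> real^3 \<Rightarrow> complex" where
  "bump3 k a y x = (\<Prod>b\<in>Basis. complex_of_real (bump (k b) (a * ((x - y) \<bullet> b))))"

lemma n_times_differentiable_add:
  fixes f g :: "real^3 \<Rightarrow> complex"
  shows "n_times_differentiable n f \<Longrightarrow> n_times_differentiable n g \<Longrightarrow> n_times_differentiable n (\<lambda>x. f x + g x)"
proof (induction n arbitrary: f g)
  case 0 then show ?case by (auto intro: continuous_intros)
next
  case (Suc n)
  have d: "(f has_derivative frechet_derivative f (at x)) (at x)" "(g has_derivative frechet_derivative g (at x)) (at x)" for x
    using Suc.prems by (auto simp: frechet_derivative_works)
  have "frechet_derivative (\<lambda>x. f x + g x) (at x) = (\<lambda>v. frechet_derivative f (at x) v + frechet_derivative g (at x) v)" for x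
    by (rule frechet_derivative_at[symmetric]) (intro has_derivative_add d)
  then show ?case using Suc by (auto intro!: differentiable_add)
qed

lemma n_times_differentiable_cmult:
  fixes f :: "real^3 \<Rightarrow> complex"
  shows "n_times_differentiable n f \<Longrightarrow> n_times_differentiable n (\<lambda>x. c * f x)"
proof (induction n arbitrary: f)
  case 0 then show ?case by (auto intro: continuous_intros)
next
  case (Suc n)
  have d: "(f has_derivative frechet_derivative f (at x)) (at x)" for x
    using Suc.prems by (auto simp: frechet_derivative_works)
  have "frechet_derivative (\<lambda>x. c * f x) (at x) = (\<lambda>v. c * frechet_derivative f (at x) v)" for x
    by (rule frechet_derivative_at[symmetric]) (intro has_derivative_mult_right d)
  then show ?case using Suc by (auto intro!: differentiable_mult)
qed

lemma n_times_differentiable_sum: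
  fixes f :: "'i \<Rightarrow> real^3 \<Rightarrow> complex"
  assumes "finite I" "\<And>i. i \<in> I \<Longrightarrow> n_times_differentiable n (f i)"
  shows "n_times_differentiable n (\<lambda>x. \<Sum>i\<in>I. f i x)"
  using assms
proof (induction I rule: finite_induct)
  case empty
  have "n_times_differentiable n (\<lambda>x::real^3. 0::complex)"
    by (induction n) (auto simp: frechet_derivative_const)
  then show ?case by simp
next
  case (insert i I) then show ?case by (simp add: n_times_differentiable_add)
qed

lemma bump3_has_derivative:
  "(bump3 k a y has_derivative (\<lambda>v. \<Sum>b\<in>Basis. complex_of_real (a * (v \<bullet> b)) * bump3 (k(b := Suc (k b))) a y x)) (at x)"
proof -
  have 1: "((\<lambda>x. complex_of_real (bump (k b) (a * ((x - y) \<bullet> b)))) has_derivative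
      (\<lambda>v. complex_of_real (bump (Suc (k b)) (a * ((x - y) \<bullet> b)) * (a * (v \<bullet> b))))) (at x)" for b
  proof -
    have "((\<lambda>x. a * ((x - y) \<bullet> b)) has_derivative (\<lambda>v. a * (v \<bullet> b))) (at x)"
      by (auto intro!: derivative_eq_intros)
    from has_derivative_compose[OF this bump_deriv[of "k b", unfolded has_field_derivative_def]]
    show ?thesis by (intro has_derivative_of_real)
  qed
  have "(bump3 k a y has_derivative (\<lambda>v. \<Sum>b\<in>Basis. complex_of_real (bump (Suc (k b)) (a * ((x - y) \<bullet> b)) * (a * (v \<bullet> b)))
      * (\<Prod>c\<in>Basis - {b}. complex_of_real (bump (k c) (a * ((x - y) \<bullet> c)))))) (at x)"
    unfolding bump3_def[abs_def] by (rule has_derivative_prod) (rule 1)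
  moreover have "complex_of_real (bump (Suc (k b)) (a * ((x - y) \<bullet> b)) * (a * (v \<bullet> b)))
      * (\<Prod>c\<in>Basis - {b}. complex_of_real (bump (k c) (a * ((x - y) \<bullet> c))))
      = complex_of_real (a * (v \<bullet> b)) * bump3 (k(b := Suc (k b))) a y x" if "b \<in> Basis" for b v
  proof -
    have "bump3 (k(b := Suc (k b))) a y x = complex_of_real (bump (Suc (k b)) (a * ((x - y) \<bullet> b)))
        * (\<Prod>c\<in>Basis - {b}. complex_of_real (bump (k c) (a * ((x - y) \<bullet> c))))"
      unfolding bump3_def by (subst prod.remove[OF _ that]) (auto intro!: prod.cong)
    then show ?thesis by (simp add: mult_ac)
  qed
  then have "(\<lambda>v. \<Sum>b\<in>Basis. complex_of_real (bump (Suc (k b)) (a * ((x - y) \<bullet> b)) * (a * (v \<bullet> b)))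
      * (\<Prod>c\<in>Basis - {b}. complex_of_real (bump (k c) (a * ((x - y) \<bullet> c)))))
      = (\<lambda>v. \<Sum>b\<in>Basis. complex_of_real (a * (v \<bullet> b)) * bump3 (k(b := Suc (k b))) a y x)"
    by (intro ext sum.cong refl)
  ultimately show ?thesis by (simp only:)
qed

lemma bump3_smooth: "n_times_differentiable n (bump3 k a y)"
proof (induction n arbitrary: k)
  case 0
  have "continuous_on UNIV (bump3 k a y)"
    by (intro continuous_at_imp_continuous_on ballI has_derivative_continuous[OF bump3_has_derivative])
  then show ?case by simp
next
  case (Suc n)
  have fd: "frechet_derivative (bump3 k a y) (at x)
      = (\<lambda>v. \<Sum>b\<in>Basis. complex_of_real (a * (v \<bullet> b)) * bump3 (k(b := Suc (k b))) a y x)" for x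
    by (rule frechet_derivative_at[symmetric, OF bump3_has_derivative])
  have "n_times_differentiable n (\<lambda>x. \<Sum>b\<in>Basis. complex_of_real (a * (v \<bullet> b)) * bump3 (k(b := Suc (k b))) a y x)" for v
    by (intro n_times_differentiable_sum n_times_differentiable_cmult Suc) simp
  moreover have "bump3 k a y differentiable (at x)" for x
    using bump3_has_derivative differentiable_def by blast
  ultimately show ?case by (simp add: fd)
qed

definition rho :: "real^3 \<Rightarrow> complex" where
  "rho x = (\<Prod>b\<in>Basis. complex_of_real (bump 0 (x \<bullet> b)))"

lemma
  shows rho_exp_integrable: "integrable lborel (\<lambda>x. exp (- \<i> * complex_of_real (q \<bullet> x)) * rho x)"
    and ft_rho: "ft rho q = fconst * (\<Prod>b\<in>Basis. bump_ft 0 (q \<bullet> b))"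
proof -
  have eq: "(\<lambda>x. exp (- \<i> * complex_of_real (q \<bullet> x)) * rho x)
      = (\<lambda>x. \<Prod>b\<in>Basis. exp (- \<i> * complex_of_real ((q \<bullet> b) * (x \<bullet> b))) * complex_of_real (bump 0 (x \<bullet> b)))"
  proof
    fix x
    have "(\<Prod>b\<in>Basis. exp (- \<i> * complex_of_real ((q \<bullet> b) * (x \<bullet> b)))) = exp (- \<i> * complex_of_real (q \<bullet> x))"
      by (subst exp_sum[symmetric]) (simp_all add: euclidean_inner[of q x] sum_distrib_left sum_negf)
    then show "exp (- \<i> * complex_of_real (q \<bullet> x)) * rho x
        = (\<Prod>b\<in>Basis. exp (- \<i> * complex_of_real ((q \<bullet> b) * (x \<bullet> b))) * complex_of_real (bump 0 (x \<bullet> b)))"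
      unfolding prod.distrib rho_def by simp
  qed
  show "integrable lborel (\<lambda>x. exp (- \<i> * complex_of_real (q \<bullet> x)) * rho x)"
    unfolding eq by (rule integrable_lborel_prod) (rule bump_integrable)
  show "ft rho q = fconst * (\<Prod>b\<in>Basis. bump_ft 0 (q \<bullet> b))"
    unfolding ft_def eq bump_ft_def
    by (intro arg_cong[where f="\<lambda>z. fconst * z"] integral_lborel_prod) (rule bump_integrable)
qed

lemma rho_integrable: "integrable lborel rho"
  using rho_exp_integrable[of 0] by simp

lemma ft_rho_0: "ft rho 0 \<noteq> 0"
  unfolding ft_rho using bump_ft_0_nonzero fconst_pos by simp

text \<open>Some coordinate carries at least a third of |q|, and five integrations by parts in it
  give the power. The exponent 5 exceeds 2 s, which keeps w^2 times the transform bounded.\<close>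

lemma ft_rho_decay:
  obtains C where "C > 0" "\<And>q. (1 + norm q ^ 5) * cmod (ft rho q) \<le> C"
proof -
  define M where "M k = (\<integral>x. \<bar>bump k x\<bar> \<partial>lborel)" for k
  have M0: "M k \<ge> 0" for k unfolding M_def by simp
  have b0: "cmod (bump_ft 0 t) \<le> M 0" for t unfolding M_def by (rule bump_ft_bound)
  have b5: "\<bar>t\<bar> ^ 5 * cmod (bump_ft 0 t) \<le> M 5" for t unfolding M_def by (rule bump_ft_decay)
  define c where "c = cmod fconst"
  have c0: "c \<ge> 0" by (simp add: c_def)
  have card: "card (Basis :: (real^3) set) = 3" by simp
  have bnd: "(1 + norm q ^ 5) * cmod (ft rho q) \<le> c * M 0 ^ 3 + 3 ^ 5 * c * (M 5 * M 0 ^ 2)" for q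
  proof -
    have ft: "cmod (ft rho q) = c * (\<Prod>b\<in>Basis. cmod (bump_ft 0 (q \<bullet> b)))"
      by (simp add: ft_rho norm_mult c_def prod_norm)
    have 1: "cmod (ft rho q) \<le> c * M 0 ^ 3"
    proof -
      have "(\<Prod>b\<in>(Basis::(real^3) set). cmod (bump_ft 0 (q \<bullet> b))) \<le> (\<Prod>b\<in>(Basis::(real^3) set). M 0)"
        by (intro prod_mono) (auto simp: b0)
      then show ?thesis unfolding ft using c0 by (simp add: mult_left_mono)
    qed
    have "\<exists>b\<in>Basis. norm q \<le> 3 * \<bar>q \<bullet> b\<bar>"
    proof (rule ccontr)
      assume "\<not> ?thesis"
      then have "(\<Sum>b\<in>Basis. \<bar>q \<bullet> b\<bar>) < (\<Sum>b\<in>(Basis::(real^3) set). norm q / 3)"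
        by (intro sum_strict_mono) (auto simp: not_le)
      also have "\<dots> = norm q" by (simp add: card)
      finally show False using norm_le_l1[of q] by simp
    qed
    then obtain b where b: "b \<in> Basis" "norm q \<le> 3 * \<bar>q \<bullet> b\<bar>" by blast
    have "norm q ^ 5 \<le> (3 * \<bar>q \<bullet> b\<bar>) ^ 5" using b by (intro power_mono) auto
    then have nq: "norm q ^ 5 \<le> 3 ^ 5 * \<bar>q \<bullet> b\<bar> ^ 5" by (simp add: power_mult_distrib)
    have rest: "(\<Prod>d\<in>Basis - {b}. cmod (bump_ft 0 (q \<bullet> d))) \<le> M 0 ^ 2"
    proof -
      have "(\<Prod>d\<in>Basis - {b}. cmod (bump_ft 0 (q \<bullet> d))) \<le> (\<Prod>d\<in>Basis - {b}. M 0)"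
        by (intro prod_mono) (auto simp: b0)
      also have "\<dots> = M 0 ^ 2" using b(1) by (simp add: card_Diff_singleton)
      finally show ?thesis .
    qed
    have "norm q ^ 5 * cmod (ft rho q) \<le> 3 ^ 5 * \<bar>q \<bullet> b\<bar> ^ 5 * cmod (ft rho q)"
      by (intro mult_right_mono nq) simp
    also have "\<dots> = 3 ^ 5 * c * ((\<bar>q \<bullet> b\<bar> ^ 5 * cmod (bump_ft 0 (q \<bullet> b))) * (\<Prod>d\<in>Basis - {b}. cmod (bump_ft 0 (q \<bullet> d))))"
      unfolding ft by (subst prod.remove[OF _ b(1)]) (simp_all add: mult_ac)
    also have "\<dots> \<le> 3 ^ 5 * c * (M 5 * M 0 ^ 2)"
      by (intro mult_left_mono mult_mono b5 rest M0 prod_nonneg) (use c0 in auto)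
    finally show ?thesis using 1 by (simp add: distrib_right)
  qed
  have "c * M 0 ^ 3 + 3 ^ 5 * c * (M 5 * M 0 ^ 2) \<ge> 0" using c0 M0 by simp
  then show thesis
    using that[of "c * M 0 ^ 3 + 3 ^ 5 * c * (M 5 * M 0 ^ 2) + 1"] bnd by (smt (verit))
qed

definition rho_scaled :: "real \<Rightarrow> real^3 \<Rightarrow> real^3 \<Rightarrow> complex" where
  "rho_scaled e y = bump3 (\<lambda>_. 0) (1 / e) y"

lemma rho_scaled_eq: "rho_scaled e y x = rho ((1 / e) *\<^sub>R (x - y))"
  by (simp add: rho_scaled_def bump3_def rho_def)

lemma rho_scaled_affine: "e \<noteq> 0 \<Longrightarrow> rho_scaled e y (y + e *\<^sub>R x) = rho x"
  by (simp add: rho_scaled_eq)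

text \<open>The support lies in a cube of half side e; the factor 3 comes from bounding the
  Euclidean norm by the sum over three coordinates.\<close>

lemma rho_scaled_support: "e > 0 \<Longrightarrow> rho_scaled e y x \<noteq> 0 \<Longrightarrow> norm (x - y) \<le> 3 * e"
proof -
  assume e: "e > 0" and nz: "rho_scaled e y x \<noteq> 0"
  have "\<bar>(x - y) \<bullet> b\<bar> \<le> e" if "b \<in> Basis" for b
  proof -
    have "bump 0 (1 / e * ((x - y) \<bullet> b)) \<noteq> 0"
      using nz that unfolding rho_scaled_def bump3_def by auto
    then have "\<bar>1 / e * ((x - y) \<bullet> b)\<bar> < 1" using bump_zero not_le by blast
    then show ?thesis using e by (simp add: abs_mult field_simps)
  qed
  then have "(\<Sum>b\<in>Basis. \<bar>(x - y) \<bullet> b\<bar>) \<le> (\<Sum>b\<in>(Basis::(real^3) set). e)" by (intro sum_mono)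
  then show ?thesis using norm_le_l1[of "x - y"] by simp
qed

lemma rho_scaled_test_function:
  assumes "e > 0" "3 * e < norm y"
  shows "rho_scaled e y \<in> test_functions_off_0"
proof -
  have sub: "closure {x. rho_scaled e y x \<noteq> 0} \<subseteq> cball y (3 * e)"
  proof (rule closure_minimal)
    show "{x. rho_scaled e y x \<noteq> 0} \<subseteq> cball y (3 * e)"
      using rho_scaled_support[OF assms(1), of y] by (auto simp: dist_norm norm_minus_commute[of y])
  qed simp
  then have "compact (closure {x. rho_scaled e y x \<noteq> 0})"
    using bounded_subset[OF bounded_cball sub] by (simp add: compact_eq_bounded_closed)
  moreover have "0 \<notin> closure {x. rho_scaled e y x \<noteq> 0}" using sub assms(2) by (auto simp: dist_norm)
  moreover have "n_times_differentiable n (rho_scaled e y)" for n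
    unfolding rho_scaled_def by (rule bump3_smooth)
  ultimately show ?thesis by (simp add: test_functions_off_0_def)
qed

lemma test_function_square_integrable:
  assumes "\<phi> \<in> test_functions_off_0"
  shows "continuous_on UNIV \<phi>" "integrable lborel \<phi>" "square_integrable \<phi>" "\<phi> 0 = 0"
proof -
  let ?K = "closure {x. \<phi> x \<noteq> 0}"
  have "n_times_differentiable 0 \<phi>" using assms by (simp only: test_functions_off_0_def mem_Collect_eq)
  then show c: "continuous_on UNIV \<phi>" by simp
  have K: "compact ?K" using assms by (simp add: test_functions_off_0_def)
  have out: "\<phi> x = 0" if "x \<notin> ?K" for x using that closure_subset[of "{x. \<phi> x \<noteq> 0}"] by blast
  show "\<phi> 0 = 0" by (rule out) (use assms in \<open>simp add: test_functions_off_0_def\<close>)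
  have "set_integrable lborel ?K \<phi>"
    unfolding set_integrable_def by (rule borel_integrable_compact[OF K continuous_on_subset[OF c subset_UNIV]])
  moreover have "indicator ?K x *\<^sub>R \<phi> x = \<phi> x" for x using out[of x] by (cases "x \<in> ?K") simp_all
  ultimately show "integrable lborel \<phi>" by (simp add: set_integrable_def)
  have "set_integrable lborel ?K (\<lambda>x. (cmod (\<phi> x))\<^sup>2)"
    unfolding set_integrable_def
    by (intro borel_integrable_compact[OF K] continuous_intros continuous_on_subset[OF c subset_UNIV])
  moreover have "indicator ?K x *\<^sub>R (cmod (\<phi> x))\<^sup>2 = (cmod (\<phi> x))\<^sup>2" for x using out[of x] by (cases "x \<in> ?K") simp_all
  ultimately have "integrable lborel (\<lambda>x. (cmod (\<phi> x))\<^sup>2)" unfolding set_integrable_def by (simp only:)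
  moreover have "\<phi> \<in> borel_measurable lborel" using borel_measurable_continuous_onI[OF c] by simp
  ultimately show "square_integrable \<phi>" by (simp add: square_integrable_def)
qed

lemma ft_rho_scaled:
  assumes e: "e > 0" and i: "integrable lborel (rho_scaled e y)"
  shows "ft (rho_scaled e y) p = complex_of_real (e ^ 3) * exp (- \<i> * complex_of_real (p \<bullet> y)) * ft rho (e *\<^sub>R p)"
proof -
  have "(\<integral>x. exp (- \<i> * complex_of_real (p \<bullet> x)) * rho_scaled e y x \<partial>lborel)
      = (\<bar>e\<bar> ^ DIM(real^3)) *\<^sub>R (\<integral>x. exp (- \<i> * complex_of_real (p \<bullet> (y + e *\<^sub>R x))) * rho_scaled e y (y + e *\<^sub>R x) \<partial>lborel)"
    by (rule lborel_integral_affine[OF _ integrable_exp_mult(1)[OF i]]) (use e in simp)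
  also have "(\<lambda>x. exp (- \<i> * complex_of_real (p \<bullet> (y + e *\<^sub>R x))) * rho_scaled e y (y + e *\<^sub>R x))
      = (\<lambda>x. exp (- \<i> * complex_of_real (p \<bullet> y)) * (exp (- \<i> * complex_of_real ((e *\<^sub>R p) \<bullet> x)) * rho x))"
    unfolding mult.assoc[symmetric] exp_add[symmetric] using e
    by (auto simp: fun_eq_iff rho_scaled_affine inner_add_right distrib_left)
  finally show ?thesis
    unfolding ft_def integral_mult_right_zero using e by (simp add: scaleR_conv_of_real)
qed

section \<open>The core of test functions vanishing near the origin\<close>

lemma norm_ball_indicator:
  assumes "r \<ge> 0"
  shows "norm (to_L2 (\<lambda>x. complex_of_real (indicator (cball 0 r) x))) = sqrt (4 / 3 * pi * r ^ 3)"
proof -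
  have "(norm (to_L2 (\<lambda>x. complex_of_real (indicator (cball 0 r) x))))\<^sup>2
      = (\<integral>x. (cmod (complex_of_real (indicator (cball (0::real^3) r) x)))\<^sup>2 \<partial>lborel)"
    by (rule norm_to_L2[OF ball_square_integrable])
  also have "\<dots> = (\<integral>x. indicator (cball (0::real^3) r) x \<partial>lborel)"
    by (intro Bochner_Integration.integral_cong) (auto simp: indicator_def)
  also have "\<dots> = 4 / 3 * pi * r ^ 3"
    using assms by (simp add: content_cball unit_ball_vol_3)
  finally show ?thesis by (metis norm_ge_zero real_sqrt_unique)
qed

text \<open>Cauchy-Schwarz against the indicator of the ball; the factor is the square root of its
  volume and later contributes a power e^(3/2).\<close>

lemma compact_support_L1_bound:
  assumes g: "square_integrable g" and r: "r \<ge> 0" and z: "\<And>x. r < norm x \<Longrightarrow> g x = 0"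
  shows "integrable lborel g" "(\<integral>x. cmod (g x) \<partial>lborel) \<le> sqrt (4 / 3 * pi * r ^ 3) * norm (to_L2 g)"
proof -
  let ?I = "\<lambda>x::real^3. complex_of_real (indicator (cball 0 r) x)"
  have ng: "square_integrable (\<lambda>x. complex_of_real (cmod (g x)))" by (rule square_integrable_norm[OF g])
  have eq: "cnj (?I x) * g x = g x" "cnj (?I x) * complex_of_real (cmod (g x)) = complex_of_real (cmod (g x))" for x
    using z[of x] by (auto simp: indicator_def)
  show "integrable lborel g"
    using square_integrable_mult_integrable[OF ball_square_integrable[of r] g] unfolding eq .
  have "complex_of_real (\<integral>x. cmod (g x) \<partial>lborel) = cinner (to_L2 ?I) (to_L2 (\<lambda>x. complex_of_real (cmod (g x))))"
    unfolding cinner_to_L2[OF ball_square_integrable ng] eq integral_complex_of_real ..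
  then have "(\<integral>x. cmod (g x) \<partial>lborel) = cmod (cinner (to_L2 ?I) (to_L2 (\<lambda>x. complex_of_real (cmod (g x)))))"
    by (metis abs_of_nonneg integral_nonneg_AE norm_of_real always_eventually norm_ge_zero)
  also have "\<dots> \<le> norm (to_L2 ?I) * norm (to_L2 (\<lambda>x. complex_of_real (cmod (g x))))" by (rule cinner_Cauchy_Schwarz)
  also have "norm (to_L2 (\<lambda>x. complex_of_real (cmod (g x)))) = norm (to_L2 g)"
    by (rule norm_to_L2_eqI[OF ng g]) simp
  finally show "(\<integral>x. cmod (g x) \<partial>lborel) \<le> sqrt (4 / 3 * pi * r ^ 3) * norm (to_L2 g)"
    unfolding norm_ball_indicator[OF r] .
qed

lemma norm_exp_i_diff: "cmod (exp (- \<i> * complex_of_real a) - exp (- \<i> * complex_of_real b)) \<le> \<bar>a - b\<bar>"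
proof -
  have "exp (- \<i> * complex_of_real a) - exp (- \<i> * complex_of_real b) = exp (- \<i> * complex_of_real a) * (1 - iexp (a - b))"
    by (simp add: right_diff_distrib exp_add[symmetric] algebra_simps)
  then have "cmod (exp (- \<i> * complex_of_real a) - exp (- \<i> * complex_of_real b)) = cmod (iexp (a - b) - 1)"
    by (simp add: norm_mult norm_minus_commute)
  also have "\<dots> \<le> \<bar>a - b\<bar>" using iexp_approx1[of "a - b" 0] by simp
  finally show ?thesis .
qed

text \<open>On the support the two exponentials differ by at most |p - q| |x| \<le> |p - q|
  r.\<close>

lemma ft_Lipschitz:
  assumes g: "integrable lborel g" and r: "r \<ge> 0" and z: "\<And>x. r < norm x \<Longrightarrow> g x = 0"
  shows "cmod (ft g p - ft g q) \<le> cmod fconst * (norm (p - q) * r * (\<integral>x. cmod (g x) \<partial>lborel))"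
proof -
  let ?e = "\<lambda>p x. exp (- \<i> * complex_of_real (p \<bullet> x))"
  have "ft g p - ft g q = fconst * (\<integral>x. ?e p x * g x - ?e q x * g x \<partial>lborel)"
    unfolding ft_def by (simp only: Bochner_Integration.integral_diff[OF integrable_exp_mult(1)[OF g] integrable_exp_mult(1)[OF g]] right_diff_distrib)
  then have "cmod (ft g p - ft g q) = cmod fconst * cmod (\<integral>x. ?e p x * g x - ?e q x * g x \<partial>lborel)"
    by (simp add: norm_mult)
  also have "cmod (\<integral>x. ?e p x * g x - ?e q x * g x \<partial>lborel) \<le> (\<integral>x. norm (p - q) * r * cmod (g x) \<partial>lborel)"
  proof (rule order_trans[OF integral_norm_bound integral_mono])
    show "integrable lborel (\<lambda>x. norm (?e p x * g x - ?e q x * g x))"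
      by (intro integrable_norm Bochner_Integration.integrable_diff integrable_exp_mult(1) g)
    show "integrable lborel (\<lambda>x. norm (p - q) * r * cmod (g x))" using g by simp
    fix x :: "real^3"
    show "norm (?e p x * g x - ?e q x * g x) \<le> norm (p - q) * r * cmod (g x)"
    proof (cases "norm x \<le> r")
      case True
      have "\<bar>p \<bullet> x - q \<bullet> x\<bar> \<le> norm (p - q) * norm x"
        using Cauchy_Schwarz_ineq2[of "p - q" x] by (simp add: inner_diff_left)
      also have "\<dots> \<le> norm (p - q) * r" using True by (intro mult_left_mono) auto
      finally have "cmod (?e p x - ?e q x) \<le> norm (p - q) * r"
        using norm_exp_i_diff[of "p \<bullet> x" "q \<bullet> x"] by linarith
      then show ?thesis
        unfolding left_diff_distrib[symmetric] norm_mult by (rule mult_right_mono) simp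
    qed (simp add: z)
  qed
  finally show ?thesis by (simp add: mult_left_mono)
qed

lemma AE_lborel_exists: "(AE p in lborel. P (p::real^3)) \<Longrightarrow> \<exists>p. P p"
proof (rule ccontr)
  assume a: "AE p in lborel. P (p::real^3)" and "\<not> (\<exists>p. P p)"
  then have "AE p in (lborel :: (real^3) measure). False" by simp
  then have "emeasure lborel (UNIV :: (real^3) set) = 0"
    by (subst (asm) AE_iff_measurable[where N=UNIV]) auto
  then show False by simp
qed

context frac_weight
begin

lemma w_square_bound: "(w p)\<^sup>2 \<le> (2 + 2 * lam\<^sup>2) * (1 + norm p ^ 5)"
proof -
  have half: "(norm p powr s)\<^sup>2 \<le> 1 + norm p ^ 5"
  proof (cases "norm p \<le> 1")
    case True
    then have "norm p powr s \<le> 1 powr s" using s_gt by (intro powr_mono2) auto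
    then have "(norm p powr s)\<^sup>2 \<le> 1\<^sup>2" by (intro power_mono) auto
    then show ?thesis by (simp add: add_increasing2)
  next
    case False
    then have "norm p powr s \<le> norm p powr (5 / 2)" using s_lt by (intro powr_mono) auto
    then have "(norm p powr s)\<^sup>2 \<le> (norm p powr (5 / 2))\<^sup>2" by (intro power_mono) auto
    also have "(norm p powr (5 / 2))\<^sup>2 = norm p powr (5 / 2 + 5 / 2)"
      unfolding powr_add by (rule power2_eq_square)
    also have "\<dots> = norm p ^ 5" using False by simp
    finally show ?thesis by simp
  qed
  have "(w p)\<^sup>2 \<le> 2 * (norm p powr s)\<^sup>2 + 2 * lam\<^sup>2"
    using zero_le_power2[of "norm p powr s - lam"] by (simp add: w_def power2_sum power2_diff)
  also have "\<dots> \<le> 2 * (1 + norm p ^ 5) + 2 * lam\<^sup>2 * (1 + norm p ^ 5)"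
  proof (rule add_mono)
    show "2 * (norm p powr s)\<^sup>2 \<le> 2 * (1 + norm p ^ 5)" using half by simp
    have "2 * lam\<^sup>2 * 1 \<le> 2 * lam\<^sup>2 * (1 + norm p ^ 5)" by (intro mult_left_mono) auto
    then show "2 * lam\<^sup>2 \<le> 2 * lam\<^sup>2 * (1 + norm p ^ 5)" by (simp only: mult_1_right)
  qed
  finally show ?thesis by (simp add: algebra_simps)
qed

lemma powr_s_bound: "norm q powr s \<le> 1 + norm q ^ 5"
proof (cases "norm q \<le> 1")
  case True
  then have "norm q powr s \<le> 1 powr s" using s_gt by (intro powr_mono2) auto
  then show ?thesis by (simp add: add_increasing2)
next
  case False
  then have "norm q powr s \<le> norm q powr 5" using s_lt by (intro powr_mono) auto
  also have "norm q powr 5 = norm q ^ 5" using False by simp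
  finally show ?thesis by simp
qed

text \<open>Up to a phase and the factor e^3, the Fourier transform of the shifted fractional
  Laplacian applied to a bump of scale e.\<close>

definition rho_weight :: "real \<Rightarrow> real^3 \<Rightarrow> complex" where
  "rho_weight e p = complex_of_real (w p) * ft rho (e *\<^sub>R p)"

lemma rho_weight_measurable [measurable]: "rho_weight e \<in> borel_measurable borel"
  using rho_integrable unfolding rho_weight_def[abs_def] by measurable

text \<open>With q = e p one has |p|^s = |q|^s e^(-s), and the growth in q is absorbed by the decay
  of the transform of \<open>rho\<close>. The factor e^(-s) is the loss to be weighed against a gain
  of e^(5/2).\<close>

lemma rho_weight_bound:
  obtains C where "C > 0" "\<And>e p. 0 < e \<Longrightarrow> e \<le> 1 \<Longrightarrow> cmod (rho_weight e p) \<le> C * e powr (- s)"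
proof -
  obtain C where C: "C > 0" "\<And>q. (1 + norm q ^ 5) * cmod (ft rho q) \<le> C" using ft_rho_decay by blast
  show thesis
  proof (rule that)
    show "(1 + lam) * C > 0" using C lam_pos by simp
    fix e :: real and p :: "real^3" assume e: "0 < e" "e \<le> 1"
    define q where "q = e *\<^sub>R p"
    have es: "1 \<le> e powr (- s)" using powr_mono'[of "- s" 0 e] e s_gt by simp
    have "norm p = norm q / e" using e by (simp add: q_def)
    then have "norm p powr s = norm q powr s * e powr (- s)"
      using e by (simp add: powr_divide powr_minus_divide)
    also have "\<dots> \<le> (1 + norm q ^ 5) * e powr (- s)" by (intro mult_right_mono powr_s_bound) simp
    finally have 1: "norm p powr s \<le> (1 + norm q ^ 5) * e powr (- s)" .
    have "1 * 1 \<le> (1 + norm q ^ 5) * e powr (- s)" by (intro mult_mono es) auto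
    then have "lam * 1 \<le> lam * ((1 + norm q ^ 5) * e powr (- s))"
      using lam_pos by (intro mult_left_mono) auto
    with 1 have "w p \<le> (1 + lam) * ((1 + norm q ^ 5) * e powr (- s))" by (simp add: w_def distrib_right)
    then have "w p * cmod (ft rho q) \<le> (1 + lam) * ((1 + norm q ^ 5) * e powr (- s)) * cmod (ft rho q)"
      by (intro mult_right_mono) auto
    also have "\<dots> = (1 + lam) * e powr (- s) * ((1 + norm q ^ 5) * cmod (ft rho q))" by (simp add: mult_ac)
    also have "\<dots> \<le> (1 + lam) * e powr (- s) * C" using lam_pos by (intro mult_left_mono C) auto
    finally show "cmod (rho_weight e p) \<le> (1 + lam) * C * e powr (- s)"
      using w_pos[of p] by (simp add: rho_weight_def norm_mult q_def mult_ac)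
  qed
qed

text \<open>Domination by a multiple of 1/w: at each fixed scale, w^2 times the rescaled transform
  of \<open>rho\<close> is bounded.\<close>

lemma rho_weight_square_integrable:
  assumes e: "0 < e" "e \<le> 1"
  shows "square_integrable (rho_weight e)"
proof -
  obtain C where C: "C > 0" "\<And>q. (1 + norm q ^ 5) * cmod (ft rho q) \<le> C" using ft_rho_decay by blast
  define c where "c = (2 + 2 * lam\<^sup>2) / e ^ 5 * C"
  show ?thesis
  proof (rule square_integrable_bound[OF square_integrable_inv_w])
    fix p :: "real^3"
    define q where "q = e *\<^sub>R p"
    have "e ^ 5 * (1 + norm p ^ 5) \<le> 1 + norm q ^ 5"
      using e power_le_one[of e 5] by (simp add: q_def power_mult_distrib distrib_left)
    then have "1 + norm p ^ 5 \<le> (1 + norm q ^ 5) / e ^ 5" using e by (simp add: field_simps)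
    then have "(w p)\<^sup>2 \<le> (2 + 2 * lam\<^sup>2) * ((1 + norm q ^ 5) / e ^ 5)"
      using w_square_bound[of p] by (meson mult_left_mono order_trans add_nonneg_nonneg zero_le_numeral zero_le_power2 mult_nonneg_nonneg)
    then have "(w p)\<^sup>2 * cmod (ft rho q) \<le> (2 + 2 * lam\<^sup>2) * ((1 + norm q ^ 5) / e ^ 5) * cmod (ft rho q)"
      by (intro mult_right_mono) auto
    also have "\<dots> = (2 + 2 * lam\<^sup>2) / e ^ 5 * ((1 + norm q ^ 5) * cmod (ft rho q))" by simp
    also have "\<dots> \<le> c" unfolding c_def using e by (intro mult_left_mono C) auto
    finally have "w p * (w p * cmod (ft rho q)) \<le> c" by (simp add: power2_eq_square mult.assoc)
    moreover have "cmod (complex_of_real (1 / w p)) = 1 / w p"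
      unfolding norm_of_real using w_pos[of p] by simp
    moreover have "cmod (rho_weight e p) = w p * cmod (ft rho q)"
      using w_pos[of p] by (simp add: rho_weight_def norm_mult q_def)
    ultimately show "cmod (rho_weight e p) \<le> c * cmod (complex_of_real (1 / w p))"
      using w_pos[of p] by (simp only:) (simp add: field_simps)
  qed measurable
qed

text \<open>If \<open>u\<close> annihilates all translated and scaled bumps supported off the origin, then the Fourier
  transform of \<open>u\<^sup>* w \<rho>\<^sup>^(\<epsilon> \<cdot>)\<close> is supported in a ball of radius \<open>3 \<epsilon>\<close>. Inverting it, \<open>u\<^sup>* w \<rho>\<^sup>^(\<epsilon> \<cdot>)\<close> has a
  Lipschitz constant of order \<open>\<epsilon>\<^sup>5\<^sup>/\<^sup>2\<^sup>-\<^sup>s\<close>, and since \<open>s < 5/2\<close> the function \<open>u\<^sup>* w\<close> is constant.\<close>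

lemma orthogonal_bumps_Lipschitz:
  assumes orth: "\<And>e y v. 0 < e \<Longrightarrow> e \<le> 1 \<Longrightarrow> 3 * e < norm y \<Longrightarrow> R v = to_L2 (rho_scaled e y) \<Longrightarrow> cinner u v = 0"
  obtains D where "\<And>e. 0 < e \<Longrightarrow> e \<le> 1 \<Longrightarrow> \<exists>G. (AE p in lborel. cnj (fhat u p) * rho_weight e p = G p)
    \<and> (\<forall>p q. cmod (G p - G q) \<le> D * norm (p - q) * e powr (5 / 2 - s))"
proof -
  obtain C where C: "C > 0" "\<And>e p. 0 < e \<Longrightarrow> e \<le> 1 \<Longrightarrow> cmod (rho_weight e p) \<le> C * e powr (- s)"
    using rho_weight_bound by blast
  define D where "D = cmod fconst * (3 * (sqrt (4 / 3 * pi * 3 ^ 3) * (C * norm u)))"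
  have "\<exists>G. (AE p in lborel. cnj (fhat u p) * rho_weight e p = G p)
    \<and> (\<forall>p q. cmod (G p - G q) \<le> D * norm (p - q) * e powr (5 / 2 - s))" if e: "0 < e" "e \<le> 1" for e
  proof -
    define h where "h p = cnj (fhat u p) * rho_weight e p" for p
    note m = rho_weight_square_integrable[OF e]
    note su = square_integrable_L2_fun[of "fourier u"]
    have hm [measurable]: "h \<in> borel_measurable borel" unfolding h_def[abs_def] by measurable
    have hi: "integrable lborel h"
      unfolding h_def[abs_def] by (rule square_integrable_mult_integrable[OF su m])
    have hb: "cmod (h p) \<le> cmod (complex_of_real (C * e powr (- s)) * fhat u p)" for p
      using mult_right_mono[OF C(2)[OF e, of p], of "cmod (fhat u p)"] C(1)
      by (simp add: h_def norm_mult mult_ac)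
    have hs: "square_integrable h"
      by (rule square_integrable_bound[OF square_integrable_cmult[OF su], where C=1]) (use hb in auto)
    have hn: "norm (to_L2 h) \<le> C * e powr (- s) * norm u"
    proof -
      have "norm (to_L2 h) \<le> norm (to_L2 (\<lambda>p. complex_of_real (C * e powr (- s)) * fhat u p))"
        by (rule norm_to_L2_mono[OF hs square_integrable_cmult[OF su] hb])
      then show ?thesis using C(1) by (simp add: to_L2_scaleC su abs_mult del: of_real_mult)
    qed
    \<comment> \<open>Up to the factor e^3 and normalisation, \<open>ft h y\<close> is the pairing
      of u with the preimage under \<open>R\<close> of the bump centred at y, which
      \<open>orth\<close> makes zero.\<close>
    have van: "ft h y = 0" if y: "3 * e < norm y" for y
    proof -
      let ?\<phi> = "rho_scaled e y"
      note t = test_function_square_integrable[OF rho_scaled_test_function[OF e(1) y]]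
      let ?V = "\<lambda>p. complex_of_real (e ^ 3) * (exp (- \<i> * complex_of_real (p \<bullet> y)) * rho_weight e p)"
      have em: "(\<lambda>p. exp (- \<i> * complex_of_real (p \<bullet> y))) \<in> borel_measurable borel"
        by (intro borel_measurable_continuous_onI continuous_intros)
      have sV: "square_integrable ?V"
        by (rule square_integrable_cmult, rule square_integrable_bound[OF m, where C=1])
          (use em in \<open>auto simp: norm_mult\<close>)
      define v where "v = inv_fourier (to_L2 ?V)"
      have v: "AE p in lborel. fhat v p = ?V p" unfolding v_def by (rule fhat_inv_fourier[OF sV])
      have "AE p in lborel. fhat (to_L2 ?\<phi>) p = ft ?\<phi> p"
        unfolding fourier_to_L2(2)[OF t(3,2)] by (rule L2_fun_to_L2[OF fourier_to_L2(1)[OF t(3,2)]])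
      then have "to_L2 ?\<phi> = R v"
        unfolding eq_R_iff using v
        by eventually_elim (simp add: ft_rho_scaled[OF e(1) t(2)] rho_weight_def)
      then have "cinner u v = 0" using orth[OF e y] by simp
      moreover have "cinner u v = (\<integral>p. cnj (fhat u p) * ?V p \<partial>lborel)"
        by (rule cinner_fhat_AE[OF _ v]) (use sV in \<open>auto dest: square_integrable_measurable\<close>)
      moreover have "cnj (fhat u p) * ?V p = complex_of_real (e ^ 3) * (exp (- \<i> * complex_of_real (y \<bullet> p)) * h p)" for p
        by (simp add: h_def inner_commute mult_ac)
      ultimately have "complex_of_real (e ^ 3) * (\<integral>p. exp (- \<i> * complex_of_real (y \<bullet> p)) * h p \<partial>lborel) = 0"
        by (simp only: integral_mult_right_zero)
      then show ?thesis using e by (simp add: ft_def)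
    qed
    \<comment> \<open>The inverse transform of h up to reflection and conjugation: it lives in the
      ball of radius 3 e, and h is recovered as the conjugate of its transform.\<close>
    define g where "g x = cnj (ft h x)" for x
    note fh = fourier_to_L2[OF hs hi]
    have gs: "square_integrable g" unfolding g_def[abs_def] by (rule square_integrable_cnj[OF fh(1)])
    have gz: "g x = 0" if "3 * e < norm x" for x by (simp add: g_def van[OF that])
    note g1 = compact_support_L1_bound[OF gs _ gz]
    have e3: "3 * e \<ge> 0" using e by simp
    have gi: "integrable lborel g" by (rule g1(1)[OF e3])
    have cg: "cnj_L2 (to_L2 (ft h)) = to_L2 g" unfolding g_def[abs_def] by (rule cnj_to_L2[OF fh(1)])
    have gn: "norm (to_L2 g) = norm (to_L2 h)"
      unfolding cg[symmetric] norm_cnj_L2 fh(2)[symmetric] by simp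
    note fg = fourier_to_L2[OF gs gi]
    have "to_L2 h = inv_fourier (fourier (to_L2 h))" by simp
    also have "\<dots> = to_L2 (\<lambda>p. cnj (ft g p))"
      unfolding inv_fourier_eq fh(2) cg fg(2) by (rule cnj_to_L2[OF fg(1)])
    finally have "AE p in lborel. h p = cnj (ft g p)"
      by (subst (asm) to_L2_eq_iff[OF hs square_integrable_cnj[OF fg(1)]])
    moreover have "cmod (cnj (ft g p) - cnj (ft g q)) \<le> D * norm (p - q) * e powr (5 / 2 - s)" for p q
    proof -
      have "cmod (cnj (ft g p) - cnj (ft g q)) = cmod (ft g p - ft g q)"
        unfolding complex_cnj_diff[symmetric] by (rule complex_mod_cnj)
      also have "\<dots> \<le> cmod fconst * (norm (p - q) * (3 * e) * (\<integral>x. cmod (g x) \<partial>lborel))"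
        by (rule ft_Lipschitz[OF gi e3 gz])
      also have "\<dots> \<le> cmod fconst * (norm (p - q) * (3 * e) * (sqrt (4 / 3 * pi * (3 * e) ^ 3) * (C * e powr (- s) * norm u)))"
      proof (intro mult_left_mono)
        have "sqrt (4 / 3 * pi * (3 * e) ^ 3) * norm (to_L2 g) \<le> sqrt (4 / 3 * pi * (3 * e) ^ 3) * (C * e powr (- s) * norm u)"
          unfolding gn using e by (intro mult_left_mono hn) auto
        then show "(\<integral>x. cmod (g x) \<partial>lborel) \<le> sqrt (4 / 3 * pi * (3 * e) ^ 3) * (C * e powr (- s) * norm u)"
          using g1(2)[OF e3] by linarith
      qed (use e in auto)
      \<comment> \<open>One factor e comes from the radius, e^(3/2) from the volume and e^(-s) from
        the weight.\<close>
      also have "\<dots> = D * norm (p - q) * (e * sqrt (e ^ 3) * e powr (- s))"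
        by (simp add: D_def power_mult_distrib real_sqrt_mult mult_ac)
      also have "e * sqrt (e ^ 3) * e powr (- s) = e powr (5 / 2 - s)"
      proof -
        have "sqrt (e ^ 3) = e powr (3 / 2)"
          using powr_three_half[OF e(1)] by (simp add: real_sqrt_power)
        then have "e * sqrt (e ^ 3) * e powr (- s) = e powr 1 * e powr (3 / 2) * e powr (- s)" using e by simp
        also have "\<dots> = e powr (1 + 3 / 2 + - s)" unfolding powr_add ..
        finally show ?thesis by simp
      qed
      finally show ?thesis .
    qed
    ultimately show ?thesis
      unfolding h_def by (intro exI[of _ "\<lambda>p. cnj (ft g p)"] conjI allI)
  qed
  then show thesis using that by blast
qed

text \<open>Along e = 1 / (n + 1) the weighted functions converge to a nonzero constant times U =
  conj(fhat u) w, while their Lipschitz constants tend to 0. So U is constant almost everywhere and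
  \<open>fhat u\<close> is a multiple of 1/w.\<close>

lemma orthogonal_bumps_eta:
  assumes orth: "\<And>e y v. 0 < e \<Longrightarrow> e \<le> 1 \<Longrightarrow> 3 * e < norm y \<Longrightarrow> R v = to_L2 (rho_scaled e y) \<Longrightarrow> cinner u v = 0"
  shows "\<exists>c. u = c *\<^sub>C \<eta>"
proof -
  obtain D where D: "\<And>e. 0 < e \<Longrightarrow> e \<le> 1 \<Longrightarrow> \<exists>G. (AE p in lborel. cnj (fhat u p) * rho_weight e p = G p)
    \<and> (\<forall>p q. cmod (G p - G q) \<le> D * norm (p - q) * e powr (5 / 2 - s))"
    by (rule orthogonal_bumps_Lipschitz[OF orth]) blast+
  define e where "e n = inverse (real (Suc n))" for n
  have e: "0 < e n" "e n \<le> 1" for n by (auto simp: e_def inverse_le_1_iff)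
  have elim: "e \<longlonglongrightarrow> 0" unfolding e_def[abs_def] by (rule LIMSEQ_inverse_real_of_nat)
  define h where "h n p = cnj (fhat u p) * rho_weight (e n) p" for n p
  have "\<forall>n. \<exists>G. (AE p in lborel. h n p = G p) \<and> (\<forall>p q. cmod (G p - G q) \<le> D * norm (p - q) * e n powr (5 / 2 - s))"
    unfolding h_def using D[OF e] by blast
  then obtain G where G: "\<And>n. AE p in lborel. h n p = G n p"
    "\<And>n p q. cmod (G n p - G n q) \<le> D * norm (p - q) * e n powr (5 / 2 - s)" by metis
  have good: "AE p in lborel. \<forall>n. h n p = G n p" using G(1) by (subst AE_all_countable) auto
  \<comment> \<open>A reference point at which all countably many identities hold; the other good
    points are compared with it.\<close>
  then obtain p0 where p0: "\<forall>n. h n p0 = G n p0" using AE_lborel_exists by blast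
  define U where "U p = cnj (fhat u p) * complex_of_real (w p)" for p
  have hlim: "(\<lambda>n. h n p) \<longlonglongrightarrow> U p * ft rho 0" for p
  proof -
    have "(\<lambda>n. e n *\<^sub>R p) \<longlonglongrightarrow> 0 *\<^sub>R p" by (intro tendsto_intros elim)
    then have "(\<lambda>n. ft rho (e n *\<^sub>R p)) \<longlonglongrightarrow> ft rho 0"
      using continuous_on_tendsto_compose[OF continuous_ft[OF rho_integrable], of "\<lambda>n. e n *\<^sub>R p" 0] by simp
    then show ?thesis unfolding h_def rho_weight_def U_def mult.assoc by (intro tendsto_intros)
  qed
  have "AE p in lborel. fhat u p = fhat (cnj (U p0) *\<^sub>C \<eta>) p"
    using good fhat_scaleC[of "cnj (U p0)" \<eta>] fhat_eta
  proof eventually_elim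
    case (elim p)
    have "(\<lambda>n. e n powr (5 / 2 - s)) \<longlonglongrightarrow> 0"
      by (rule tendsto_zero_powrI[OF \<open>e \<longlonglongrightarrow> 0\<close> tendsto_const])
        (use e(1) s_lt in \<open>auto intro!: always_eventually less_imp_le\<close>)
    then have "(\<lambda>n. D * norm (p - p0) * e n powr (5 / 2 - s)) \<longlonglongrightarrow> D * norm (p - p0) * 0"
      by (intro tendsto_intros)
    then have z: "(\<lambda>n. D * norm (p - p0) * e n powr (5 / 2 - s)) \<longlonglongrightarrow> 0" by simp
    have "cmod (h n p - h n p0) \<le> D * norm (p - p0) * e n powr (5 / 2 - s)" for n
      using G(2)[of n p p0] elim(1) p0 by simp
    then have "(\<lambda>n. h n p - h n p0) \<longlonglongrightarrow> 0"
      by (rule Lim_null_comparison[OF always_eventually[OF allI] z])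
    moreover have "(\<lambda>n. h n p - h n p0) \<longlonglongrightarrow> U p * ft rho 0 - U p0 * ft rho 0"
      by (intro tendsto_diff hlim)
    ultimately have "U p * ft rho 0 - U p0 * ft rho 0 = 0" using LIMSEQ_unique by blast
    then have "U p = U p0" using ft_rho_0 by simp
    then have "cnj (U p0) = fhat u p * complex_of_real (w p)"
      by (simp only: \<open>U p = U p0\<close>[symmetric] U_def[of p] complex_cnj_mult complex_cnj_cnj
          complex_cnj_complex_of_real)
    then show ?case using elim(2,3) w_nz[of p] by simp
  qed
  then show ?thesis using fhat_eqI by blast
qed

section \<open>The closure of the operator on test functions off the origin\<close>

lemma closed_S: "closed S"
proof -
  have "S = W \<inter> {z. cinner \<eta> (snd z) = 0}" by (auto simp: S_def W_def)
  moreover have "closed {z::L2 \<times> L2. cinner \<eta> (snd z) = 0}"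
    unfolding closed_sequential_limits
  proof (intro allI impI, elim conjE)
    fix X and l :: "L2 \<times> L2" assume X: "\<forall>n. X n \<in> {z. cinner \<eta> (snd z) = 0}" "X \<longlonglongrightarrow> l"
    have "(\<lambda>n. cinner \<eta> (snd (X n))) \<longlonglongrightarrow> cinner \<eta> (snd l)" by (intro tendsto_intros X)
    then show "l \<in> {z. cinner \<eta> (snd z) = 0}" using X(1) by (simp add: LIMSEQ_const_iff)
  qed
  ultimately show ?thesis using self_adjoint_closed[OF self_adjoint_W] by (simp add: closed_Int)
qed

text \<open>The number <\<eta>, v> is the integral of the transform of \<open>R v\<close>, hence
  proportional to the value at 0 of its continuous representative, and the test function vanishes
  there.\<close>

lemma test_function_eta:
  assumes "\<phi> \<in> test_functions_off_0" "R v = to_L2 \<phi>"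
  shows "cinner \<eta> v = 0"
proof -
  note t = test_function_square_integrable[OF assms(1)]
  have i: "integrable lborel (fhat (to_L2 \<phi>))" "(\<integral>p. fhat (to_L2 \<phi>) p \<partial>lborel) = cinner \<eta> v"
    using cinner_eta_R[of "to_L2 \<phi>" v] assms(2) by auto
  have "AE x in lborel. \<phi> x = L2_fun (to_L2 \<phi>) x"
    using L2_fun_to_L2[OF t(3)] by (auto elim: eventually_mono)
  from value_at_0_eq(2)[OF i(1) t(1) this] show ?thesis using t(4) i(2) fconst_pos by simp
qed

text \<open>One inclusion holds because \<open>S\<close> is closed. For the other, the preimages
  under \<open>R\<close> of test functions lie in the complement of \<eta>, and a vector orthogonal
  to all of them is a multiple of \<eta>; so they are dense in that complement. Continuity of
  \<open>R\<close> carries this to the closure of the graph.\<close>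

lemma k_ring_shift: "op_shift (k_ring s) (complex_of_real lam) = S"
proof -
  define G0 where "G0 = {(f, h) \<in> frac_laplacian s. f \<in> to_L2 ` test_functions_off_0}"
  have k: "k_ring s = closure G0" by (simp add: k_ring_def G0_def)
  have mem: "(f, h) \<in> G0 \<longleftrightarrow> f = R (h + complex_of_real lam *\<^sub>C f) \<and> f \<in> to_L2 ` test_functions_off_0" for f h
  proof -
    have "(f, h) \<in> frac_laplacian s \<longleftrightarrow> (f, h + complex_of_real lam *\<^sub>C f) \<in> op_shift (frac_laplacian s) (complex_of_real lam)"
      by (simp add: mem_op_shift)
    also have "\<dots> \<longleftrightarrow> f = R (h + complex_of_real lam *\<^sub>C f)" unfolding frac_laplacian_shift by (auto simp: W_def)
    finally show ?thesis by (auto simp: G0_def)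
  qed
  have "G0 \<subseteq> op_shift S (- complex_of_real lam)"
  proof clarify
    fix f h assume "(f, h) \<in> G0"
    then obtain \<phi> where \<phi>: "f = R (h + complex_of_real lam *\<^sub>C f)" "\<phi> \<in> test_functions_off_0" "f = to_L2 \<phi>"
      unfolding mem by blast
    then have "cinner \<eta> (h + complex_of_real lam *\<^sub>C f) = 0" using test_function_eta by metis
    then have "(f, h + complex_of_real lam *\<^sub>C f) \<in> S" unfolding S_def using \<phi>(1) by blast
    then show "(f, h) \<in> op_shift S (- complex_of_real lam)" by (simp add: mem_op_shift scaleC_minus_left)
  qed
  then have sub1: "k_ring s \<subseteq> op_shift S (- complex_of_real lam)"
    unfolding k by (rule closure_minimal) (rule closed_op_shift[OF closed_S])
  define V where "V = {v. \<exists>\<phi>\<in>test_functions_off_0. R v = to_L2 \<phi>}"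
  define V' where "V' = {v. (R v, v - complex_of_real lam *\<^sub>C R v) \<in> closure G0}"
  have V0: "cinner \<eta> v = 0" if "v \<in> V" for v using that test_function_eta by (auto simp: V_def)
  have VV': "V \<subseteq> V'"
  proof
    fix v assume "v \<in> V"
    then have "(R v, v - complex_of_real lam *\<^sub>C R v) \<in> G0" unfolding mem by (auto simp: V_def)
    then show "v \<in> V'" using closure_subset by (auto simp: V'_def)
  qed
  have V'lim: "l \<in> V'" if "\<And>n. X n \<in> V'" "X \<longlonglongrightarrow> l" for X l
  proof -
    have "(\<lambda>n. (R (X n), X n - complex_of_real lam *\<^sub>C R (X n))) \<longlonglongrightarrow> (R l, l - complex_of_real lam *\<^sub>C R l)"
      unfolding R_def by (intro tendsto_intros that)
    from closed_sequentially[OF closed_closure _ this] that(1) show ?thesis by (auto simp: V'_def)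
  qed
  have testlin: "\<phi> \<in> test_functions_off_0 \<Longrightarrow> \<psi> \<in> test_functions_off_0 \<Longrightarrow> (\<lambda>x. \<phi> x + c * \<psi> x) \<in> test_functions_off_0" for \<phi> \<psi> c
  proof -
    assume \<phi>: "\<phi> \<in> test_functions_off_0" and \<psi>: "\<psi> \<in> test_functions_off_0"
    let ?K = "closure {x. \<phi> x \<noteq> 0} \<union> closure {x. \<psi> x \<noteq> 0}"
    have sub: "closure {x. \<phi> x + c * \<psi> x \<noteq> 0} \<subseteq> ?K"
    proof (rule closure_minimal)
      have "{x. \<phi> x + c * \<psi> x \<noteq> 0} \<subseteq> {x. \<phi> x \<noteq> 0} \<union> {x. \<psi> x \<noteq> 0}" by auto
      then show "{x. \<phi> x + c * \<psi> x \<noteq> 0} \<subseteq> ?K"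
        using closure_subset[of "{x. \<phi> x \<noteq> 0}"] closure_subset[of "{x. \<psi> x \<noteq> 0}"] by blast
    qed (intro closed_Un closed_closure)
    have "compact ?K" using \<phi> \<psi> by (intro compact_Un) (auto simp: test_functions_off_0_def)
    then have "compact (closure {x. \<phi> x + c * \<psi> x \<noteq> 0})"
      using compact_Int_closed[of ?K "closure {x. \<phi> x + c * \<psi> x \<noteq> 0}"] sub by (simp add: Int_absorb1)
    moreover have "0 \<notin> closure {x. \<phi> x + c * \<psi> x \<noteq> 0}" using sub \<phi> \<psi> by (auto simp: test_functions_off_0_def)
    moreover have "n_times_differentiable n (\<lambda>x. \<phi> x + c * \<psi> x)" for n
      using \<phi> \<psi> by (intro n_times_differentiable_add n_times_differentiable_cmult) (auto simp: test_functions_off_0_def)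
    ultimately show ?thesis unfolding test_functions_off_0_def by blast
  qed
  have Vlin: "v + c *\<^sub>C v' \<in> V" if v: "v \<in> V" "v' \<in> V" for v v' c
  proof -
    obtain \<phi> \<psi> where *: "\<phi> \<in> test_functions_off_0" "R v = to_L2 \<phi>" "\<psi> \<in> test_functions_off_0" "R v' = to_L2 \<psi>"
      using v by (auto simp: V_def)
    have "R (v + c *\<^sub>C v') = to_L2 (\<lambda>x. \<phi> x + c * \<psi> x)"
      using * by (simp add: R_add R_scaleC to_L2_add to_L2_scaleC test_function_square_integrable square_integrable_cmult)
    then show ?thesis using testlin[OF *(1,3)] by (auto simp: V_def)
  qed
  have "(\<lambda>x. 0) \<in> test_functions_off_0"
    using n_times_differentiable_sum[of "{}"] by (auto simp: test_functions_off_0_def)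
  moreover have "to_L2 (\<lambda>x. 0) = 0" by (rule to_L2_eqI) (simp_all add: L2_fun_0)
  ultimately have V_0: "0 \<in> V" unfolding V_def by (auto intro!: bexI[of _ "\<lambda>x. 0"])
  \<comment> \<open>Adding the line of \<eta> makes the space dense in all of L^2, where the
    orthogonality criterion applies; the \<eta>-component is projected away afterwards.\<close>
  define Z where "Z = {v + c *\<^sub>C \<eta> | v c. v \<in> V}"
  have Z_sub: "csubspace Z"
    unfolding csubspace_def
  proof (intro conjI ballI allI)
    show "0 \<in> Z" unfolding Z_def using V_0 by (intro CollectI exI[of _ 0]) simp
    fix z assume "z \<in> Z"
    then obtain v c where z: "z = v + c *\<^sub>C \<eta>" "v \<in> V" by (auto simp: Z_def)
    show "a *\<^sub>C z \<in> Z" for a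
      unfolding Z_def z(1) using Vlin[OF V_0 z(2), of a]
      by (intro CollectI exI[of _ "a *\<^sub>C v"] exI[of _ "a * c"]) (simp add: scaleC_add_right)
    fix z' assume "z' \<in> Z"
    then obtain v' c' where z': "z' = v' + c' *\<^sub>C \<eta>" "v' \<in> V" by (auto simp: Z_def)
    show "z + z' \<in> Z"
      unfolding Z_def z(1) z'(1) using Vlin[OF z(2) z'(2), of 1]
      by (intro CollectI exI[of _ "v + v'"] exI[of _ "c + c'"]) (simp add: scaleC_add_left)
  qed
  have Z_dense: "closure Z = UNIV"
  proof (rule orthogonal_dense[OF Z_sub])
    fix u assume u: "\<And>z. z \<in> Z \<Longrightarrow> cinner u z = 0"
    have "cinner u v = 0" if "v \<in> V" for v
    proof (rule u)
      show "v \<in> Z" unfolding Z_def using that by (intro CollectI exI[of _ v] exI[of _ 0]) simp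
    qed
    then have "\<exists>c. u = c *\<^sub>C \<eta>"
      using rho_scaled_test_function by (intro orthogonal_bumps_eta) (auto simp: V_def)
    then obtain c where c: "u = c *\<^sub>C \<eta>" by blast
    have "\<eta> \<in> Z" unfolding Z_def using V_0 by (intro CollectI exI[of _ 0] exI[of _ 1]) simp
    then have "cinner u \<eta> = 0" by (rule u)
    then have "cinner u u = 0" by (simp add: c cinner_simps)
    then show "u = 0" by (simp add: cinner_self)
  qed
  have main: "v \<in> V'" if v: "cinner \<eta> v = 0" for v
  proof -
    obtain X where X: "\<And>n. X n \<in> Z" "X \<longlonglongrightarrow> v" using Z_dense closure_sequential[of v Z] by auto
    have "\<forall>n. \<exists>v c. X n = v + c *\<^sub>C \<eta> \<and> v \<in> V" using X(1) by (auto simp: Z_def)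
    then obtain y c where y: "\<And>n. X n = y n + c n *\<^sub>C \<eta>" "\<And>n. y n \<in> V" by metis
    have n0: "cinner \<eta> \<eta> \<noteq> 0" using eta_pos by simp
    have "c n = cinner \<eta> (X n) / cinner \<eta> \<eta>" for n
      using n0 unfolding y(1) by (simp add: cinner_simps V0[OF y(2)])
    then have yX: "y = (\<lambda>n. X n - (cinner \<eta> (X n) / cinner \<eta> \<eta>) *\<^sub>C \<eta>)"
      using y(1) by (auto simp: fun_eq_iff algebra_simps)
    have "(\<lambda>n. X n - (cinner \<eta> (X n) / cinner \<eta> \<eta>) *\<^sub>C \<eta>) \<longlonglongrightarrow> v - (cinner \<eta> v / cinner \<eta> \<eta>) *\<^sub>C \<eta>"
      by (intro tendsto_intros X n0)
    then have "y \<longlonglongrightarrow> v" unfolding yX[symmetric] by (simp add: v)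
    then show ?thesis using V'lim[of y v] y(2) VV' by blast
  qed
  have "op_shift S (- complex_of_real lam) \<subseteq> k_ring s"
  proof clarify
    fix f h assume "(f, h) \<in> op_shift S (- complex_of_real lam)"
    then have "f = R (h + complex_of_real lam *\<^sub>C f)" "cinner \<eta> (h + complex_of_real lam *\<^sub>C f) = 0"
      by (auto simp: mem_op_shift scaleC_minus_left S_def)
    then show "(f, h) \<in> k_ring s"
      using main[of "h + complex_of_real lam *\<^sub>C f"] unfolding k V'_def by simp
  qed
  with sub1 have "k_ring s = op_shift S (- complex_of_real lam)" by blast
  then show ?thesis by simp
qed

end

section \<open>The extensions and their resolvents\<close>

lemma op_shift_eq_iff: "op_shift T z = T' \<longleftrightarrow> T = op_shift T' (- z)"
  by (metis add.right_inverse add.left_inverse op_shift_0 op_shift_op_shift)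

lemma self_adjoint_shift_iff: "self_adjoint (op_shift T (complex_of_real r)) \<longleftrightarrow> self_adjoint T"
  using self_adjoint_shift[of "op_shift T (complex_of_real r)" "- r"] self_adjoint_shift[of T r] by auto

lemma op_shift_mono_iff: "op_shift A z \<subseteq> op_shift B z \<longleftrightarrow> A \<subseteq> B"
proof -
  have "A \<subseteq> B \<Longrightarrow> op_shift A z \<subseteq> op_shift B z" for A B z by (auto simp: mem_op_shift)
  from this[of A B z] this[of "op_shift A z" "op_shift B z" "- z"] show ?thesis by auto
qed

lemma k_ext_cases:
  assumes "\<tau> \<noteq> - \<infinity>"
  obtains "\<tau> = \<infinity>" | t where "\<tau> = ereal t"
  using assms by (cases \<tau>) auto

context frac_weight
begin

lemma k_ext_infinity: "op_shift (k_ext s lam \<infinity>) (complex_of_real lam) = W"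
  by (simp add: k_ext_def frac_laplacian_shift)

lemma k_ext_finite: "op_shift (k_ext s lam (ereal t)) (complex_of_real lam) = K (t * wint)"
  by (simp add: k_ext_def k_ext_real_shift)

lemma extensions_k_ring:
  "{T. self_adjoint T \<and> k_ring s \<subseteq> T} = k_ext s lam ` {\<tau>. \<tau> \<noteq> - \<infinity>}"
proof (rule set_eqI)
  fix T
  have "T \<in> {T. self_adjoint T \<and> k_ring s \<subseteq> T}
      \<longleftrightarrow> self_adjoint (op_shift T (complex_of_real lam)) \<and> S \<subseteq> op_shift T (complex_of_real lam)"
    by (simp add: self_adjoint_shift_iff op_shift_mono_iff k_ring_shift[symmetric])
  also have "\<dots> \<longleftrightarrow> op_shift T (complex_of_real lam) = W \<or> (\<exists>t. op_shift T (complex_of_real lam) = K t)"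
    by (rule self_adjoint_extensions)
  also have "\<dots> \<longleftrightarrow> T \<in> k_ext s lam ` {\<tau>. \<tau> \<noteq> - \<infinity>}"
  proof
    assume "op_shift T (complex_of_real lam) = W \<or> (\<exists>t. op_shift T (complex_of_real lam) = K t)"
    then show "T \<in> k_ext s lam ` {\<tau>. \<tau> \<noteq> - \<infinity>}"
    proof
      assume "op_shift T (complex_of_real lam) = W"
      then have "T = k_ext s lam \<infinity>" using k_ext_infinity by (metis op_shift_eq_iff)
      then show ?thesis by auto
    next
      assume "\<exists>t. op_shift T (complex_of_real lam) = K t"
      then obtain t where "op_shift T (complex_of_real lam) = K t" by blast
      \<comment> \<open>Positivity of |\<eta>|^2 lets \<tau> = t / wint range over all real
        numbers.\<close>
      moreover have "t = t / wint * wint" using wint_pos by simp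
      ultimately have "T = k_ext s lam (ereal (t / wint))" using k_ext_finite by (metis op_shift_eq_iff)
      then show ?thesis by auto
    qed
  next
    assume "T \<in> k_ext s lam ` {\<tau>. \<tau> \<noteq> - \<infinity>}"
    then obtain \<tau> where "T = k_ext s lam \<tau>" "\<tau> \<noteq> - \<infinity>" by auto
    then show "op_shift T (complex_of_real lam) = W \<or> (\<exists>t. op_shift T (complex_of_real lam) = K t)"
      using k_ext_cases[of \<tau>] k_ext_infinity k_ext_finite by metis
  qed
  finally show "T \<in> {T. self_adjoint T \<and> k_ring s \<subseteq> T} \<longleftrightarrow> T \<in> k_ext s lam ` {\<tau>. \<tau> \<noteq> - \<infinity>}" .
qed

lemma k_ring_unshift: "k_ring s = op_shift S (complex_of_real (- lam))"
  and frac_laplacian_unshift: "frac_laplacian s = op_shift W (complex_of_real (- lam))"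
  and k_ext_finite_unshift: "k_ext s lam (ereal t) = op_shift (K (t * wint)) (complex_of_real (- lam))"
  using k_ring_shift frac_laplacian_shift k_ext_finite[of t] by (simp_all add: op_shift_eq_iff)

lemma friedrichs_k_ring: "is_friedrichs_extension (k_ring s) (k_ext s lam \<infinity>)"
  using friedrichs_W[of "- lam"] unfolding k_ring_unshift[symmetric] frac_laplacian_unshift[symmetric]
  by (simp add: k_ext_def)

lemma Domain_frac_laplacian: "Domain (frac_laplacian s) = sobolev s"
proof -
  have "Domain (frac_laplacian s) = Domain W" by (metis Domain_op_shift frac_laplacian_shift)
  then show ?thesis unfolding sobolev_range_R by (auto simp: W_def)
qed

lemma Gfun_eta: "Gfun s lam = fconst *\<^sub>C \<eta>"
  by (simp add: Gfun_def \<eta>_def fconst_def w_def)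

lemma value_at_0_R: "value_at_0 (R v) = fconst * cinner \<eta> v"
  using value_at_0_eq(1)[OF cinner_eta_R(1)[OF refl]] cinner_eta_R(2)[OF refl] by simp

lemma fconst_sq: "fconst * fconst = complex_of_real (1 / (8 * pi ^ 3))"
proof -
  have "(2 * pi) powr (- 3 / 2) * (2 * pi) powr (- 3 / 2) = (2 * pi) powr (- 3)"
    unfolding powr_add[symmetric] by simp
  also have "\<dots> = 1 / (2 * pi) ^ 3" by (simp add: powr_minus_divide)
  also have "\<dots> = 1 / (8 * pi ^ 3)" by (simp add: power_mult_distrib)
  finally show ?thesis unfolding fconst_def of_real_mult[symmetric] by (rule arg_cong)
qed

text \<open>In terms of \<eta> the rank-one coefficient is 1 / (t |\<eta>|^2); passing to the Green
  function in both places multiplies it by (2 pi)^3 = 8 pi^3.\<close>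

lemma G_coeff_finite:
  assumes "t \<noteq> 0"
  shows "G_coeff s lam (ereal t) = 8 * pi ^ 3 / (t * wint)"
proof -
  have "lam powr (2 - 3 / s) * lam powr (3 / s - 2) = 1"
    unfolding powr_add[symmetric] using lam_pos by simp
  then have l: "lam powr (2 - 3 / s) = 1 / lam powr (3 / s - 2)" using lam_pos by (simp add: field_simps)
  have "s\<^sup>2 \<noteq> 0" "s - 3 \<noteq> 0" "sin (3 * pi / s) \<noteq> 0" "lam powr (3 / s - 2) \<noteq> 0"
    using s_gt s_lt sin_neg lam_pos by auto
  then show ?thesis
    using assms unfolding G_coeff_def wint_def l
    by (simp add: power2_eq_square power3_eq_cube divide_simps)
qed

lemma G_coeff_fconst:
  assumes "t \<noteq> 0"
  shows "complex_of_real (G_coeff s lam (ereal t)) * (fconst * fconst) = 1 / complex_of_real (t * wint)"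
proof -
  have "complex_of_real (G_coeff s lam (ereal t)) * (fconst * fconst)
      = complex_of_real (8 * pi ^ 3 / (t * wint) * (1 / (8 * pi ^ 3)))"
    unfolding fconst_sq G_coeff_finite[OF assms] of_real_mult ..
  also have "8 * pi ^ 3 / (t * wint) * (1 / (8 * pi ^ 3)) = 1 / (t * wint)" by simp
  finally show ?thesis by (simp only: of_real_divide of_real_1)
qed

text \<open>For finite \<tau> the domain is the range of the inverse: v is arbitrary, F = R v runs
  through \<open>sobolev s\<close>, and F(0) is \<open>fconst\<close> times <\<eta>, v>.\<close>

lemma Domain_k_ext:
  assumes "\<tau> \<noteq> - \<infinity>" "\<tau> \<noteq> 0"
  shows "Domain (k_ext s lam \<tau>) =
    {F + (complex_of_real (G_coeff s lam \<tau>) * value_at_0 F) *\<^sub>C Gfun s lam | F. F \<in> sobolev s}"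
  using assms(1)
proof (cases rule: k_ext_cases)
  case 1
  then show ?thesis by (simp add: k_ext_def G_coeff_def Domain_frac_laplacian)
next
  case (2 t)
  have t: "t \<noteq> 0" using assms(2) 2 by auto
  have tw: "t * wint \<noteq> 0" using t wint_pos by simp
  have c: "(complex_of_real (G_coeff s lam \<tau>) * value_at_0 (R v)) *\<^sub>C Gfun s lam
      = (cinner \<eta> v / complex_of_real (t * wint)) *\<^sub>C \<eta>" for v
  proof -
    have "complex_of_real (G_coeff s lam \<tau>) * value_at_0 (R v) * fconst
        = (complex_of_real (G_coeff s lam \<tau>) * (fconst * fconst)) * cinner \<eta> v"
      unfolding value_at_0_R by (simp only: mult_ac)
    then show ?thesis unfolding Gfun_eta scaleC_scaleC 2 G_coeff_fconst[OF t] by simp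
  qed
  have "Domain (k_ext s lam \<tau>) = Domain (K (t * wint))"
    unfolding 2 k_ext_finite_unshift by simp
  also have "\<dots> = Range (graph_of (\<lambda>v. R v + (cinner \<eta> v / complex_of_real (t * wint)) *\<^sub>C \<eta>))"
    unfolding converse_K[OF tw, symmetric] by simp
  also have "\<dots> = {F + (complex_of_real (G_coeff s lam \<tau>) * value_at_0 F) *\<^sub>C Gfun s lam | F. F \<in> sobolev s}"
    unfolding sobolev_range_R graph_of_def c[symmetric] by auto
  finally show ?thesis .
qed

lemma semibounded_k_ext: "\<tau> \<noteq> - \<infinity> \<Longrightarrow> semibounded_below (k_ext s lam \<tau>)"
proof -
  have "semibounded_below T \<Longrightarrow> semibounded_below (op_shift T (complex_of_real r))" for T r
    using op_ge_shift[of T r] by (metis add_diff_cancel_right' semibounded_below_iff)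
  then have "semibounded_below (frac_laplacian s)" "semibounded_below (k_ext s lam (ereal t))" for t
    unfolding frac_laplacian_unshift k_ext_finite_unshift using semibounded_W semibounded_K by blast+
  then show "\<tau> \<noteq> - \<infinity> \<Longrightarrow> semibounded_below (k_ext s lam \<tau>)" by (cases \<tau>) (auto simp: k_ext_def)
qed

lemma spectral_properties:
  assumes "\<tau> \<noteq> - \<infinity>"
  defines "A \<equiv> op_shift (k_ext s lam \<tau>) (complex_of_real lam)"
  shows "(inf_spectrum A \<ge> 0 \<longleftrightarrow> \<tau> \<ge> 0) \<and> (inf_spectrum A > 0 \<longleftrightarrow> \<tau> > 0) \<and> (invertible_op A \<longleftrightarrow> \<tau> \<noteq> 0)"
  using assms(1)
proof (cases rule: k_ext_cases)
  case 1
  have A: "A = W" unfolding A_def 1 by (rule k_ext_infinity)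
  have "0 < inf_spectrum W"
    using inf_spectrum_pos_iff[OF self_adjoint_W semibounded_W] op_ge_W lam_pos by (metis real_sqrt_gt_0_iff zero_less_divide_1_iff zero_less_power)
  then show ?thesis using invertible_W by (simp add: A 1)
next
  case (2 t)
  have A: "A = K (t * wint)" unfolding A_def 2 by (rule k_ext_finite)
  have ge: "0 \<le> inf_spectrum A \<longleftrightarrow> 0 \<le> t"
    using inf_spectrum_ge_iff[OF self_adjoint_K semibounded_K, of 0 "t * wint"] op_ge_K_iff[of "t * wint"] wint_pos
    by (simp add: A zero_ereal_def zero_le_mult_iff)
  have inv: "invertible_op A \<longleftrightarrow> t \<noteq> 0" unfolding A invertible_K_iff using wint_pos by simp
  have pos: "0 < inf_spectrum A \<longleftrightarrow> 0 < t"
  proof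
    assume p: "0 < inf_spectrum A"
    then have t0: "0 \<le> t" using ge less_imp_le by blast
    \<comment> \<open>A strictly positive infimum excludes 0 from the spectrum; invertibility of A
      then rules out t = 0.\<close>
    have "0 \<notin> spectrum A"
    proof
      assume "0 \<in> spectrum A"
      then have "inf_spectrum A \<le> ereal (Re 0)" unfolding inf_spectrum_def by (rule INF_lower)
      then show False using p by (simp add: zero_ereal_def[symmetric])
    qed
    then have "invertible_op A" by (simp add: spectrum_def)
    then show "0 < t" using inv t0 by simp
  next
    assume t: "0 < t"
    then have "invertible_op (K (t * wint))" "op_ge (K (t * wint)) 0"
      using wint_pos by (simp_all add: invertible_K_iff op_ge_K_iff)
    then obtain m where "m > 0" "op_ge (K (t * wint)) m"
      using invertible_nonneg_op_ge[OF self_adjoint_K] by metis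
    then show "0 < inf_spectrum A"
      unfolding A inf_spectrum_pos_iff[OF self_adjoint_K semibounded_K] by blast
  qed
  show ?thesis using ge pos inv by (simp add: 2)
qed

lemma form_domain_k_ext:
  "form_domain (k_ext s lam (ereal \<tau>)) = {F + \<kappa> *\<^sub>C Gfun s lam | F \<kappa>. F \<in> sobolev (s / 2)}"
proof -
  have "form_domain (k_ext s lam (ereal \<tau>)) = {Q \<Phi> + \<xi> *\<^sub>C \<eta> | \<Phi> \<xi>. True}"
    unfolding k_ext_finite_unshift form_domain_shift by (rule form_domain_K)
  also have "\<dots> = {F + \<kappa> *\<^sub>C Gfun s lam | F \<kappa>. F \<in> sobolev (s / 2)}"
  proof (intro equalityI subsetI)
    fix f assume "f \<in> {Q \<Phi> + \<xi> *\<^sub>C \<eta> | \<Phi> \<xi>. True}"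
    then obtain \<Phi> \<xi> where f: "f = Q \<Phi> + \<xi> *\<^sub>C \<eta>" by blast
    then have "f = Q \<Phi> + (\<xi> / fconst) *\<^sub>C Gfun s lam" using fconst_pos by (simp add: Gfun_eta)
    then show "f \<in> {F + \<kappa> *\<^sub>C Gfun s lam | F \<kappa>. F \<in> sobolev (s / 2)}" unfolding sobolev_half by blast
  next
    fix f assume "f \<in> {F + \<kappa> *\<^sub>C Gfun s lam | F \<kappa>. F \<in> sobolev (s / 2)}"
    then show "f \<in> {Q \<Phi> + \<xi> *\<^sub>C \<eta> | \<Phi> \<xi>. True}" unfolding sobolev_half Gfun_eta by auto
  qed
  finally show ?thesis .
qed

lemma direct_sum_Gfun: "sobolev (s / 2) \<inter> {\<kappa> *\<^sub>C Gfun s lam | \<kappa>. True} = {0}"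
proof (intro equalityI subsetI)
  fix f assume "f \<in> sobolev (s / 2) \<inter> {\<kappa> *\<^sub>C Gfun s lam | \<kappa>. True}"
  then obtain \<Phi> \<kappa> where \<Phi>: "f = Q \<Phi>" and \<kappa>: "f = \<kappa> *\<^sub>C Gfun s lam" unfolding sobolev_half by blast
  have "f = (\<kappa> * fconst) *\<^sub>C \<eta>" using \<kappa> by (simp add: Gfun_eta)
  with \<Phi> have "Q \<Phi> + (- (\<kappa> * fconst)) *\<^sub>C \<eta> = 0" by (simp add: scaleC_minus_left)
  then have "\<Phi> = 0" using eta_notin_range by blast
  then show "f \<in> {0}" using \<Phi> by simp
next
  fix f :: L2 assume "f \<in> {0}"
  then have "f = Q 0" "f = 0 *\<^sub>C Gfun s lam" by simp_all
  then show "f \<in> sobolev (s / 2) \<inter> {\<kappa> *\<^sub>C Gfun s lam | \<kappa>. True}" unfolding sobolev_half by blast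
qed

text \<open>In frequency space |p|^s + lam = w splits |\<Phi>|^2, since the transform of \<Phi> is
  w^(1/2) times that of \<open>Q \<Phi>\<close>.\<close>

lemma abs_nabla_norm:
  "(norm (op_apply (abs_nabla (s / 2)) (Q \<Phi>)))\<^sup>2 + lam * (norm (Q \<Phi>))\<^sup>2 = (norm \<Phi>)\<^sup>2"
proof -
  let ?F = "Q \<Phi>"
  have \<Phi>: "AE p in lborel. fhat \<Phi> p = complex_of_real (sqrt (w p)) * fhat ?F p"
    using eq_Q_iff[of ?F \<Phi>] by simp
  let ?g = "\<lambda>p. complex_of_real (norm p powr (s / 2)) * fhat ?F p"
  have pw: "(norm p powr (s / 2))\<^sup>2 + lam = w p" for p :: "real^3"
    by (simp add: w_def power2_eq_square powr_add[symmetric])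
  have sq: "norm p powr (s / 2) \<le> sqrt (w p)" for p :: "real^3"
    using pw[of p] lam_pos by (intro real_le_rsqrt) simp
  have s1: "square_integrable (\<lambda>p. complex_of_real (sqrt (w p)) * fhat ?F p)"
    by (rule square_integrable_AE_cong[OF square_integrable_L2_fun \<Phi>]) measurable
  have sg: "square_integrable ?g"
    by (rule square_integrable_bound[OF s1, where C=1])
      (use sq w_ge lam_pos in \<open>auto simp: norm_mult abs_of_nonneg[OF order_trans[OF powr_ge_zero sq]] intro!: mult_right_mono\<close>)
  define g where "g = inv_fourier (to_L2 ?g)"
  have g: "AE p in lborel. fhat g p = ?g p" unfolding g_def by (rule fhat_inv_fourier[OF sg])
  have app: "op_apply (abs_nabla (s / 2)) ?F = g"
    unfolding op_apply_def abs_nabla_def fourier_multiplier_def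
  proof (rule the_equality)
    show "(?F, g) \<in> {(f, h). AE p in lborel. fhat h p = complex_of_real (norm p powr (s / 2)) * fhat f p}"
      using g by simp
    fix h assume "(?F, h) \<in> {(f, h). AE p in lborel. fhat h p = complex_of_real (norm p powr (s / 2)) * fhat f p}"
    then have "AE p in lborel. fhat h p = fhat g p" using g by (auto elim: eventually_elim2)
    then show "h = g" by (rule fhat_eqI)
  qed
  have ig: "integrable lborel (\<lambda>p. (cmod (fhat g p))\<^sup>2)" "integrable lborel (\<lambda>p. (cmod (fhat ?F p))\<^sup>2)"
    using square_integrable_L2_fun[of "fourier g"] square_integrable_L2_fun[of "fourier ?F"]
    by (auto simp: square_integrable_def)
  have "(norm g)\<^sup>2 + lam * (norm ?F)\<^sup>2 = (\<integral>p. (cmod (fhat g p))\<^sup>2 + lam * (cmod (fhat ?F p))\<^sup>2 \<partial>lborel)"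
    unfolding norm_fhat using ig by simp
  also have "\<dots> = (\<integral>p. (cmod (fhat \<Phi> p))\<^sup>2 \<partial>lborel)"
  proof (rule integral_cong_AE)
    show "AE p in lborel. (cmod (fhat g p))\<^sup>2 + lam * (cmod (fhat ?F p))\<^sup>2 = (cmod (fhat \<Phi> p))\<^sup>2"
      using g \<Phi>
    proof eventually_elim
      case (elim p)
      have "(cmod (fhat g p))\<^sup>2 + lam * (cmod (fhat ?F p))\<^sup>2 = ((norm p powr (s / 2))\<^sup>2 + lam) * (cmod (fhat ?F p))\<^sup>2"
        unfolding elim by (simp add: norm_mult power_mult_distrib distrib_right)
      also have "\<dots> = (cmod (fhat \<Phi> p))\<^sup>2"
        unfolding pw elim using w_pos[of p] by (simp add: norm_mult power_mult_distrib)
      finally show ?case .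
    qed
  qed measurable
  also have "\<dots> = (norm \<Phi>)\<^sup>2" by (rule norm_fhat[symmetric])
  finally show ?thesis unfolding app .
qed

lemma quad_form_k_ext:
  assumes "F \<in> sobolev (s / 2)"
  shows "quad_form (k_ext s lam (ereal \<tau>)) (F + \<kappa> *\<^sub>C Gfun s lam) =
    (norm (op_apply (abs_nabla (s / 2)) F))\<^sup>2 - lam * (norm (F + \<kappa> *\<^sub>C Gfun s lam))\<^sup>2 + lam * (norm F)\<^sup>2
    + \<tau> * (s - 3) / (2 * pi * s\<^sup>2 * lam powr (2 - 3 / s) * sin (3 * pi / s)) * (cmod \<kappa>)\<^sup>2"
proof -
  obtain \<Phi> where F: "F = Q \<Phi>" using assms unfolding sobolev_half by blast
  have G: "\<kappa> *\<^sub>C Gfun s lam = (\<kappa> * fconst) *\<^sub>C \<eta>" by (simp add: Gfun_eta)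
  have "(cmod fconst)\<^sup>2 = cmod (fconst * fconst)" by (simp add: norm_mult power2_eq_square)
  also have "\<dots> = 1 / (8 * pi ^ 3)" unfolding fconst_sq norm_of_real by simp
  finally have f2: "(cmod fconst)\<^sup>2 = 1 / (8 * pi ^ 3)" .
  have "\<tau> * wint * (cmod (\<kappa> * fconst))\<^sup>2
      = \<tau> * (s - 3) / (2 * pi * s\<^sup>2 * lam powr (2 - 3 / s) * sin (3 * pi / s)) * (cmod \<kappa>)\<^sup>2"
  \<comment> \<open>For \<tau> \<noteq> 0 the constant is the reciprocal of \<open>G_coeff\<close>;
    at \<tau> = 0 both sides vanish.\<close>
  proof (cases "\<tau> = 0")
    case False
    have "G_coeff s lam (ereal \<tau>) = 2 * pi * s\<^sup>2 * sin (3 * pi / s) * lam powr (2 - 3 / s) / (\<tau> * (s - 3))"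
      by (simp add: G_coeff_def)
    then have "\<tau> * (s - 3) / (2 * pi * s\<^sup>2 * lam powr (2 - 3 / s) * sin (3 * pi / s)) = 1 / G_coeff s lam (ereal \<tau>)"
      by (simp add: mult_ac)
    also have "\<dots> = \<tau> * wint * (1 / (8 * pi ^ 3))" unfolding G_coeff_finite[OF False] by simp
    finally show ?thesis by (simp add: norm_mult power_mult_distrib f2)
  qed simp
  moreover have "quad_form (k_ext s lam (ereal \<tau>)) (F + \<kappa> *\<^sub>C Gfun s lam)
      = (norm \<Phi>)\<^sup>2 + \<tau> * wint * (cmod (\<kappa> * fconst))\<^sup>2 + (- lam) * (norm (F + \<kappa> *\<^sub>C Gfun s lam))\<^sup>2"
    unfolding k_ext_finite_unshift F G by (rule quad_form_K)
  moreover have "(norm \<Phi>)\<^sup>2 = (norm (op_apply (abs_nabla (s / 2)) F))\<^sup>2 + lam * (norm F)\<^sup>2"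
    unfolding F by (rule abs_nabla_norm[symmetric])
  ultimately show ?thesis by simp
qed

text \<open>Inverses are converse graphs, and both sides are graphs of everywhere defined maps, so
  \<open>converse_K\<close> and \<open>converse_W\<close> decide the identity. For \<tau> =
  \<infinity> the coefficient is 0 by definition.\<close>

lemma resolvent_identity:
  assumes "\<tau> \<noteq> - \<infinity>" "\<tau> \<noteq> 0"
  shows "converse (op_shift (k_ext s lam \<tau>) (complex_of_real lam)) =
    op_add (converse (op_shift (frac_laplacian s) (complex_of_real lam)))
      (graph_of (\<lambda>h. complex_of_real (G_coeff s lam \<tau>) *\<^sub>C rank_one (Gfun s lam) h))"
proof -
  have add: "op_add (graph_of f) (graph_of g) = graph_of (\<lambda>h. f h + g h)" for f g
    by (auto simp: op_add_def graph_of_def)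
  show ?thesis
    using assms(1)
  proof (cases rule: k_ext_cases)
    case 1
    then show ?thesis unfolding frac_laplacian_shift 1 k_ext_infinity converse_W add by (simp add: G_coeff_def)
  next
    case (2 t)
    have t: "t \<noteq> 0" using assms(2) 2 by auto
    then have tw: "t * wint \<noteq> 0" using wint_pos by simp
    have "complex_of_real (G_coeff s lam \<tau>) *\<^sub>C rank_one (Gfun s lam) h = (cinner \<eta> h / complex_of_real (t * wint)) *\<^sub>C \<eta>" for h
    proof -
      have "complex_of_real (G_coeff s lam \<tau>) *\<^sub>C rank_one (Gfun s lam) h
          = ((complex_of_real (G_coeff s lam \<tau>) * (fconst * fconst)) * cinner \<eta> h) *\<^sub>C \<eta>"
        by (simp add: rank_one_def Gfun_eta cinner_scaleC_left fconst_pos mult_ac)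
      then show ?thesis unfolding 2 G_coeff_fconst[OF t] by simp
    qed
    then show ?thesis unfolding frac_laplacian_shift 2 k_ext_finite converse_W add converse_K[OF tw] by simp
  qed
qed

end

theorem theorem4p1:
  fixes s lam :: real
  assumes "3 / 2 < s" and "s < 5 / 2" and "0 < lam"
  shows
    "\<comment> \<open>(i)\<close>
     {T. self_adjoint T \<and> k_ring s \<subseteq> T} = k_ext s lam ` {\<tau>. \<tau> \<noteq> - \<infinity>} \<and>
     is_friedrichs_extension (k_ring s) (k_ext s lam \<infinity>) \<and>
     k_ext s lam \<infinity> = frac_laplacian s \<and> Domain (frac_laplacian s) = sobolev s \<and>
     (\<forall>\<tau>::ereal. \<tau> \<noteq> - \<infinity> \<and> \<tau> \<noteq> 0 \<longrightarrow>
        Domain (k_ext s lam \<tau>) =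
          {F + (complex_of_real (G_coeff s lam \<tau>) * value_at_0 F) *\<^sub>C Gfun s lam | F. F \<in> sobolev s}) \<and>
     \<comment> \<open>(ii)\<close>
     (\<forall>\<tau>::ereal. \<tau> \<noteq> - \<infinity> \<longrightarrow>
        semibounded_below (k_ext s lam \<tau>) \<and>
        (inf_spectrum (op_shift (k_ext s lam \<tau>) (complex_of_real lam)) \<ge> 0 \<longleftrightarrow> \<tau> \<ge> 0) \<and>
        (inf_spectrum (op_shift (k_ext s lam \<tau>) (complex_of_real lam)) > 0 \<longleftrightarrow> \<tau> > 0) \<and>
        (invertible_op (op_shift (k_ext s lam \<tau>) (complex_of_real lam)) \<longleftrightarrow> \<tau> \<noteq> 0)) \<and>
     \<comment> \<open>(iii)\<close>
     (\<forall>\<tau>::real.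
        form_domain (k_ext s lam (ereal \<tau>)) =
          {F + \<kappa> *\<^sub>C Gfun s lam | F \<kappa>. F \<in> sobolev (s / 2)} \<and>
        sobolev (s / 2) \<inter> {\<kappa> *\<^sub>C Gfun s lam | \<kappa>. True} = {0} \<and>
        (\<forall>F\<in>sobolev (s / 2). \<forall>\<kappa>.
           quad_form (k_ext s lam (ereal \<tau>)) (F + \<kappa> *\<^sub>C Gfun s lam) =
             (norm (op_apply (abs_nabla (s / 2)) F))\<^sup>2
             - lam * (norm (F + \<kappa> *\<^sub>C Gfun s lam))\<^sup>2
             + lam * (norm F)\<^sup>2
             + \<tau> * (s - 3) / (2 * pi * s\<^sup>2 * lam powr (2 - 3 / s) * sin (3 * pi / s)) * (cmod \<kappa>)\<^sup>2)) \<and>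
     \<comment> \<open>(iv)\<close>
     (\<forall>\<tau>::ereal. \<tau> \<noteq> - \<infinity> \<and> \<tau> \<noteq> 0 \<longrightarrow>
        converse (op_shift (k_ext s lam \<tau>) (complex_of_real lam)) =
          op_add (converse (op_shift (frac_laplacian s) (complex_of_real lam)))
            (graph_of (\<lambda>h. complex_of_real (G_coeff s lam \<tau>) *\<^sub>C rank_one (Gfun s lam) h)))"
proof -
  interpret frac_weight s lam by unfold_locales (fact assms)+
  have "k_ext s lam \<infinity> = frac_laplacian s" by (simp add: k_ext_def)
  then show ?thesis
    by (intro conjI extensions_k_ring friedrichs_k_ring Domain_frac_laplacian allI impI ballI
        Domain_k_ext semibounded_k_ext spectral_properties[THEN conjunct1]
        spectral_properties[THEN conjunct2, THEN conjunct1] spectral_properties[THEN conjunct2, THEN conjunct2]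
        form_domain_k_ext direct_sum_Gfun quad_form_k_ext resolvent_identity) auto
qed

end
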